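(* Let $(M,g,\Omega)$ be a Bochner-Kähler $n$-manifold and let $\mathfrak g$ be the Lie algebra of vector fields on $M$ whose (local) flows preserve the complex structure and $\Omega$. For every $k$ in the range $0\le k\le n-1$, the function $$z_{k+2}=2i(-1)^k\bigl(H^k-h_1H^{k-1}+h_2H^{k-2}+\cdots+(-1)^kh_k\,I_n\bigr)T$$ is the representative function of a vector field $Z_{k+2}\in\mathfrak g$. Moreover, the (real) span $\mathfrak z$ of $Z_2,\ldots,Z_{n+1}$ lies in the center of $\mathfrak g$. For $x\in M$, the subspace $\mathfrak z_x=\operatorname{span}\{Z_2(x),\ldots,Z_{n+1}(x)\}\subset T_xM$ is the $\Omega$-complement of $\ker df_x$, where $f:M\to\mathbb R^{2n+1}$ is the moduli mapping. If $M$ is connected, then $\dim\mathfrak z\le n$ is the maximum over $x\in M$ of $\dim\mathfrak z_x$. If (with $M$ connected) $\dim\mathfrak z=n$, then $\mathfrak g=\mathfrak z$.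
   Context: $\mathbb C^n$ consists of columns; $z^*$ denotes conjugate transpose; $\mathfrak u(n)=\{a\in M_n(\mathbb C): a^*=-a\}$. Let $(M,g,\Omega)$ be a Kähler manifold of complex dimension $n\ge1$. Its unitary coframe bundle $\pi:P\to M$ has as fiber $P_x$ the set of complex-linear isometries $u:T_xM\to\mathbb C^n$, with right $U(n)$-action $u\cdot a=a^{-1}\circ u$. Let $\omega$ be the $\mathbb C^n$-valued $1$-form on $P$ with $\omega(v)=u(\pi'(v))$ for $v\in T_uP$ (so $\pi^*\Omega=-\frac i2\,\omega^*\wedge\omega$), and let $\phi$ be the unique $\mathfrak u(n)$-valued $1$-form on $P$ with $d\omega=-\phi\wedge\omega$. The structure is called Bochner-Kähler if there are functions $H:P\to i\mathfrak u(n)$ (Hermitian matrices), $T:P\to\mathbb C^n$, $V:P\to\mathbb R$ satisfying $$d\phi=-\phi\wedge\phi+H\,\omega^*\wedge\omega-H\,\omega\wedge\omega^*-\omega\wedge\omega^*H+(\omega^*\wedge H\omega)\,I_n+(\operatorname{tr}H)\bigl(\omega^*\wedge\omega\,I_n-\omega\wedge\omega^*\bigr),$$ $$dH=-\phi H+H\phi+T\omega^*+\omega T^*,\qquad dT=-\phi T+\bigl(H^2+(\operatorname{tr}H)H+V I_n\bigr)\omega,$$ $$dV=(\operatorname{tr}H)(T^*\omega+\omega^*T)+(T^*H\omega+\omega^*HT).$$ For $n\ge2$ this is equivalent to the vanishing of the Bochner curvature; for $n=1$ it is the definition. The functions $H,T,V$ are unique and satisfy $(H,T,V)(u\cdot a)=(a^{-1}Ha,a^{-1}T,V)(u)$.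 Bochner-Kähler structures are assumed real-analytic. A vector field $Z$ on $M$ has representative function $z:P\to\mathbb C^n$ given by $z(u)=u(Z_{\pi(u)})$. For $0\le k\le n$, $h_k$ is the $k$-th elementary symmetric function of the eigenvalues of $H$. Set $A_k=\operatorname{tr}(H^k)$, $B_2=V$, $B_k=T^*H^{k-3}T$ for $k\ge3$; these functions are constant on the fibers of $\pi$ and so are functions on $M$. The moduli mapping is $f=(A_1,\ldots,A_n,B_2,B_3,\ldots,B_{n+2}):M\to\mathbb R^{2n+1}$. The $\Omega$-complement of a subspace $K\subset T_xM$ is $\{v\in T_xM:\Omega(v,w)=0\ \text{for all }w\in K\}$. *)

theory Defs
  imports
    "HOL-Analysis.Analysis"
    "HOL-Library.Function_Algebras"
    "HOL-Library.FuncSet"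
    "HOL-Library.Numeral_Type"
    "HOL-Computational_Algebra.Polynomial"
begin

section \<open>Smooth and real-analytic functions on open subsets of Euclidean spaces\<close>

primrec Ck_on :: "nat \<Rightarrow> 'a::euclidean_space set \<Rightarrow> ('a \<Rightarrow> 'b::euclidean_space) \<Rightarrow> bool" where
  "Ck_on 0 S f = continuous_on S f"
| "Ck_on (Suc k) S f =
     ((\<forall>x\<in>S. f differentiable (at x)) \<and> (\<forall>v. Ck_on k S (\<lambda>x. frechet_derivative f (at x) v)))"

definition smooth_on :: "'a::euclidean_space set \<Rightarrow> ('a \<Rightarrow> 'b::euclidean_space) \<Rightarrow> bool" where
  "smooth_on S f \<longleftrightarrow> (\<forall>k. Ck_on k S f)"

definition real_analytic_on :: "'a::euclidean_space set \<Rightarrow> ('a \<Rightarrow> 'b::euclidean_space) \<Rightarrow> bool" where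
  "real_analytic_on S f \<longleftrightarrow>
     (\<forall>x\<in>S. \<exists>r>0. \<exists>a :: ('a \<Rightarrow> nat) \<Rightarrow> 'b. ball x r \<subseteq> S \<and>
        (\<forall>y\<in>ball x r. ((\<lambda>m. (\<Prod>b\<in>Basis. ((y - x) \<bullet> b) ^ m b) *\<^sub>R a m) has_sum f y)
                        (Basis \<rightarrow>\<^sub>E UNIV)))"


section \<open>Manifolds given by an atlas\<close>

text \<open>
  A chart is a domain together with a coordinate map; only the values of the coordinate map on the
  domain matter. A tangent vector at \<^term>\<open>x\<close> is stored as its coordinate vector in the chart
  \<open>chart_at A x\<close>, which is chosen once and for all; thus \<open>T\<^sub>x\<close> is (a copy of) the model space for
  every \<^term>\<open>x\<close>, and vector fields, forms and tensors are functions of the point and of such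
  coordinate vectors. In another chart the coordinates of a tangent vector are obtained from the
  derivative of the transition map (\<open>to_chart\<close>, \<open>from_chart\<close> below).
\<close>

type_synonym ('x, 'e) chart = "'x set \<times> ('x \<Rightarrow> 'e)"

abbreviation chart_inv :: "('x, 'e) chart \<Rightarrow> 'e \<Rightarrow> 'x" where
  "chart_inv c \<equiv> inv_into (fst c) (snd c)"

abbreviation chart_image :: "('x, 'e) chart \<Rightarrow> 'e set" where
  "chart_image c \<equiv> snd c ` fst c"

definition carrier :: "('x, 'e) chart set \<Rightarrow> 'x set" where
  "carrier A = (\<Union>c\<in>A. fst c)"

definition chart_at :: "('x, 'e) chart set \<Rightarrow> 'x \<Rightarrow> ('x, 'e) chart" where
  "chart_at A x = (SOME c. c \<in> A \<and> x \<in> fst c)"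

definition to_chart ::
  "('x, 'e::euclidean_space) chart set \<Rightarrow> ('x, 'e) chart \<Rightarrow> 'x \<Rightarrow> 'e \<Rightarrow> 'e" where
  "to_chart A c x =
     frechet_derivative (snd c \<circ> chart_inv (chart_at A x)) (at (snd (chart_at A x) x))"

definition from_chart ::
  "('x, 'e::euclidean_space) chart set \<Rightarrow> ('x, 'e) chart \<Rightarrow> 'x \<Rightarrow> 'e \<Rightarrow> 'e" where
  "from_chart A c x = frechet_derivative (snd (chart_at A x) \<circ> chart_inv c) (at (snd c x))"

definition atlas_open :: "('x, 'e::euclidean_space) chart set \<Rightarrow> 'x set \<Rightarrow> bool" where
  "atlas_open A N \<longleftrightarrow> N \<subseteq> carrier A \<and> (\<forall>c\<in>A. open (snd c ` (fst c \<inter> N)))"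

definition smooth_map ::
  "('x, 'e::euclidean_space) chart set \<Rightarrow> ('y, 'f::euclidean_space) chart set \<Rightarrow> ('x \<Rightarrow> 'y) \<Rightarrow> bool" where
  "smooth_map A B f \<longleftrightarrow>
     f ` carrier A \<subseteq> carrier B \<and>
     (\<forall>c\<in>A. \<forall>d\<in>B. open (snd c ` (fst c \<inter> f -` fst d)) \<and>
        smooth_on (snd c ` (fst c \<inter> f -` fst d)) (snd d \<circ> f \<circ> chart_inv c))"

definition tangent_map ::
  "('x, 'e::euclidean_space) chart set \<Rightarrow> ('y, 'f::euclidean_space) chart set \<Rightarrow> ('x \<Rightarrow> 'y) \<Rightarrow> 'x \<Rightarrow> 'e \<Rightarrow> 'f" where
  "tangent_map A B f x =
     frechet_derivative (snd (chart_at B (f x)) \<circ> f \<circ> chart_inv (chart_at A x))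
       (at (snd (chart_at A x) x))"

definition smooth_fun ::
  "('x, 'e::euclidean_space) chart set \<Rightarrow> ('x \<Rightarrow> 'f::euclidean_space) \<Rightarrow> bool" where
  "smooth_fun A f \<longleftrightarrow> (\<forall>c\<in>A. smooth_on (chart_image c) (f \<circ> chart_inv c))"

definition differential ::
  "('x, 'e::euclidean_space) chart set \<Rightarrow> ('x \<Rightarrow> 'f::euclidean_space) \<Rightarrow> 'x \<Rightarrow> 'e \<Rightarrow> 'f" where
  "differential A f x =
     frechet_derivative (f \<circ> chart_inv (chart_at A x)) (at (snd (chart_at A x) x))"


subsection \<open>Forms and tensors\<close>

definition one_form_in_chart ::
  "('x, 'e::euclidean_space) chart set \<Rightarrow> ('x, 'e) chart \<Rightarrow> ('x \<Rightarrow> 'e \<Rightarrow> 'f) \<Rightarrow> 'e \<Rightarrow> 'e \<Rightarrow> 'f" where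
  "one_form_in_chart A c \<alpha> y v = \<alpha> (chart_inv c y) (from_chart A c (chart_inv c y) v)"

definition two_tensor_in_chart ::
  "('x, 'e::euclidean_space) chart set \<Rightarrow> ('x, 'e) chart \<Rightarrow> ('x \<Rightarrow> 'e \<Rightarrow> 'e \<Rightarrow> 'f) \<Rightarrow> 'e \<Rightarrow> 'e \<Rightarrow> 'e \<Rightarrow> 'f" where
  "two_tensor_in_chart A c \<beta> y v w =
     \<beta> (chart_inv c y) (from_chart A c (chart_inv c y) v) (from_chart A c (chart_inv c y) w)"

definition smooth_one_form ::
  "('x, 'e::euclidean_space) chart set \<Rightarrow> ('x \<Rightarrow> 'e \<Rightarrow> 'f::euclidean_space) \<Rightarrow> bool" where
  "smooth_one_form A \<alpha> \<longleftrightarrow>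
     (\<forall>x\<in>carrier A. linear (\<alpha> x)) \<and>
     (\<forall>c\<in>A. \<forall>v. smooth_on (chart_image c) (\<lambda>y. one_form_in_chart A c \<alpha> y v))"

text \<open>
  The exterior derivatives of a 1-form and of a 2-form, computed in the chart at the point. With
  \<open>wedge\<close> below, the normalisation is
  \<open>d\<alpha>(X,Y) = X(\<alpha>(Y)) - Y(\<alpha>(X)) - \<alpha>([X,Y])\<close> and \<open>(\<alpha> \<and> \<beta>)(v,w) = \<alpha>(v) \<beta>(w) - \<alpha>(w) \<beta>(v)\<close>.
\<close>

definition d_one_form ::
  "('x, 'e::euclidean_space) chart set \<Rightarrow> ('x \<Rightarrow> 'e \<Rightarrow> 'f::euclidean_space) \<Rightarrow> 'x \<Rightarrow> 'e \<Rightarrow> 'e \<Rightarrow> 'f" where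
  "d_one_form A \<alpha> x v w =
     (let c = chart_at A x;
          D = (\<lambda>a b. frechet_derivative (\<lambda>y. one_form_in_chart A c \<alpha> y b) (at (snd c x)) a)
      in D v w - D w v)"

definition d_two_form ::
  "('x, 'e::euclidean_space) chart set \<Rightarrow> ('x \<Rightarrow> 'e \<Rightarrow> 'e \<Rightarrow> 'f::euclidean_space) \<Rightarrow> 'x \<Rightarrow> 'e \<Rightarrow> 'e \<Rightarrow> 'e \<Rightarrow> 'f" where
  "d_two_form A \<beta> x u v w =
     (let c = chart_at A x;
          D = (\<lambda>a b b'. frechet_derivative (\<lambda>y. two_tensor_in_chart A c \<beta> y b b') (at (snd c x)) a)
      in D u v w - D v u w + D w u v)"

definition wedge :: "('a \<Rightarrow> 'b \<Rightarrow> 'f::ab_group_add) \<Rightarrow> ('e \<Rightarrow> 'a) \<Rightarrow> ('e \<Rightarrow> 'b) \<Rightarrow> 'e \<Rightarrow> 'e \<Rightarrow> 'f" where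
  "wedge mul \<alpha> \<beta> v w = mul (\<alpha> v) (\<beta> w) - mul (\<alpha> w) (\<beta> v)"


subsection \<open>Vector fields\<close>

definition field_in_chart ::
  "('x, 'e::euclidean_space) chart set \<Rightarrow> ('x, 'e) chart \<Rightarrow> ('x \<Rightarrow> 'e) \<Rightarrow> 'e \<Rightarrow> 'e" where
  "field_in_chart A c X y = to_chart A c (chart_inv c y) (X (chart_inv c y))"

definition smooth_field :: "('x, 'e::euclidean_space) chart set \<Rightarrow> ('x \<Rightarrow> 'e) \<Rightarrow> bool" where
  "smooth_field A X \<longleftrightarrow> (\<forall>c\<in>A. smooth_on (chart_image c) (field_in_chart A c X))"

definition lie_bracket ::
  "('x, 'e::euclidean_space) chart set \<Rightarrow> ('x \<Rightarrow> 'e) \<Rightarrow> ('x \<Rightarrow> 'e) \<Rightarrow> 'x \<Rightarrow> 'e" where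
  "lie_bracket A X Y x =
     (let c = chart_at A x
      in frechet_derivative (field_in_chart A c Y) (at (snd c x)) (X x)
         - frechet_derivative (field_in_chart A c X) (at (snd c x)) (Y x))"

definition lie_center :: "('x, 'e::euclidean_space) chart set \<Rightarrow> ('x \<Rightarrow> 'e) set \<Rightarrow> ('x \<Rightarrow> 'e) set" where
  "lie_center A L = {Z \<in> L. \<forall>X\<in>L. \<forall>x\<in>carrier A. lie_bracket A Z X x = 0}"

definition flow_box_atlas ::
  "('x, 'e) chart set \<Rightarrow> real \<Rightarrow> 'x set \<Rightarrow> (real \<times> 'x, real \<times> 'e) chart set" where
  "flow_box_atlas A \<epsilon> W = (\<lambda>c. ({-\<epsilon><..<\<epsilon>} \<times> (fst c \<inter> W), \<lambda>(t, x). (t, snd c x))) ` A"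

definition local_flow ::
  "('x, 'e::euclidean_space) chart set \<Rightarrow> ('x \<Rightarrow> 'e) \<Rightarrow> real \<Rightarrow> 'x set \<Rightarrow> (real \<Rightarrow> 'x \<Rightarrow> 'x) \<Rightarrow> bool" where
  "local_flow A X \<epsilon> W \<Phi> \<longleftrightarrow>
     \<epsilon> > 0 \<and> atlas_open A W \<and>
     smooth_map (flow_box_atlas A \<epsilon> W) A (\<lambda>(t, x). \<Phi> t x) \<and>
     (\<forall>x\<in>W. \<Phi> 0 x = x) \<and>
     (\<forall>x\<in>W. \<forall>t\<in>{-\<epsilon><..<\<epsilon>}.
        ((\<lambda>s. snd (chart_at A (\<Phi> t x)) (\<Phi> s x)) has_vector_derivative X (\<Phi> t x)) (at t))"


subsection \<open>Embedded submanifolds\<close>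

text \<open>
  All charts, with values in the model space \<^typ>\<open>'d\<close>, of the embedded submanifold \<^term>\<open>P\<close> of the
  manifold with atlas \<^term>\<open>A\<close>: their inverses are smooth immersions which are homeomorphisms onto
  relatively open subsets of \<^term>\<open>P\<close>.
\<close>

definition submanifold_atlas ::
  "('x, 'e::euclidean_space) chart set \<Rightarrow> 'x set \<Rightarrow> ('x, 'd::euclidean_space) chart set" where
  "submanifold_atlas A P = {c.
     fst c \<subseteq> P \<and> inj_on (snd c) (fst c) \<and> open (chart_image c) \<and>
     (\<forall>U. open U \<longrightarrow> (\<exists>N. atlas_open A N \<and> fst c \<inter> snd c -` U = P \<inter> N)) \<and>
     smooth_map {c} A (\<lambda>p. p) \<and>
     (\<forall>d\<in>A. \<forall>p\<in>fst c \<inter> fst d. inj (frechet_derivative (snd d \<circ> chart_inv c) (at (snd c p))))}"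


section \<open>Complex vectors and matrices\<close>

definition adjoint_matrix :: "complex^'n^'m \<Rightarrow> complex^'m^'n" where
  "adjoint_matrix a = (\<chi> i j. cnj (a $ j $ i))"

text \<open>The products \<open>z\<^sup>* w\<close> and \<open>z w\<^sup>*\<close> of columns.\<close>

definition hdot :: "complex^'n \<Rightarrow> complex^'n \<Rightarrow> complex" where
  "hdot z w = (\<Sum>i\<in>UNIV. cnj (z $ i) * w $ i)"

definition houter :: "complex^'n \<Rightarrow> complex^'n \<Rightarrow> complex^'n^'n" where
  "houter z w = (\<chi> i j. z $ i * cnj (w $ j))"

definition mat_power :: "complex^'n^'n \<Rightarrow> nat \<Rightarrow> complex^'n^'n" where
  "mat_power a k = (((**) a) ^^ k) (mat 1)"

definition char_poly :: "complex^'n^'n \<Rightarrow> complex poly" where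
  "char_poly a = det (\<chi> i j. (if i = j then [:0, 1:] else 0) - [:a $ i $ j:])"

definition eigenvalues :: "complex^'n^'n \<Rightarrow> 'n \<Rightarrow> complex" where
  "eigenvalues a = (SOME l. char_poly a = (\<Prod>i\<in>UNIV. [:- l i, 1:]))"

definition elem_sym_eigenvalues :: "complex^'n^'n \<Rightarrow> nat \<Rightarrow> complex" where
  "elem_sym_eigenvalues a k = (\<Sum>I | card I = k. \<Prod>i\<in>I. eigenvalues a i)"


section \<open>Kaehler manifolds\<close>

text \<open>
  Since the transition maps are holomorphic, the complex structure of \<open>T\<^sub>x\<close> is multiplication by
  \<^term>\<open>\<i>\<close> of the coordinate vector in \<^typ>\<open>complex^'n\<close>.
\<close>

definition complex_manifold ::
  "('m::{t2_space,second_countable_topology}, complex^'n) chart set \<Rightarrow> bool" where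
  "complex_manifold A \<longleftrightarrow>
     carrier A = UNIV \<and>
     (\<forall>c\<in>A. open (fst c) \<and> open (chart_image c) \<and>
        homeomorphism (fst c) (chart_image c) (snd c) (chart_inv c)) \<and>
     (\<forall>c\<in>A. \<forall>d\<in>A. \<forall>y\<in>snd c ` (fst c \<inter> fst d).
        \<exists>D. ((snd d \<circ> chart_inv c) has_derivative D) (at y) \<and> (\<forall>a v. D (a *s v) = a *s D v))"

definition kaehler ::
  "('m::{t2_space,second_countable_topology}, complex^'n) chart set \<Rightarrow>
   ('m \<Rightarrow> complex^'n \<Rightarrow> complex^'n \<Rightarrow> real) \<Rightarrow> ('m \<Rightarrow> complex^'n \<Rightarrow> complex^'n \<Rightarrow> real) \<Rightarrow> bool" where
  "kaehler A g \<Omega> \<longleftrightarrow>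
     complex_manifold A \<and>
     (\<forall>x. bilinear (g x)) \<and>
     (\<forall>x v w. g x v w = g x w v) \<and>
     (\<forall>x v. v \<noteq> 0 \<longrightarrow> g x v v > 0) \<and>
     (\<forall>x v w. g x (\<i> *s v) (\<i> *s w) = g x v w) \<and>
     (\<forall>c\<in>A. \<forall>v w. real_analytic_on (chart_image c) (\<lambda>y. two_tensor_in_chart A c g y v w)) \<and>
     (\<forall>x v w. \<Omega> x v w = g x (\<i> *s v) w) \<and>
     (\<forall>x u v w. d_two_form A \<Omega> x u v w = 0)"

definition kaehler_fields ::
  "('m, complex^'n) chart set \<Rightarrow> ('m \<Rightarrow> complex^'n \<Rightarrow> complex^'n \<Rightarrow> real) \<Rightarrow> ('m \<Rightarrow> complex^'n) set" where
  "kaehler_fields A \<Omega> = {X. smooth_field A X \<and>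
     (\<forall>\<epsilon> W \<Phi>. local_flow A X \<epsilon> W \<Phi> \<longrightarrow>
        (\<forall>t\<in>{-\<epsilon><..<\<epsilon>}. \<forall>x\<in>W.
           (\<forall>v. tangent_map A A (\<Phi> t) x (\<i> *s v) = \<i> *s tangent_map A A (\<Phi> t) x v) \<and>
           (\<forall>v w. \<Omega> (\<Phi> t x) (tangent_map A A (\<Phi> t) x v) (tangent_map A A (\<Phi> t) x w)
                   = \<Omega> x v w)))}"

definition omega_complement ::
  "('m \<Rightarrow> complex^'n \<Rightarrow> complex^'n \<Rightarrow> real) \<Rightarrow> 'm \<Rightarrow> (complex^'n) set \<Rightarrow> (complex^'n) set" where
  "omega_complement \<Omega> x K = {v. \<forall>w\<in>K. \<Omega> x v w = 0}"


section \<open>The unitary coframe bundle\<close>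

text \<open>
  A complex-linear map \<open>u : T\<^sub>x \<rightarrow> \<complex>\<^sup>n\<close> is stored as its matrix, so the bundle of all such maps has
  underlying set \<^typ>\<open>'m \<times> (complex^'n^'n)\<close>. Its atlas \<open>hom_atlas\<close> sends \<open>(x, u)\<close> to the coordinates
  of \<^term>\<open>x\<close> and the matrix of \<^term>\<open>u\<close> in a given chart of the base. (The induced topology is in
  general not the product topology, as \<^term>\<open>chart_at A x\<close> jumps with \<^term>\<open>x\<close>.) The unitary
  coframes form an embedded submanifold of real dimension \<open>2n + n\<^sup>2\<close>; the model space
  \<^typ>\<open>(complex^'n) \<times> (real^'n^'n)\<close> has this dimension, and its choice is otherwise immaterial.
\<close>

definition hom_atlas ::
  "('m, complex^'n) chart set \<Rightarrow> ('m \<times> (complex^'n^'n), (complex^'n) \<times> (complex^'n^'n)) chart set" where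
  "hom_atlas A =
     (\<lambda>c. (fst c \<times> UNIV, \<lambda>(x, u). (snd c x, u ** matrix (from_chart A c x)))) ` A"

definition coframes ::
  "('m \<Rightarrow> complex^'n \<Rightarrow> complex^'n \<Rightarrow> real) \<Rightarrow> ('m \<times> (complex^'n^'n)) set" where
  "coframes g = {(x, u). \<forall>v w. (u *v v) \<bullet> (u *v w) = g x v w}"

definition coframe_atlas ::
  "('m, complex^'n) chart set \<Rightarrow> ('m \<Rightarrow> complex^'n \<Rightarrow> complex^'n \<Rightarrow> real) \<Rightarrow>
   ('m \<times> (complex^'n^'n), (complex^'n) \<times> (real^'n^'n)) chart set" where
  "coframe_atlas A g = submanifold_atlas (hom_atlas A) (coframes g)"

definition tautological_form ::
  "('m, complex^'n) chart set \<Rightarrow> ('m \<Rightarrow> complex^'n \<Rightarrow> complex^'n \<Rightarrow> real) \<Rightarrow>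
   'm \<times> (complex^'n^'n) \<Rightarrow> (complex^'n) \<times> (real^'n^'n) \<Rightarrow> complex^'n" where
  "tautological_form A g p v = snd p *v tangent_map (coframe_atlas A g) A fst p v"

definition connection_form ::
  "('m, complex^'n) chart set \<Rightarrow> ('m \<Rightarrow> complex^'n \<Rightarrow> complex^'n \<Rightarrow> real) \<Rightarrow>
   ('m \<times> (complex^'n^'n) \<Rightarrow> (complex^'n) \<times> (real^'n^'n) \<Rightarrow> complex^'n^'n) \<Rightarrow> bool" where
  "connection_form A g \<phi> \<longleftrightarrow>
     (let \<omega> = tautological_form A g in
      smooth_one_form (coframe_atlas A g) \<phi> \<and>
      (\<forall>p\<in>coframes g. \<forall>v. adjoint_matrix (\<phi> p v) = - \<phi> p v) \<and>
      (\<forall>p\<in>coframes g. \<forall>v w.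
         d_one_form (coframe_atlas A g) \<omega> p v w = - wedge (*v) (\<phi> p) (\<omega> p) v w))"


section \<open>Bochner-Kaehler structures\<close>

text \<open>Scalar matrices \<open>s I\<^sub>n\<close> are written \<^term>\<open>mat s\<close>, and \<open>s a\<close> is written \<open>mat s ** a\<close>.\<close>

definition bochner_kaehler ::
  "('m::{t2_space,second_countable_topology}, complex^'n) chart set \<Rightarrow>
   ('m \<Rightarrow> complex^'n \<Rightarrow> complex^'n \<Rightarrow> real) \<Rightarrow>
   ('m \<Rightarrow> complex^'n \<Rightarrow> complex^'n \<Rightarrow> real) \<Rightarrow>
   ('m \<times> (complex^'n^'n) \<Rightarrow> (complex^'n) \<times> (real^'n^'n) \<Rightarrow> complex^'n^'n) \<Rightarrow>
   ('m \<times> (complex^'n^'n) \<Rightarrow> complex^'n^'n) \<Rightarrow>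
   ('m \<times> (complex^'n^'n) \<Rightarrow> complex^'n) \<Rightarrow>
   ('m \<times> (complex^'n^'n) \<Rightarrow> real) \<Rightarrow> bool" where
  "bochner_kaehler A g \<Omega> \<phi> H T V \<longleftrightarrow>
     (let PA = coframe_atlas A g; \<omega> = tautological_form A g in
      kaehler A g \<Omega> \<and> connection_form A g \<phi> \<and>
      smooth_fun PA H \<and> smooth_fun PA T \<and> smooth_fun PA V \<and>
      (\<forall>p\<in>coframes g. adjoint_matrix (H p) = H p) \<and>
      (\<forall>p\<in>coframes g. \<forall>v w.
         d_one_form PA \<phi> p v w =
           - wedge (**) (\<phi> p) (\<phi> p) v w
           + mat (wedge hdot (\<omega> p) (\<omega> p) v w) ** H p
           - H p ** wedge houter (\<omega> p) (\<omega> p) v w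
           - wedge houter (\<omega> p) (\<omega> p) v w ** H p
           + mat (wedge hdot (\<omega> p) (\<lambda>a. H p *v \<omega> p a) v w)
           + mat (trace (H p)) **
               (mat (wedge hdot (\<omega> p) (\<omega> p) v w) - wedge houter (\<omega> p) (\<omega> p) v w)) \<and>
      (\<forall>p\<in>coframes g. \<forall>v.
         differential PA H p v =
           - (\<phi> p v ** H p) + H p ** \<phi> p v + houter (T p) (\<omega> p v) + houter (\<omega> p v) (T p)) \<and>
      (\<forall>p\<in>coframes g. \<forall>v.
         differential PA T p v =
           - (\<phi> p v *v T p)
           + (mat_power (H p) 2 + mat (trace (H p)) ** H p + mat (complex_of_real (V p))) *v \<omega> p v) \<and>
      (\<forall>p\<in>coframes g. \<forall>v.
         complex_of_real (differential PA V p v) =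
           trace (H p) * (hdot (T p) (\<omega> p v) + hdot (\<omega> p v) (T p))
           + (hdot (T p) (H p *v \<omega> p v) + hdot (\<omega> p v) (H p *v T p))))"

definition represents ::
  "('m \<Rightarrow> complex^'n \<Rightarrow> complex^'n \<Rightarrow> real) \<Rightarrow> ('m \<Rightarrow> complex^'n) \<Rightarrow>
   ('m \<times> (complex^'n^'n) \<Rightarrow> complex^'n) \<Rightarrow> bool" where
  "represents g Z z \<longleftrightarrow> (\<forall>(x, u)\<in>coframes g. z (x, u) = u *v Z x)"

text \<open>The function written \<open>z\<^sub>k\<^sub>+\<^sub>2\<close>; the argument is \<^term>\<open>k\<close>.\<close>

definition z_fun ::
  "('m \<times> (complex^'n^'n) \<Rightarrow> complex^'n^'n) \<Rightarrow> ('m \<times> (complex^'n^'n) \<Rightarrow> complex^'n) \<Rightarrow> nat \<Rightarrow>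
   'm \<times> (complex^'n^'n) \<Rightarrow> complex^'n" where
  "z_fun H T k p =
     (2 * \<i> * (-1) ^ k) *s
       ((\<Sum>j\<le>k. mat ((-1) ^ j * elem_sym_eigenvalues (H p) j) ** mat_power (H p) (k - j)) *v T p)"

definition A_inv :: "('p \<Rightarrow> complex^'n^'n) \<Rightarrow> nat \<Rightarrow> 'p \<Rightarrow> real" where
  "A_inv H k p = Re (trace (mat_power (H p) k))"

definition B_inv ::
  "('p \<Rightarrow> complex^'n^'n) \<Rightarrow> ('p \<Rightarrow> complex^'n) \<Rightarrow> ('p \<Rightarrow> real) \<Rightarrow> nat \<Rightarrow> 'p \<Rightarrow> real" where
  "B_inv H T V k p = (if k = 2 then V p else Re (hdot (T p) (mat_power (H p) (k - 3) *v T p)))"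

text \<open>
  The index type \<^typ>\<open>'n bit1\<close> has \<open>2n + 1\<close> elements, represented by the integers \<open>0, \<dots>, 2n\<close>;
  the components are \<open>A\<^sub>1, \<dots>, A\<^sub>n, B\<^sub>2, \<dots>, B\<^sub>n\<^sub>+\<^sub>2\<close> in this order. Those functions are constant on the
  fibres, so that any coframe at \<^term>\<open>x\<close> may be used.
\<close>

definition moduli_map ::
  "('m \<Rightarrow> complex^'n \<Rightarrow> complex^'n \<Rightarrow> real) \<Rightarrow>
   ('m \<times> (complex^'n^'n) \<Rightarrow> complex^'n^'n) \<Rightarrow> ('m \<times> (complex^'n^'n) \<Rightarrow> complex^'n) \<Rightarrow>
   ('m \<times> (complex^'n^'n) \<Rightarrow> real) \<Rightarrow> 'm \<Rightarrow> real^('n bit1)" where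
  "moduli_map g H T V x =
     (let p = (SOME p. p \<in> coframes g \<and> fst p = x) in
      \<chi> i. let j = nat (Rep_bit1 i) in
           if j < CARD('n) then A_inv H (j + 1) p else B_inv H T V (j - CARD('n) + 2) p)"


section \<open>The real vector space of functions\<close>

instantiation "fun" :: (type, real_vector) real_vector
begin

definition scaleR_fun :: "real \<Rightarrow> ('a \<Rightarrow> 'b) \<Rightarrow> 'a \<Rightarrow> 'b" where
  "scaleR_fun r f = (\<lambda>x. r *\<^sub>R f x)"

instance
  by standard (auto simp: scaleR_fun_def plus_fun_def scaleR_add_right scaleR_add_left)

end


section \<open>Consistency of the sign conventions\<close>

lemma kaehler_form_coframes:
  fixes A :: "('m::{t2_space,second_countable_topology}, complex^'n) chart set"
  assumes "kaehler A g \<Omega>" and "p \<in> coframes g"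
  shows "complex_of_real (\<Omega> (fst p) (tangent_map (coframe_atlas A g) A fst p v)
                                   (tangent_map (coframe_atlas A g) A fst p w))
         = - (\<i> / 2) * wedge hdot (tautological_form A g p) (tautological_form A g p) v w"
proof -
  have Im_hdot: "Im (hdot a b) = (\<i> *s a) \<bullet> b" for a b :: "complex^'n"
    by (simp add: hdot_def inner_vec_def inner_complex_def algebra_simps)
  have cnj: "hdot b a = cnj (hdot a b)" for a b :: "complex^'n"
    by (simp add: hdot_def mult.commute)
  have lin: "u *v (\<i> *s a) = \<i> *s (u *v a)" for u :: "complex^'n^'n" and a
    by (simp add: vec_eq_iff matrix_vector_mult_def sum_distrib_left algebra_simps)
  define a where "a = tangent_map (coframe_atlas A g) A fst p v"
  define b where "b = tangent_map (coframe_atlas A g) A fst p w"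
  have "\<Omega> (fst p) a b = g (fst p) (\<i> *s a) b"
    using assms(1) by (simp add: kaehler_def)
  also have "\<dots> = (snd p *v (\<i> *s a)) \<bullet> (snd p *v b)"
    using assms(2) by (auto simp: coframes_def)
  also have "\<dots> = Im (hdot (snd p *v a) (snd p *v b))"
    by (simp add: Im_hdot lin)
  finally have "complex_of_real (\<Omega> (fst p) a b)
      = - (\<i> / 2) * (hdot (snd p *v a) (snd p *v b) - cnj (hdot (snd p *v a) (snd p *v b)))"
    by (simp add: complex_eq_iff)
  then show ?thesis
    by (simp add: wedge_def tautological_form_def a_def b_def flip: cnj)
qed

end

theory Submission
  imports Defs "HOL-Complex_Analysis.Complex_Analysis" "HOL-Computational_Algebra.Fundamental_Theorem_Algebra"
begin

text \<open>
  Pulled back along a local unitary frame, the structure equations become equations between matrix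
  valued functions and forms on an open subset of \<open>\<complex>\<^sup>n\<close>, and they determine the connection and the
  structure functions. The latter are therefore equivariant under \<open>U(n)\<close> and natural under local
  holomorphic isometries. The recursion \<open>S\<^sub>k = H S\<^sub>k\<^sub>-\<^sub>1 + e\<^sub>k\<close> with signed elementary symmetric functions
  \<open>e\<^sub>k\<close>, together with Newton's identities, gives \<open>dz = -\<phi> z + a \<omega>\<close> with \<open>a\<close> skew-Hermitian for
  \<open>z = 2i(-1)\<^sup>k S\<^sub>k T\<close>, so the Lie derivative of the Hermitian metric along \<open>Z\<^sub>k\<close> vanishes. By naturality
  the flow of any field of \<open>\<gg>\<close> preserves the \<open>Z\<^sub>k\<close>, whence they are central. The derivatives of the
  \<open>A\<^sub>k\<close> are multiples of the forms \<open>Re (H\<^sup>j T)\<^sup>* \<omega>\<close>; the \<open>dB\<^sub>k\<close> vanish on the common kernel of these, which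
  by Cayley-Hamilton is the \<open>\<Omega>\<close>-complement of the span of the \<open>Z\<^sub>k\<close>. At every point the \<open>Z\<^sub>k\<close> span an
  isotropic, hence totally real, subspace. If a Kaehler field is a real combination of a totally
  real family of the \<open>Z\<^sub>k\<close> on an open set, then its coefficients are real holomorphic functions,
  hence constant, and unique continuation of holomorphic fields gives the statements on dimensions.
\<close>

section \<open>Calculus of smooth functions\<close>

text \<open>\<open>kaehler_fields\<close> imposes a condition on every local flow of a field, so it
  yields information only once a flow is known to exist; hence the detour through smooth dependence
  of solutions of differential equations on initial values. Likewise \<open>coframe_atlas\<close>
  collects all admissible charts, and statements about its forms have content only where such charts
  exist: smooth square roots of Gram matrices provide local sections, Cayley transforms provide the
  charts. Smoothness of the transition maps is derived from complex differentiability, that of the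
  metric from convergent power series. The bridge between real dimensions and holomorphic arguments
  is isotropy: the inner products of T with H^j T and the coefficients of the characteristic
  polynomial are real, so \<Omega> vanishes on the span of the fields at each point, and real
  independence there implies complex independence. A maximal independent family can therefore be
  completed to a complex frame, in which holomorphic fields have holomorphic coefficients.\<close>

abbreviation dd :: "('a::real_normed_vector => 'b::real_normed_vector) => 'a => 'a => 'b" where
 "dd f y \<equiv> frechet_derivative f (at y)"

abbreviation "adj \<equiv> adjoint_matrix"

lemma dd_eqI: "(f has_derivative f') (at x) ==> dd f x = f'"
 using frechet_derivative_at by metis

lemma Ck_on_continuous: "Ck_on k S f ==> continuous_on S f"
 by (cases k) (auto intro!: continuous_at_imp_continuous_on differentiable_imp_continuous_within)

lemma Ck_on_subset: "Ck_on k S f ==> T \<subseteq> S ==> Ck_on k T f"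
 by (induction k arbitrary: f) (auto intro: continuous_on_subset)

lemma dd_cong:
 assumes "open S" "x \<in> S" "\<And>y. y \<in> S ==> f y = g y"
 shows "dd f x = dd g x"
proof -
 have "(f has_derivative D) (at x) \<longleftrightarrow> (g has_derivative D) (at x)" for D
  using assms has_derivative_transform_within_open[of f D x UNIV S g]
   has_derivative_transform_within_open[of g D x UNIV S f] by auto
 then show ?thesis by (simp add: frechet_derivative_def)
qed

lemma differentiable_cong_open:
 assumes "open S" "x \<in> S" "\<And>y. y \<in> S ==> f y = g y" "f differentiable (at x)"
 shows "g differentiable (at x)"
 using assms has_derivative_transform_within_open[of f _ x UNIV S g]
 by (auto simp: differentiable_def)

lemma Ck_on_cong:
 assumes "open S" "\<And>x. x \<in> S ==> f x = g x" "Ck_on k S f"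
 shows "Ck_on k S g"
 using assms(2,3)
proof (induction k arbitrary: f g)
 case 0
 then show ?case using continuous_on_cong[of S S f g] by auto
next
 case (Suc k)
 have "Ck_on k S (%x. dd g x v)" for v
  apply (rule Suc.IH[of "%x. dd f x v"])
  using Suc.prems dd_cong[OF assms(1), of _ f g] by auto
 then show ?case
  using Suc.prems differentiable_cong_open[OF assms(1), of _ f g] by auto
qed

text \<open>The induction step of most smoothness proofs: on an open set the chosen
  \<open>frechet_derivative\<close> may be replaced by any explicit formula for the derivative,
  whose values in fixed directions are then left to the induction hypothesis.\<close>

lemma Ck_on_SucI:
 assumes "open S" "\<And>x. x \<in> S ==> (f has_derivative f' x) (at x)"
  "\<And>v. Ck_on k S (%x. f' x v)"
 shows "Ck_on (Suc k) S f"
proof -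
 have "Ck_on k S (%x. dd f x v)" for v
  by (rule Ck_on_cong[OF assms(1) _ assms(3)[of v]]) (simp add: dd_eqI[OF assms(2)])
 then show ?thesis using assms(2) by (auto simp: differentiable_def)
qed

lemma Ck_on_SucD:
 assumes "Ck_on (Suc k) S f"
 shows "Ck_on k S f"
 using assms
proof (induction k arbitrary: f)
 case 0
 show ?case using Ck_on_continuous[OF 0] by simp
next
 case (Suc k)
 show ?case
  unfolding Ck_on.simps(2)[of k]
 proof (intro conjI allI)
  show "\<forall>x\<in>S. f differentiable at x" using Suc.prems by simp
  show "Ck_on k S (%x. dd f x v)" for v
   by (rule Suc.IH) (use Suc.prems in \<open>simp only: Ck_on.simps(2)[of "Suc k"]\<close>)
 qed
qed

lemma Ck_on_le: "Ck_on k S f ==> j \<le> k ==> Ck_on j S f"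
 by (induction k) (auto simp: le_Suc_eq dest: Ck_on_SucD simp del: Ck_on.simps)

lemma Ck_dd:
 "Ck_on (Suc k) S f ==> x \<in> S ==> (f has_derivative dd f x) (at x)"
 by (simp add: frechet_derivative_works)

lemma Ck_on_local:
 assumes "\<And>x. x \<in> S ==> \<exists>U. open U \<and> x \<in> U \<and> Ck_on k U f"
 shows "Ck_on k S f"
 using assms
proof (induction k arbitrary: f)
 case 0
 show ?case
  unfolding Ck_on.simps
 proof (rule continuous_at_imp_continuous_on, rule ballI)
  fix x assume "x \<in> S"
  then obtain U where "open U" "x \<in> U" "continuous_on U f" using 0 by auto
  then show "isCont f x" using continuous_on_eq_continuous_at by blast
 qed
next
 case (Suc k)
 have "Ck_on k S (%x. dd f x v)" for v
  by (rule Suc.IH) (use Suc.prems in \<open>simp only: Ck_on.simps(2)[of k], blast\<close>)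
 moreover have "f differentiable at x" if "x \<in> S" for x
  using Suc.prems[OF that] by auto
 ultimately show ?case by simp
qed

lemma Ck_on_const: "Ck_on k S (%x. c)"
 by (induction k arbitrary: c) (auto simp: frechet_derivative_const)

lemma Ck_on_linear_comp:
 assumes "open S" "bounded_linear h" "Ck_on k S f"
 shows "Ck_on k S (%x. h (f x))"
 using assms(3)
proof (induction k arbitrary: f)
 case 0
 then show ?case using assms(2) by (simp add: bounded_linear.continuous_on)
next
 case (Suc k)
 show ?case
 proof (rule Ck_on_SucI[OF assms(1)])
  show "((%x. h (f x)) has_derivative (%v. h (dd f x v))) (at x)" if "x \<in> S" for x
   by (rule bounded_linear.has_derivative[OF assms(2) Ck_dd[OF Suc.prems that]])
  show "Ck_on k S (%x. h (dd f x v))" for v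
   by (rule Suc.IH) (use Suc.prems in simp)
 qed
qed

lemma Ck_on_id: "open S ==> Ck_on k S (%x. x)"
 by (cases k) (simp_all add: Ck_on_SucI[where f' = "%_ v. v"] Ck_on_const del: Ck_on.simps(2))

lemma Ck_on_linear: "open S ==> bounded_linear h ==> Ck_on k S h"
 using Ck_on_linear_comp[OF _ _ Ck_on_id] by blast

lemma Ck_on_add:
 assumes "open S" "Ck_on k S f" "Ck_on k S g"
 shows "Ck_on k S (%x. f x + g x)"
 using assms(2,3)
proof (induction k arbitrary: f g)
 case 0
 then show ?case by (simp add: continuous_on_add)
next
 case (Suc k)
 show ?case
 proof (rule Ck_on_SucI[OF assms(1)])
  show "((%x. f x + g x) has_derivative
   (%v. dd f x v + dd g x v)) (at x)" if "x \<in> S" for x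
   by (intro has_derivative_add Ck_dd[OF Suc.prems(1) that]
     Ck_dd[OF Suc.prems(2) that])
  show "Ck_on k S (%x. dd f x v + dd g x v)" for v
   by (rule Suc.IH) (use Suc.prems in simp_all)
 qed
qed

lemma Ck_on_sum:
 assumes "open S" "\<And>i. i \<in> I ==> Ck_on k S (f i)"
 shows "Ck_on k S (%x. \<Sum>i\<in>I. f i x)"
 using assms(2)
 by (induction I rule: infinite_finite_induct) (auto intro!: Ck_on_const Ck_on_add assms(1))

lemma Ck_on_bilinear:
 assumes "open S" "bounded_bilinear h" "Ck_on k S f" "Ck_on k S g"
 shows "Ck_on k S (%x. h (f x) (g x))"
 using assms(3,4)
proof (induction k arbitrary: f g)
 case 0
 then show ?case using assms(2) by (simp add: bounded_bilinear.continuous_on)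
next
 case (Suc k)
 show ?case
 proof (rule Ck_on_SucI[OF assms(1)])
  show "((%x. h (f x) (g x)) has_derivative
   (%v. h (f x) (dd g x v) + h (dd f x v) (g x))) (at x)"
   if "x \<in> S" for x
   by (rule bounded_bilinear.FDERIV[OF assms(2)];
     rule Ck_dd[OF Suc.prems(1) that] Ck_dd[OF Suc.prems(2) that])
  show "Ck_on k S (%x. h (f x) (dd g x v) + h (dd f x v) (g x))" for v
   using Suc.prems Ck_on_SucD[OF Suc.prems(1)] Ck_on_SucD[OF Suc.prems(2)]
   by (intro Ck_on_add assms(1) Suc.IH) auto
 qed
qed

lemma Ck_on_Pair:
 assumes "open S" "Ck_on k S f" "Ck_on k S g"
 shows "Ck_on k S (%x. (f x, g x))"
proof -
 have "Ck_on k S (%x. (f x, 0) + (0, g x))"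
  by (rule Ck_on_add[OF assms(1)]; rule Ck_on_linear_comp[OF assms(1)])
   (auto intro!: assms bounded_linear_Pair bounded_linear_ident bounded_linear_zero)
 then show ?thesis by simp
qed

lemma linear_expand_Basis:
 fixes D :: "'a::euclidean_space => 'b::real_vector"
 assumes "linear D"
 shows "D v = (\<Sum>b\<in>Basis. (v \<bullet> b) *\<^sub>R D b)"
 by (metis (no_types, lifting) assms euclidean_representation linear_scale linear_sum sum.cong)

text \<open>\<open>Ck_on\<close> tests derivatives in fixed directions only, whereas the chain rule
  evaluates \<open>dd f (g x)\<close> in the moving direction \<open>dd g x v\<close>. Expanding
  this direction in the basis makes every term a product of a scalar function and a derivative in a
  fixed direction.\<close>

lemma Ck_on_compose:
 assumes "open S" "open T" "Ck_on k T f" "Ck_on k S g" "g ` S \<subseteq> T"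
 shows "Ck_on k S (%x. f (g x))"
 using assms(3,4)
proof (induction k arbitrary: f)
 case 0
 then show ?case using continuous_on_compose2[of T f S g] assms(5) by auto
next
 case (Suc k)
 show ?case
 proof (rule Ck_on_SucI[OF assms(1)])
  fix x assume x: "x \<in> S"
  note f = Ck_dd[OF Suc.prems(1), of "g x"]
  have l: "linear (dd f (g x))"
   using f x assms(5) has_derivative_linear by blast
  have "((%x. f (g x)) has_derivative (%v. dd f (g x) (dd g x v))) (at x)"
   using has_derivative_compose[OF Ck_dd[OF Suc.prems(2) x] f] x assms(5) by auto
  then show "((%x. f (g x)) has_derivative (%v. \<Sum>b\<in>Basis. (dd g x v \<bullet> b) *\<^sub>R
    dd f (g x) b)) (at x)"
   by (subst (asm) linear_expand_Basis[OF l])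
 next
  fix v
  show "Ck_on k S (%x. \<Sum>b\<in>Basis. (dd g x v \<bullet> b) *\<^sub>R dd f (g x) b)"
   using Suc.prems Ck_on_SucD[OF Suc.prems(2)]
   by (intro Ck_on_sum assms(1) Ck_on_bilinear[OF assms(1) bounded_bilinear_scaleR] Suc.IH
     Ck_on_linear_comp[OF assms(1) bounded_linear_inner_left]) auto
 qed
qed

text \<open>A moving base point and a moving direction cost only the one order spent on the
  derivative of \<open>f\<close>. The right side of the variational equation of a differential
  equation has this form.\<close>

lemma Ck_on_derivative_apply:
 assumes "open S" "open T" "Ck_on (Suc k) T f" "Ck_on k S g" "g ` S \<subseteq> T" "Ck_on k S v"
 shows "Ck_on k S (%x. dd f (g x) (v x))"
proof -
 have "linear (dd f (g x))" if "x \<in> S" for x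
  using Ck_dd[OF assms(3), of "g x"] that assms(5) has_derivative_linear by blast
 note * = linear_expand_Basis[OF this]
 have "Ck_on k S (%x. \<Sum>b\<in>Basis. (v x \<bullet> b) *\<^sub>R dd f (g x) b)"
  using assms(3)
  by (intro Ck_on_sum assms(1) Ck_on_bilinear[OF assms(1) bounded_bilinear_scaleR]
     Ck_on_compose[OF assms(1,2) _ assms(4,5)]
     Ck_on_linear_comp[OF assms(1) bounded_linear_inner_left] assms(6)) auto
 then show ?thesis
  by (rule Ck_on_cong[OF assms(1), rotated]) (simp add: *[symmetric])
qed

lemma Ck_on_inverse:
 fixes f :: "'a::euclidean_space => complex"
 assumes "open S" "Ck_on k S f" "\<And>x. x \<in> S ==> f x \<noteq> 0"
 shows "Ck_on k S (%x. inverse (f x))"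
 using assms(2)
proof (induction k)
 case 0
 then show ?case using assms(3) by (auto intro!: continuous_on_inverse)
next
 case (Suc k)
 show ?case
 proof (rule Ck_on_SucI[OF assms(1)])
  show "((%x. inverse (f x)) has_derivative
    (%v. - (inverse (f x) * dd f x v * inverse (f x)))) (at x)" if "x \<in> S" for x
   using Deriv.has_derivative_inverse[OF assms(3)[OF that] Ck_dd[OF Suc.prems that]] .
  have "Ck_on k S (%x. - 1 * (inverse (f x) * dd f x v * inverse (f x)))" for v
   using Suc.prems Suc.IH Ck_on_SucD[OF Suc.prems]
   by (intro Ck_on_bilinear[OF assms(1) bounded_bilinear_mult] Ck_on_const) auto
  then show "Ck_on k S (%x. - (inverse (f x) * dd f x v * inverse (f x)))" for v
   by simp
 qed
qed

lemma Ck_on_prod: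
 fixes f :: "'i => 'a::euclidean_space => complex"
 assumes "open S" "\<And>i. i \<in> I ==> Ck_on k S (f i)"
 shows "Ck_on k S (%x. \<Prod>i\<in>I. f i x)"
 using assms(2)
 by (induction I rule: infinite_finite_induct)
  (auto intro!: Ck_on_const Ck_on_bilinear[OF assms(1) bounded_bilinear_mult])

lemma Ck_on_vec:
 fixes f :: "'a::euclidean_space => ('b::euclidean_space)^'n"
 assumes "open S" "\<And>i. Ck_on k S (%x. f x $ i)"
 shows "Ck_on k S f"
proof -
 have l: "bounded_linear (axis i :: 'b => 'b^'n)" for i
  by (auto simp: linear_linear axis_def vec_eq_iff intro!: linearI)
 have "f x = (\<Sum>i\<in>UNIV. axis i (f x $ i))" for x
  by (simp add: vec_eq_iff axis_def sum.delta)
 moreover have "Ck_on k S (%x. \<Sum>i\<in>UNIV. axis i (f x $ i))"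
  by (intro Ck_on_sum assms(1) Ck_on_linear_comp[OF assms(1) l] assms(2))
 ultimately show ?thesis by (auto intro: Ck_on_cong[OF assms(1), rotated])
qed

lemma Ck_on_nth: "open S ==> Ck_on k S f ==> Ck_on k S (%x. f x $ i)"
 by (rule Ck_on_linear_comp[OF _ bounded_linear_vec_nth])

lemma Ck_on_det:
 fixes M :: "'a::euclidean_space => complex^'n^'n"
 assumes "open S" "Ck_on k S M"
 shows "Ck_on k S (%x. det (M x))"
 unfolding det_def
 by (intro Ck_on_sum Ck_on_prod Ck_on_bilinear[OF _ bounded_bilinear_mult] Ck_on_const Ck_on_nth assms)

lemma matrix_inv_right: "invertible M ==> M ** matrix_inv M = mat 1"
 and matrix_inv_left: "invertible M ==> matrix_inv M ** M = mat 1"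
 unfolding invertible_def matrix_inv_def by (metis (mono_tags, lifting) someI_ex)+

text \<open>Cramer's rule, applied to each column of the inverse. It turns the entries into
  quotients of determinants, for which smoothness is already known.\<close>

lemma matrix_inv_nth:
 fixes M :: "complex^'n^'n"
 assumes "invertible M"
 shows "matrix_inv M $ k $ j = det (\<chi> i l. if l = k then axis j 1 $ i else M $ i $ l) * inverse (det M)"
proof -
 have d: "det M \<noteq> 0" using assms invertible_det_nz by blast
 have "M *v (matrix_inv M *v axis j 1) = axis j 1"
  by (simp add: matrix_vector_mul_assoc matrix_inv_right[OF assms])
 then have "matrix_inv M *v axis j 1 = (\<chi> k. det (\<chi> i l. if l = k then axis j 1 $ i else M $ i $ l) / det M)"
  using cramer[OF d] by blast
 then have "(matrix_inv M *v axis j 1) $ k = det (\<chi> i l. if l = k then axis j 1 $ i else M $ i $ l) * inverse (det M)"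
  by (simp add: divide_inverse)
 moreover have "(matrix_inv M *v axis j 1) $ k = matrix_inv M $ k $ j"
  by (simp add: matrix_vector_mult_def axis_def if_distrib cong: if_cong)
 ultimately show ?thesis by simp
qed

lemma Ck_on_matrix_inv:
 fixes M :: "'a::euclidean_space => complex^'n^'n"
 assumes "open S" "Ck_on k S M" "\<And>x. x \<in> S ==> invertible (M x)"
 shows "Ck_on k S (%x. matrix_inv (M x))"
proof (intro Ck_on_vec assms(1))
 fix i j
 have "Ck_on k S (%x. det (\<chi> p l. if l = i then axis j 1 $ p else M x $ p $ l) * inverse (det (M x)))"
 proof (intro Ck_on_bilinear[OF assms(1) bounded_bilinear_mult] Ck_on_inverse Ck_on_det assms)
  show "det (M x) \<noteq> 0" if "x \<in> S" for x
   using assms(3)[OF that] invertible_det_nz by blast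
  show "Ck_on k S (%x. \<chi> p l. if l = i then axis j 1 $ p else M x $ p $ l)"
   apply (intro Ck_on_vec assms(1))
   subgoal for p l
    by (cases "l = i") (auto intro!: Ck_on_const Ck_on_nth assms)
   done
 qed
 then show "Ck_on k S (%x. matrix_inv (M x) $ i $ j)"
  by (rule Ck_on_cong[OF assms(1), rotated]) (simp add: matrix_inv_nth[OF assms(3)])
qed

section \<open>Rules for infinitely differentiable maps\<close>

lemma smooth_onD: "smooth_on S f ==> Ck_on k S f"
 by (simp add: smooth_on_def)

lemma smooth_onI: "(\<And>k. Ck_on k S f) ==> smooth_on S f"
 by (simp add: smooth_on_def)

lemma smooth_dd:
 "smooth_on S f ==> x \<in> S ==> (f has_derivative dd f x) (at x)"
 using Ck_dd[OF smooth_onD[of _ _ "Suc 0"]] .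

lemma linear_dd:
 "smooth_on S f ==> x \<in> S ==> linear (dd f x)"
 using smooth_dd has_derivative_linear by blast

lemma smooth_on_continuous: "smooth_on S f ==> continuous_on S f"
 using Ck_on_continuous[OF smooth_onD[of _ _ 0]] .

lemma smooth_on_subset: "smooth_on S f ==> T \<subseteq> S ==> smooth_on T f"
 unfolding smooth_on_def using Ck_on_subset by blast

lemma smooth_on_cong:
 "open S ==> (\<And>x. x \<in> S ==> f x = g x) ==> smooth_on S f ==> smooth_on S g"
 unfolding smooth_on_def using Ck_on_cong[of S f g] by blast

lemma smooth_on_local:
 assumes "\<And>x. x \<in> S ==> \<exists>U. open U \<and> x \<in> U \<and> smooth_on U f"
 shows "smooth_on S f"
 using assms unfolding smooth_on_def by (intro allI Ck_on_local) blast

lemma smooth_on_dd: "smooth_on S f ==> smooth_on S (%x. dd f x v)"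
 by (intro smooth_onI) (metis Ck_on.simps(2) smooth_onD)

lemma smooth_on_const: "smooth_on S (%x. c)"
 by (rule smooth_onI, rule Ck_on_const)

lemma smooth_on_id: "open S ==> smooth_on S (%x. x)"
 by (rule smooth_onI, rule Ck_on_id) (simp_all add: smooth_on_def)

lemma smooth_on_linear: "open S ==> linear h ==> smooth_on S (h :: _::euclidean_space => _::euclidean_space)"
 by (rule smooth_onI, rule Ck_on_linear) (simp_all add: smooth_on_def linear_conv_bounded_linear)

lemma smooth_on_linear_comp:
 "open S ==> linear (h :: _::euclidean_space => _::euclidean_space) ==> smooth_on S f ==> smooth_on S (%x. h (f x))"
 by (rule smooth_onI, rule Ck_on_linear_comp) (simp_all add: smooth_on_def linear_conv_bounded_linear)

lemma smooth_on_add: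
 "open S ==> smooth_on S f ==> smooth_on S g ==> smooth_on S (%x. f x + g x)"
 by (rule smooth_onI, rule Ck_on_add) (simp_all add: smooth_on_def)

lemma smooth_on_sum:
 "open S ==> (\<And>i. i \<in> I ==> smooth_on S (f i)) ==> smooth_on S (%x. \<Sum>i\<in>I. f i x)"
 by (rule smooth_onI, rule Ck_on_sum) (simp_all add: smooth_on_def)

lemma smooth_on_bilinear:
 assumes "open S" "bilinear (h :: _::euclidean_space => _::euclidean_space => _::euclidean_space)"
  "smooth_on S f" "smooth_on S g"
 shows "smooth_on S (%x. h (f x) (g x))"
 by (rule smooth_onI, rule Ck_on_bilinear) (use assms in \<open>simp_all add: smooth_on_def bilinear_conv_bounded_bilinear\<close>)

lemma smooth_on_minus: "open S ==> smooth_on S f ==> smooth_on S (%x. - f x)"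
 by (rule smooth_on_linear_comp[where h = uminus]) (auto intro: linearI)

lemma smooth_on_diff:
 assumes "open S" "smooth_on S f" "smooth_on S g"
 shows "smooth_on S (%x. f x - g x)"
 using smooth_on_add[OF assms(1,2) smooth_on_minus[OF assms(1,3)]] by simp

lemma smooth_on_Pair:
 "open S ==> smooth_on S f ==> smooth_on S g ==> smooth_on S (%x. (f x, g x))"
 by (rule smooth_onI, rule Ck_on_Pair) (simp_all add: smooth_on_def)

lemma smooth_on_compose:
 assumes "open S" "open T" "smooth_on T f" "smooth_on S g" "g ` S \<subseteq> T"
 shows "smooth_on S (%x. f (g x))"
 by (rule smooth_onI, rule Ck_on_compose[OF assms(1,2)]) (use assms in \<open>simp_all add: smooth_on_def\<close>)

lemma smooth_on_matrix_inv:
 fixes M :: "'a::euclidean_space => complex^'n^'n"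
 shows "open S ==> smooth_on S M ==> (\<And>x. x \<in> S ==> invertible (M x)) ==> smooth_on S (%x. matrix_inv (M x))"
 by (rule smooth_onI, rule Ck_on_matrix_inv) (simp_all add: smooth_on_def)

lemma smooth_on_vec:
 fixes f :: "'a::euclidean_space => ('b::euclidean_space)^'n"
 shows "open S ==> (\<And>i. smooth_on S (%x. f x $ i)) ==> smooth_on S f"
 by (rule smooth_onI, rule Ck_on_vec) (simp_all add: smooth_on_def)

lemma smooth_on_nth: "open S ==> smooth_on S f ==> smooth_on S (%x. f x $ i)"
 by (rule smooth_onI, rule Ck_on_nth) (simp_all add: smooth_on_def)

section \<open>The linear and bilinear operations on complex vectors and matrices\<close>

lemma bilinear_mult_complex: "bilinear ((*) :: complex => complex => complex)"
 by (simp add: bilinear_conv_bounded_bilinear bounded_bilinear_mult)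

lemma bilinear_mm: "bilinear ((**) :: complex^'n^'m => complex^'p^'n => complex^'p^'m)"
 by (auto simp: bilinear_def matrix_matrix_mult_def vec_eq_iff scaleR_sum_right sum.distrib
   algebra_simps intro!: linearI)

lemma bilinear_mv: "bilinear ((*v) :: complex^'n^'m => complex^'n => complex^'m)"
 by (auto simp: bilinear_def matrix_vector_mult_def vec_eq_iff scaleR_sum_right sum.distrib
   algebra_simps intro!: linearI)

lemma bilinear_vector_smult: "bilinear ((*s) :: complex => complex^'n => complex^'n)"
 by (auto simp: bilinear_def vec_eq_iff algebra_simps intro!: linearI)

lemma bilinear_scaleR: "bilinear ((*\<^sub>R) :: real => 'a::real_vector => 'a)"
 by (auto simp: bilinear_def algebra_simps intro!: linearI)

lemma bilinear_hdot: "bilinear (hdot :: complex^'n => complex^'n => complex)"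
 by (auto simp: bilinear_def hdot_def scaleR_sum_right sum.distrib
   algebra_simps intro!: linearI)

lemma bilinear_linear: "bilinear h ==> linear (h a)" "bilinear h ==> linear (%a. h a b)"
 by (simp_all add: bilinear_def)

lemmas linear_mm = bilinear_linear[OF bilinear_mm]
 and linear_mv = bilinear_linear[OF bilinear_mv]
 and linear_vector_smult = bilinear_linear[OF bilinear_vector_smult]
 and linear_hdot = bilinear_linear[OF bilinear_hdot]

lemma linear_trace: "linear (trace :: complex^'n^'n => complex)"
 by (auto simp: trace_def sum.distrib scaleR_sum_right intro!: linearI)

lemma linear_mat: "linear (mat :: complex => complex^'n^'n)"
 by (auto simp: mat_def vec_eq_iff intro!: linearI)

lemma linear_of_real: "linear (of_real :: real => complex)"
 by (auto simp: scaleR_conv_of_real intro!: linearI)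

lemma linear_adjoint_matrix: "linear (adj :: complex^'n^'m => _)"
 by (auto simp: adjoint_matrix_def vec_eq_iff intro!: linearI)

lemma linear_Re: "linear Re"
 by (auto intro!: linearI)

lemma hd_bilinear:
 assumes "bilinear (h :: _::euclidean_space => _::euclidean_space => _::euclidean_space)"
  "(f has_derivative f') (at x)" "(g has_derivative g') (at x)"
 shows "((%x. h (f x) (g x)) has_derivative (%v. h (f x) (g' v) + h (f' v) (g x))) (at x)"
 using assms by (intro bounded_bilinear.FDERIV) (simp_all add: bilinear_conv_bounded_bilinear)

lemma hd_linear:
 assumes "linear (h :: _::euclidean_space => _::euclidean_space)" "(f has_derivative f') (at x)"
 shows "((%x. h (f x)) has_derivative (%v. h (f' v))) (at x)"
 by (rule bounded_linear.has_derivative[OF _ assms(2)]) (use assms(1) in \<open>simp add: linear_conv_bounded_linear\<close>)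

lemma linear_Pair_partial: "linear A ==> linear (%d. A (0, d))"
 using linear_compose[of "%d. (0, d)" A] by (simp add: o_def linear_iff)

text \<open>An injective linear map in finite dimension is bounded below, and
  \<open>L y - L y0\<close> is controlled by its values on the basis, which vary continuously. Where
  this deviation is below half of the bound at \<open>y0\<close>, a lower bound with half the
  constant survives.\<close>

lemma bounded_below_perturb:
 fixes L :: "'w::metric_space => 'd::euclidean_space => 'e::euclidean_space"
 assumes W: "open W" "y0 \<in> W" and lin: "\<And>y. y \<in> W ==> linear (L y)" and inj: "inj (L y0)"
  and cont: "\<And>b. continuous_on W (%y. L y b)"
 obtains U c where "open U" "y0 \<in> U" "U \<subseteq> W" "c > 0" "\<And>y d. y \<in> U ==> norm d \<le> c * norm (L y d)"
proof -
 obtain c where c: "c > 0" "\<And>x. c * norm x \<le> norm (L y0 x)"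
  using linear_inj_bounded_below_pos[OF lin[OF W(2)] inj] by blast
 define h where "h y = (\<Sum>b\<in>Basis. norm (L y b - L y0 b))" for y
 have "continuous_on W h"
  unfolding h_def by (intro continuous_intros cont)
 then have "isCont h y0" using W continuous_on_eq_continuous_at by blast
 moreover have "h y0 < c / 2" using c by (simp add: h_def)
 ultimately have "\<forall>\<^sub>F y in nhds y0. h y < c / 2"
  unfolding eventually_nhds_conv_at isCont_def
  using order_tendstoD(2)[of h "h y0" "at y0" "c / 2"] by blast
 then obtain U where U: "open U" "y0 \<in> U" "\<And>y. y \<in> U ==> h y < c / 2"
  unfolding eventually_nhds by blast
 show ?thesis
 proof
  show "open (U \<inter> W)" "y0 \<in> U \<inter> W" "U \<inter> W \<subseteq> W" "2 / c > 0" using U W c by auto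
  fix y d assume y: "y \<in> U \<inter> W"
  have l: "linear (%d. L y d - L y0 d)"
   using lin y W by (auto intro: linear_compose_sub)
  have "norm (L y d - L y0 d) = norm (\<Sum>b\<in>Basis. (d \<bullet> b) *\<^sub>R (L y b - L y0 b))"
   using linear_expand_Basis[OF l, of d] by simp
  also have "\<dots> \<le> (\<Sum>b\<in>Basis. norm d * norm (L y b - L y0 b))"
   by (intro order_trans[OF norm_sum] sum_mono) (simp add: Basis_le_norm mult_right_mono)
  also have "\<dots> = norm d * h y" by (simp add: h_def sum_distrib_left)
  also have "\<dots> \<le> norm d * (c / 2)" using U(3)[of y] y by (intro mult_left_mono) auto
  finally have "norm (L y d) \<ge> c * norm d - norm d * (c / 2)"
   using c(2)[of d] norm_triangle_ineq2[of "L y0 d" "L y d"] by (simp add: norm_minus_commute mult.commute[of c])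
  then have "c * norm d \<le> 2 * norm (L y d)" by (simp add: mult.commute)
  then show "norm d \<le> 2 / c * norm (L y d)" using c(1) by (simp add: field_simps)
 qed
qed

text \<open>If both factors vanish at the point, differentiability of one and continuity of the
  other suffice. In \<open>linear_solution_Ck_on\<close> the continuous factor is the unknown
  solution, whose differentiability is the goal.\<close>

lemma has_derivative_scaleR_vanishing:
 fixes f :: "'a::real_normed_vector => real"
 assumes f: "isCont f x" "f x = 0" and g: "(g has_derivative D) (at x)" "g x = 0"
 shows "((%y. f y *\<^sub>R g y) has_derivative (%_. 0)) (at x)"
 unfolding has_derivative_at_alt
proof (intro conjI allI impI)
 fix e :: real assume e: "e > 0"
 obtain K where K: "K > 0" "\<And>h. norm (D h) \<le> norm h * K"
  using bounded_linear.pos_bounded[OF has_derivative_bounded_linear[OF g(1)]] by blast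
 obtain d where d: "d > 0" "\<And>y. norm (y - x) < d ==> norm (g y - D (y - x)) \<le> 1 * norm (y - x)"
  using g unfolding has_derivative_at_alt by (metis diff_zero zero_less_one)
 obtain d' where d': "d' > 0" "\<And>y. dist y x < d' ==> \<bar>f y\<bar> < e / (1 + K)"
 proof -
  have "e / (1 + K) > 0" using e K by simp
  then show ?thesis using f that unfolding continuous_at_eps_delta dist_real_def by (metis diff_zero)
 qed
 have "norm (f y *\<^sub>R g y) \<le> e * norm (y - x)" if y: "norm (y - x) < min d d'" for y
 proof -
  have "norm (g y) \<le> (1 + K) * norm (y - x)"
   using d(2)[of y] K(2)[of "y - x"] norm_triangle_ineq2[of "g y" "D (y - x)"] y by (simp add: algebra_simps)
  then have "\<bar>f y\<bar> * norm (g y) \<le> e / (1 + K) * ((1 + K) * norm (y - x))"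
   using d'(2)[of y] y K e by (intro mult_mono) (auto simp: dist_norm)
  then show ?thesis using K by simp
 qed
 then show "\<exists>d>0. \<forall>y. norm (y - x) < d \<longrightarrow> norm (f y *\<^sub>R g y - f x *\<^sub>R g x - 0) \<le> e * norm (y - x)"
  using d(1) d'(1) f(2) by (intro exI[of _ "min d d'"]) simp
qed simp

text \<open>Implicit differentiation of a linear system: the derivative of \<open>u\<close> solves a
  system with the same matrix \<open>B\<close> and a right side made of \<open>u\<close> and first
  derivatives of \<open>r\<close> and \<open>B\<close>. Hence each order of smoothness of the data
  passes to \<open>u\<close> by induction.\<close>

lemma linear_solution_Ck_on:
 fixes B :: "'w::euclidean_space => 'd::euclidean_space => 'd"
 assumes W: "open W" and B: "\<And>y. y \<in> W ==> linear (B y)" "\<And>y. y \<in> W ==> inj (B y)"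
  and C: "\<And>d. Ck_on k W (%y. B y d)" "Ck_on k W r" and eq: "\<And>y. y \<in> W ==> B y (u y) = r y"
 shows "Ck_on k W u"
 using C eq
proof (induction k arbitrary: r u)
 case 0
 have "isCont u y0" if y0: "y0 \<in> W" for y0
 proof -
  obtain U c where U: "open U" "y0 \<in> U" "U \<subseteq> W" "c > 0" "\<And>y d. y \<in> U ==> norm d \<le> c * norm (B y d)"
   using bounded_below_perturb[OF W y0, of B] B B(2)[OF y0] 0(1) by (metis Ck_on.simps(1))
  have "norm (u y - u y0) \<le> c * norm (r y - B y (u y0))" if "y \<in> U" for y
   using U(3) U(5)[OF that, of "u y - u y0"] that by (simp add: linear_diff[OF B(1)] 0(3) subset_iff)
  then have "\<forall>\<^sub>F y in at y0. norm (u y - u y0) \<le> c * norm (r y - B y (u y0))"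
   using U(1,2) by (auto simp: eventually_at_topological)
  moreover have "isCont (%y. c * norm (r y - B y (u y0))) y0"
   using 0(1)[of "u y0"] 0(2) y0 continuous_on_eq_continuous_at[OF W] by (intro continuous_intros) auto
  then have "((%y. c * norm (r y - B y (u y0))) \<longlongrightarrow> 0) (at y0)"
   using 0(3)[OF y0] by (simp add: isCont_def)
  ultimately have "((%y. u y - u y0) \<longlongrightarrow> 0) (at y0)" by (rule Lim_null_comparison)
  then show ?thesis by (simp add: isCont_def LIM_zero_iff)
 qed
 then show ?case by (simp add: continuous_at_imp_continuous_on)
next
 case (Suc k)
 note CB = Ck_dd[OF Suc.prems(1)]
 have uk: "Ck_on k W u" by (rule Suc.IH[OF Suc.prems(1,2)[THEN Ck_on_SucD] Suc.prems(3)])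
 have "\<exists>L. linear L \<and> (\<forall>d. L (B y d) = d \<and> B y (L d) = d)" if "y \<in> W" for y
  using linear_injective_isomorphism[OF B[OF that]] by blast
 then obtain L where L: "\<And>y. y \<in> W ==> linear (L y)" "\<And>y d. y \<in> W ==> L y (B y d) = d" "\<And>y d. y \<in> W ==> B y (L y d) = d"
  by metis
 let ?R = "%y v. dd r y v + (\<Sum>b\<in>Basis. - (u y \<bullet> b) *\<^sub>R dd (%y. B y b) y v)"
 show ?case
 proof (rule Ck_on_SucI[OF W])
  fix y0 assume y0: "y0 \<in> W"
  \<comment> \<open>On \<open>W\<close> this equals \<open>B y0 (u y - u y0)\<close>, because
    \<open>B y (u y) = r y\<close>. Its last summand pairs \<open>u y - u y0\<close>, so far only
    continuous, with \<open>B y b - B y0 b\<close>; both vanish at \<open>y0\<close>.\<close>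
  let ?P = "%y. r y + (\<Sum>b\<in>Basis. - (u y0 \<bullet> b) *\<^sub>R B y b + - (((u y - u y0) \<bullet> b) *\<^sub>R (B y b - B y0 b)))"
  have cu: "isCont (%y. (u y - u y0) \<bullet> b) y0" for b
   using Ck_on_continuous[OF uk] y0 continuous_on_eq_continuous_at[OF W] by (intro continuous_intros) auto
  have dB: "((%y. B y b - B y0 b) has_derivative (%v. dd (%y. B y b) y0 v - 0)) (at y0)" for b
   by (intro has_derivative_diff CB[OF y0] has_derivative_const)
  have "(?P has_derivative (%v. dd r y0 v + (\<Sum>b\<in>Basis. - (u y0 \<bullet> b) *\<^sub>R dd (%y. B y b) y0 v + - 0))) (at y0)"
   by (intro has_derivative_add has_derivative_sum has_derivative_minus has_derivative_scaleR_right
     Ck_dd[OF Suc.prems(2) y0] CB[OF y0] has_derivative_scaleR_vanishing[OF cu _ dB]) auto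
  then have "((%y. u y0 + L y0 (?P y)) has_derivative (%v. 0 + L y0 (?R y0 v))) (at y0)"
   using has_derivative_add[OF has_derivative_const hd_linear[OF L(1)[OF y0]]] by simp
  then have "(u has_derivative (%v. 0 + L y0 (?R y0 v))) (at y0)"
  proof (rule has_derivative_transform_within_open[OF _ W y0])
   fix y assume y: "y \<in> W"
   note e = linear_expand_Basis[OF B(1), symmetric]
   have "?P y = B y0 (u y - u y0)"
    by (simp add: sum.distrib sum_negf sum_subtractf scaleR_diff_right scaleR_left_diff_distrib inner_diff_left
      e[OF y] e[OF y0] linear_diff[OF B(1)[OF y0]] Suc.prems(3)[OF y])
   then show "u y0 + L y0 (?P y) = u y" by (simp add: L(2)[OF y0])
  qed
  then show "(u has_derivative (%v. L y0 (?R y0 v))) (at y0)" by simp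
 next
  fix v
  show "Ck_on k W (%y. L y (?R y v))"
  proof (rule Suc.IH[OF Ck_on_SucD[OF Suc.prems(1)]])
   show "Ck_on k W (%y. ?R y v)" using Suc.prems(1,2)
    by (intro Ck_on_add Ck_on_sum W Ck_on_bilinear[OF W bounded_bilinear_scaleR]
      Ck_on_linear_comp[OF W bounded_linear_minus[OF bounded_linear_inner_left] uk]) auto
  qed (rule L(3))
 qed
qed

text \<open>The inverse function theorem supplies a differentiable inverse whose derivative
  satisfies \<open>dd G (g y) (g' y v) = v\<close>. As a linear system in \<open>g' y v\<close> with
  coefficients depending on \<open>g\<close>, this lifts the order of smoothness of \<open>g\<close>
  by one each time.\<close>

lemma smooth_local_inverse:
 fixes G :: "'d::euclidean_space => 'd"
 assumes T: "open T" and G: "smooth_on T G" and z: "z \<in> T" and inj: "inj (dd G z)"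
 obtains U V g where "open U" "z \<in> U" "U \<subseteq> T" "open V" "homeomorphism U V G g" "smooth_on V g"
proof -
 note D = smooth_dd[OF G]
 define G' where "G' y = Blinfun (dd G y)" for y
 have G': "blinfun_apply (G' y) = dd G y" if "y \<in> T" for y
  unfolding G'_def by (rule bounded_linear_Blinfun_apply[OF has_derivative_bounded_linear[OF D[OF that]]])
 have "continuous_on T G'"
  by (rule continuous_on_blinfun_componentwise)
   (rule continuous_on_eq[OF smooth_on_continuous[OF smooth_on_dd[OF G]]], simp add: G')
 moreover obtain L where L: "linear L" "\<And>d. L (dd G z d) = d"
  using linear_injective_isomorphism[OF linear_dd[OF G z] inj] by blast
 have "Blinfun L o\<^sub>L G' z = id_blinfun"
  by (rule blinfun_eqI) (simp add: G'[OF z] bounded_linear_Blinfun_apply L flip: linear_conv_bounded_linear)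
 ultimately obtain U V g g' where g: "open U" "U \<subseteq> T" "z \<in> U" "open V" "homeomorphism U V G g"
  "\<And>y. y \<in> V ==> (g has_derivative g' y) (at y)" "\<And>y. y \<in> V ==> g' y = inv (G' (g y))" "\<And>y. y \<in> V ==> bij (G' (g y))"
  using inverse_function_theorem[OF T _ _ z, of G G'] D G' by metis
 have gT: "g y \<in> T" if "y \<in> V" for y using g(2,5) that unfolding homeomorphism_def by blast
 have "Ck_on k V g" for k
 proof (induction k)
  case 0
  show ?case using g(5) by (simp add: homeomorphism_def)
 next
  case (Suc k)
  have "Ck_on k V (%y. g' y v)" for v
  proof (rule linear_solution_Ck_on[OF g(4), where B = "%y. dd G (g y)"])
   fix y assume y: "y \<in> V"
   show "linear (dd G (g y))" by (rule linear_dd[OF G gT[OF y]])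
   note b = g(7,8)[OF y, unfolded G'[OF gT[OF y]]]
   show "inj (dd G (g y))" "dd G (g y) (g' y v) = v" using b by (auto simp: bij_def surj_f_inv_f)
  qed (use gT in \<open>auto intro!: Ck_on_compose[OF g(4) T smooth_onD[OF smooth_on_dd[OF G]] Suc] Ck_on_const\<close>)
  from Ck_on_SucI[OF g(4,6) this] show ?case .
 qed
 then show ?thesis by (intro that[of U V g] g smooth_onI)
qed

text \<open>The increment of \<open>f\<close> in direction \<open>v\<close> is an integral of
  \<open>dd f\<close> in that direction. Differentiating it in direction \<open>w\<close> under the
  integral sign, and then with respect to the upper limit, gives the two mixed derivatives as
  one-sided derivatives of the same function.\<close>

lemma dd_symmetric:
 assumes S: "open S" and f: "smooth_on S f" and x: "x \<in> S"
 shows "dd (%y. dd f y v) x w = dd (%y. dd f y w) x v"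
proof -
 obtain e where e: "e > 0" "ball x e \<subseteq> S" using S x openE by blast
 \<comment> \<open>Small enough for the whole parallelogram with sides \<open>r\<close> times
   \<open>v\<close> and \<open>r\<close> times \<open>w\<close> to lie in \<open>ball x e\<close>;
   the summand 1 avoids division by zero.\<close>
 define r where "r = e / (2 * (norm v + norm w + 1))"
 define p where "p s t = x + s *\<^sub>R v + t *\<^sub>R w" for s t
 have nz: "norm v + norm w + 1 > 0" by (simp add: add_nonneg_pos)
 have r: "r > 0" using e nz by (simp add: r_def)
 have pS: "p s t \<in> S" if "s \<in> {0..r}" "t \<in> {0..r}" for s t
 proof -
  have "norm (s *\<^sub>R v + t *\<^sub>R w) \<le> r * norm v + r * norm w"
   using that by (intro norm_triangle_mono) (auto intro: mult_right_mono)
  also have "\<dots> < r * (2 * (norm v + norm w + 1))" using r by (simp add: algebra_simps add_strict_increasing2)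
  also have "\<dots> = e" using nz by (simp add: r_def)
  finally have "dist x (p s t) < e" unfolding p_def dist_norm norm_minus_commute[of x] by (simp add: add.assoc)
  then show ?thesis using e by auto
 qed
 have ds: "((%s. g (p s t)) has_vector_derivative dd g (p s t) v) (at s within U)"
  and dt: "((%t. g (p s t)) has_vector_derivative dd g (p s t) w) (at t within U)"
  if st: "s \<in> {0..r}" "t \<in> {0..r}" and g: "smooth_on S g" for g :: "'a => 'b" and s t U
 proof -
  note D = smooth_dd[OF g pS[OF st]]
  note sc = linear_scale[OF has_derivative_linear[OF D]]
  have "((%s. p s t) has_derivative (%h. h *\<^sub>R v)) (at s within U)" "((%t. p s t) has_derivative (%h. h *\<^sub>R w)) (at t within U)"
   unfolding p_def by (auto intro!: derivative_eq_intros)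
  from this[THEN has_derivative_compose, OF D]
  show "((%s. g (p s t)) has_vector_derivative dd g (p s t) v) (at s within U)"
   "((%t. g (p s t)) has_vector_derivative dd g (p s t) w) (at t within U)"
   by (simp_all add: has_vector_derivative_def sc)
 qed
 let ?I = "{0..r}" let ?Q = "dd (%y. dd f y v)"
 have I: "0 \<in> ?I" "0 \<in> cbox 0 r" "0 < r" using r by auto
 note fv = smooth_on_dd[OF f, of v] and fw = smooth_on_dd[OF f, of w]
 have cont: "continuous_on (?I \<times> ?I) (%(t, s). g (p s t))" if "smooth_on S g" for g :: "'a => 'b"
  unfolding case_prod_beta
  by (rule continuous_on_compose2[OF smooth_on_continuous[OF that]])
   (use pS in \<open>auto simp: p_def intro!: continuous_intros\<close>)
 \<comment> \<open>Both sides are the derivative at \<open>t = 0\<close> of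
   \<open>f (p s t) - f (p 0 t)\<close>, once directly and once under the integral sign.\<close>
 have key: "dd f (p s 0) w - dd f x w = integral {0..s} (%z. ?Q (p z 0) w)" if s: "s \<in> ?I" for s
 proof -
  have sub: "{0..s} \<subseteq> ?I" using s by auto
  have ftc: "((%z. dd f (p z t) v) has_integral f (p s t) - f (p 0 t)) {0..s}" if "t \<in> ?I" for t
   using s by (intro fundamental_theorem_of_calculus ds[OF _ that f]) auto
  have "((%t. integral (cbox 0 s) (%z. dd f (p z t) v)) has_vector_derivative integral (cbox 0 s) (%z. ?Q (p z 0) w)) (at 0 within ?I)"
  proof (rule leibniz_rule_vector_derivative[OF _ _ _ I(1)])
   show "((%t. dd f (p z t) v) has_vector_derivative ?Q (p z t) w) (at t within ?I)" if "t \<in> ?I" "z \<in> cbox 0 s" for t z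
    using that sub by (intro dt[OF _ _ fv]) auto
   show "(%z. dd f (p z t) v) integrable_on cbox 0 s" if "t \<in> ?I" for t using ftc[OF that] by auto
   show "continuous_on (?I \<times> cbox 0 s) (%(t, z). ?Q (p z t) w)"
    by (rule continuous_on_subset[OF cont[OF smooth_on_dd[OF fv]]]) (use sub in auto)
  qed simp
  then have "((%t. f (p s t) - f (p 0 t)) has_vector_derivative integral (cbox 0 s) (%z. ?Q (p z 0) w)) (at 0 within ?I)"
   by (rule has_vector_derivative_transform[OF I(1), rotated]) (simp add: integral_unique[OF ftc])
  moreover have "((%t. f (p s t) - f (p 0 t)) has_vector_derivative dd f (p s 0) w - dd f (p 0 0) w) (at 0 within ?I)"
   by (intro has_vector_derivative_diff dt s I f)
  ultimately show ?thesis
   using vector_derivative_unique_within_closed_interval[OF I(3,2)] by (simp add: p_def)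
 qed
 have "((%s. integral {0..s} (%z. ?Q (p z 0) w)) has_vector_derivative ?Q (p 0 0) w) (at 0 within ?I)"
 proof (rule integral_has_vector_derivative[OF _ I(1)])
  show "continuous_on ?I (%z. ?Q (p z 0) w)"
  proof (rule continuous_on_compose2[OF smooth_on_continuous[OF smooth_on_dd[OF fv]]])
   show "continuous_on ?I (%z. p z 0)" unfolding p_def by (intro continuous_intros)
  qed (use pS I in auto)
 qed
 then have "((%s. dd f (p s 0) w - dd f x w) has_vector_derivative ?Q (p 0 0) w) (at 0 within ?I)"
  by (rule has_vector_derivative_transform[OF I(1), rotated]) (simp add: key)
 moreover have "((%s. dd f (p s 0) w - dd f x w) has_vector_derivative dd (%y. dd f y w) (p 0 0) v - 0) (at 0 within ?I)"
  by (intro has_vector_derivative_diff ds I fw has_vector_derivative_const)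
 ultimately show ?thesis
  using vector_derivative_unique_within_closed_interval[OF I(3,2)] by (simp add: p_def)
qed

text \<open>Enumerating the index set reduces the claim to series. The tails of the summable
  majorant \<open>M\<close> bound the remainders of the derivatives uniformly in the point, which is
  what termwise differentiation requires.\<close>

lemma has_derivative_infsum:
 fixes u :: "'i => 'a::real_normed_vector => real"
 assumes I: "countable I" "infinite I" and S: "convex S"
  and u: "\<And>i x. i \<in> I ==> x \<in> S ==> (u i has_derivative u' i x) (at x within S)"
  and M: "\<And>i x h. i \<in> I ==> x \<in> S ==> \<bar>u' i x h\<bar> \<le> M i * norm h" "M summable_on I"
  and s: "\<And>x. x \<in> S ==> (%i. u i x) summable_on I"
  and x: "x \<in> S"
 shows "((%x. \<Sum>\<^sub>\<infinity>i\<in>I. u i x) has_derivative (%h. \<Sum>\<^sub>\<infinity>i\<in>I. u' i x h)) (at x within S)"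
proof -
 define e where "e = from_nat_into I"
 have bij: "bij_betw e UNIV I" using bij_betw_from_nat_into[OF I] by (simp add: e_def)
 have eI: "e n \<in> I" for n using bij by (auto simp: bij_betw_def)
 have sumsI: "(%n. q (e n)) sums infsum q I" if "q summable_on I" for q :: "'i => real"
  using has_sum_imp_sums has_sum_reindex_bij_betw[OF bij, of q] has_sum_infsum[OF that] by blast
 have sM: "summable (%n. M (e n))" using sumsI[OF M(2)] sums_summable by blast
 have su': "(%i. u' i x h) summable_on I" if "x \<in> S" for x h
 proof (rule abs_summable_summable, rule Infinite_Sum.abs_summable_on_comparison_test')
  show "(%i. M i * norm h) summable_on I" using M(2) by (rule summable_on_cmult_left)
  show "norm (u' i x h) \<le> M i * norm h" if "i \<in> I" for i using M(1) that \<open>x \<in> S\<close> by simp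
 qed
 have "\<exists>g. \<forall>x\<in>S. (%n. u (e n) x) sums g x \<and> (g has_derivative (%h. \<Sum>\<^sub>\<infinity>i\<in>I. u' i x h)) (at x within S)"
 proof (rule has_derivative_series[where f = "%n. u (e n)" and f' = "%n. u' (e n)", OF S _ _ x sumsI[OF s[OF x]]])
  show "(u (e n) has_derivative u' (e n) x) (at x within S)" if "x \<in> S" for n x
   using u[OF eI that] .
  fix eps :: real assume "eps > 0"
  then obtain N where N: "\<And>n. n \<ge> N ==> norm (\<Sum>i. M (e (i + n))) < eps"
   using suminf_exist_split[OF _ sM] by blast
  show "\<forall>\<^sub>F n in sequentially. \<forall>x\<in>S. \<forall>h. norm ((\<Sum>i<n. u' (e i) x h) - (\<Sum>\<^sub>\<infinity>i\<in>I. u' i x h)) \<le> eps * norm h"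
   unfolding eventually_sequentially
  proof (intro exI allI impI ballI)
   fix n x and h :: 'a assume n: "N \<le> n" and x: "x \<in> S"
   have ss: "(%n. u' (e n) x h) sums (\<Sum>\<^sub>\<infinity>i\<in>I. u' i x h)"
    using sumsI[of "%i. u' i x h"] su'[OF x] by blast
   have sn: "summable (%i. M (e (i + n)) * norm h)"
    by (rule summable_mult2[OF summable_ignore_initial_segment[OF sM]])
   have "(\<Sum>\<^sub>\<infinity>i\<in>I. u' i x h) - (\<Sum>i<n. u' (e i) x h) = (\<Sum>i. u' (e (i + n)) x h)"
    using suminf_minus_initial_segment[OF sums_summable[OF ss], of n] sums_unique[OF ss] by simp
   then have "norm ((\<Sum>i<n. u' (e i) x h) - (\<Sum>\<^sub>\<infinity>i\<in>I. u' i x h)) = norm (\<Sum>i. u' (e (i + n)) x h)"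
    by (simp add: abs_minus_commute)
   also have "\<dots> \<le> (\<Sum>i. M (e (i + n)) * norm h)"
    by (rule norm_suminf_le[OF _ sn]) (use M(1)[OF eI x] in simp)
   also have "\<dots> = (\<Sum>i. M (e (i + n))) * norm h"
    by (rule suminf_mult2[OF summable_ignore_initial_segment[OF sM], symmetric])
   also have "\<dots> \<le> eps * norm h"
    using N[OF n] by (intro mult_right_mono) auto
   finally show "norm ((\<Sum>i<n. u' (e i) x h) - (\<Sum>\<^sub>\<infinity>i\<in>I. u' i x h)) \<le> eps * norm h" .
  qed
 qed
 then obtain g where g: "\<And>x. x \<in> S ==> (%n. u (e n) x) sums g x"
  "\<And>x. x \<in> S ==> (g has_derivative (%h. \<Sum>\<^sub>\<infinity>i\<in>I. u' i x h)) (at x within S)" by blast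
 have "g y = (\<Sum>\<^sub>\<infinity>i\<in>I. u i y)" if "y \<in> S" for y
  using sums_unique2[OF g(1)[OF that] sumsI[OF s[OF that]]] .
 then show ?thesis using has_derivative_transform[OF x _ g(2)[OF x]] by metis
qed

lemma has_sum_finite_sum:
 fixes f :: "'j => 'i => real"
 assumes "\<And>j. j \<in> J ==> (f j has_sum s j) I"
 shows "((%i. \<Sum>j\<in>J. f j i) has_sum (\<Sum>j\<in>J. s j)) I"
 using assms by (induction J rule: infinite_finite_induct) (auto intro: has_sum_add)

section \<open>Real-analytic functions are smooth\<close>

definition monomial :: "('a::euclidean_space => nat) => 'a => real" where
 "monomial m y = (\<Prod>b\<in>Basis. (y \<bullet> b) ^ m b)"

definition multi_degree :: "('a::euclidean_space => nat) => nat" where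
 "multi_degree m = (\<Sum>b\<in>Basis. m b)"

text \<open>A ball of the maximum norm: it bounds every coordinate separately, which is the form in
  which monomials are estimated.\<close>

definition open_box :: "'a::euclidean_space => real => 'a set" where
 "open_box x R = {y. \<forall>b\<in>Basis. \<bar>(y - x) \<bullet> b\<bar> < R}"

lemma open_box_eq: "open_box x R = box (x - R *\<^sub>R One) (x + R *\<^sub>R One)"
 by (auto simp: open_box_def box_def inner_simps abs_less_iff)

lemma open_open_box: "open (open_box x R)" and convex_open_box: "convex (open_box x R)"
 by (simp_all add: open_box_eq open_box)

lemma monomial_le:
 assumes "\<And>b. b \<in> Basis ==> \<bar>y \<bullet> b\<bar> \<le> rho"
 shows "\<bar>monomial m y\<bar> \<le> rho ^ multi_degree m"
proof -
 have "\<bar>monomial m y\<bar> = (\<Prod>b\<in>Basis. \<bar>y \<bullet> b\<bar> ^ m b)"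
  by (simp add: monomial_def abs_prod power_abs)
 also have "\<dots> \<le> (\<Prod>b\<in>Basis. rho ^ m b)"
  using assms by (intro prod_mono) (auto intro: power_mono)
 finally show ?thesis by (simp add: power_sum multi_degree_def)
qed

lemma has_derivative_monomial:
 "((%y. monomial m (y - x)) has_derivative
   (%h. \<Sum>b\<in>Basis. (h \<bullet> b) * (real (m b) * monomial (m(b := m b - 1)) (y - x)))) (at y within S)"
proof -
 have 1: "((%y. ((y - x) \<bullet> b) ^ m b) has_derivative (%h. real (m b) * (h \<bullet> b) * ((y - x) \<bullet> b) ^ (m b - 1))) (at y within S)" for b
  by (auto intro!: derivative_eq_intros)
 have "((%y. monomial m (y - x)) has_derivative (%h. \<Sum>b\<in>Basis. (real (m b) * (h \<bullet> b) * ((y - x) \<bullet> b) ^ (m b - 1)) *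
   (\<Prod>j\<in>Basis - {b}. ((y - x) \<bullet> j) ^ m j))) (at y within S)"
  unfolding monomial_def by (rule has_derivative_prod) (rule 1)
 moreover have "((y - x) \<bullet> b) ^ (m b - 1) * (\<Prod>j\<in>Basis - {b}. ((y - x) \<bullet> j) ^ m j) = monomial (m(b := m b - 1)) (y - x)"
  if "b \<in> Basis" for b
  unfolding monomial_def by (subst prod.remove[OF finite_Basis that]) simp
 ultimately show ?thesis
  by (elim has_derivative_eq_rhs) (auto intro!: sum.cong simp: fun_eq_iff mult.assoc mult.left_commute)
qed

lemma multi_degree_upd:
 assumes "b \<in> Basis"
 shows "multi_degree (m(b := k)) + m b = multi_degree m + k"
proof -
 have "multi_degree m' = m' b + (\<Sum>j\<in>Basis - {b}. m' j)" for m' :: "'a => nat"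
  unfolding multi_degree_def by (rule sum.remove[OF finite_Basis assms])
 from this[of m] this[of "m(b := k)"] show ?thesis by simp
qed

abbreviation multi_indices :: "('a::euclidean_space => nat) set" where
 "multi_indices \<equiv> Basis \<rightarrow>\<^sub>E UNIV"

lemma infinite_multi_indices: "infinite (multi_indices :: ('a::euclidean_space => nat) set)"
proof
 assume "finite (multi_indices :: ('a => nat) set)"
 moreover have "range (%n::nat. \<lambda>b\<in>(Basis :: 'a set). n) \<subseteq> multi_indices" by auto
 moreover have "inj (%n::nat. \<lambda>b\<in>(Basis :: 'a set). n)"
  by (rule injI) (metis SOME_Basis restrict_apply')
 ultimately show False using finite_subset range_inj_infinite by blast
qed

text \<open>Absolute convergence at the corner where all coordinates equal \<open>R\<close>. By
  \<open>monomial_le\<close> this majorises the series on the whole box of half-width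
  \<open>R\<close>.\<close>

definition abs_power_series :: "real => (('a::euclidean_space => nat) => real) => bool" where
 "abs_power_series R a \<longleftrightarrow> (%m. \<bar>a m\<bar> * R ^ multi_degree m) summable_on multi_indices"

lemma bij_betw_multi_index_shift:
 assumes "b \<in> Basis"
 shows "bij_betw (%m. m(b := m b + 1)) multi_indices {m\<in>multi_indices. m b > 0}"
 by (rule bij_betw_byWitness[where f' = "%m. m(b := m b - 1)"]) (use assms in \<open>auto simp: PiE_iff extensional_def\<close>)

text \<open>Halving the radius absorbs the factor produced by differentiating a monomial, since
  \<open>n * (R / 2) ^ (n - 1)\<close> is at most \<open>2 / R * R ^ n\<close>. The second claim
  supplies the majorant for termwise differentiation.\<close>

lemma abs_power_series_derivative:
 fixes a :: "('a::euclidean_space => nat) => real"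
 assumes a: "abs_power_series R a" and R: "R > 0" and b: "b \<in> Basis"
 shows "abs_power_series (R / 2) (%m. real (m b + 1) * a (m(b := m b + 1)))"
  and "(%m. \<bar>a m\<bar> * (real (m b) * (R / 2) ^ (multi_degree m - 1))) summable_on multi_indices" (is "?f summable_on ?I")
proof -
 have n: "real n * (R / 2) ^ (n - 1) \<le> 2 / R * R ^ n" for n
 proof (cases n)
  case (Suc k)
  have "real n \<le> 2 * 2 ^ k" using of_nat_less_two_power[of n, where 'a = real] Suc by simp
  then have "real n * R ^ k \<le> 2 * 2 ^ k * R ^ k" using R by (intro mult_right_mono) auto
  then show ?thesis using R Suc by (simp add: power_divide field_simps)
 qed (use R in simp)
 show summ: "?f summable_on ?I"
 proof (rule summable_on_comparison_test)
  show "(%m. 2 / R * (\<bar>a m\<bar> * R ^ multi_degree m)) summable_on ?I"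
   using a unfolding abs_power_series_def by (rule summable_on_cmult_right)
  fix m :: "'a => nat"
  have "m b \<le> multi_degree m" unfolding multi_degree_def using b by (intro member_le_sum) auto
  then have "real (m b) * (R / 2) ^ (multi_degree m - 1) \<le> 2 / R * R ^ multi_degree m"
   using R by (intro order_trans[OF mult_right_mono n]) auto
  from mult_left_mono[OF this, of "\<bar>a m\<bar>"] show "?f m \<le> 2 / R * (\<bar>a m\<bar> * R ^ multi_degree m)"
   by (simp only: mult.left_commute abs_ge_zero)
  show "0 \<le> ?f m" using R by simp
 qed
 have "?f summable_on {m\<in>?I. m b > 0}" by (rule summable_on_subset_banach[OF summ]) auto
 then have "(%m. ?f (m(b := m b + 1))) summable_on ?I"
  using summable_on_reindex_bij_betw[OF bij_betw_multi_index_shift[OF b], of ?f] by blast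
 moreover have "multi_degree (m(b := m b + 1)) - 1 = multi_degree m" for m :: "'a => nat"
  using multi_degree_upd[OF b, of m "m b + 1"] by simp
 ultimately show "abs_power_series (R / 2) (%m. real (m b + 1) * a (m(b := m b + 1)))"
  by (simp add: abs_power_series_def abs_mult mult_ac)
qed

lemma abs_power_series_summable:
 assumes "abs_power_series R c" and y: "y \<in> open_box x R"
 shows "(%m. c m * monomial m (y - x)) summable_on multi_indices"
proof (rule abs_summable_summable, rule Infinite_Sum.abs_summable_on_comparison_test')
 show "(%m. \<bar>c m\<bar> * R ^ multi_degree m) summable_on multi_indices" using assms by (simp add: abs_power_series_def)
 show "norm (c m * monomial m (y - x)) \<le> \<bar>c m\<bar> * R ^ multi_degree m" for m
  using y monomial_le[of "y - x" R m] by (auto simp: abs_mult open_box_def less_imp_le intro!: mult_left_mono)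
qed

text \<open>After termwise differentiation, raising the exponent index in direction \<open>b\<close>
  by one brings each partial derivative back to a power series about \<open>x\<close>, so the
  argument can be iterated.\<close>

lemma power_series_derivative:
 fixes a :: "('a::euclidean_space => nat) => real"
 assumes a: "abs_power_series R a" and R: "R > 0" and y: "y \<in> open_box x (R / 2)"
 shows "((%y. \<Sum>\<^sub>\<infinity>m\<in>multi_indices. a m * monomial m (y - x)) has_derivative
  (%h. \<Sum>b\<in>Basis. (h \<bullet> b) * (\<Sum>\<^sub>\<infinity>m\<in>multi_indices. (real (m b + 1) * a (m(b := m b + 1))) * monomial m (y - x)))) (at y)"
  (is "(?F has_derivative (%h. \<Sum>b\<in>Basis. (h \<bullet> b) * ?G b)) _")
proof -
 let ?I = "multi_indices :: ('a => nat) set" let ?B = "open_box x (R / 2)"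
 note der = abs_power_series_derivative[OF a R]
 let ?w = "%m b y. real (m b) * monomial (m(b := m b - 1)) (y - x)"
 let ?u' = "%m y h. a m * (\<Sum>b\<in>Basis. (h \<bullet> b) * ?w m b y)"
 let ?M = "%m. \<Sum>b\<in>Basis. \<bar>a m\<bar> * (real (m b) * (R / 2) ^ (multi_degree m - 1))"
 have bound: "\<bar>?w m b z\<bar> \<le> real (m b) * (R / 2) ^ (multi_degree m - 1)" if "z \<in> ?B" "b \<in> Basis" for m z b
 proof (cases "m b = 0")
  case False
  have "\<bar>monomial (m(b := m b - 1)) (z - x)\<bar> \<le> (R / 2) ^ multi_degree (m(b := m b - 1))"
   using that by (intro monomial_le) (auto simp: open_box_def less_imp_le)
  moreover have "multi_degree (m(b := m b - 1)) = multi_degree m - 1"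
   using multi_degree_upd[OF that(2), of m "m b - 1"] False by simp
  ultimately show ?thesis by (simp add: abs_mult mult_left_mono)
 qed simp
 have "(?F has_derivative (%h. \<Sum>\<^sub>\<infinity>m\<in>?I. ?u' m y h)) (at y within ?B)"
 proof (rule has_derivative_infsum[OF _ infinite_multi_indices convex_open_box, where M = ?M])
  show "countable ?I" by (intro countable_PiE) auto
  show "((%y. a m * monomial m (y - x)) has_derivative ?u' m z) (at z within ?B)" for m z
   by (intro has_derivative_mult_right has_derivative_monomial)
  show "\<bar>?u' m z h\<bar> \<le> ?M m * norm h" if "z \<in> ?B" for m z h
  proof -
   have "\<bar>?u' m z h\<bar> \<le> (\<Sum>b\<in>Basis. \<bar>a m\<bar> * \<bar>(h \<bullet> b) * ?w m b z\<bar>)"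
    unfolding abs_mult[of "a m"] by (subst sum_distrib_left[symmetric]) (intro mult_left_mono sum_abs abs_ge_zero)
   also have "\<dots> \<le> (\<Sum>b\<in>Basis. \<bar>a m\<bar> * (norm h * (real (m b) * (R / 2) ^ (multi_degree m - 1))))"
    unfolding abs_mult[of "_ \<bullet> _"] by (intro sum_mono mult_left_mono mult_mono Basis_le_norm bound that) auto
   finally show ?thesis by (simp add: sum_distrib_left mult_ac)
  qed
  show "?M summable_on ?I"
   by (rule has_sum_imp_summable[OF has_sum_finite_sum[OF has_sum_infsum[OF der(2)]]])
  show "(%m. a m * monomial m (z - x)) summable_on ?I" if "z \<in> ?B" for z
   by (rule abs_power_series_summable[OF a]) (use that R in \<open>force simp: open_box_def\<close>)
 qed (rule y)
 then have "(?F has_derivative (%h. \<Sum>\<^sub>\<infinity>m\<in>?I. ?u' m y h)) (at y)"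
  using at_within_open[OF y open_open_box] by simp
 moreover have "(\<Sum>\<^sub>\<infinity>m\<in>?I. ?u' m y h) = (\<Sum>b\<in>Basis. (h \<bullet> b) * ?G b)" for h
 proof -
  have hs: "((%m. a m * ?w m b y) has_sum ?G b) ?I" if b: "b \<in> Basis" for b
  proof -
   have "((%m. (real (m b + 1) * a (m(b := m b + 1))) * monomial m (y - x)) has_sum ?G b) ?I"
    by (rule has_sum_infsum[OF abs_power_series_summable[OF der(1)[OF b] y]])
   then have "((%m. a m * ?w m b y) has_sum ?G b) {m\<in>?I. m b > 0}"
    using has_sum_reindex_bij_betw[OF bij_betw_multi_index_shift[OF b], of "%m. a m * ?w m b y"] by (simp add: mult_ac)
   then show ?thesis
    by (subst has_sum_cong_neutral[where T = "{m\<in>?I. m b > 0}" and g = "%m. a m * ?w m b y"]) auto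
  qed
  have "((%m. \<Sum>b\<in>Basis. (h \<bullet> b) * (a m * ?w m b y)) has_sum (\<Sum>b\<in>Basis. (h \<bullet> b) * ?G b)) ?I"
   by (intro has_sum_finite_sum has_sum_cmult_right hs)
  then show ?thesis
   by (subst infsumI[symmetric]) (auto simp: sum_distrib_left mult_ac intro!: infsum_cong sum.cong)
 qed
 ultimately show ?thesis by simp
qed

lemma open_box_mono: "0 < R ==> open_box x (R / 2 ^ j) \<subseteq> open_box x R"
 using divide_left_mono[of 1 "2 ^ j" R] by (force simp: open_box_def)

text \<open>Every differentiation halves the radius, so the box depends on \<open>k\<close>. This is
  harmless because \<open>Ck_on_local\<close> accepts a different neighbourhood for each
  order.\<close>

lemma power_series_Ck_on:
 fixes a :: "('a::euclidean_space => nat) => real"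
 assumes "abs_power_series R a" "R > 0"
 shows "Ck_on k (open_box x (R / 2 ^ (k + 1))) (%y. \<Sum>\<^sub>\<infinity>m\<in>multi_indices. a m * monomial m (y - x))"
 using assms
proof (induction k arbitrary: a R)
 case 0
 show ?case unfolding Ck_on.simps
  using power_series_derivative[OF 0] has_derivative_continuous
  by (intro continuous_at_imp_continuous_on) fastforce
next
 case (Suc k)
 have sub: "open_box x (R / 2 ^ (Suc k + 1)) \<subseteq> open_box x (R / 2)"
  using open_box_mono[of "R / 2" x "k + 1"] Suc.prems(2) by simp
 show ?case
 proof (rule Ck_on_SucI[OF open_open_box power_series_derivative[OF Suc.prems subsetD[OF sub]]])
  have "Ck_on k (open_box x (R / 2 ^ (Suc k + 1)))
    (%y. \<Sum>\<^sub>\<infinity>m\<in>multi_indices. (real (m b + 1) * a (m(b := m b + 1))) * monomial m (y - x))" if "b \<in> Basis" for b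
   using Suc.IH[OF abs_power_series_derivative(1)[OF Suc.prems that]] Suc.prems(2) by (simp del: fun_upd_apply)
  then show "Ck_on k (open_box x (R / 2 ^ (Suc k + 1))) (%y. \<Sum>b\<in>Basis. (h \<bullet> b) *
   (\<Sum>\<^sub>\<infinity>m\<in>multi_indices. (real (m b + 1) * a (m(b := m b + 1))) * monomial m (y - x)))" for h
   by (intro Ck_on_sum[OF open_open_box] Ck_on_bilinear[OF open_open_box bounded_bilinear_mult] Ck_on_const)
 qed
qed

lemma real_analytic_on_imp_smooth_on:
 fixes f :: "'a::euclidean_space => real"
 assumes "real_analytic_on S f"
 shows "smooth_on S f"
proof (rule smooth_onI, rule Ck_on_local)
 fix k x assume "x \<in> S"
 then obtain r and a :: "('a => nat) => real" where r: "r > 0" and hs: "\<And>y. y \<in> ball x r ==>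
  ((%m. (\<Prod>b\<in>Basis. ((y - x) \<bullet> b) ^ m b) *\<^sub>R a m) has_sum f y) multi_indices"
  using assms unfolding real_analytic_on_def by blast
 \<comment> \<open>The Euclidean norm is at most the sum of the absolute coordinates, so the closed
   box of half-width \<open>R\<close> lies in \<open>ball x r\<close>.\<close>
 define R where "R = r / (2 * real DIM('a))"
 have R: "R > 0" using r by (simp add: R_def)
 have small: "y \<in> ball x r" if "\<And>b. b \<in> Basis ==> \<bar>(y - x) \<bullet> b\<bar> \<le> R" for y :: 'a
 proof -
  have "norm (y - x) \<le> (\<Sum>b\<in>Basis. \<bar>(y - x) \<bullet> b\<bar>)" by (rule norm_le_l1)
  also have "\<dots> \<le> (\<Sum>b\<in>(Basis :: 'a set). R)" by (rule sum_mono) (rule that)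
  also have "\<dots> < r" using r by (simp add: R_def)
  finally show ?thesis by (simp add: dist_norm norm_minus_commute)
 qed
 \<comment> \<open>The corner of the box. Unconditional convergence of a real family at this one
   point is already absolute convergence, and all its monomials are powers of
   \<open>R\<close>.\<close>
 define y where "y = x + (\<Sum>b\<in>Basis. R *\<^sub>R b)"
 have yb: "(y - x) \<bullet> b = R" if "b \<in> Basis" for b using that by (simp add: y_def inner_sum_left inner_Basis flip: sum_distrib_left)
 have "(%m. (\<Prod>b\<in>Basis. ((y - x) \<bullet> b) ^ m b) *\<^sub>R a m) summable_on multi_indices"
  by (rule has_sum_imp_summable[OF hs[OF small]]) (use yb R in simp)
 moreover have "(\<Prod>b\<in>Basis. ((y - x) \<bullet> b) ^ m b) = R ^ multi_degree m" for m
  by (simp add: yb multi_degree_def power_sum cong: prod.cong)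
 ultimately have "abs_power_series R a"
  using R summable_on_iff_abs_summable_on_real[of "%m. R ^ multi_degree m * a m"]
  by (simp add: abs_power_series_def abs_mult mult.commute)
 then have "Ck_on k (open_box x (R / 2 ^ (k + 1))) (%y. \<Sum>\<^sub>\<infinity>m\<in>multi_indices. a m * monomial m (y - x))"
  using R by (rule power_series_Ck_on)
 then have "Ck_on k (open_box x (R / 2 ^ (k + 1))) f"
 proof (rule Ck_on_cong[OF open_open_box, rotated])
  fix y assume "y \<in> open_box x (R / 2 ^ (k + 1))"
  from subsetD[OF open_box_mono[OF R] this] have "y \<in> ball x r"
   by (intro small) (simp add: open_box_def less_imp_le)
  from infsumI[OF hs[OF this]] show "(\<Sum>\<^sub>\<infinity>m\<in>multi_indices. a m * monomial m (y - x)) = f y"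
   by (simp add: monomial_def mult.commute)
 qed
 moreover have "x \<in> open_box x (R / 2 ^ (k + 1))" using R by (simp add: open_box_def)
 ultimately show "\<exists>U. open U \<and> x \<in> U \<and> Ck_on k U f" using open_open_box by blast
qed

section \<open>Holomorphic maps of several variables are smooth\<close>

text \<open>Complex differentiability at each point, in the form in which
  \<open>complex_manifold\<close> states it for transition maps. Continuity and holomorphy of the
  derivative come from Cauchy's formula below.\<close>

definition holo_on :: "(complex^'n) set => (complex^'n => complex^'m) => bool" where
 "holo_on S f \<longleftrightarrow> (\<forall>y\<in>S. \<exists>D. (f has_derivative D) (at y) \<and> (\<forall>a v. D (a *s v) = a *s D v))"

lemma norm_vector_smult_complex: "norm (c *s (v :: complex^'n)) = cmod c * norm v"
 by (simp add: norm_vec_def L2_set_right_distrib norm_mult)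

lemma bounded_bilinear_vector_smult: "bounded_bilinear ((*s) :: complex => complex^'n => complex^'n)"
 using bilinear_vector_smult by (simp add: bilinear_conv_bounded_bilinear)

lemma mv_smult: "(u :: complex^'n^'m) *v (a *s v) = a *s (u *v v)"
 by (simp add: vec_eq_iff matrix_vector_mult_def sum_distrib_left algebra_simps)

lemma has_derivative_vec:
 fixes f :: "'a::real_normed_vector => ('b::euclidean_space)^'n"
 assumes "\<And>i. ((%x. f x $ i) has_derivative (%v. f' v $ i)) (at x)"
 shows "(f has_derivative f') (at x)"
proof -
 have l: "bounded_linear (axis i :: 'b => 'b^'n)" for i
  by (auto simp: axis_def vec_eq_iff linear_conv_bounded_linear[symmetric] intro!: linearI)
 have e: "g = (\<Sum>i\<in>UNIV. axis i (g $ i))" for g :: "'b^'n"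
  by (simp add: vec_eq_iff axis_def sum.delta)
 have "((%x. \<Sum>i\<in>UNIV. axis i (f x $ i)) has_derivative (%v. \<Sum>i\<in>UNIV. axis i (f' v $ i))) (at x)"
  by (intro has_derivative_sum bounded_linear.has_derivative[OF l] assms)
 then show ?thesis by (simp flip: e)
qed

lemma of_real_smult: "complex_of_real r *s (v :: complex^'n) = r *\<^sub>R v"
 by (simp add: vec_eq_iff scaleR_conv_of_real[where 'a = complex])

lemma holo_onE:
 assumes "holo_on S f" "y \<in> S"
 shows "(f has_derivative dd f y) (at y)"
  "dd f y (a *s v) = a *s dd f y v"
proof -
 obtain D where D: "(f has_derivative D) (at y)" "\<forall>a v. D (a *s v) = a *s D v"
  using assms by (auto simp: holo_on_def)
 then show "(f has_derivative dd f y) (at y)"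
  "dd f y (a *s v) = a *s dd f y v"
  using dd_eqI[OF D(1)] by auto
qed

lemma holo_on_subset: "holo_on S f ==> T \<subseteq> S ==> holo_on T f"
 by (auto simp: holo_on_def)

lemma holo_on_continuous: "holo_on S f ==> continuous_on S f"
 by (meson continuous_at_imp_continuous_on has_derivative_continuous holo_onE(1))

definition circle :: "real => real => complex" where
 "circle rho t = of_real rho * exp (2 * of_real pi * \<i> * of_real t)"

lemma circle_props: "rho > 0 ==> circle rho t \<noteq> 0" "rho > 0 ==> cmod (circle rho t) = rho" "continuous_on S (circle rho)"
proof -
 show "rho > 0 ==> circle rho t \<noteq> 0" by (simp add: circle_def)
 have "cmod (exp (2 * of_real pi * \<i> * of_real t)) = 1"
  by (simp add: norm_exp_eq_Re)
 then show "rho > 0 ==> cmod (circle rho t) = rho" by (simp add: circle_def norm_mult)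
 show "continuous_on S (circle rho)" unfolding circle_def by (intro continuous_intros)
qed

text \<open>Cauchy's formula for the derivative at 0 of the one-variable function
  \<open>zeta \<mapsto> f (y + zeta *s v) $ i\<close>. The integral involves values of
  \<open>f\<close> only, so it is as regular in \<open>y\<close> as \<open>f\<close> itself.\<close>

lemma holo_derivative_integral:
 fixes f :: "complex^'n => complex^'m"
 assumes f: "holo_on S f" and S: "open S" and rho: "rho > 0"
  and disc: "\<And>zeta. cmod zeta \<le> rho ==> y + zeta *s v \<in> S"
 shows "dd f y v $ i = integral (cbox 0 1) (%t. f (y + circle rho t *s v) $ i / circle rho t)"
proof -
 define h where "h zeta = f (y + zeta *s v) $ i" for zeta
 have lin: "((%zeta. y + zeta *s v) has_derivative (%zeta. zeta *s v)) (at zeta)" for zeta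
 proof -
  have "linear (%zeta. zeta *s v)" by (rule linear_vector_smult)
  then have "((%zeta. zeta *s v) has_derivative (%zeta. zeta *s v)) (at zeta)"
   by (simp add: bounded_linear_imp_has_derivative linear_conv_bounded_linear)
  then show ?thesis by (auto intro!: derivative_eq_intros)
 qed
 have dh: "(h has_field_derivative (dd f (y + zeta *s v) v $ i)) (at zeta)" if "y + zeta *s v \<in> S" for zeta
 proof -
  have "(h has_derivative (%t. dd f (y + zeta *s v) (t *s v) $ i)) (at zeta)"
   unfolding h_def
   by (rule bounded_linear.has_derivative[OF bounded_linear_vec_nth])
    (rule has_derivative_compose[OF lin holo_onE(1)[OF f that]])
  then show ?thesis unfolding has_field_derivative_def
   by (rule has_derivative_eq_rhs) (simp add: fun_eq_iff holo_onE(2)[OF f that] mult.commute)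
 qed
 have dh': "(h has_field_derivative (dd f (y + zeta *s v) v $ i)) (at zeta)" if "cmod zeta \<le> rho" for zeta
  using dh disc[OF that] by blast
 have "h holomorphic_on cball 0 rho"
  unfolding holomorphic_on_def field_differentiable_def
  by (intro ballI exI, rule has_field_derivative_at_within[OF dh']) simp
 then have 1: "continuous_on (cball 0 rho) h" "h holomorphic_on ball 0 rho"
  using holomorphic_on_imp_continuous_on holomorphic_on_subset ball_subset_cball by blast+
 have "deriv h 0 = dd f y v $ i"
  using DERIV_imp_deriv[OF dh'[of 0]] rho by simp
 then have "dd f y v $ i = contour_integral (circlepath 0 rho) (%u. h u / (u - 0)^2) / (2 * pi * \<i>)"
  using Cauchy_contour_integral_circlepath_2[OF 1, of 0] rho by simp
 also have "\<dots> = integral {0..1} (%t. (h (circle rho t) / (circle rho t)^2 * (2 * pi * \<i> * circle rho t)) / (2 * pi * \<i>))"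
 proof -
  have 1: "circlepath 0 rho t = circle rho t" for t by (simp add: circle_def circlepath)
  have 2: "vector_derivative (circlepath 0 rho) (at t) = 2 * pi * \<i> * circle rho t" for t
   by (simp add: vector_derivative_circlepath circle_def)
  show ?thesis unfolding contour_integral_integral 1 2 by (simp only: integral_divide diff_zero)
 qed
 also have "\<dots> = integral {0..1} (%t. h (circle rho t) / circle rho t)"
  using circle_props(1)[OF rho] by (intro integral_cong) (simp add: power2_eq_square)
 finally show ?thesis by (simp add: h_def cbox_interval)
qed

text \<open>One radius \<open>rho\<close> serves for all \<open>y\<close> near \<open>y0\<close>, so
  the Cauchy integral becomes a parameter integral over a fixed circle.\<close>

lemma disc_neighbourhood:
 fixes v :: "complex^'n"
 assumes "open S" "y0 \<in> S"
 obtains r rho where "r > 0" "rho > 0" "ball y0 r \<subseteq> S" "\<And>y zeta. y \<in> ball y0 r ==> cmod zeta \<le> rho ==> y + zeta *s v \<in> S"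
proof -
 obtain e where e: "e > 0" "ball y0 e \<subseteq> S" using assms openE by blast
 define rho where "rho = e / (2 * (norm v + 1))"
 have n: "norm v + 1 > 0" by (simp add: add_nonneg_pos)
 have rho: "rho > 0" using e n by (simp add: rho_def)
 have "rho * norm v < rho * (norm v + 1)" using rho by simp
 also have "\<dots> = e / 2" using n by (simp add: rho_def field_simps)
 finally have rhov: "rho * norm v < e / 2" .
 show ?thesis
 proof
  show "e / 2 > 0" "ball y0 (e / 2) \<subseteq> S" using e by auto
  fix y zeta assume y: "y \<in> ball y0 (e / 2)" and z: "cmod zeta \<le> rho"
  have "norm (zeta *s v) \<le> rho * norm v" by (simp add: norm_vector_smult_complex mult_right_mono z)
  then have "norm (zeta *s v) < e / 2" using rhov by simp
  moreover have "dist y0 (y + zeta *s v) \<le> dist y0 y + norm (zeta *s v)"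
   using dist_triangle[of y0 "y + zeta *s v" y] by (simp add: dist_norm)
  ultimately show "y + zeta *s v \<in> S" using y e by auto
 qed (rule rho)
qed

lemma holo_on_derivative_continuous:
 fixes f :: "complex^'n => complex^'m"
 assumes f: "holo_on S f" and S: "open S"
 shows "continuous_on S (%y. dd f y v)"
proof (rule continuous_at_imp_continuous_on, rule ballI)
 fix y0 assume "y0 \<in> S"
 then obtain r rho where r: "r > 0" "rho > 0" "ball y0 r \<subseteq> S" "\<And>y zeta. y \<in> ball y0 r ==> cmod zeta \<le> rho ==> y + zeta *s v \<in> S"
  using disc_neighbourhood[OF S] by blast
 have "continuous_on (ball y0 r) (%y. dd f y v $ i)" for i
 proof -
  have "continuous_on (ball y0 r) (%y. integral (cbox 0 1) (%t. f (y + circle rho t *s v) $ i / circle rho t))"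
  proof (rule integral_continuous_on_param)
   have c: "continuous_on (ball y0 r \<times> cbox 0 1) (%p. circle rho (snd p))"
    by (intro continuous_on_compose2[OF circle_props(3)] continuous_intros) auto
   have "continuous_on (ball y0 r \<times> cbox 0 1) (%p. fst p + circle rho (snd p) *s v)"
    by (rule continuous_on_add[OF continuous_on_fst[OF continuous_on_id]
       bounded_bilinear.continuous_on[OF bounded_bilinear_vector_smult c continuous_on_const]])
   then have "continuous_on (ball y0 r \<times> cbox 0 1) (%p. f (fst p + circle rho (snd p) *s v))"
    by (rule continuous_on_compose2[OF holo_on_continuous[OF f]]) (use r circle_props(2)[OF r(2)] in auto)
   then have "continuous_on (ball y0 r \<times> cbox 0 1) (%p. f (fst p + circle rho (snd p) *s v) $ i / circle rho (snd p))"
    using circle_props(1)[OF r(2)] by (intro continuous_intros c) auto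
   then show "continuous_on (ball y0 r \<times> cbox 0 1) (%(y, t). f (y + circle rho t *s v) $ i / circle rho t)"
    by (simp add: case_prod_beta)
  qed
  then show ?thesis
   by (rule continuous_on_eq) (rule holo_derivative_integral[OF f S r(2) r(4), symmetric])
 qed
 then have "continuous_on (ball y0 r) (%y. dd f y v)"
  using continuous_on_vec_lambda[of "ball y0 r" "%i y. dd f y v $ i"] by simp
 then show "isCont (%y. dd f y v) y0"
  by (rule continuous_on_interior) (use r(1) in simp)
qed

text \<open>Cauchy's integral is differentiated under the integral sign in \<open>y\<close>; the
  integrand depends on \<open>y\<close> with a complex-linear derivative, and integration preserves
  this. The preceding lemma provides the continuity demanded by the Leibniz rule.\<close>

lemma holo_on_derivative:
 fixes f :: "complex^'n => complex^'m"
 assumes f: "holo_on S f" and S: "open S"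
 shows "holo_on S (%y. dd f y v)"
 unfolding holo_on_def
proof
 fix y0 assume "y0 \<in> S"
 then obtain r rho where r: "r > 0" "rho > 0" "ball y0 r \<subseteq> S" "\<And>y zeta. y \<in> ball y0 r ==> cmod zeta \<le> rho ==> y + zeta *s v \<in> S"
  using disc_neighbourhood[OF S] by blast
 have y0: "y0 \<in> ball y0 r" using r by simp
 have "\<exists>D. ((%y. dd f y v $ i) has_derivative D) (at y0) \<and> (\<forall>a w. D (a *s w) = a * D w)" for i
 proof -
  let ?g = "%y t w. dd f (y + circle rho t *s v) w $ i / circle rho t"
  have inS: "y + circle rho t *s v \<in> S" if "y \<in> ball y0 r" for y t
   using r(4)[OF that] circle_props(2)[OF r(2)] by simp
  have derg: "((%y. f (y + circle rho t *s v) $ i / circle rho t) has_derivative ?g y t) (at y within ball y0 r)"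
   if "y \<in> ball y0 r" for y t
  proof -
   have "((%y. y + circle rho t *s v) has_derivative (%w. w)) (at y within ball y0 r)"
    by (auto intro!: derivative_eq_intros)
   then have "((%y. f (y + circle rho t *s v)) has_derivative dd f (y + circle rho t *s v)) (at y within ball y0 r)"
    using has_derivative_compose[of "%y. y + circle rho t *s v", OF _ holo_onE(1)[OF f inS[OF that]]] by blast
   then show ?thesis
    unfolding divide_inverse
    by (intro has_derivative_mult_left bounded_linear.has_derivative[OF bounded_linear_vec_nth])
  qed
  have bl: "bounded_linear (?g y t)" if "y \<in> ball y0 r" for y t
   using has_derivative_bounded_linear[OF derg[OF that]] .
  define fx where "fx y t = Blinfun (?g y t)" for y t
  have fx: "blinfun_apply (fx y t) = ?g y t" if "y \<in> ball y0 r" for y t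
   unfolding fx_def by (rule bounded_linear_Blinfun_apply[OF bl[OF that]])
  have c: "continuous_on (ball y0 r \<times> cbox 0 1) (%p. circle rho (snd p))"
   by (intro continuous_on_compose2[OF circle_props(3)] continuous_intros) auto
  have cp: "continuous_on (ball y0 r \<times> cbox 0 1) (%p. fst p + circle rho (snd p) *s v)"
   by (rule continuous_on_add[OF continuous_on_fst[OF continuous_on_id]
       bounded_bilinear.continuous_on[OF bounded_bilinear_vector_smult c continuous_on_const]])
  have contg: "continuous_on (ball y0 r \<times> cbox 0 1) (%p. ?g (fst p) (snd p) w)" for w
  proof -
   have "continuous_on (ball y0 r \<times> cbox 0 1) (%p. dd f (fst p + circle rho (snd p) *s v) w)"
    by (rule continuous_on_compose2[OF holo_on_derivative_continuous[OF f S] cp]) (use inS in auto)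
   then show ?thesis using circle_props(1)[OF r(2)] by (intro continuous_intros c) auto
  qed
  have contfx: "continuous_on (ball y0 r \<times> cbox 0 1) (%(y, t). fx y t)"
  proof (rule continuous_on_blinfun_componentwise)
   fix b :: "complex^'n"
   show "continuous_on (ball y0 r \<times> cbox 0 1) (%p. blinfun_apply (case p of (y, t) => fx y t) b)"
    by (rule continuous_on_eq[OF contg[of b]]) (auto simp: fx)
  qed
  have contf: "continuous_on (cbox 0 1) (%t. f (y + circle rho t *s v) $ i / circle rho t)" if y: "y \<in> ball y0 r" for y
  proof -
   have "continuous_on (cbox 0 1) (%t. y + circle rho t *s v)"
    by (rule continuous_on_add[OF continuous_on_const
       bounded_bilinear.continuous_on[OF bounded_bilinear_vector_smult circle_props(3) continuous_on_const]])
   then have "continuous_on (cbox 0 1) (%t. f (y + circle rho t *s v))"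
    by (rule continuous_on_compose2[OF holo_on_continuous[OF f]]) (use inS[OF y] in auto)
   then show ?thesis using circle_props(1)[OF r(2)] by (intro continuous_intros circle_props(3)) auto
  qed
  let ?D = "integral (cbox 0 1) (fx y0)"
  have "((%y. integral (cbox 0 1) (%t. f (y + circle rho t *s v) $ i / circle rho t)) has_derivative blinfun_apply ?D) (at y0 within ball y0 r)"
  proof (rule leibniz_rule[OF _ _ contfx y0 convex_ball])
   show "((%y. f (y + circle rho t *s v) $ i / circle rho t) has_derivative blinfun_apply (fx y t)) (at y within ball y0 r)"
    if "y \<in> ball y0 r" for y t
    using derg[OF that] fx[OF that] by simp
   show "(%t. f (y + circle rho t *s v) $ i / circle rho t) integrable_on cbox 0 1" if "y \<in> ball y0 r" for y
    by (rule integrable_continuous[OF contf[OF that]])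
  qed
  then have 1: "((%y. integral (cbox 0 1) (%t. f (y + circle rho t *s v) $ i / circle rho t)) has_derivative blinfun_apply ?D) (at y0)"
   using at_within_open[OF y0 open_ball] by simp
  have d: "((%y. dd f y v $ i) has_derivative blinfun_apply ?D) (at y0)"
   by (rule has_derivative_transform_within_open[OF 1 open_ball y0])
    (rule holo_derivative_integral[OF f S r(2) r(4), symmetric])
  have c0: "continuous_on (cbox 0 1) (%t. (y0, t))" by (rule continuous_on_Pair[OF continuous_on_const continuous_on_id])
  have "continuous_on (cbox 0 1) (fx y0)"
   using continuous_on_compose2[OF contfx c0 image_subsetI] y0 by simp
  then have int: "fx y0 integrable_on cbox 0 1" by (rule integrable_continuous)
  have app: "blinfun_apply ?D w = integral (cbox 0 1) (%t. ?g y0 t w)" for w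
   using blinfun_apply_integral[OF int, of w] fx[OF y0] by simp
  have "blinfun_apply ?D (a *s w) = a * blinfun_apply ?D w" for a w
   unfolding app by (simp add: holo_onE(2)[OF f inS[OF y0]] flip: integral_mult_right)
  with d show ?thesis by blast
 qed
 then obtain D where D: "\<And>i. ((%y. dd f y v $ i) has_derivative D i) (at y0)"
  "\<And>i a w. D i (a *s w) = a * D i w" by metis
 have "((%y. \<chi> i. dd f y v $ i) has_derivative (%w. \<chi> i. D i w)) (at y0)"
  by (rule has_derivative_vec) (use D(1) in simp)
 then show "\<exists>D. ((%y. dd f y v) has_derivative D) (at y0) \<and> (\<forall>a w. D (a *s w) = a *s D w)"
  by (intro exI[of _ "%w. \<chi> i. D i w"]) (simp add: vec_eq_iff D(2))
qed

lemma holo_on_smooth_on: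
 fixes f :: "complex^'n => complex^'m"
 assumes "holo_on S f" "open S"
 shows "smooth_on S f"
proof (rule smooth_onI)
 fix k show "Ck_on k S f"
  using assms(1)
 proof (induction k arbitrary: f)
  case 0
  then show ?case by (simp add: holo_on_continuous)
 next
  case (Suc k)
  show ?case
   by (rule Ck_on_SucI[OF assms(2) holo_onE(1)[OF Suc.prems] Suc.IH[OF holo_on_derivative[OF Suc.prems assms(2)]]])
 qed
qed

section \<open>A smooth square root of matrices\<close>

lemma adjoint_matrix_mult: "adj (a ** b) = adj b ** adj (a :: complex^'n^'m)"
 by (simp add: adjoint_matrix_def matrix_matrix_mult_def vec_eq_iff mult.commute)

lemma adjoint_matrix_adjoint [simp]: "adj (adj a) = a"
 by (simp add: adjoint_matrix_def vec_eq_iff)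

lemma adjoint_matrix_mat: "adj (mat c) = mat (cnj c)"
 by (simp add: adjoint_matrix_def mat_def vec_eq_iff)

text \<open>Squaring has derivative \<open>d + d\<close> at the identity, so it is locally
  invertible there. The adjoint of a root of a Hermitian matrix is again a root, so local uniqueness
  makes the root Hermitian.\<close>

lemma smooth_matrix_sqrt:
 obtains N :: "(complex^'n^'n) set" and R where "open N" "mat 1 \<in> N" "smooth_on N R"
  "\<And>K. K \<in> N ==> R K ** R K = K"
  "\<And>K. K \<in> N ==> adj K = K ==> adj (R K) = R K"
proof -
 let ?f = "%h :: complex^'n^'n. h ** h"
 have sf: "smooth_on UNIV ?f"
  by (rule smooth_on_bilinear[OF open_UNIV bilinear_mm smooth_on_id smooth_on_id]) simp_all
 have "dd ?f (mat 1) = (%d. d + d)"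
  using dd_eqI[OF hd_bilinear[OF bilinear_mm has_derivative_ident has_derivative_ident], of "mat 1"]
  by (simp only: matrix_mul_lid matrix_mul_rid)
 then have inj: "inj (dd ?f (mat 1))" by (intro injI) (simp add: scaleR_2[symmetric])
 obtain U V g where g: "open U" "mat 1 \<in> U" "open V" "homeomorphism U V ?f g" and sm: "smooth_on V g"
  by (rule smooth_local_inverse[OF open_UNIV sf UNIV_I inj])
 have gV: "g K \<in> U" "?f (g K) = K" if "K \<in> V" for K
  using g(4) that unfolding homeomorphism_def by auto
 have gU: "g (?f h) = h" "?f h \<in> V" if "h \<in> U" for h
  using g(4) that unfolding homeomorphism_def by auto
 have cg: "continuous_on V g" using g(4) by (simp add: homeomorphism_def)
 \<comment> \<open>The extra condition keeps the adjoint of the root inside \<open>U\<close>, where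
   squaring is injective.\<close>
 define N where "N = V \<inter> (%K. adj (g K)) -` U"
 have ca: "continuous_on V (%K. adj (g K))"
  using continuous_on_compose2[OF linear_continuous_on[OF iffD1[OF linear_conv_bounded_linear linear_adjoint_matrix]] cg, of UNIV]
  by auto
 have g1: "g (mat 1) = mat 1" using gU(1)[OF g(2)] by (simp add: matrix_mul_lid)
 show ?thesis
 proof
  show "open N" unfolding N_def using ca g(1,3) by (metis Int_commute continuous_open_preimage)
  show "mat 1 \<in> N" using g(2) gU(2)[OF g(2)] by (simp add: N_def g1 adjoint_matrix_mat matrix_mul_lid)
  show "smooth_on N g" by (rule smooth_on_subset[OF sm]) (auto simp: N_def)
  show "?f (g K) = K" if "K \<in> N" for K using gV that by (auto simp: N_def)
  fix K assume K: "K \<in> N" "adj K = K"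
  have "?f (adj (g K)) = adj (?f (g K))" by (simp add: adjoint_matrix_mult)
  also have "\<dots> = K" using gV(2)[of K] K by (simp add: N_def)
  finally have "g K = g (?f (adj (g K)))" by simp
  also have "\<dots> = adj (g K)" using K by (intro gU) (simp add: N_def)
  finally show "adj (g K) = g K" by simp
 qed
qed

section \<open>Smooth local flows\<close>

text \<open>The oriented integral of \<open>g\<close> from 0 to \<open>t\<close>, substituted onto
  the unit interval: negative times need no separate treatment, and continuity in \<open>t\<close>
  is that of a parameter integral.\<close>

definition sint :: "(real => 'a::euclidean_space) => real => 'a" where
 "sint g t = t *\<^sub>R integral {0..1} (%sig. g (sig * t))"

lemma scaled_in_interval:
 fixes t :: real
 assumes "t \<in> {-tau..tau}" "sig \<in> {0..1}"
 shows "sig * t \<in> {-tau..tau}"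
proof -
 have "\<bar>sig * t\<bar> \<le> \<bar>t\<bar>" using assms(2) by (simp add: abs_mult mult_left_le_one_le)
 then show ?thesis using assms(1) by auto
qed

lemma scaled_continuous:
 fixes g :: "real => 'a::topological_space"
 assumes "continuous_on {-tau..tau} g" "t \<in> {-tau..tau}"
 shows "continuous_on {0..1} (%sig. g (sig * t))"
 by (rule continuous_on_compose2[OF assms(1)]) (use scaled_in_interval[OF assms(2)] in \<open>auto intro!: continuous_intros\<close>)

lemma sint_norm_le:
 assumes "continuous_on {-tau..tau} g" "t \<in> {-tau..tau}" "\<And>s. s \<in> {-tau..tau} ==> norm (g s) \<le> B"
 shows "norm (sint g t) \<le> tau * B"
proof -
 have "norm (integral {0..1} (%sig. g (sig * t))) \<le> B * (1 - 0)"
  by (rule integral_bound[OF _ scaled_continuous[OF assms(1,2)]]) (use assms(3) scaled_in_interval[OF assms(2)] in auto)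
 then have "norm (sint g t) \<le> \<bar>t\<bar> * B" by (simp add: sint_def mult_left_mono)
 moreover have "0 \<le> B" using assms(3)[OF assms(2)] norm_ge_zero order_trans by blast
 moreover have "\<bar>t\<bar> \<le> tau" using assms(2) by (simp add: abs_le_iff)
 ultimately show ?thesis using mult_right_mono[of "\<bar>t\<bar>" tau B] by linarith
qed

lemma sint_diff:
 assumes "continuous_on {-tau..tau} f" "continuous_on {-tau..tau} g" "t \<in> {-tau..tau}"
 shows "sint (%s. f s - g s) t = sint f t - sint g t"
 unfolding sint_def
 by (subst integral_diff) (auto intro!: integrable_continuous_interval scaled_continuous[OF _ assms(3)] assms simp: scaleR_diff_right)

lemma sint_scaleR: "sint (%s. c *\<^sub>R f s) t = c *\<^sub>R sint f t"
 by (simp add: sint_def)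

lemma sint_sum:
 assumes "finite I" "\<And>i. i \<in> I ==> continuous_on {-tau..tau} (f i)" "t \<in> {-tau..tau}"
 shows "sint (%s. \<Sum>i\<in>I. f i s) t = (\<Sum>i\<in>I. sint (f i) t)"
 unfolding sint_def
 by (subst integral_sum) (auto intro!: integrable_continuous_interval scaled_continuous[OF _ assms(3)] assms simp: scaleR_sum_right)

lemma sint_continuous:
 assumes "continuous_on {-tau..tau} g"
 shows "continuous_on {-tau..tau} (sint g)"
proof -
 have "continuous_on ({-tau..tau} \<times> {0..1}) (%p. g (snd p * fst p))"
 proof (rule continuous_on_compose2[OF assms])
  show "continuous_on ({-tau..tau} \<times> {0..1}) (%p. snd p * fst p)" by (intro continuous_intros)
  show "(%p. snd p * fst p) ` ({-tau..tau} \<times> {0..1}) \<subseteq> {-tau..tau}"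
   using scaled_in_interval by fastforce
 qed
 then have "continuous_on {-tau..tau} (%t. integral (cbox 0 1) (%sig. g (sig * t)))"
  by (intro integral_continuous_on_param) (simp add: case_prod_beta)
 then show ?thesis unfolding sint_def by (intro continuous_intros) simp
qed

lemma sint_has_vector_derivative:
 fixes g :: "real => 'a::euclidean_space"
 assumes g: "continuous_on {-tau..tau} g" and t: "t \<in> {-tau<..<tau}"
 shows "(sint g has_vector_derivative g t) (at t)"
proof -
 define G where "G s = integral {-tau..s} g" for s
 have G: "(G has_vector_derivative g s) (at s within {-tau..tau})" if "s \<in> {-tau..tau}" for s
  unfolding G_def by (rule integral_has_vector_derivative[OF g that])
 have eq: "sint g s = G s - G 0" if s: "s \<in> {-tau..tau}" for s
 proof -
  have "((%sig. s *\<^sub>R g (sig * s)) has_integral G (1 * s) - G (0 * s)) {0..1}"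
  proof (rule fundamental_theorem_of_calculus)
   fix sig :: real assume sig: "sig \<in> {0..1}"
   have "(G has_vector_derivative g (sig * s)) (at (sig * s) within (%sig. sig * s) ` {0..1})"
    by (rule has_vector_derivative_within_subset[OF G[OF scaled_in_interval[OF s sig]]])
     (use scaled_in_interval[OF s] in blast)
   moreover have "((%sig. sig * s) has_vector_derivative s) (at sig within {0..1})"
    by (auto intro!: derivative_eq_intros)
   ultimately show "((%sig. G (sig * s)) has_vector_derivative s *\<^sub>R g (sig * s)) (at sig within {0..1})"
    using vector_diff_chain_within[of "%sig. sig * s" s sig "{0..1}" G] by (simp add: o_def)
  qed simp
  from integral_unique[OF this] show ?thesis by (simp add: sint_def)
 qed
 have "((%s. G s - G 0) has_vector_derivative g t) (at t within {-tau..tau})"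
  using G[of t] t by (auto intro!: derivative_eq_intros)
 then have "((%s. G s - G 0) has_vector_derivative g t) (at t)"
  using t by (simp add: at_within_Icc_at)
 then show ?thesis
  by (rule has_vector_derivative_transform_within_open[where S = "{-tau<..<tau}"]) (use t eq in auto)
qed

text \<open>Picard iteration as a fixed point in the space of bounded continuous functions;
  \<open>tau * L \<le> 1 / 2\<close> makes it a contraction with factor one half.\<close>

lemma integral_equation_solution:
 fixes F :: "real => 'a::euclidean_space => 'a"
 assumes tau: "0 \<le> tau" and L: "0 \<le> L" "tau * L \<le> 1 / 2"
  and F: "continuous_on ({-tau..tau} \<times> UNIV) (%(t, y). F t y)"
  and lip: "\<And>t y1 y2. t \<in> {-tau..tau} ==> norm (F t y1 - F t y2) \<le> L * norm (y1 - y2)"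
 obtains u where "continuous_on {-tau..tau} u" "\<And>t. t \<in> {-tau..tau} ==> u t = eta + sint (%s. F s (u s)) t"
proof -
 \<comment> \<open>Clamping the time to the interval turns functions on it into bounded continuous
   functions on the whole line, where \<open>banach_fix_type\<close> applies.\<close>
 define cl where "cl t = max (-tau) (min tau t)" for t
 have cl: "cl t \<in> {-tau..tau}" for t using tau by (auto simp: cl_def)
 have cl_id: "cl t = t" if "t \<in> {-tau..tau}" for t using that by (auto simp: cl_def)
 have ccl: "continuous_on UNIV cl" unfolding cl_def by (intro continuous_intros)
 define h where "h u = (%t. eta + sint (%s. F s (apply_bcontfun u s)) (cl t))" for u
 have cF: "continuous_on {-tau..tau} (%s. F s (apply_bcontfun u s))" for u
 proof -
  have "continuous_on {-tau..tau} (%s. (s, apply_bcontfun u s))"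
   using continuous_on_apply_bcontfun continuous_on_subset by (intro continuous_intros) blast
  from continuous_on_compose2[OF F this] show ?thesis by auto
 qed
 have "h u \<in> bcontfun" for u
 proof -
  have 1: "continuous_on {-tau..tau} (%t. eta + sint (%s. F s (apply_bcontfun u s)) t)"
   by (intro continuous_on_add continuous_on_const sint_continuous cF)
  have "continuous_on UNIV (h u)"
   unfolding h_def by (rule continuous_on_compose2[OF 1 ccl image_subsetI[OF cl]])
  moreover have "range (h u) \<subseteq> (%t. eta + sint (%s. F s (apply_bcontfun u s)) t) ` {-tau..tau}"
   unfolding h_def using cl by blast
  then have "bounded (range (h u))"
   using compact_continuous_image[OF 1] bounded_subset compact_imp_bounded by blast
  ultimately show ?thesis by (simp add: bcontfun_def)
 qed
 then have P: "apply_bcontfun (Bcontfun (h u)) = h u" for u by (rule Bcontfun_inverse)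
 have "\<exists>!u. Bcontfun (h u) = u"
 proof (rule banach_fix_type[of "1 / 2"])
  show "\<forall>u v. dist (Bcontfun (h u)) (Bcontfun (h v)) \<le> 1 / 2 * dist u v"
  proof (intro allI dist_bound)
   fix u v t
   let ?w = "%s. F s (apply_bcontfun u s) - F s (apply_bcontfun v s)"
   have "norm (sint ?w (cl t)) \<le> tau * (L * dist u v)"
   proof (rule sint_norm_le[OF _ cl])
    show "continuous_on {-tau..tau} ?w" by (intro continuous_on_diff cF)
    fix s assume s: "s \<in> {-tau..tau}"
    have "norm (?w s) \<le> L * norm (apply_bcontfun u s - apply_bcontfun v s)" by (rule lip[OF s])
    also have "\<dots> \<le> L * dist u v"
     using dist_bounded[of u s v] L by (intro mult_left_mono) (auto simp: dist_norm)
    finally show "norm (?w s) \<le> L * dist u v" .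
   qed
   also have "\<dots> \<le> 1 / 2 * dist u v"
    using mult_right_mono[OF L(2), of "dist u v"] by (simp add: mult.assoc)
   finally show "dist (apply_bcontfun (Bcontfun (h u)) t) (apply_bcontfun (Bcontfun (h v)) t) \<le> 1 / 2 * dist u v"
    unfolding P by (simp add: h_def dist_norm sint_diff[OF cF cF cl])
  qed
 qed auto
 then obtain u where u: "Bcontfun (h u) = u" by blast
 then have "apply_bcontfun u = h u" using P[of u] by simp
 then have e: "apply_bcontfun u t = eta + sint (%s. F s (apply_bcontfun u s)) (cl t)" for t
  by (metis h_def)
 show ?thesis
  by (rule that[of "apply_bcontfun u"]) (use continuous_on_apply_bcontfun continuous_on_subset e cl_id in \<open>blast, metis\<close>)
qed

text \<open>Takes the place of Gronwall's inequality: applied with \<open>M\<close> equal to the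
  attained maximum, the term \<open>q * M\<close> can be absorbed on the left because
  \<open>q < 1\<close>.\<close>

lemma sup_estimate:
 fixes w :: "real => 'a::real_normed_vector"
 assumes "0 \<le> tau" "continuous_on {-tau..tau} w"
  and step: "\<And>M t. (\<And>s. s \<in> {-tau..tau} ==> norm (w s) \<le> M) ==> t \<in> {-tau..tau} ==> norm (w t) \<le> delta + q * M"
  and q: "q < 1" and t: "t \<in> {-tau..tau}"
 shows "norm (w t) \<le> delta / (1 - q)"
proof -
 have "continuous_on {-tau..tau} (%t. norm (w t))" by (intro continuous_intros assms)
 then obtain s where s: "s \<in> {-tau..tau}" "\<And>t. t \<in> {-tau..tau} ==> norm (w t) \<le> norm (w s)"
  using continuous_attains_sup[of "{-tau..tau}" "%t. norm (w t)"] t by auto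
 have "norm (w s) \<le> delta + q * norm (w s)" by (rule step[OF s(2) s(1)])
 then have "norm (w s) \<le> delta / (1 - q)" using q by (simp add: pos_le_divide_eq algebra_simps)
 then show ?thesis using s(2)[OF t] by simp
qed

text \<open>On a compact thickening of \<open>K\<close> the derivative is uniformly continuous, so
  the mean value inequality for \<open>f\<close> minus its linearisation at \<open>p\<close> is
  uniform in \<open>p\<close>. It is applied with \<open>K\<close> the graph of a solution over a
  compact time interval.\<close>

lemma uniformly_differentiable:
 fixes f :: "'a::euclidean_space => 'b::euclidean_space"
 assumes f: "Ck_on (Suc 0) S f" and S: "open S" and K: "compact K" "K \<subseteq> S" and e: "e > 0"
 shows "\<exists>d>0. \<forall>p\<in>K. \<forall>q. norm (q - p) < d \<longrightarrow>
  q \<in> S \<and> norm (f q - f p - dd f p (q - p)) \<le> e * norm (q - p)"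
proof -
 obtain r where r: "r > 0" "(\<Union>p\<in>K. cball p r) \<subseteq> S"
  using compact_subset_open_imp_cball_epsilon_subset[OF K(1) S K(2)] by blast
 define K' where "K' = {p + v | p v. p \<in> K \<and> v \<in> cball 0 r}"
 have K'c: "compact K'" unfolding K'_def by (rule compact_sums[OF K(1) compact_cball])
 have K'S: "K' \<subseteq> S" unfolding K'_def using r(2) by (fastforce simp: dist_norm)
 define e1 where "e1 = e / DIM('a)"
 have e1: "e1 > 0" using e by (simp add: e1_def)
 let ?D = "%p. dd f p"
 have lin: "linear (?D p)" if "p \<in> S" for p using Ck_dd[OF f that] has_derivative_linear by blast
 have "\<exists>d>0. \<forall>p\<in>K'. \<forall>q\<in>K'. dist q p < d \<longrightarrow> dist (?D q b) (?D p b) < e1" for b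
 proof -
  have "continuous_on S (%p. ?D p b)" using f by simp
  then have "continuous_on K' (%p. ?D p b)" using K'S by (rule continuous_on_subset)
  from compact_uniformly_continuous[OF this K'c] show ?thesis
   using e1 unfolding uniformly_continuous_on_def by blast
 qed
 then obtain d where d: "\<And>b. d b > 0" "\<And>b p q. p \<in> K' ==> q \<in> K' ==> dist q p < d b ==> dist (?D q b) (?D p b) < e1"
  by metis
 define d0 where "d0 = min r (Min (d ` Basis))"
 have d0: "d0 > 0" using r d(1) by (simp add: d0_def)
 have "q \<in> S \<and> norm (f q - f p - ?D p (q - p)) \<le> e * norm (q - p)" if p: "p \<in> K" and q: "norm (q - p) < d0" for p q
 proof
  have inK': "y \<in> K'" if "y \<in> ball p d0" for y
  proof -
   have "y = p + (y - p)" "y - p \<in> cball 0 r" using that by (auto simp: d0_def dist_norm norm_minus_commute)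
   then show ?thesis unfolding K'_def using p by blast
  qed
  have qb: "q \<in> ball p d0" "p \<in> ball p d0" using q d0 by (auto simp: dist_norm norm_minus_commute)
  show "q \<in> S" using inK'[OF qb(1)] K'S by blast
  have pS: "p \<in> S" using p K by blast
  have "norm ((f q - ?D p q) - (f p - ?D p p)) \<le> e * norm (q - p)"
  proof (rule differentiable_bound[OF convex_ball _ _ qb])
   fix y assume y: "y \<in> ball p d0"
   have yS: "y \<in> S" using inK'[OF y] K'S by blast
   have "((%y. f y - ?D p y) has_derivative (%v. ?D y v - ?D p v)) (at y)"
    by (intro has_derivative_diff Ck_dd[OF f yS] bounded_linear_imp_has_derivative)
     (use lin[OF pS] in \<open>simp add: linear_conv_bounded_linear\<close>)
   then show "((%y. f y - ?D p y) has_derivative (%v. ?D y v - ?D p v)) (at y within ball p d0)"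
    by (rule has_derivative_at_withinI)
   show "onorm (%v. ?D y v - ?D p v) \<le> e"
   proof (rule onorm_bound)
    fix v
    have l: "linear (%v. ?D y v - ?D p v)" by (intro linear_compose_sub lin yS pS)
    have "norm (?D y v - ?D p v) = norm (\<Sum>b\<in>Basis. (v \<bullet> b) *\<^sub>R (?D y b - ?D p b))"
     using linear_expand_Basis[OF l, of v] by simp
    also have "\<dots> \<le> (\<Sum>b\<in>(Basis::'a set). norm v * e1)"
    proof (rule order_trans[OF norm_sum sum_mono])
     fix b :: 'a assume b: "b \<in> Basis"
     have "Min (d ` Basis) \<le> d b" using b by simp
     then have "dist y p < d b" using y b by (auto simp: d0_def dist_commute)
     then have "norm (?D y b - ?D p b) \<le> e1"
      using d(2)[OF inK'[OF qb(2)] inK'[OF y]] by (force simp: dist_norm)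
     then show "norm ((v \<bullet> b) *\<^sub>R (?D y b - ?D p b)) \<le> norm v * e1"
      unfolding norm_scaleR using Basis_le_norm[OF b, of v] by (intro mult_mono) auto
    qed
    also have "\<dots> = e * norm v" by (simp add: e1_def)
    finally show "norm (?D y v - ?D p v) \<le> e * norm v" .
   qed (use e in simp)
  qed
  then show "norm (f q - f p - ?D p (q - p)) \<le> e * norm (q - p)"
   by (simp add: linear_diff[OF lin[OF pS]] algebra_simps)
 qed
 then show ?thesis using d0 by blast
qed

section \<open>Solutions of differential equations depending on a parameter\<close>

lemma lipschitz_derivative_bound:
 fixes f :: "'a::real_normed_vector => 'b::real_normed_vector"
 assumes f: "(f has_derivative A) (at y0)" and Y: "open Y" "y0 \<in> Y" and L: "0 \<le> L"
  and lip: "\<And>y. y \<in> Y ==> norm (f y - f y0) \<le> L * norm (y - y0)"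
 shows "norm (A y) \<le> L * norm y"
proof (cases "y = 0")
 case True
 then show ?thesis using linear_0[OF has_derivative_linear[OF f]] by simp
next
 case False
 have lA: "linear A" using f has_derivative_linear by blast
 show ?thesis
 proof (rule field_le_epsilon)
  fix e :: real assume e: "e > 0"
  define e1 where "e1 = e / norm y"
  have e1: "e1 > 0" using e False by (simp add: e1_def)
  obtain d where d: "d > 0" "\<And>z. norm (z - y0) < d ==> norm (f z - f y0 - A (z - y0)) \<le> e1 * norm (z - y0)"
   using f e1 unfolding has_derivative_at_alt by blast
  obtain d' where d': "d' > 0" "ball y0 d' \<subseteq> Y" using Y openE by blast
  define h where "h = min d d' / (2 * norm y)"
  have h: "h > 0" "norm (h *\<^sub>R y) < d" "norm (h *\<^sub>R y) < d'"
  proof -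
   show "h > 0" using d d' False by (simp add: h_def)
   then have "norm (h *\<^sub>R y) = h * norm y" by simp
   then have "norm (h *\<^sub>R y) = min d d' / 2" using False by (simp add: h_def)
   then show "norm (h *\<^sub>R y) < d" "norm (h *\<^sub>R y) < d'" using d d' by auto
  qed
  have "y0 + h *\<^sub>R y \<in> Y" using h d' by (auto simp: dist_norm)
  from lip[OF this] have 1: "norm (f (y0 + h *\<^sub>R y) - f y0) \<le> L * (h * norm y)" using h by simp
  have 2: "norm (f (y0 + h *\<^sub>R y) - f y0 - A (h *\<^sub>R y)) \<le> e1 * (h * norm y)"
   using d(2)[of "y0 + h *\<^sub>R y"] h by simp
  have "h * norm (A y) = norm (A (h *\<^sub>R y))" using h by (simp add: linear_scale[OF lA])
  also have "\<dots> \<le> norm (f (y0 + h *\<^sub>R y) - f y0) + norm (f (y0 + h *\<^sub>R y) - f y0 - A (h *\<^sub>R y))"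
   using norm_triangle_sub[of "A (h *\<^sub>R y)" "f (y0 + h *\<^sub>R y) - f y0"] by (simp add: norm_minus_commute)
  also have "\<dots> \<le> h * (L * norm y + e)" using 1 2 False by (simp add: e1_def algebra_simps)
  finally show "norm (A y) \<le> L * norm y + e" using h(1) by simp
 qed
qed

text \<open>The derivative in the state variable inherits the Lipschitz constant, so the variational
  equation can be solved on the same time interval as the equation itself.\<close>

lemma partial_derivative_bound:
 fixes F :: "'s::real_normed_vector \<times> 'x::real_normed_vector \<times> 'y::real_normed_vector => 'z::real_normed_vector"
 assumes F: "(F has_derivative A) (at (s, x, y0))" and Y: "open Y" "y0 \<in> Y" and L: "0 \<le> L"
  and lip: "\<And>y. y \<in> Y ==> norm (F (s, x, y) - F (s, x, y0)) \<le> L * norm (y - y0)"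
 shows "norm (A (0, 0, y)) \<le> L * norm y"
proof (rule lipschitz_derivative_bound[OF _ Y L lip])
 have "((%y. (s, x, y)) has_derivative (%y. (0, 0, y))) (at y0)"
  by (auto intro!: derivative_eq_intros)
 from has_derivative_compose[OF this F]
 show "((%y. F (s, x, y)) has_derivative (%y. A (0, 0, y))) (at y0)" .
qed

lemma linear_derivative_lipschitz:
 assumes "linear A" "\<And>y. norm (A (0, 0, y)) \<le> L * norm y"
 shows "norm (A (0, b, y1) - A (0, b, y2)) \<le> L * norm (y1 - y2)"
 using assms(2)[of "y1 - y2"] linear_diff[OF assms(1), of "(0, b, y1)" "(0, b, y2)"] by simp

text \<open>The arguments of \<open>F\<close> are time, parameter and state. A solution is required
  to be continuous in time only; its regularity in the parameter is what has to be proved. The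
  predicate is general enough to contain the variational equation, with \<open>Y = UNIV\<close>, and
  \<open>eps * L \<le> 1 / 2\<close> lets every estimate by \<open>sup_estimate\<close>
  close.\<close>

definition ode_family ::
 "real => real => 'x::euclidean_space set => 'y::euclidean_space set => (real \<times> 'x \<times> 'y => 'y) => ('x => 'y) => (real \<times> 'x => 'y) => bool" where
 "ode_family eps L W Y F eta u \<longleftrightarrow> 0 < eps \<and> 0 \<le> L \<and> eps * L \<le> 1 / 2 \<and> open W \<and> open Y \<and>
  (\<forall>t x y1 y2. t \<in> {-eps<..<eps} \<and> x \<in> W \<and> y1 \<in> Y \<and> y2 \<in> Y \<longrightarrow> norm (F (t, x, y1) - F (t, x, y2)) \<le> L * norm (y1 - y2)) \<and>
  (\<forall>x\<in>W. continuous_on {-eps<..<eps} (%t. u (t, x)) \<and>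
    (\<forall>t\<in>{-eps<..<eps}. u (t, x) \<in> Y \<and> u (t, x) = eta x + sint (%s. F (s, x, u (s, x))) t))"

context
 fixes eps L :: real and W :: "'x::euclidean_space set" and Y :: "'y::euclidean_space set" and F eta u
 assumes fam: "ode_family eps L W Y F eta u"
  and cF: "continuous_on ({-eps<..<eps} \<times> W \<times> Y) F" and ceta: "continuous_on W eta"
begin

lemma fam_basic: "0 < eps" "0 \<le> L" "eps * L \<le> 1 / 2" "open W" "open Y"
 "\<And>t x y1 y2. t \<in> {-eps<..<eps} ==> x \<in> W ==> y1 \<in> Y ==> y2 \<in> Y ==> norm (F (t, x, y1) - F (t, x, y2)) \<le> L * norm (y1 - y2)"
 "\<And>x. x \<in> W ==> continuous_on {-eps<..<eps} (%t. u (t, x))"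
 "\<And>x t. x \<in> W ==> t \<in> {-eps<..<eps} ==> u (t, x) \<in> Y"
 "\<And>x t. x \<in> W ==> t \<in> {-eps<..<eps} ==> u (t, x) = eta x + sint (%s. F (s, x, u (s, x))) t"
 using fam unfolding ode_family_def by blast+

lemma sub_interval: "tau < eps ==> {-tau..tau} \<subseteq> {-eps<..<eps}"
 by auto

lemma fam_continuous_F:
 assumes "x \<in> W" "x0 \<in> W"
 shows "continuous_on {-eps<..<eps} (%s. F (s, x, u (s, x0)))"
proof (rule continuous_on_compose2[OF cF])
 show "continuous_on {-eps<..<eps} (%s. (s, x, u (s, x0)))"
  by (intro continuous_on_Pair continuous_on_id continuous_on_const fam_basic(7) assms)
qed (use assms fam_basic(8) in auto)

text \<open>The difference of two solutions is bounded by the difference of initial values, the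
  difference of \<open>F\<close> along the fixed solution at \<open>x0\<close>, and half of its own
  maximum.\<close>

lemma fam_uniform_continuity:
 assumes x0: "x0 \<in> W" and tau: "0 < tau" "tau < eps" and e: "e > 0"
 shows "\<exists>d>0. \<forall>x. dist x x0 < d \<longrightarrow> x \<in> W \<and> (\<forall>t\<in>{-tau..tau}. norm (u (t, x) - u (t, x0)) \<le> e)"
proof -
 note sub = sub_interval[OF tau(2)]
 \<comment> \<open>Chosen so that \<open>e1 + tau * e1\<close> is \<open>e / 2\<close>; the factor
   \<open>1 / (1 - 1 / 2)\<close> of \<open>sup_estimate\<close> then gives
   \<open>e\<close>.\<close>
 define e1 where "e1 = e / 2 / (1 + tau)"
 have e1: "e1 > 0" using e tau by (simp add: e1_def)
 have ccF: "continuous_on (W \<times> {-tau..tau}) (%p. F (snd p, fst p, u (snd p, x0)))"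
 proof (rule continuous_on_compose2[OF cF])
  show "continuous_on (W \<times> {-tau..tau}) (%p. (snd p, fst p, u (snd p, x0)))"
  proof (intro continuous_on_Pair continuous_on_fst continuous_on_snd continuous_on_id)
   show "continuous_on (W \<times> {-tau..tau}) (%p. u (snd p, x0))"
    by (rule continuous_on_compose2[OF fam_basic(7)[OF x0] continuous_on_snd[OF continuous_on_id]]) (use sub in auto)
  qed
 qed (use sub x0 fam_basic(8) in auto)
 obtain X where X: "x0 \<in> X" "open X" "\<forall>x\<in>X \<inter> W. \<forall>s\<in>{-tau..tau}. dist (F (s, x, u (s, x0))) (F (s, x0, u (s, x0))) \<le> e1"
  using continuous_on_prod_compactE[OF ccF compact_Icc x0 e1] by auto
 have "isCont eta x0" using ceta x0 fam_basic(4) continuous_on_eq_continuous_at by blast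
 then obtain d1 where d1: "d1 > 0" "\<And>x. dist x x0 < d1 ==> dist (eta x) (eta x0) < e1"
  using e1 unfolding continuous_at_eps_delta by blast
 have "open (X \<inter> W)" "x0 \<in> X \<inter> W" using X fam_basic(4) x0 by auto
 then obtain d2 where d2: "d2 > 0" "ball x0 d2 \<subseteq> X \<inter> W" using openE by blast
 show ?thesis
 proof (intro exI[of _ "min d1 d2"] conjI allI impI ballI)
  show "min d1 d2 > 0" using d1 d2 by simp
  fix x assume x: "dist x x0 < min d1 d2"
  then have xW: "x \<in> X \<inter> W" using d2 by (auto simp: dist_commute)
  then show "x \<in> W" by blast
  fix t assume t: "t \<in> {-tau..tau}"
  have xW': "x \<in> W" using xW by blast
  note cc = continuous_on_subset[OF fam_continuous_F sub]
  have "norm (u (t, x) - u (t, x0)) \<le> (e1 + tau * e1) / (1 - 1 / 2)"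
  proof (rule sup_estimate[where w = "%t. u (t, x) - u (t, x0)", OF _ _ _ _ t])
   show "continuous_on {-tau..tau} (%t. u (t, x) - u (t, x0))"
    by (intro continuous_on_diff continuous_on_subset[OF fam_basic(7) sub] xW' x0)
   fix M t assume M: "\<And>s. s \<in> {-tau..tau} ==> norm (u (s, x) - u (s, x0)) \<le> M" and t: "t \<in> {-tau..tau}"
   have te: "t \<in> {-eps<..<eps}" using t sub by blast
   have "u (t, x) - u (t, x0) = (eta x - eta x0) + sint (%s. F (s, x, u (s, x)) - F (s, x0, u (s, x0))) t"
    unfolding sint_diff[OF cc[OF xW' xW'] cc[OF x0 x0] t]
    by (subst fam_basic(9)[OF xW' te], subst fam_basic(9)[OF x0 te]) simp
   moreover have "norm (sint (%s. F (s, x, u (s, x)) - F (s, x0, u (s, x0))) t) \<le> tau * (L * M + e1)"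
   proof (rule sint_norm_le[OF _ t])
    show "continuous_on {-tau..tau} (%s. F (s, x, u (s, x)) - F (s, x0, u (s, x0)))"
     by (intro continuous_on_diff cc xW' x0)
    fix s assume s: "s \<in> {-tau..tau}"
    have se: "s \<in> {-eps<..<eps}" using s sub by blast
    have "norm (F (s, x, u (s, x)) - F (s, x, u (s, x0))) \<le> L * norm (u (s, x) - u (s, x0))"
     by (intro fam_basic(6) se xW' fam_basic(8) x0)
    also have "\<dots> \<le> L * M" using M[OF s] fam_basic(2) by (rule mult_left_mono)
    finally have "norm (F (s, x, u (s, x)) - F (s, x, u (s, x0))) \<le> L * M" .
    moreover have "norm (F (s, x, u (s, x0)) - F (s, x0, u (s, x0))) \<le> e1"
     using X(3) xW s by (simp add: dist_norm)
    ultimately show "norm (F (s, x, u (s, x)) - F (s, x0, u (s, x0))) \<le> L * M + e1"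
     using norm_triangle_le[of "F (s, x, u (s, x)) - F (s, x, u (s, x0))" "F (s, x, u (s, x0)) - F (s, x0, u (s, x0))"] by simp
   qed
   moreover have "norm (eta x - eta x0) \<le> e1" using d1(2)[of x] x by (simp add: dist_norm)
   moreover have "tau * (L * M + e1) \<le> 1 / 2 * M + tau * e1"
   proof -
    have "0 \<le> M" using M[OF t] norm_ge_zero order_trans by blast
    moreover have "tau * L \<le> 1 / 2" using fam_basic(2,3) tau mult_right_mono[of tau eps L] by linarith
    ultimately show ?thesis using mult_right_mono[of "tau * L" "1 / 2" M] by (simp add: algebra_simps)
   qed
   ultimately show "norm (u (t, x) - u (t, x0)) \<le> (e1 + tau * e1) + 1 / 2 * M"
    using norm_triangle_le[of "eta x - eta x0" "sint (%s. F (s, x, u (s, x)) - F (s, x0, u (s, x0))) t"] by simp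
  qed (use tau in auto)
  also have "e1 + tau * e1 = e / 2"
  proof -
   have "e1 + tau * e1 = (1 + tau) * e1" by (simp add: algebra_simps)
   also have "\<dots> = e / 2"
   proof -
    have "c * (e / 2 / c) = e / 2" if "c \<noteq> 0" for c :: real using that by simp
    from this[of "1 + tau"] show ?thesis unfolding e1_def using tau by linarith
   qed
   finally show ?thesis .
  qed
  also have "e / 2 / (1 - 1 / 2) = e" by simp
  finally show "norm (u (t, x) - u (t, x0)) \<le> e" .
 qed
qed

lemma fam_continuous: "continuous_on ({-eps<..<eps} \<times> W) u"
proof (rule continuous_at_imp_continuous_on, rule ballI)
 fix p assume "p \<in> {-eps<..<eps} \<times> W"
 then obtain t0 x0 where p: "p = (t0, x0)" "t0 \<in> {-eps<..<eps}" "x0 \<in> W" by blast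
 define tau where "tau = (\<bar>t0\<bar> + eps) / 2"
 have tau: "0 < tau" "tau < eps" "\<bar>t0\<bar> < tau" using p(2) by (auto simp: tau_def)
 show "isCont u p"
  unfolding continuous_at_eps_delta
 proof (intro allI impI)
  fix e :: real assume e: "e > 0"
  obtain d1 where d1: "d1 > 0" "\<And>x t. dist x x0 < d1 ==> t \<in> {-tau..tau} ==> norm (u (t, x) - u (t, x0)) \<le> e / 3"
   using fam_uniform_continuity[OF p(3) tau(1,2), of "e / 3"] e by auto
  have "isCont (%t. u (t, x0)) t0"
   using fam_basic(7)[OF p(3)] p(2) continuous_on_eq_continuous_at[OF open_greaterThanLessThan] by blast
  then obtain d2 where d2: "d2 > 0" "\<And>t. dist t t0 < d2 ==> dist (u (t, x0)) (u (t0, x0)) < e / 3"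
   using e unfolding continuous_at_eps_delta by (meson divide_pos_pos zero_less_numeral)
  show "\<exists>d>0. \<forall>q. dist q p < d \<longrightarrow> dist (u q) (u p) < e"
  proof (intro exI[of _ "min d1 (min d2 (tau - \<bar>t0\<bar>))"] conjI allI impI)
   show "min d1 (min d2 (tau - \<bar>t0\<bar>)) > 0" using d1 d2 tau by simp
   fix q assume q: "dist q p < min d1 (min d2 (tau - \<bar>t0\<bar>))"
   obtain t x where tx: "q = (t, x)" by (cases q)
   have d: "dist t t0 < min d1 (min d2 (tau - \<bar>t0\<bar>))" "dist x x0 < min d1 (min d2 (tau - \<bar>t0\<bar>))"
    using dist_fst_le[of q p] dist_snd_le[of q p] q tx p by auto
   then have "t \<in> {-tau..tau}" by (auto simp: dist_real_def)
   then have "norm (u (t, x) - u (t, x0)) \<le> e / 3" using d1(2) d by simp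
   moreover have "norm (u (t, x0) - u (t0, x0)) < e / 3" using d2(2)[of t] d by (simp add: dist_norm)
   ultimately have "norm ((u (t, x) - u (t, x0)) + (u (t, x0) - u (t0, x0))) < e"
      using e by (intro norm_triangle_lt) linarith
   then show "dist (u q) (u p) < e" by (simp add: tx p dist_norm)
  qed
 qed
qed

text \<open>The functions \<open>zeta b\<close> solve the variational equation and are the
  candidates for the partial derivatives. The remainder satisfies an integral inequality of its own,
  whose inhomogeneous part is small relative to the increment by uniform differentiability of
  \<open>F\<close> along the solution.\<close>

lemma fam_has_derivative:
 assumes x: "x \<in> W" and tau: "0 < tau" "tau < eps"
  and F1: "Ck_on (Suc 0) ({-eps<..<eps} \<times> W \<times> Y) F" and eta1: "Ck_on (Suc 0) W eta"
  and czeta: "\<And>b. b \<in> Basis ==> continuous_on {-tau..tau} (zeta b)"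
  and zeta: "\<And>b t. b \<in> Basis ==> t \<in> {-tau..tau} ==> zeta b t = dd eta x b +
   sint (%s. dd F (s, x, u (s, x)) (0, b, zeta b s)) t"
  and t: "t \<in> {-tau..tau}"
 shows "((%x. u (t, x)) has_derivative (%w. \<Sum>b\<in>Basis. (w \<bullet> b) *\<^sub>R zeta b t)) (at x)"
proof -
 note sub = sub_interval[OF tau(2)]
 let ?S = "{-eps<..<eps} \<times> W \<times> Y"
 have oS: "open ?S" by (intro open_Times fam_basic(4,5)) auto
 let ?p = "%s. (s, x, u (s, x))"
 let ?A = "%s. dd F (?p s)"
 have pS: "?p s \<in> ?S" if "s \<in> {-tau..tau}" for s using that sub x fam_basic(8) by blast
 have lA: "linear (?A s)" if "s \<in> {-tau..tau}" for s
  using Ck_dd[OF F1 pS[OF that]] has_derivative_linear by blast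
 have cp: "continuous_on {-tau..tau} ?p"
  by (intro continuous_on_Pair continuous_on_id continuous_on_const continuous_on_subset[OF fam_basic(7)[OF x] sub])
 have cA: "continuous_on {-tau..tau} (%s. ?A s v)" for v
 proof -
  have "continuous_on ?S (%q. dd F q v)" using F1 unfolding Ck_on.simps by blast
  then show ?thesis by (rule continuous_on_compose2[OF _ cp image_subsetI[OF pS]])
 qed
 have cAv: "continuous_on {-tau..tau} (%s. ?A s (v s))" if v: "continuous_on {-tau..tau} v" for v
 proof -
  have "continuous_on {-tau..tau} (%s. \<Sum>b\<in>Basis. (v s \<bullet> b) *\<^sub>R ?A s b)"
   by (intro continuous_intros cA v)
  then show ?thesis
   by (rule continuous_on_eq) (rule linear_expand_Basis[OF lA, symmetric])
 qed
 define Z where "Z w s = (\<Sum>b\<in>Basis. (w \<bullet> b) *\<^sub>R zeta b s)" for w s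
 have cZ: "continuous_on {-tau..tau} (Z w)" for w unfolding Z_def by (intro continuous_intros czeta)
 have cAZ: "continuous_on {-tau..tau} (%s. ?A s (0, w, Z w s))" for w
  by (intro cAv continuous_on_Pair continuous_on_const cZ)
 have lD: "linear (dd eta x)"
  using Ck_dd[OF eta1 x] has_derivative_linear by blast
 have Zeq: "Z w t = dd eta x w + sint (%s. ?A s (0, w, Z w s)) t" if t: "t \<in> {-tau..tau}" for w t
 proof -
  have "Z w t = (\<Sum>b\<in>Basis. (w \<bullet> b) *\<^sub>R dd eta x b) +
    (\<Sum>b\<in>Basis. sint (%s. (w \<bullet> b) *\<^sub>R ?A s (0, b, zeta b s)) t)"
   unfolding Z_def by (simp add: zeta[OF _ t] scaleR_add_right sum.distrib sint_scaleR)
  also have "(\<Sum>b\<in>Basis. (w \<bullet> b) *\<^sub>R dd eta x b) = dd eta x w"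
   by (rule linear_expand_Basis[OF lD, symmetric])
  also have "(\<Sum>b\<in>Basis. sint (%s. (w \<bullet> b) *\<^sub>R ?A s (0, b, zeta b s)) t)
    = sint (%s. \<Sum>b\<in>Basis. (w \<bullet> b) *\<^sub>R ?A s (0, b, zeta b s)) t"
   by (rule sint_sum[symmetric, OF finite_Basis _ t])
    (intro continuous_intros cAv continuous_on_Pair continuous_on_const czeta)
  also have "\<dots> = sint (%s. ?A s (0, w, Z w s)) t"
  proof -
   have "(\<Sum>b\<in>Basis. (w \<bullet> b) *\<^sub>R ?A s (0, b, zeta b s)) = ?A s (0, w, Z w s)" if s: "s \<in> {-tau..tau}" for s
   proof -
    have "?A s (0, w, Z w s) = ?A s (\<Sum>b\<in>Basis. (w \<bullet> b) *\<^sub>R (0, b, zeta b s))"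
     by (simp add: Z_def sum_prod scaleR_Pair euclidean_representation)
    then show ?thesis by (simp only: linear_sum[OF lA[OF s]] linear_scale[OF lA[OF s]])
   qed
   then show ?thesis unfolding sint_def
    using scaled_in_interval[OF t] by (intro arg_cong[where f = "(*\<^sub>R) t"] integral_cong) auto
  qed
  finally show ?thesis .
 qed
 obtain BZ where BZ: "BZ > 0" "\<And>w s. s \<in> {-tau..tau} ==> norm (Z w s) \<le> BZ * norm w"
 proof -
  have "\<exists>B. \<forall>s\<in>{-tau..tau}. norm (zeta b s) \<le> B" if "b \<in> Basis" for b
   using compact_imp_bounded[OF compact_continuous_image[OF czeta[OF that] compact_Icc]] unfolding bounded_iff by blast
  then obtain B where B: "\<And>b s. b \<in> Basis ==> s \<in> {-tau..tau} ==> norm (zeta b s) \<le> B b" by metis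
  show ?thesis
  proof (rule that)
   have 0: "0 \<le> B b" if "b \<in> Basis" for b using B[OF that t] norm_ge_zero order_trans by blast
   show "(\<Sum>b\<in>Basis. B b) + 1 > 0" using sum_nonneg[of Basis B] 0 by force
   fix w s assume s: "s \<in> {-tau..tau}"
   have "norm (Z w s) \<le> (\<Sum>b\<in>Basis. norm w * B b)"
    unfolding Z_def
   proof (rule order_trans[OF norm_sum sum_mono])
    fix b :: 'x assume b: "b \<in> Basis"
    show "norm ((w \<bullet> b) *\<^sub>R zeta b s) \<le> norm w * B b"
     unfolding norm_scaleR using Basis_le_norm[OF b, of w] B[OF b s] by (intro mult_mono) auto
   qed
   also have "\<dots> = norm w * (\<Sum>b\<in>Basis. B b)" by (simp add: sum_distrib_left)
   also have "\<dots> \<le> ((\<Sum>b\<in>Basis. B b) + 1) * norm w" by (simp add: algebra_simps)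
   finally show "norm (Z w s) \<le> ((\<Sum>b\<in>Basis. B b) + 1) * norm w" .
  qed
 qed
 have Lip: "norm (?A s (0, 0, y)) \<le> L * norm y" if s: "s \<in> {-tau..tau}" for s y
 proof (rule partial_derivative_bound[OF Ck_dd[OF F1 pS[OF s]] fam_basic(5) _ fam_basic(2)])
  show "u (s, x) \<in> Y" using pS[OF s] by simp
  fix y assume "y \<in> Y"
  then show "norm (F (s, x, y) - F (s, x, u (s, x))) \<le> L * norm (y - u (s, x))"
   using s sub x pS[OF s] by (intro fam_basic(6)) auto
 qed
 show ?thesis
  unfolding has_derivative_at_alt Z_def[symmetric]
 proof (intro conjI allI impI)
  have "linear (%w. Z w t)" unfolding Z_def
   by (auto simp: inner_add_left scaleR_add_left sum.distrib scaleR_sum_right intro!: linearI)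
  then show "bounded_linear (%w. Z w t)" by (simp add: linear_conv_bounded_linear)
  fix e :: real assume e: "e > 0"
  \<comment> \<open>The first bound gives \<open>tau * e1 \<le> 1 / 4\<close>, so the remainder is
    estimated with contraction factor \<open>1 / 2 + 1 / 4\<close>. The second one pays for the
    resulting factor 4 and for the constants in front of the increment.\<close>
  define e1 where "e1 = min (1 / (4 * tau)) (e / (4 * (1 + tau * (1 + BZ))))"
  have tauB: "1 + tau * (1 + BZ) > 0" using tau BZ(1) by (simp add: add_pos_pos)
  have e1: "e1 > 0" "tau * e1 \<le> 1 / 4" "4 * (1 + tau * (1 + BZ)) * e1 \<le> e"
  proof -
   show "e1 > 0" using e tau tauB by (simp add: e1_def)
   have "e1 \<le> 1 / (4 * tau)" by (simp add: e1_def)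
   then show "tau * e1 \<le> 1 / 4" using tau(1) by (simp add: field_simps)
   have "e1 \<le> e / (4 * (1 + tau * (1 + BZ)))" by (simp add: e1_def)
   then show "4 * (1 + tau * (1 + BZ)) * e1 \<le> e"
    using tauB by (subst (asm) pos_le_divide_eq) (simp_all add: mult.commute)
  qed
  have K: "compact (?p ` {-tau..tau})" "?p ` {-tau..tau} \<subseteq> ?S"
   using compact_continuous_image[OF cp] pS by auto
  obtain d where d: "d > 0" "\<And>s q. s \<in> {-tau..tau} ==> norm (q - ?p s) < d ==>
    q \<in> ?S \<and> norm (F q - F (?p s) - ?A s (q - ?p s)) \<le> e1 * norm (q - ?p s)"
   using uniformly_differentiable[OF F1 oS K e1(1)] by blast
  obtain d1 where d1: "d1 > 0" "\<And>x' s. dist x' x < d1 ==> x' \<in> W"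
    "\<And>x' s. dist x' x < d1 ==> s \<in> {-tau..tau} ==> norm (u (s, x') - u (s, x)) \<le> d / 4"
   using fam_uniform_continuity[OF x tau, of "d / 4"] d(1) by auto
  obtain d2 where d2: "d2 > 0" "\<And>x'. norm (x' - x) < d2 ==>
    norm (eta x' - eta x - dd eta x (x' - x)) \<le> e1 * norm (x' - x)"
   using Ck_dd[OF eta1 x] e1(1) unfolding has_derivative_at_alt by blast
  show "\<exists>d>0. \<forall>y. norm (y - x) < d \<longrightarrow> norm (u (t, y) - u (t, x) - Z (y - x) t) \<le> e * norm (y - x)"
  proof (intro exI[of _ "min (min d1 d2) (d / 4)"] conjI allI impI)
   show "min (min d1 d2) (d / 4) > 0" using d d1 d2 by simp
   fix y assume y: "norm (y - x) < min (min d1 d2) (d / 4)"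
   define h where "h = y - x"
   have yW: "y \<in> W" using d1(2)[of y] y by (simp add: dist_norm)
   let ?R = "%s. u (s, y) - u (s, x) - Z h s"
   let ?q = "%s. (s, y, u (s, y))"
   let ?G = "%s. (F (?q s) - F (?p s)) - ?A s (0, h, Z h s)"
   have cc: "continuous_on {-tau..tau} (%s. F (s, z, u (s, z)))" if "z \<in> W" for z
    by (rule continuous_on_subset[OF fam_continuous_F[OF that that] sub])
   have "norm (?R t) \<le> (e1 * norm h * (1 + tau * (1 + BZ))) / (1 - 3 / 4)"
   proof (rule sup_estimate[where w = ?R, OF _ _ _ _ t])
    show "continuous_on {-tau..tau} ?R"
     by (intro continuous_on_diff continuous_on_subset[OF fam_basic(7) sub] x yW cZ)
    fix M t assume M: "\<And>s. s \<in> {-tau..tau} ==> norm (?R s) \<le> M" and t: "t \<in> {-tau..tau}"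
    have te: "t \<in> {-eps<..<eps}" using t sub by blast
    have eqR: "?R t = (eta y - eta x - dd eta x h) + sint ?G t"
     unfolding sint_diff[OF continuous_on_diff[OF cc[OF yW] cc[OF x]] cAZ t] sint_diff[OF cc[OF yW] cc[OF x] t] Zeq[OF t, of h]
     by (subst fam_basic(9)[OF yW te], subst fam_basic(9)[OF x te]) simp
    have a1: "norm (eta y - eta x - dd eta x h) \<le> e1 * norm h"
     using d2(2)[of y] y by (simp add: h_def)
    have a2: "norm (sint ?G t) \<le> tau * (L * M + e1 * ((1 + BZ) * norm h + M))"
    proof (rule sint_norm_le[OF _ t])
     show "continuous_on {-tau..tau} ?G" by (intro continuous_on_diff cc x yW cAZ)
     fix s assume s: "s \<in> {-tau..tau}"
     have qp: "?q s - ?p s = (0, h, u (s, y) - u (s, x))" by (simp add: h_def)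
     have "norm (?q s - ?p s) \<le> norm h + norm (u (s, y) - u (s, x))"
      unfolding qp using norm_Pair_le[of 0 "(h, u (s, y) - u (s, x))"] norm_Pair_le[of h "u (s, y) - u (s, x)"] by simp
     moreover have "norm (u (s, y) - u (s, x)) \<le> d / 4" using d1(3)[of y s] y s by (simp add: dist_norm)
     moreover have "norm (u (s, y) - u (s, x)) \<le> norm (?R s) + norm (Z h s)"
      using norm_triangle_ineq[of "?R s" "Z h s"] by simp
     ultimately have small: "norm (?q s - ?p s) < d" and
      le: "norm (?q s - ?p s) \<le> (1 + BZ) * norm h + M"
      using y M[OF s] BZ(2)[OF s, of h] d(1) by (auto simp: h_def algebra_simps)
     have "?G s = (F (?q s) - F (?p s) - ?A s (?q s - ?p s)) + ?A s (0, 0, ?R s)"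
      unfolding qp using linear_diff[OF lA[OF s], of "(0, h, u (s, y) - u (s, x))" "(0, h, Z h s)"] by simp
     then have "norm (?G s) \<le> norm (F (?q s) - F (?p s) - ?A s (?q s - ?p s)) + norm (?A s (0, 0, ?R s))"
      using norm_triangle_ineq by metis
     also have "\<dots> \<le> e1 * norm (?q s - ?p s) + L * norm (?R s)"
      using d(2)[OF s small] Lip[OF s] by (intro add_mono) auto
     also have "\<dots> \<le> e1 * ((1 + BZ) * norm h + M) + L * M"
      using le M[OF s] e1(1) fam_basic(2) by (intro add_mono mult_left_mono) auto
     finally show "norm (?G s) \<le> L * M + e1 * ((1 + BZ) * norm h + M)" by simp
    qed
    have "norm (?R t) \<le> e1 * norm h + tau * (L * M + e1 * ((1 + BZ) * norm h + M))"
     unfolding eqR by (rule norm_triangle_mono[OF a1 a2])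
    also have "\<dots> = e1 * norm h * (1 + tau * (1 + BZ)) + (tau * L + tau * e1) * M" by (simp add: algebra_simps)
    also have "(tau * L + tau * e1) * M \<le> 3 / 4 * M"
    proof (rule mult_right_mono)
     show "0 \<le> M" using M[OF t] norm_ge_zero order_trans by blast
     have "tau * L \<le> 1 / 2" using fam_basic(2,3) tau mult_right_mono[of tau eps L] by linarith
     then show "tau * L + tau * e1 \<le> 3 / 4" using e1(2) by linarith
    qed
    finally show "norm (?R t) \<le> e1 * norm h * (1 + tau * (1 + BZ)) + 3 / 4 * M" by simp
   qed (use tau in auto)
   also have "\<dots> = (4 * (1 + tau * (1 + BZ)) * e1) * norm h" by (simp add: field_simps)
   also have "\<dots> \<le> e * norm h" by (rule mult_right_mono[OF e1(3)]) simp
   finally show "norm (u (t, y) - u (t, x) - Z (y - x) t) \<le> e * norm (y - x)" by (simp add: h_def)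
  qed
 qed
qed

end

declare Ck_on.simps(2) [simp del]

text \<open>Bootstrapping: if \<open>u\<close> is of class k, the variational equation, whose
  coefficients contain \<open>u\<close>, has data of class k. Applied to that equation, the
  induction hypothesis makes the parameter derivatives of class k, while the time derivative is
  \<open>F\<close> along \<open>u\<close>.\<close>

lemma ode_family_Ck_on:
 fixes W :: "'x::euclidean_space set" and Y :: "'y::euclidean_space set"
 assumes "ode_family eps L W Y F eta u" "Ck_on k ({-eps<..<eps} \<times> W \<times> Y) F" "Ck_on k W eta" "0 < tau" "tau < eps"
 shows "Ck_on k ({-tau<..<tau} \<times> W) u"
 using assms
proof (induction k arbitrary: eps tau Y F eta u)
 case 0
 have "continuous_on ({-eps<..<eps} \<times> W) u" using fam_continuous[OF 0(1)] 0(2,3) by simp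
 then have "continuous_on ({-tau<..<tau} \<times> W) u" by (rule continuous_on_subset) (use 0(5) in auto)
 then show ?case by simp
next
 case (Suc k eps tau Y F eta u)
 \<comment> \<open>The induction hypothesis is used twice and shrinks the time interval each time:
   from \<open>eps\<close> to \<open>tau'\<close> for \<open>u\<close>, then from
   \<open>tau'\<close> to \<open>tau\<close> for the variational equation.\<close>
 define tau' where "tau' = (tau + eps) / 2"
 have tau': "0 < tau'" "tau' < eps" "tau < tau'" using Suc.prems(4,5) by (auto simp: tau'_def)
 have cF: "continuous_on ({-eps<..<eps} \<times> W \<times> Y) F" and ceta: "continuous_on W eta"
  using Ck_on_continuous[OF Suc.prems(2)] Ck_on_continuous[OF Suc.prems(3)] by auto
 note b = fam_basic[OF Suc.prems(1) cF ceta]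
 have F1: "Ck_on (Suc 0) ({-eps<..<eps} \<times> W \<times> Y) F" and eta1: "Ck_on (Suc 0) W eta"
  by (rule Ck_on_le[OF Suc.prems(2)] Ck_on_le[OF Suc.prems(3)]; simp)+
 have uk: "Ck_on k ({-tau'<..<tau'} \<times> W) u"
  by (rule Suc.IH[OF Suc.prems(1) Ck_on_SucD[OF Suc.prems(2)] Ck_on_SucD[OF Suc.prems(3)] tau'(1,2)])
 have cu: "continuous_on ({-eps<..<eps} \<times> W) u" by (rule fam_continuous[OF Suc.prems(1) cF ceta])
 let ?S = "{-eps<..<eps} \<times> W \<times> Y"
 have oS: "open ?S" by (intro open_Times b(4,5)) auto
 have sub: "{-tau'..tau'} \<subseteq> {-eps<..<eps}" using tau' by auto
 let ?A = "%t x. dd F (t, x, u (t, x))"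
 have pS: "(t, x, u (t, x)) \<in> ?S" if "t \<in> {-tau'..tau'}" "x \<in> W" for t x using that sub b(8) by blast
 have lA: "linear (?A t x)" if "t \<in> {-tau'..tau'}" "x \<in> W" for t x
  using Ck_dd[OF F1 pS[OF that]] has_derivative_linear by blast
 have bA: "norm (?A t x (0, 0, y)) \<le> L * norm y" if "t \<in> {-tau'..tau'}" "x \<in> W" for t x y
 proof (rule partial_derivative_bound[OF Ck_dd[OF F1 pS[OF that]] b(5) _ b(2)])
  show "u (t, x) \<in> Y" using pS[OF that] by simp
  fix y assume "y \<in> Y"
  then show "norm (F (t, x, y) - F (t, x, u (t, x))) \<le> L * norm (y - u (t, x))"
   using that sub pS[OF that] by (intro b(6)) auto
 qed
 have lipA: "norm (?A t x (0, b, y1) - ?A t x (0, b, y2)) \<le> L * norm (y1 - y2)" if "t \<in> {-tau'..tau'}" "x \<in> W" for t x b y1 y2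
  by (rule linear_derivative_lipschitz[OF lA[OF that] bA[OF that]])
 have "tau' * L \<le> 1 / 2" using b(2,3) tau' mult_right_mono[of tau' eps L] by linarith
 note L' = b(2) this
 have exzeta: "\<exists>zeta. continuous_on {-tau'..tau'} zeta \<and> (\<forall>t\<in>{-tau'..tau'}. zeta t = dd eta x b + sint (%s. ?A s x (0, b, zeta s)) t)"
  if x: "x \<in> W" for x b
 proof -
  have "continuous_on ({-tau'..tau'} \<times> (UNIV :: 'y set)) (%q. \<Sum>c\<in>Basis. ((0, b, snd q) \<bullet> c) *\<^sub>R ?A (fst q) x c)"
  proof (intro continuous_on_sum continuous_on_scaleR)
   fix c :: "real \<times> 'x \<times> 'y"
   show "continuous_on ({-tau'..tau'} \<times> (UNIV :: 'y set)) (%q. (0, b, snd q) \<bullet> c)"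
    by (intro continuous_intros)
   have 1: "continuous_on ?S (%q. dd F q c)" using F1 unfolding Ck_on.simps by blast
   have "continuous_on ({-tau'..tau'} \<times> (UNIV :: 'y set)) (%q. u (fst q, x))"
    by (rule continuous_on_compose2[OF continuous_on_subset[OF b(7)[OF x] sub] continuous_on_fst[OF continuous_on_id]]) auto
   then have 2: "continuous_on ({-tau'..tau'} \<times> (UNIV :: 'y set)) (%q. (fst q, x, u (fst q, x)))"
    by (intro continuous_on_Pair continuous_on_fst continuous_on_id continuous_on_const)
   show "continuous_on ({-tau'..tau'} \<times> (UNIV :: 'y set)) (%q. ?A (fst q) x c)"
    by (rule continuous_on_compose2[OF 1 2 image_subsetI]) (use pS x in auto)
  qed
  then have "continuous_on ({-tau'..tau'} \<times> (UNIV :: 'y set)) (%q. ?A (fst q) x (0, b, snd q))"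
  proof (rule continuous_on_eq)
   fix q assume "q \<in> {-tau'..tau'} \<times> (UNIV :: 'y set)"
   then have "fst q \<in> {-tau'..tau'}" by (simp add: mem_Times_iff)
   from linear_expand_Basis[OF lA[OF this x], of "(0, b, snd q)"]
   show "(\<Sum>c\<in>Basis. ((0, b, snd q) \<bullet> c) *\<^sub>R ?A (fst q) x c) = ?A (fst q) x (0, b, snd q)" by (rule sym)
  qed
  then have "continuous_on ({-tau'..tau'} \<times> (UNIV :: 'y set)) (%(t, y). ?A t x (0, b, y))"
   by (simp only: case_prod_beta')
  then show ?thesis
   by (rule integral_equation_solution[where F = "%t y. ?A t x (0, b, y)" and eta = "dd eta x b",
      OF less_imp_le[OF tau'(1)] L' _ lipA[OF _ x]]) blast+
 qed
 define zeta where "zeta x b = (SOME zeta. continuous_on {-tau'..tau'} zeta \<and>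
  (\<forall>t\<in>{-tau'..tau'}. zeta t = dd eta x b + sint (%s. ?A s x (0, b, zeta s)) t))" for x b
 have czeta: "continuous_on {-tau'..tau'} (zeta x b)"
  and zeta: "t \<in> {-tau'..tau'} ==> zeta x b t = dd eta x b + sint (%s. ?A s x (0, b, zeta x b s)) t"
  if "x \<in> W" for x b t
  using someI_ex[OF exzeta[OF that, of b]] unfolding zeta_def[symmetric] by blast+
 have ou: "open ({-tau'<..<tau'} \<times> W)" "open ({-tau'<..<tau'} \<times> W \<times> (UNIV :: 'y set))" "open ({-tau<..<tau} \<times> W)"
  by (intro open_Times b(4) open_UNIV; simp)+
 have smt: "Ck_on k ({-tau<..<tau} \<times> W) (%(t, x). zeta x b t)" for b
 proof (rule Suc.IH[where Y = UNIV and F = "%(t, x, y). ?A t x (0, b, y)" and eta = "%x. dd eta x b", OF _ _ _ Suc.prems(4) tau'(3)])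
  show "ode_family tau' L W UNIV (%(t, x, y). ?A t x (0, b, y)) (%x. dd eta x b) (%(t, x). zeta x b t)"
   unfolding ode_family_def
  proof (intro conjI allI impI ballI)
   show "tau' * L \<le> 1 / 2" by (rule L'(2))
   fix x assume x: "x \<in> W"
   show "continuous_on {-tau'<..<tau'} (%t. (%(t, x). zeta x b t) (t, x))"
    unfolding prod.case by (rule continuous_on_subset[OF czeta[OF x]]) auto
   fix t assume "t \<in> {-tau'<..<tau'}"
   then have t: "t \<in> {-tau'..tau'}" by auto
   show "(%(t, x). zeta x b t) (t, x) = dd eta x b +
     sint (%s. (%(t, x, y). ?A t x (0, b, y)) (s, x, (%(t, x). zeta x b t) (s, x))) t"
    using zeta[OF x t, of b] by simp
  next
   fix t x and y1 y2 :: 'y assume "t \<in> {-tau'<..<tau'} \<and> x \<in> W \<and> y1 \<in> UNIV \<and> y2 \<in> UNIV"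
   then show "norm ((%(t, x, y). ?A t x (0, b, y)) (t, x, y1) - (%(t, x, y). ?A t x (0, b, y)) (t, x, y2)) \<le> L * norm (y1 - y2)"
    using lipA[of t x b y1 y2] by simp
  qed (use tau' b in auto)
  have "Ck_on k ({-tau'<..<tau'} \<times> W \<times> UNIV) (%q. dd F (fst q, fst (snd q), u (fst q, fst (snd q))) (0, b, snd (snd q)))"
  proof (rule Ck_on_derivative_apply[OF ou(2) oS Suc.prems(2)])
   show "Ck_on k ({-tau'<..<tau'} \<times> W \<times> (UNIV :: 'y set)) (%q. (fst q, fst (snd q), u (fst q, fst (snd q))))"
    by (intro Ck_on_Pair ou(2) Ck_on_linear[OF ou(2)] bounded_linear_fst bounded_linear_compose[OF bounded_linear_fst bounded_linear_snd]
      Ck_on_compose[OF ou(2,1) uk]) auto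
   show "(%q. (fst q, fst (snd q), u (fst q, fst (snd q)))) ` ({-tau'<..<tau'} \<times> W \<times> UNIV) \<subseteq> ?S"
    using pS by auto
   show "Ck_on k ({-tau'<..<tau'} \<times> W \<times> (UNIV :: 'y set)) (%q. (0, b, snd (snd q)))"
    by (intro Ck_on_Pair ou(2) Ck_on_const Ck_on_linear[OF ou(2)] bounded_linear_compose[OF bounded_linear_snd bounded_linear_snd])
  qed
  then show "Ck_on k ({-tau'<..<tau'} \<times> W \<times> UNIV) (%(t, x, y). ?A t x (0, b, y))"
   by (simp only: case_prod_beta')
  show "Ck_on k W (%x. dd eta x b)" using Suc.prems(3) unfolding Ck_on.simps by blast
 qed
 have der: "(u has_derivative (%v. fst v *\<^sub>R F (fst p, snd p, u p) + (\<Sum>b\<in>Basis. (snd v \<bullet> b) *\<^sub>R (%(t, x). zeta x b t) p))) (at p)"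
  if p: "p \<in> {-tau<..<tau} \<times> W" for p
 proof -
  obtain t x where tx: "p = (t, x)" "t \<in> {-tau<..<tau}" "x \<in> W" using p by blast
  have t': "t \<in> {-tau'..tau'}" using tx tau' by auto
  let ?I = "{-tau<..<tau}"
  have gc: "continuous_on (W \<times> ?I) (%q. F (snd q, fst q, u (snd q, fst q)))"
  proof (rule continuous_on_compose2[OF cF])
   have "continuous_on (W \<times> ?I) (%q. u (snd q, fst q))"
    by (rule continuous_on_compose2[OF cu]) (use tau' in \<open>auto intro!: continuous_intros\<close>)
   then show "continuous_on (W \<times> ?I) (%q. (snd q, fst q, u (snd q, fst q)))"
    by (intro continuous_on_Pair continuous_on_fst continuous_on_snd continuous_on_id)
   show "(%q. (snd q, fst q, u (snd q, fst q))) ` (W \<times> ?I) \<subseteq> ?S" using pS tau' by force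
  qed
  \<comment> \<open>The arguments are swapped because \<open>has_derivative_partialsI\<close> asks
    for continuity of the partial derivative in the second variable. In time this derivative is
    \<open>F\<close> along the solution, known to be continuous.\<close>
  have "((%(x, t). u (t, x)) has_derivative (%(w, r). (\<Sum>b\<in>Basis. (w \<bullet> b) *\<^sub>R zeta x b t) + blinfun_apply (blinfun_scaleR_left (F (t, x, u (t, x)))) r))
    (at (x, t) within W \<times> ?I)"
  proof (rule has_derivative_partialsI[where fy = "%x t. blinfun_scaleR_left (F (t, x, u (t, x)))"])
   show "((%x. u (t, x)) has_derivative (%w. \<Sum>b\<in>Basis. (w \<bullet> b) *\<^sub>R zeta x b t)) (at x within W)"
    by (rule has_derivative_at_withinI, rule fam_has_derivative[OF Suc.prems(1) cF ceta tx(3) tau'(1,2) F1 eta1])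
     (use czeta zeta tx(3) t' in auto)
   show "((%t. u (t, x)) has_derivative blinfun_apply (blinfun_scaleR_left (F (t, x, u (t, x))))) (at t within ?I)"
    if x: "x \<in> W" and t: "t \<in> ?I" for x t
   proof -
    have te: "t \<in> {-tau'<..<tau'}" using t tau' by auto
    have c: "continuous_on {-tau'..tau'} (%s. F (s, x, u (s, x)))"
     by (rule continuous_on_subset[OF fam_continuous_F[OF Suc.prems(1) cF ceta x x] sub])
    have "((%t. eta x + sint (%s. F (s, x, u (s, x))) t) has_vector_derivative F (t, x, u (t, x))) (at t)"
     using sint_has_vector_derivative[OF c te] by (auto intro!: derivative_eq_intros)
    then have "((%t. u (t, x)) has_vector_derivative F (t, x, u (t, x))) (at t)"
     by (rule has_vector_derivative_transform_within_open[where S = "{-tau'<..<tau'}"])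
      (use te tau' in \<open>auto intro!: b(9)[OF x, symmetric]\<close>)
    then show ?thesis unfolding has_vector_derivative_def by (simp add: has_derivative_at_withinI)
   qed
   show "continuous (at (x, t) within W \<times> ?I) (%(x, t). blinfun_scaleR_left (F (t, x, u (t, x))))"
   proof -
    have "continuous_on (W \<times> ?I) (%q. blinfun_scaleR_left (F (snd q, fst q, u (snd q, fst q))))"
     by (rule bounded_linear.continuous_on[OF bounded_linear_blinfun_scaleR_left gc])
    then show ?thesis using tx by (simp add: continuous_on_eq_continuous_within case_prod_beta')
   qed
  qed (use tx in auto)
  then have 1: "((%(x, t). u (t, x)) has_derivative (%(w, r). (\<Sum>b\<in>Basis. (w \<bullet> b) *\<^sub>R zeta x b t) + r *\<^sub>R F (t, x, u (t, x)))) (at (x, t))"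
   using at_within_open[of "(x, t)" "W \<times> ?I"] tx open_Times[OF b(4) open_greaterThanLessThan[of "-tau" tau]] by simp
  have sw: "((%q. (snd q, fst q)) has_derivative (%v. (snd v, fst v))) (at p)"
   by (auto intro!: derivative_eq_intros)
  have h1: "((%(x, t). u (t, x)) has_derivative (%(w, r). (\<Sum>b\<in>Basis. (w \<bullet> b) *\<^sub>R zeta x b t) + r *\<^sub>R F (t, x, u (t, x)))) (at (snd p, fst p))"
   using 1 tx by simp
  from has_derivative_compose[OF sw h1]
  show ?thesis using tx by (simp add: add.commute)
 qed
 show ?case
 proof (rule Ck_on_SucI[OF ou(3) der])
  fix v :: "real \<times> 'x"
  have uk': "Ck_on k ({-tau<..<tau} \<times> W) u" by (rule Ck_on_subset[OF uk]) (use tau' in auto)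
  have "Ck_on k ({-tau<..<tau} \<times> W) (%p. F (fst p, snd p, u p))"
  proof (rule Ck_on_compose[OF ou(3) oS Ck_on_SucD[OF Suc.prems(2)]])
   show "Ck_on k ({-tau<..<tau} \<times> W) (%p. (fst p, snd p, u p))"
    by (intro Ck_on_Pair ou(3) Ck_on_linear[OF ou(3)] bounded_linear_fst bounded_linear_snd uk')
   show "(%p. (fst p, snd p, u p)) ` ({-tau<..<tau} \<times> W) \<subseteq> ?S" using pS tau' by force
  qed
  then show "Ck_on k ({-tau<..<tau} \<times> W) (%p. fst v *\<^sub>R F (fst p, snd p, u p) + (\<Sum>b\<in>Basis. (snd v \<bullet> b) *\<^sub>R (%(t, x). zeta x b t) p))"
   by (intro Ck_on_add Ck_on_sum ou(3) Ck_on_linear_comp[OF ou(3) bounded_linear_scaleR_right] smt)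
 qed
qed

text \<open>Composing \<open>X\<close> with the projection onto a closed ball makes it globally
  Lipschitz, so solutions exist for a common time. Started in the smaller ball they never reach the
  boundary, hence they solve the original equation.\<close>

theorem smooth_local_flow:
 fixes X :: "'a::euclidean_space => 'a"
 assumes U: "open U" and X: "smooth_on U X" and x0: "x0 \<in> U"
 obtains eps W Phi where "eps > 0" "open W" "x0 \<in> W" "W \<subseteq> U" "smooth_on ({-eps<..<eps} \<times> W) Phi"
  "\<And>x. x \<in> W ==> Phi (0, x) = x"
  "\<And>x t. x \<in> W ==> t \<in> {-eps<..<eps} ==> Phi (t, x) \<in> U"
  "\<And>x t. x \<in> W ==> t \<in> {-eps<..<eps} ==> ((%s. Phi (s, x)) has_vector_derivative X (Phi (t, x))) (at t)"
proof -
 obtain r where r: "r > 0" "cball x0 r \<subseteq> U" using U x0 open_contains_cball by blast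
 have r0: "cball x0 r \<noteq> {}" using r by auto
 have cX: "continuous_on (cball x0 r) X" using smooth_on_continuous[OF X] r continuous_on_subset by blast
 obtain B where B: "\<And>y. y \<in> cball x0 r ==> norm (X y) \<le> B"
  using compact_imp_bounded[OF compact_continuous_image[OF cX compact_cball]] unfolding bounded_iff by blast
 have B0: "0 \<le> B" by (rule order_trans[OF norm_ge_zero B[of x0]]) (use r in simp)
 have "\<exists>C. \<forall>y\<in>cball x0 r. norm (dd X y b) \<le> C" for b
 proof -
  have "continuous_on (cball x0 r) (%y. dd X y b)"
   using smooth_on_continuous[OF smooth_on_dd[OF X]] r continuous_on_subset by blast
  from compact_imp_bounded[OF compact_continuous_image[OF this compact_cball]]
  show ?thesis unfolding bounded_iff by blast
 qed
 then obtain C where C: "\<And>y b. y \<in> cball x0 r ==> norm (dd X y b) \<le> C b" by metis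
 define L where "L = (\<Sum>b\<in>Basis. \<bar>C b\<bar>)"
 have L0: "0 \<le> L" by (simp add: L_def sum_nonneg)
 have lip: "norm (X y - X z) \<le> L * norm (y - z)" if "y \<in> cball x0 r" "z \<in> cball x0 r" for y z
 proof (rule differentiable_bound[OF convex_cball _ _ that])
  fix y assume y: "y \<in> cball x0 r"
  then have yU: "y \<in> U" using r by blast
  show "(X has_derivative dd X y) (at y within cball x0 r)"
   by (rule has_derivative_at_withinI[OF smooth_dd[OF X yU]])
  show "onorm (dd X y) \<le> L"
  proof (rule onorm_bound[OF L0])
   fix v
   have "norm (dd X y v) = norm (\<Sum>b\<in>Basis. (v \<bullet> b) *\<^sub>R dd X y b)"
    by (subst linear_expand_Basis[OF linear_dd[OF X yU]]) simp
   also have "\<dots> \<le> (\<Sum>b\<in>(Basis::'a set). norm v * \<bar>C b\<bar>)"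
   proof (rule order_trans[OF norm_sum sum_mono])
    fix b :: 'a assume b: "b \<in> Basis"
    show "norm ((v \<bullet> b) *\<^sub>R dd X y b) \<le> norm v * \<bar>C b\<bar>"
     unfolding norm_scaleR using Basis_le_norm[OF b, of v] C[OF y, of b] by (intro mult_mono) auto
   qed
   also have "\<dots> = L * norm v" by (simp add: L_def sum_distrib_left mult.commute)
   finally show "norm (dd X y v) \<le> L * norm v" .
  qed
 qed
 \<comment> \<open>The first entry gives the contraction, the second limits the displacement to
   \<open>r / 4\<close>, so that solutions starting in \<open>ball x0 (r / 2)\<close> stay in
   \<open>ball x0 r\<close>.\<close>
 define tau where "tau = min (1 / (2 * (L + 1))) (r / (4 * (B + 1)))"
 have tau: "tau > 0" "tau * L \<le> 1 / 2" "tau * B \<le> r / 4"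
 proof -
  show tau0: "tau > 0" using L0 B0 r by (simp add: tau_def)
  have "tau \<le> 1 / (2 * (L + 1))" "tau \<le> r / (4 * (B + 1))" by (auto simp: tau_def)
  moreover have "2 * (L + 1) > 0" "4 * (B + 1) > 0" using L0 B0 by auto
  ultimately have "tau * (2 * (L + 1)) \<le> 1" "tau * (4 * (B + 1)) \<le> r"
   by (metis pos_le_divide_eq)+
  then show "tau * L \<le> 1 / 2" "tau * B \<le> r / 4" using tau0 by (simp_all add: algebra_simps)
 qed
 \<comment> \<open>The nearest-point projection does not increase distances, so \<open>X\<close>
   composed with \<open>P\<close> has the Lipschitz constant \<open>L\<close> everywhere.\<close>
 define P where "P = closest_point (cball x0 r)"
 have P: "P y \<in> cball x0 r" "y \<in> cball x0 r ==> P y = y" for y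
  unfolding P_def using closest_point_in_set[OF closed_cball r0] closest_point_self[of y "cball x0 r"] by blast+
 have Plip: "norm (P y - P z) \<le> norm (y - z)" for y z
  using closest_point_lipschitz[OF convex_cball closed_cball r0, of y z] by (simp add: P_def dist_norm)
 have cP: "continuous_on UNIV P" unfolding P_def by (rule continuous_on_closest_point[OF convex_cball closed_cball r0])
 have cXP: "continuous_on UNIV (%y. X (P y))" by (rule continuous_on_compose2[OF cX cP]) (use P in auto)
 have "\<exists>u. continuous_on {-tau..tau} u \<and> (\<forall>t\<in>{-tau..tau}. u t = x + sint (%s. X (P (u s))) t)" for x
 proof -
  have "continuous_on ({-tau..tau} \<times> UNIV) (%(t, y). X (P y))"
   unfolding case_prod_beta' by (rule continuous_on_compose2[OF cXP continuous_on_snd[OF continuous_on_id]]) auto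
  moreover have "norm (X (P y1) - X (P y2)) \<le> L * norm (y1 - y2)" for y1 y2
   using lip[OF P(1) P(1), of y1 y2] mult_left_mono[OF Plip L0, of y1 y2] by linarith
  ultimately show ?thesis
   by (rule_tac integral_equation_solution[where F = "%t y. X (P y)" and eta = x, OF less_imp_le[OF tau(1)] L0 tau(2)]) blast+
 qed
 then obtain u where cu: "\<And>x. continuous_on {-tau..tau} (u x)"
  and u: "\<And>x t. t \<in> {-tau..tau} ==> u x t = x + sint (%s. X (P (u x s))) t" by metis
 define W where "W = ball x0 (r / 2)"
 have cg: "continuous_on {-tau..tau} (%s. X (P (u x s)))" for x
  by (rule continuous_on_compose2[OF cXP cu]) auto
 have uB: "u x t \<in> ball x0 r" if x: "x \<in> W" and t: "t \<in> {-tau..tau}" for x t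
 proof -
  have "norm (sint (%s. X (P (u x s))) t) \<le> tau * B" by (rule sint_norm_le[OF cg t]) (rule B[OF P(1)])
  then have "norm (u x t - x) \<le> r / 4" using u[OF t, of x] tau(3) by simp
  then show ?thesis using x r(1) dist_triangle[of x0 "u x t" x] by (simp add: W_def dist_norm norm_minus_commute)
 qed
 have Pu: "P (u x t) = u x t" if "x \<in> W" "t \<in> {-tau..tau}" for x t
  using uB[OF that] P(2) by auto
 have u': "u x t = x + sint (%s. X (u x s)) t" if x: "x \<in> W" and t: "t \<in> {-tau..tau}" for x t
 proof -
  have "sint (%s. X (P (u x s))) t = sint (%s. X (u x s)) t"
   unfolding sint_def using Pu[OF x] scaled_in_interval[OF t]
   by (intro arg_cong[where f = "(*\<^sub>R) t"] integral_cong) auto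
  then show ?thesis using u[OF t, of x] by simp
 qed
 define Phi where "Phi = (%(t, x). u x t)"
 have fam: "ode_family tau L W (ball x0 r) (%(t, x, y). X y) (%x. x) Phi"
  unfolding ode_family_def
 proof (intro conjI allI impI ballI)
  show "open W" by (simp add: W_def)
  fix x assume x: "x \<in> W"
  show "continuous_on {-tau<..<tau} (%t. Phi (t, x))"
   unfolding Phi_def prod.case by (rule continuous_on_subset[OF cu]) auto
  fix t assume t: "t \<in> {-tau<..<tau}"
  show "Phi (t, x) \<in> ball x0 r" using uB[OF x, of t] t by (auto simp: Phi_def)
  show "Phi (t, x) = x + sint (%s. (%(t, x, y). X y) (s, x, Phi (s, x))) t"
   using u'[OF x, of t] t by (auto simp: Phi_def)
 qed (use tau L0 lip in auto)
 have sm: "smooth_on ({- (tau / 2)<..<tau / 2} \<times> W) Phi"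
 proof (rule smooth_onI, rule ode_family_Ck_on[OF fam])
  fix k
  have o: "open ({-tau<..<tau} \<times> W \<times> ball x0 r)" by (intro open_Times) (auto simp: W_def)
  show "Ck_on k ({-tau<..<tau} \<times> W \<times> ball x0 r) (%(t, x, y). X y)"
   unfolding case_prod_beta'
   by (rule Ck_on_compose[OF o U smooth_onD[OF X] Ck_on_linear[OF o bounded_linear_compose[OF bounded_linear_snd bounded_linear_snd]]])
    (use r in auto)
  show "Ck_on k W (%x. x)" by (rule Ck_on_id) (simp add: W_def)
 qed (use tau in auto)
 show ?thesis
 proof (rule that[OF _ _ _ _ sm])
  show "tau / 2 > 0" "open W" "x0 \<in> W" using tau r by (auto simp: W_def)
  show "W \<subseteq> U" using r by (auto simp: W_def subset_eq)
  show "Phi (0, x) = x" if "x \<in> W" for x using u'[OF that, of 0] tau by (simp add: Phi_def sint_def)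
  fix x t assume x: "x \<in> W" and t: "t \<in> {- (tau / 2)<..<tau / 2}"
  then have t': "t \<in> {-tau<..<tau}" using tau by auto
  show "Phi (t, x) \<in> U" using uB[OF x, of t] t' r by (auto simp: Phi_def)
  have cX': "continuous_on {-tau..tau} (%s. X (u x s))"
   by (rule continuous_on_eq[OF cg[of x]]) (simp add: Pu[OF x])
  have "((%t. x + sint (%s. X (u x s)) t) has_vector_derivative X (u x t)) (at t)"
   using sint_has_vector_derivative[OF cX' t'] by (auto intro!: derivative_eq_intros)
  then show "((%s. Phi (s, x)) has_vector_derivative X (Phi (t, x))) (at t)"
   unfolding Phi_def prod.case
   by (rule has_vector_derivative_transform_within_open[where S = "{-tau<..<tau}"])
    (use t' u'[OF x] in auto)
 qed
qed

no_notation fps_nth (infixl "$" 75)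

section \<open>The characteristic polynomial\<close>

lemma det_row_sum:
 fixes c :: "'n::finite => ('a::comm_ring_1)^'n"
 assumes "finite S"
 shows "det (\<chi> i. if i = k then (\<Sum>j\<in>S. f j) else c i) = (\<Sum>j\<in>S. det (\<chi> i. if i = k then f j else c i))"
 using assms
proof (induction S rule: finite_induct)
 case (insert x F)
 show ?case unfolding sum.insert[OF insert(1,2)] det_row_add insert(3) by (rule refl)
qed (simp only: sum.empty det_row_0)

definition char_matrix :: "complex^'n^'n => complex poly^'n^'n" where
 "char_matrix a = (\<chi> i j. (if i = j then [:0, 1:] else 0) - [:a $ i $ j:])"

text \<open>The adjugate of the matrix x I - a: each entry is a cofactor, written as the determinant
  with one row replaced by a unit vector.\<close>

definition char_adjugate :: "complex^'n^'n => complex poly^'n^'n" where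
 "char_adjugate a = (\<chi> i j. det (\<chi> k. if k = j then axis i 1 else char_matrix a $ k))"

lemma det_char_matrix: "det (char_matrix a) = char_poly a"
 by (simp add: char_poly_def char_matrix_def)

text \<open>Laplace expansion of the determinant in which row \<open>l\<close> is replaced by row
  \<open>k\<close>; for \<open>k \<noteq> l\<close> two rows coincide.\<close>

lemma char_matrix_adjugate:
 fixes a :: "complex^'n^'n"
 shows "char_matrix a ** char_adjugate a = mat (char_poly a)"
proof -
 have "(char_matrix a ** char_adjugate a) $ k $ l = (mat (char_poly a) :: complex poly^'n^'n) $ k $ l" for k l
 proof -
  have "(char_matrix a ** char_adjugate a) $ k $ l
    = (\<Sum>j\<in>UNIV. det (\<chi> i. if i = l then char_matrix a $ k $ j *s axis j 1 else char_matrix a $ i))"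
   by (simp add: matrix_matrix_mult_def char_adjugate_def det_row_mul)
  also have "\<dots> = det (\<chi> i. if i = l then (\<Sum>j\<in>UNIV. char_matrix a $ k $ j *s axis j 1) else char_matrix a $ i)"
   by (simp add: det_row_sum)
  also have "(\<Sum>j\<in>UNIV. char_matrix a $ k $ j *s axis j 1) = char_matrix a $ k"
   by (simp add: vec_eq_iff axis_def if_distrib cong: if_cong)
  also have "det (\<chi> i. if i = l then char_matrix a $ k else char_matrix a $ i) = (if k = l then char_poly a else 0)"
  proof (cases "k = l")
   case True
   then have "(\<chi> i. if i = l then char_matrix a $ k else char_matrix a $ i) = char_matrix a"
    by (simp add: vec_eq_iff)
   then show ?thesis using True by (simp add: det_char_matrix)
  next
   case False
   have "det (\<chi> i. if i = l then char_matrix a $ k else char_matrix a $ i) = 0"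
    by (rule det_identical_rows[OF False]) (simp add: row_def vec_eq_iff)
   then show ?thesis using False by simp
  qed
  finally show ?thesis by (simp add: mat_def)
 qed
 then show ?thesis by (simp add: vec_eq_iff)
qed

lemma pderiv_sum': "pderiv (\<Sum>i\<in>I. f i) = (\<Sum>i\<in>I. pderiv (f i))"
 by (induction I rule: infinite_finite_induct) (simp_all add: pderiv_add)

text \<open>Jacobi's formula: differentiating the determinant row by row, the derivative of row i of
  x I - a is the i-th unit vector. This is the source of Newton's identities below.\<close>

lemma trace_char_adjugate:
 fixes a :: "complex^'n^'n"
 shows "trace (char_adjugate a) = pderiv (char_poly a)"
proof -
 have "pderiv (char_poly a) = (\<Sum>p | p permutes UNIV. of_int (sign p) *
   (\<Sum>i\<in>UNIV. (\<Prod>j\<in>UNIV - {i}. char_matrix a $ j $ p j) * pderiv (char_matrix a $ i $ p i)))"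
  unfolding det_char_matrix[symmetric] det_def
 proof -
  have "pderiv (of_int (sign p) * q) = of_int (sign p) * pderiv q" for p :: "'n => 'n" and q :: "complex poly"
   by (cases "evenperm p") (simp_all add: sign_def pderiv_minus)
  then show "pderiv (\<Sum>p | p permutes UNIV. of_int (sign p) * (\<Prod>i\<in>UNIV. char_matrix a $ i $ p i)) =
   (\<Sum>p | p permutes UNIV. of_int (sign p) *
   (\<Sum>i\<in>UNIV. (\<Prod>j\<in>UNIV - {i}. char_matrix a $ j $ p j) * pderiv (char_matrix a $ i $ p i)))"
   by (simp add: pderiv_sum' pderiv_prod)
 qed
 also have "\<dots> = (\<Sum>p | p permutes UNIV. \<Sum>i\<in>UNIV. of_int (sign p) *
   (\<Prod>j\<in>UNIV. (\<chi> k. if k = i then axis i 1 else char_matrix a $ k) $ j $ p j))"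
 proof (intro sum.cong refl)
  fix p :: "'n => 'n"
  have "(\<Prod>j\<in>UNIV - {i}. char_matrix a $ j $ p j) * pderiv (char_matrix a $ i $ p i) =
    (\<Prod>j\<in>UNIV. (\<chi> k. if k = i then axis i 1 else char_matrix a $ k) $ j $ p j)" for i
  proof -
   have "pderiv (char_matrix a $ i $ p i) = axis i 1 $ p i"
    by (simp add: char_matrix_def axis_def pderiv_diff pderiv_pCons)
   moreover have "(\<Prod>j\<in>UNIV. (\<chi> k. if k = i then axis i 1 else char_matrix a $ k) $ j $ p j) =
    axis i 1 $ p i * (\<Prod>j\<in>UNIV - {i}. char_matrix a $ j $ p j)"
    by (subst prod.remove[of _ i]) (auto intro!: prod.cong arg_cong2[where f = "(*)"])
   ultimately show ?thesis by (simp add: mult.commute)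
  qed
  then show "of_int (sign p) * (\<Sum>i\<in>UNIV. (\<Prod>j\<in>UNIV - {i}. char_matrix a $ j $ p j) * pderiv (char_matrix a $ i $ p i)) =
    (\<Sum>i\<in>UNIV. of_int (sign p) * (\<Prod>j\<in>UNIV. (\<chi> k. if k = i then axis i 1 else char_matrix a $ k) $ j $ p j))"
   by (simp add: sum_distrib_left)
 qed
 also have "\<dots> = trace (char_adjugate a)"
  by (subst sum.swap) (simp add: trace_def char_adjugate_def det_def)
 finally show ?thesis by simp
qed

text \<open>A permutation contributes degree at most the number of its fixed points, so only the
  identity reaches the top degree.\<close>

lemma char_poly_top:
 fixes a :: "complex^'n^'n"
 shows "coeff (char_poly a) (CARD('n)) = 1" "m > CARD('n) ==> coeff (char_poly a) m = 0"
proof -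
 have deg1: "degree (char_matrix a $ i $ j) \<le> (if i = j then 1 else 0)" for i j
  by (simp add: char_matrix_def degree_diff_le)
 have deg: "degree (\<Prod>i\<in>UNIV. char_matrix a $ i $ p i) \<le> card {i. p i = i}" for p
 proof -
  have "degree (\<Prod>i\<in>UNIV. char_matrix a $ i $ p i) \<le> (\<Sum>i\<in>UNIV. degree (char_matrix a $ i $ p i))"
   using degree_prod_sum_le[of "UNIV :: 'n set" "%i. char_matrix a $ i $ p i"] by (simp add: o_def)
  also have "\<dots> \<le> (\<Sum>i\<in>UNIV. if p i = i then 1 else 0)"
   by (rule sum_mono) (use deg1 in \<open>metis (full_types)\<close>)
  also have "\<dots> = card {i. p i = i}" by (simp add: sum.If_cases)
  finally show ?thesis .
 qed
 have coeff_sign: "coeff (of_int (sign p) * q) m = of_int (sign p) * coeff q m" for p :: "'n => 'n" and q :: "complex poly" and m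
  by (cases "evenperm p") (simp_all add: sign_def)
 have co: "coeff (char_poly a) m = (\<Sum>p | p permutes UNIV. of_int (sign p) * coeff (\<Prod>i\<in>UNIV. char_matrix a $ i $ p i) m)" for m
  unfolding det_char_matrix[symmetric] det_def by (simp add: coeff_sum coeff_sign)
 show "coeff (char_poly a) m = 0" if m: "m > CARD('n)"
 proof -
  have "coeff (\<Prod>i\<in>UNIV. char_matrix a $ i $ p i) m = 0" for p
  proof (rule coeff_eq_0)
   have "card {i. p i = i} \<le> CARD('n)" by (simp add: card_mono)
   then show "degree (\<Prod>i\<in>UNIV. char_matrix a $ i $ p i) < m" using deg[of p] m by linarith
  qed
  then show ?thesis unfolding co by simp
 qed
 have "coeff (\<Prod>i\<in>UNIV. char_matrix a $ i $ p i) (CARD('n)) = 0" if "p \<noteq> id" for p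
 proof (rule coeff_eq_0)
  have "{i. p i = i} \<subset> UNIV" using that by (auto simp: fun_eq_iff)
  then have "card {i. p i = i} < CARD('n)" by (rule psubset_card_mono[OF finite])
  then show "degree (\<Prod>i\<in>UNIV. char_matrix a $ i $ p i) < CARD('n)" using deg[of p] by linarith
 qed
 then have "coeff (char_poly a) (CARD('n)) = (\<Sum>p | p permutes (UNIV :: 'n set). if p = id then coeff (\<Prod>i\<in>UNIV. char_matrix a $ i $ i) (CARD('n)) else 0)"
  unfolding co by (intro sum.cong) (auto simp: sign_id)
 also have "\<dots> = coeff (\<Prod>i\<in>UNIV. char_matrix a $ i $ i) (CARD('n))"
  by (simp add: finite_permutations permutes_id)
 also have "\<dots> = 1"
 proof -
  have *: "char_matrix a $ i $ i = [:- (a $ i $ i), 1:]" for i by (simp add: char_matrix_def)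
  have "lead_coeff (\<Prod>i\<in>UNIV. [:- (a $ i $ i), 1:]) = 1" using lead_coeff_prod[of "%i. [:- (a $ i $ i), 1:]" UNIV] by simp
  moreover have "degree (\<Prod>i\<in>UNIV. [:- (a $ i $ i), 1:]) = CARD('n)"
   by (subst degree_prod_eq_sum_degree) auto
  ultimately show ?thesis by (simp add: *)
 qed
 finally show "coeff (char_poly a) (CARD('n)) = 1" .
qed

text \<open>The matrix coefficient of x^m in the adjugate of x I - a. Comparing coefficients in its
  product with x I - a gives the Faddeev-LeVerrier recursion.\<close>

definition Bcoef :: "complex^'n^'n => nat => complex^'n^'n" where
 "Bcoef a m = (\<chi> i j. coeff (char_adjugate a $ i $ j) m)"

lemma Bcoef_rec:
 "a ** Bcoef a 0 = - mat (coeff (char_poly a) 0)"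
 "Bcoef a m = a ** Bcoef a (Suc m) + mat (coeff (char_poly a) (Suc m))"
proof -
 have eq: "pCons 0 (char_adjugate a $ k $ l) - (\<Sum>j\<in>UNIV. smult (a $ k $ j) (char_adjugate a $ j $ l)) =
   (if k = l then char_poly a else 0)" for k l
 proof -
  have "(\<Sum>j\<in>UNIV. char_matrix a $ k $ j * char_adjugate a $ j $ l) = (if k = l then char_poly a else 0)"
   using arg_cong[OF char_matrix_adjugate[of a], of "%m. m $ k $ l"] by (simp add: matrix_matrix_mult_def mat_def)
  moreover have "(\<Sum>j\<in>UNIV. char_matrix a $ k $ j * char_adjugate a $ j $ l) =
   (\<Sum>j\<in>UNIV. (if k = j then pCons 0 (char_adjugate a $ j $ l) else 0)) - (\<Sum>j\<in>UNIV. smult (a $ k $ j) (char_adjugate a $ j $ l))"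
   unfolding sum_subtractf[symmetric] by (intro sum.cong) (auto simp: char_matrix_def algebra_simps)
  ultimately show ?thesis by simp
 qed
 have "(a ** Bcoef a 0) $ k $ l = (- mat (coeff (char_poly a) 0)) $ k $ l" for k l
  using arg_cong[OF eq[of k l], of "%p. coeff p 0"]
  by (auto simp: matrix_matrix_mult_def Bcoef_def mat_def coeff_sum minus_equation_iff split: if_splits)
 then show "a ** Bcoef a 0 = - mat (coeff (char_poly a) 0)" by (simp add: vec_eq_iff)
 have "Bcoef a m $ k $ l = (a ** Bcoef a (Suc m) + mat (coeff (char_poly a) (Suc m))) $ k $ l" for k l
  using arg_cong[OF eq[of k l], of "%p. coeff p (Suc m)"]
  by (auto simp: matrix_matrix_mult_def Bcoef_def mat_def coeff_sum algebra_simps split: if_splits)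
 then show "Bcoef a m = a ** Bcoef a (Suc m) + mat (coeff (char_poly a) (Suc m))" by (simp add: vec_eq_iff)
qed

text \<open>Beyond all degrees the coefficients vanish. The recursion carries this downwards as long
  as the characteristic polynomial contributes no coefficient, that is, down to index n.\<close>

lemma Bcoef_0:
 fixes a :: "complex^'n^'n"
 assumes "m \<ge> CARD('n)"
 shows "Bcoef a m = 0"
proof -
 define N where "N = Suc (CARD('n) + (\<Sum>i\<in>UNIV. \<Sum>j\<in>UNIV. degree (char_adjugate a $ i $ j)))"
 have big: "Bcoef a k = 0" if "k \<ge> N" for k
 proof -
  have "degree (char_adjugate a $ i $ j) < k" for i j
  proof -
   have "degree (char_adjugate a $ i $ j) \<le> (\<Sum>j\<in>UNIV. degree (char_adjugate a $ i $ j))"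
    by (rule member_le_sum) auto
   also have "\<dots> \<le> (\<Sum>i\<in>UNIV. \<Sum>j\<in>UNIV. degree (char_adjugate a $ i $ j))"
    by (rule member_le_sum[of i UNIV "%i. \<Sum>j\<in>UNIV. degree (char_adjugate a $ i $ j)"]) auto
   finally show ?thesis using that by (simp add: N_def)
  qed
  then show ?thesis by (simp add: Bcoef_def vec_eq_iff coeff_eq_0)
 qed
 have "Bcoef a (N - d) = 0" if "N - d \<ge> CARD('n)" for d
  using that
 proof (induction d)
  case 0
  then show ?case using big by simp
 next
  case (Suc d)
  show ?case
  proof (cases "N - d = 0")
   case False
   then have s: "N - d = Suc (N - Suc d)" by simp
   have "Bcoef a (Suc (N - Suc d)) = 0" using Suc s by simp
   moreover have "coeff (char_poly a) (Suc (N - Suc d)) = 0" by (rule char_poly_top(2)) (use Suc in simp)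
   ultimately show ?thesis using Bcoef_rec(2)[of a "N - Suc d"] by (simp add: matrix_matrix_mult_def mat_def vec_eq_iff)
  qed (use Suc in simp)
 qed
 from this[of "N - m"] show ?thesis using big[of m] assms by (cases "m \<le> N") auto
qed

lemma trace_Bcoef: "trace (Bcoef a m) = of_nat (Suc m) * coeff (char_poly a) (Suc m)"
proof -
 have "trace (Bcoef a m) = coeff (trace (char_adjugate a)) m"
  by (simp add: trace_def Bcoef_def coeff_sum)
 then show ?thesis by (simp add: trace_char_adjugate coeff_pderiv)
qed

text \<open>The signed elementary symmetric functions \<open>(-1)\<^sup>k h\<^sub>k\<close>.\<close>
definition Ecoef :: "complex^'n^'n => nat => complex" where
 "Ecoef a k = (-1) ^ k * elem_sym_eigenvalues a k"

text \<open>Horner's form of the matrix sum in \<open>z_fun\<close>. By \<open>Smat_Bcoef\<close>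
  these are, from the top, the coefficients of the adjugate of x I - a.\<close>

primrec Smat :: "complex^'n^'n => nat => complex^'n^'n" where
 "Smat a 0 = mat 1"
| "Smat a (Suc k) = a ** Smat a k + mat (Ecoef a (Suc k))"

text \<open>\<open>eigenvalues\<close> is a choice; the fundamental theorem of algebra shows that
  there is something to choose, and a bijection of the index type with an initial segment labels the
  roots.\<close>

lemma char_poly_eigenvalues: "char_poly (a :: complex^'n^'n) = (\<Prod>i\<in>UNIV. [:- eigenvalues a i, 1:])"
proof -
 let ?p = "char_poly a"
 have deg: "degree ?p = CARD('n)"
 proof (rule antisym)
  show "degree ?p \<le> CARD('n)" by (rule degree_le) (simp add: char_poly_top(2))
  show "CARD('n) \<le> degree ?p" by (rule le_degree) (simp add: char_poly_top(1))
 qed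
 then have lc: "lead_coeff ?p = 1" using char_poly_top(1) by simp
 then have "?p \<noteq> 0" by auto
 from alg_closed_imp_factorization[OF this]
 obtain A where A: "size A = degree ?p" "?p = smult (lead_coeff ?p) (\<Prod>x\<in>#A. [:-x, 1:])"
  by (elim exE conjE)
 obtain xs where xs: "mset xs = A" using ex_mset by blast
 have len: "length xs = CARD('n)" using xs A deg by auto
 obtain h where h: "bij_betw h (UNIV :: 'n set) {0..<CARD('n)}"
  using ex_bij_betw_finite_nat[OF finite] by blast
 have "?p = (\<Prod>x\<in>#A. [:-x, 1:])" using A(2) lc by simp
 also have "\<dots> = prod_list (map (%x. [:-x, 1:]) xs)" by (simp flip: xs prod_mset_prod_list)
 also have "\<dots> = (\<Prod>k\<in>{0..<CARD('n)}. [:- (xs ! k), 1:])"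
  by (simp add: prod.list_conv_set_nth len)
 also have "\<dots> = (\<Prod>i\<in>UNIV. [:- (xs ! h i), 1:])" by (rule prod.reindex_bij_betw[OF h, symmetric])
 finally have "?p = (\<Prod>i\<in>UNIV. [:- (%i. xs ! h i) i, 1:])" .
 from someI[of "%l. ?p = (\<Prod>i\<in>UNIV. [:- l i, 1:])", OF this]
 show ?thesis unfolding eigenvalues_def .
qed

text \<open>Vieta's formula: expand the product over subsets, where the subset \<open>I\<close>
  contributes the power of the complement's size.\<close>

lemma coeff_prod_linear:
 fixes l :: "'n::finite => complex"
 assumes "k \<le> CARD('n)"
 shows "coeff (\<Prod>i\<in>UNIV. [:- l i, 1:]) (CARD('n) - k) = (-1) ^ k * (\<Sum>I | card I = k. \<Prod>i\<in>I. l i)"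
proof -
 have c: "(\<Prod>i\<in>I. [:- l i:]) = [:\<Prod>i\<in>I. - l i:]" for I
  by (induction I rule: infinite_finite_induct) auto
 have "(\<Prod>i\<in>UNIV. [:- l i, 1:]) = (\<Prod>i\<in>UNIV. [:- l i:] + [:0, 1:])" by simp
 also have "\<dots> = (\<Sum>I\<in>Pow UNIV. (\<Prod>i\<in>I. [:- l i:]) * (\<Prod>i\<in>UNIV - I. [:0, 1:]))"
  by (rule prod_add) simp
 also have "\<dots> = (\<Sum>I\<in>UNIV. monom (\<Prod>i\<in>I. - l i) (card (UNIV - I)))"
  unfolding Pow_UNIV by (intro sum.cong) (simp_all add: c monom_altdef)
 finally have "coeff (\<Prod>i\<in>UNIV. [:- l i, 1:]) (CARD('n) - k) = (\<Sum>I\<in>UNIV. if card (UNIV - I) = CARD('n) - k then (\<Prod>i\<in>I. - l i) else 0)"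
  by (simp add: coeff_sum)
 also have "\<dots> = (\<Sum>I\<in>UNIV. if card I = k then (-1) ^ k * (\<Prod>i\<in>I. l i) else 0)"
 proof (rule sum.cong[OF refl])
  fix I :: "'n set"
  have "card I \<le> CARD('n)" by (simp add: card_mono)
  then have "card (UNIV - I) = CARD('n) - k \<longleftrightarrow> card I = k"
   using assms by (simp add: card_Diff_subset) linarith
  then show "(if card (UNIV - I) = CARD('n) - k then (\<Prod>i\<in>I. - l i) else 0) = (if card I = k then (-1) ^ k * (\<Prod>i\<in>I. l i) else 0)"
   by (simp add: prod_uminus)
 qed
 also have "\<dots> = (-1) ^ k * (\<Sum>I | card I = k. \<Prod>i\<in>I. l i)"
  by (simp add: sum.If_cases sum_distrib_left)
 finally show ?thesis .
qed

lemma Ecoef_coeff: "k \<le> CARD('n) ==> Ecoef (a :: complex^'n^'n) k = coeff (char_poly a) (CARD('n) - k)"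
 by (simp add: Ecoef_def elem_sym_eigenvalues_def char_poly_eigenvalues coeff_prod_linear)

lemma Ecoef_0: "Ecoef (a :: complex^'n^'n) 0 = 1"
 by (simp add: Ecoef_coeff char_poly_top)

lemma Smat_Bcoef:
 fixes a :: "complex^'n^'n"
 shows "k < CARD('n) ==> Smat a k = Bcoef a (CARD('n) - Suc k)"
proof (induction k)
 case 0
 then show ?case using Bcoef_rec(2)[of a "CARD('n) - 1"]
  by (simp add: Bcoef_0 char_poly_top matrix_matrix_mult_def vec_eq_iff)
next
 case (Suc k)
 then have s: "CARD('n) - Suc k = Suc (CARD('n) - Suc (Suc k))" by simp
 show ?case using Suc Bcoef_rec(2)[of a "CARD('n) - Suc (Suc k)"] by (simp add: s[symmetric] Ecoef_coeff)
qed

text \<open>The last step of Horner's scheme evaluates the characteristic polynomial at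
  \<open>a\<close>; the constant coefficient in the adjugate identity makes the result zero.\<close>

lemma Cayley_Hamilton_Smat: "Smat (a :: complex^'n^'n) (CARD('n)) = 0"
proof -
 obtain m where m: "CARD('n) = Suc m" using zero_less_card_finite[where 'a = 'n] by (cases "CARD('n)") auto
 have "Smat a m = Bcoef a 0" using Smat_Bcoef[of m a] m by simp
 then show ?thesis using Bcoef_rec(1)[of a] Ecoef_coeff[of "Suc m" a] m by simp
qed

text \<open>Two values of the trace of \<open>Smat a k\<close> are compared:
  \<open>(n - k) e_k\<close> from the derivative of the characteristic polynomial, and
  \<open>trace (a ** Smat a (k - 1)) + n e_k\<close> from the recursion.\<close>

lemma Newton_identity:
 fixes a :: "complex^'n^'n"
 assumes "1 \<le> k" "k \<le> CARD('n)"
 shows "of_nat k * Ecoef a k = - trace (a ** Smat a (k - 1))"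
proof -
 obtain j where j: "k = Suc j" using assms by (cases k) auto
 have tS: "trace (Smat a k) = of_nat (CARD('n) - k) * Ecoef a k"
 proof (cases "k < CARD('n)")
  case True
  then have s: "CARD('n) - k = Suc (CARD('n) - Suc k)" by simp
  show ?thesis using Smat_Bcoef[OF True] Ecoef_coeff[OF assms(2), of a] by (simp add: trace_Bcoef s)
 next
  case False
  then have "k = CARD('n)" using assms by simp
  then show ?thesis by (simp add: Cayley_Hamilton_Smat trace_def)
 qed
 have "trace (Smat a k) = trace (a ** Smat a (k - 1)) + of_nat (CARD('n)) * Ecoef a k"
  by (simp add: j trace_add) (simp add: trace_def mat_def)
 then show ?thesis using tS assms(2) by (simp add: of_nat_diff algebra_simps eq_neg_iff_add_eq_0)
qed

subsection \<open>Matrix algebra\<close>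

lemma mat_mult_scale: "mat c ** (a :: complex^'m^'n) = (\<chi> i j. c * a $ i $ j)" "(a :: complex^'m^'n) ** mat c = (\<chi> i j. c * a $ i $ j)"
 by (simp_all add: matrix_matrix_mult_def mat_def vec_eq_iff if_distrib if_distribR mult.commute cong: if_cong)

lemma mat_commute: "mat c ** a = a ** (mat c :: complex^'n^'n)"
 by (simp add: mat_mult_scale)

lemma mat_left_commute: "a ** (mat c ** b) = mat c ** (a ** (b :: complex^'n^'n))"
 by (simp only: matrix_mul_assoc mat_commute[of c a])

lemma mat_vec_scale: "mat c *v (v :: complex^'n) = c *s v"
 by (simp add: matrix_vector_mult_def mat_def vec_eq_iff if_distrib if_distribR cong: if_cong)

lemma mat_power_simps [simp]: "mat_power a 0 = mat 1" "mat_power a (Suc k) = a ** mat_power a k"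
 by (simp_all add: mat_power_def)

lemma mat_power_commute: "a ** mat_power a k = mat_power a k ** a"
 by (induction k) (simp_all add: matrix_mul_lid matrix_mul_rid matrix_mul_assoc)

lemma Smat_sum: "Smat a k = (\<Sum>j\<le>k. mat (Ecoef a j) ** mat_power (a :: complex^'n^'n) (k - j))"
proof (induction k)
 case 0
 then show ?case by (simp add: Ecoef_0 matrix_mul_lid)
next
 case (Suc k)
 have "a ** (\<Sum>j\<le>k. mat (Ecoef a j) ** mat_power a (k - j)) = (\<Sum>j\<le>k. mat (Ecoef a j) ** mat_power a (Suc k - j))"
 proof -
  have "a ** (\<Sum>j\<le>k. mat (Ecoef a j) ** mat_power a (k - j)) = (\<Sum>j\<le>k. a ** (mat (Ecoef a j) ** mat_power a (k - j)))"
   by (rule linear_sum[OF linear_mm(1)])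
  also have "\<dots> = (\<Sum>j\<le>k. mat (Ecoef a j) ** mat_power a (Suc k - j))"
   by (intro sum.cong refl) (simp add: Suc_diff_le mat_left_commute)
  finally show ?thesis .
 qed
 then show ?case using Suc by (simp add: matrix_mul_rid)
qed

lemma Smat_commute: "a ** Smat a k = Smat a k ** (a :: complex^'n^'n)"
proof (induction k)
 case (Suc k)
 have "a ** Smat a (Suc k) = a ** (Smat a k ** a) + a ** mat (Ecoef a (Suc k))"
  by (simp add: matrix_add_ldistrib Suc)
 also have "\<dots> = Smat a (Suc k) ** a"
  by (simp add: matrix_mul_assoc mat_commute bilinear_ladd[OF bilinear_mm])
 finally show ?case .
qed (simp add: matrix_mul_lid matrix_mul_rid)

lemma z_fun_Smat: "z_fun H T k p = (2 * \<i> * (-1) ^ k) *s (Smat (H p) k *v T p)"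
 by (simp add: z_fun_def Smat_sum Ecoef_def)

text \<open>Newton's identities express the coefficients recursively by traces of powers. This makes
  them invariant under conjugation although they are defined through a choice of
  eigenvalues.\<close>

lemma Ecoef_determined:
 fixes a b :: "complex^'n^'n"
 assumes "\<And>m. trace (mat_power a m) = trace (mat_power b m)"
 shows "k \<le> CARD('n) ==> Ecoef a k = Ecoef b k"
proof (induction k rule: less_induct)
 case (less k)
 show ?case
 proof (cases "k = 0")
  case False
  have tr: "trace (c ** Smat c (k - 1)) = (\<Sum>j\<le>k - 1. Ecoef c j * trace (mat_power c (k - j)))" for c :: "complex^'n^'n"
  proof -
   have "trace (c ** Smat c (k - 1)) = (\<Sum>j\<le>k - 1. trace (c ** (mat (Ecoef c j) ** mat_power c (k - 1 - j))))"
    by (simp add: Smat_sum linear_sum[OF linear_mm(1)] linear_sum[OF linear_trace])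
   also have "\<dots> = (\<Sum>j\<le>k - 1. Ecoef c j * trace (mat_power c (k - j)))"
   proof (rule sum.cong[OF refl])
    fix j assume "j \<in> {..k - 1}"
    then have s: "k - j = Suc (k - 1 - j)" using False by auto
    have "c ** (mat (Ecoef c j) ** mat_power c (k - 1 - j)) = mat (Ecoef c j) ** mat_power c (k - j)"
     by (simp add: s mat_left_commute)
    then show "trace (c ** (mat (Ecoef c j) ** mat_power c (k - 1 - j))) = Ecoef c j * trace (mat_power c (k - j))"
     by (simp add: mat_mult_scale trace_def sum_distrib_left)
   qed
   finally show ?thesis .
  qed
  have nw: "of_nat k * Ecoef c k = - (\<Sum>j\<le>k - 1. Ecoef c j * trace (mat_power c (k - j)))" for c :: "complex^'n^'n"
   using Newton_identity[of k c] tr[of c] False less.prems by simp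
  have "of_nat k * Ecoef a k = of_nat k * Ecoef b k"
   unfolding nw using False less.prems
   by (intro arg_cong[where f = uminus] sum.cong refl) (auto simp: less.IH assms)
  then show ?thesis using False by simp
 qed (simp add: Ecoef_0)
qed

lemma trace_adjoint: "trace (adj a) = cnj (trace (a :: complex^'n^'n))"
 by (simp add: trace_def adjoint_matrix_def)

lemma adjoint_mat_power: "adj (mat_power a k) = mat_power (adj a) k"
 by (induction k) (simp_all add: adjoint_matrix_mat adjoint_matrix_mult mat_power_commute)

text \<open>Reality follows by induction from Newton's identity: once the earlier coefficients are
  real, \<open>a ** Smat a (k - 1)\<close> is Hermitian and its trace is real.\<close>

lemma Ecoef_real:
 fixes a :: "complex^'n^'n"
 assumes h: "adj a = a"
 shows "k \<le> CARD('n) ==> cnj (Ecoef a k) = Ecoef a k"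
proof (induction k rule: less_induct)
 case (less k)
 show ?case
 proof (cases "k = 0")
  case False
  have "adj (Smat a j) = Smat a j" if "j < k" for j
   using that
  proof (induction j)
   case (Suc j)
   then have "cnj (Ecoef a (Suc j)) = Ecoef a (Suc j)" using less by simp
   then show ?case using Suc
    by (simp add: linear_add[OF linear_adjoint_matrix] adjoint_matrix_mult adjoint_matrix_mat h Smat_commute)
  qed (simp add: adjoint_matrix_mat)
  then have "adj (a ** Smat a (k - 1)) = a ** Smat a (k - 1)"
   using False by (simp add: adjoint_matrix_mult h Smat_commute)
  then have "cnj (trace (a ** Smat a (k - 1))) = trace (a ** Smat a (k - 1))"
   by (metis trace_adjoint)
  moreover have "of_nat k * Ecoef a k = - trace (a ** Smat a (k - 1))"
   using Newton_identity[of k a] False less.prems by simp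
  ultimately have "cnj (of_nat k * Ecoef a k) = of_nat k * Ecoef a k" by simp
  then show ?thesis using False by simp
 qed (simp add: Ecoef_0)
qed

lemma Smat_adjoint:
 fixes a :: "complex^'n^'n"
 assumes h: "adj a = a"
 shows "k \<le> CARD('n) ==> adj (Smat a k) = Smat a k"
proof (induction k)
 case (Suc k)
 then show ?case
  by (simp add: linear_add[OF linear_adjoint_matrix] adjoint_matrix_mult adjoint_matrix_mat h Smat_commute Ecoef_real)
qed (simp add: adjoint_matrix_mat)

section \<open>The structure equations in a local unitary frame\<close>

lemma hdot_simps:
 fixes u v w :: "complex^'n"
 shows "hdot (u + v) w = hdot u w + hdot v w" "hdot u (v + w) = hdot u v + hdot u w"
  "hdot (u - v) w = hdot u w - hdot v w" "hdot u (v - w) = hdot u v - hdot u w"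
  "hdot (- v) w = - hdot v w" "hdot v (- w) = - hdot v w"
  "hdot (a *s v) w = cnj a * hdot v w" "hdot v (a *s w) = a * hdot v w"
  "hdot 0 w = 0" "hdot v 0 = 0"
 by (simp_all add: hdot_def sum.distrib sum_subtractf sum_negf sum_distrib_left algebra_simps)

lemma hdot_cnj: "cnj (hdot v w) = hdot w v"
 by (simp add: hdot_def mult.commute)

lemma hdot_matrix: "hdot (m *v v) w = hdot v (adj m *v w)"
 unfolding hdot_def matrix_vector_mult_def adjoint_matrix_def vec_lambda_beta cnj_sum sum_distrib_right sum_distrib_left
 by (subst sum.swap) (simp add: algebra_simps)

lemma Re_hdot: "Re (hdot v w) = v \<bullet> w"
 by (simp add: hdot_def inner_vec_def inner_complex_def)

lemma Im_hdot: "Im (hdot v w) = (\<i> *s v) \<bullet> w"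
 by (simp add: hdot_def inner_vec_def inner_complex_def)

lemma hdot_self: "hdot v v = of_real ((norm v)\<^sup>2)"
 by (rule complex_eqI) (simp_all add: Re_hdot power2_norm_eq_inner Im_hdot, simp add: inner_vec_def inner_complex_def)

lemma hdot_self_eq_0: "hdot v v = 0 \<longleftrightarrow> v = 0"
 by (simp add: hdot_self)

lemma houter_vec: "houter v w *v x = hdot w x *s v"
 by (simp add: houter_def hdot_def matrix_vector_mult_def vec_eq_iff sum_distrib_left sum_distrib_right algebra_simps)

lemma adjoint_houter: "adj (houter v w) = houter w v"
 by (simp add: houter_def adjoint_matrix_def vec_eq_iff mult.commute)

lemma trace_houter: "trace (houter v w) = hdot w v"
 by (simp add: houter_def hdot_def trace_def mult.commute)

lemma matrix_houter: "m ** houter v w = houter (m *v v) w"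
 by (simp add: houter_def matrix_matrix_mult_def matrix_vector_mult_def vec_eq_iff sum_distrib_right mult.assoc)

lemma houter_matrix: "houter v w ** m = houter v (adj m *v w)"
 by (simp add: houter_def matrix_matrix_mult_def matrix_vector_mult_def adjoint_matrix_def vec_eq_iff
   sum_distrib_left algebra_simps)

lemma mat_simps:
 fixes a :: "complex^'n^'m"
 shows "(a + b) ** c = a ** c + b ** c" "a ** (d + e) = a ** d + a ** e"
  "(a - b) ** c = a ** c - b ** c" "a ** (d - e) = a ** d - a ** e"
  "(- a) ** c = - (a ** c)" "a ** (- d) = - (a ** d)"
  "(a + b) *v x = a *v x + b *v x" "a *v (x + y) = a *v x + a *v y"
  "(a - b) *v x = a *v x - b *v x" "a *v (x - y) = a *v x - a *v y"
  "(- a) *v x = - (a *v x)" "a *v (- x) = - (a *v x)"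
 by (simp_all add: bilinear_ladd[OF bilinear_mm] bilinear_radd[OF bilinear_mm]
   bilinear_lsub[OF bilinear_mm] bilinear_rsub[OF bilinear_mm]
   bilinear_lneg[OF bilinear_mm] bilinear_rneg[OF bilinear_mm]
   bilinear_ladd[OF bilinear_mv] bilinear_radd[OF bilinear_mv]
   bilinear_lsub[OF bilinear_mv] bilinear_rsub[OF bilinear_mv]
   bilinear_lneg[OF bilinear_mv] bilinear_rneg[OF bilinear_mv])

lemma adjoint_simps:
 "adj (a + b) = adj a + adj b"
 "adj (a - b) = adj a - adj b"
 "adj (- a) = - adj a"
 by (simp_all add: linear_add[OF linear_adjoint_matrix] linear_diff[OF linear_adjoint_matrix] linear_neg[OF linear_adjoint_matrix])

lemma trace_simps:
 "trace (a + b) = trace a + trace (b :: complex^'n^'n)" "trace (a - b) = trace a - trace b" "trace (- a) = - trace a"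
 "trace (mat c :: complex^'n^'n) = of_nat (CARD('n)) * c" "trace (mat c ** a) = c * trace a"
 by (simp_all add: linear_add[OF linear_trace] linear_diff[OF linear_trace] linear_neg[OF linear_trace])
  (simp_all add: trace_def mat_mult_scale sum_distrib_left, simp add: mat_def)

text \<open>The terms of the equation for d\<phi> other than the square of \<phi>, evaluated on two
  tangent vectors on which \<omega> takes the values \<open>v\<close> and \<open>w\<close>.\<close>

definition bk_curv :: "complex^'n^'n => complex^'n => complex^'n => complex^'n^'n" where
 "bk_curv h v w = mat (hdot v w - hdot w v) ** h - h ** (houter v w - houter w v) - (houter v w - houter w v) ** h
   + mat (hdot v (h *v w) - hdot w (h *v v)) + mat (trace h) ** (mat (hdot v w - hdot w v) - (houter v w - houter w v))"

text \<open>\<open>s y\<close> is the coframe in coordinates, so \<open>s y *v v\<close> stands for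
  \<omega>. Exterior derivatives are written as alternating directional derivatives of values on
  constant vector fields, whose brackets vanish.\<close>

locale bk_local =
 fixes W :: "(complex^'n) set" and s :: "complex^'n => complex^'n^'n"
  and \<phi> :: "complex^'n => complex^'n => complex^'n^'n"
  and H :: "complex^'n => complex^'n^'n" and T :: "complex^'n => complex^'n" and V :: "complex^'n => real"
 assumes open_W: "open W" and smooth_s: "smooth_on W s" and inv_s: "\<And>y. y \<in> W ==> invertible (s y)"
  and smooth_\<phi>: "\<And>v. smooth_on W (%y. \<phi> y v)" and linear_\<phi>: "\<And>y. y \<in> W ==> linear (\<phi> y)"
  and skew_\<phi>: "\<And>y v. y \<in> W ==> adj (\<phi> y v) = - \<phi> y v"
  and torsion: "\<And>y v w. y \<in> W ==> dd s y v *v w - dd s y w *v v = - (\<phi> y v *v (s y *v w) - \<phi> y w *v (s y *v v))"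
  and smooth_H: "smooth_on W H" and smooth_T: "smooth_on W T" and smooth_V: "smooth_on W V"
  and herm_H: "\<And>y. y \<in> W ==> adj (H y) = H y"
  and curvature: "\<And>y v w. y \<in> W ==> dd (%y. \<phi> y w) y v - dd (%y. \<phi> y v) y w
   = - (\<phi> y v ** \<phi> y w - \<phi> y w ** \<phi> y v) + bk_curv (H y) (s y *v v) (s y *v w)"
  and dH: "\<And>y v. y \<in> W ==> dd H y v = - (\<phi> y v ** H y) + H y ** \<phi> y v + houter (T y) (s y *v v) + houter (s y *v v) (T y)"
  and dT: "\<And>y v. y \<in> W ==> dd T y v = - (\<phi> y v *v T y) +
   (mat_power (H y) 2 + mat (trace (H y)) ** H y + mat (of_real (V y))) *v (s y *v v)"
  and dV: "\<And>y v. y \<in> W ==> of_real (dd V y v) =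
   trace (H y) * (hdot (T y) (s y *v v) + hdot (s y *v v) (T y)) + (hdot (T y) (H y *v (s y *v v)) + hdot (s y *v v) (H y *v T y))"

lemma invertible_surj:
 assumes "invertible (m :: complex^'n^'n)"
 obtains v where "m *v v = w"
 using that[of "matrix_inv m *v w"] matrix_inv_right[OF assms] by (simp add: matrix_vector_mul_assoc)

lemma invertible_cancel:
 assumes "invertible (m :: complex^'n^'n)" "m *v v = m *v w"
 shows "v = w"
 using arg_cong[OF assms(2), of "(*v) (matrix_inv m)"] matrix_inv_left[OF assms(1)]
 by (simp add: matrix_vector_mul_assoc)

lemma matrix_eqI: "(\<And>v. a *v v = b *v v) ==> a = (b :: complex^'n^'m)"
 by (simp add: matrix_eq)

lemma hdot_eqI: "(\<And>w. hdot w v = hdot w v') ==> v = v'"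
 using hdot_self_eq_0[of "v - v'"] by (simp add: hdot_simps)

text \<open>A symmetric form is complex bilinear, which is incompatible with being skew-Hermitian.\<close>
lemma connection_unique:
 fixes d :: "complex^'n => complex^'n^'n"
 assumes s: "invertible s" and skew: "\<And>v. adj (d v) = - d v" and sym: "\<And>v w. d v *v (s *v w) = d w *v (s *v v)"
 shows "d v = 0"
proof -
 define b where "b v w = d (matrix_inv s *v v) *v w" for v w
 have inv: "s *v (matrix_inv s *v v) = v" for v
  using matrix_inv_right[OF s] by (simp add: matrix_vector_mul_assoc)
 have bsym: "b v w = b w v" for v w using sym[of "matrix_inv s *v v" "matrix_inv s *v w"] by (simp add: b_def inv)
 have bl: "b (a *s v) w = a *s b v w" for a v w
  using bsym[of "a *s v" w] bsym[of v w] by (simp add: b_def mv_smult)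
 have sk: "hdot (b v w) x = - hdot w (b v x)" for v w x
  by (simp add: b_def hdot_matrix skew mat_simps hdot_simps)
 \<comment> \<open>Replacing \<open>v\<close> by \<open>\<i> *s v\<close> multiplies the left side
   of \<open>sk\<close> by \<open>- \<i>\<close> and its right side by \<open>\<i>\<close>, so both
   are zero.\<close>
 have "hdot (b v w) x = 0" for v w x
  using sk[of "\<i> *s v" w x] sk[of v w x] by (simp add: bl hdot_simps)
 then have "b v w = 0" for v w using hdot_self_eq_0[of "b v w"] by simp
 then have "d v *v w = 0" for w
  using b_def[of "s *v v" w] matrix_inv_left[OF s] by (simp add: matrix_vector_mul_assoc)
 then show ?thesis by (intro matrix_eqI) simp
qed

lemma bk_curv_diff: "bk_curv (h - k) v w = bk_curv h v w - bk_curv k v w"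
 by (simp add: bk_curv_def mat_simps hdot_simps trace_simps linear_diff[OF linear_mat] linear_add[OF linear_mat] algebra_simps)

text \<open>For the difference \<open>d\<close>, inserting \<open>v\<close> and
  \<open>\<i> *s v\<close> and taking the trace leaves \<open>n + 2\<close> times the sum of
  \<open>hdot v (d *v v)\<close> and \<open>trace d * hdot v v\<close>. Once the trace is known to
  vanish, polarisation gives \<open>d = 0\<close>.\<close>

lemma bk_curv_inj:
 fixes h k :: "complex^'n^'n"
 assumes "\<And>v w. bk_curv h v w = bk_curv k v w"
 shows "h = k"
proof -
 define d where "d = h - k"
 have z: "bk_curv d v w = 0" for v w by (simp add: d_def bk_curv_diff assms)
 have key: "hdot v (d *v v) = - trace d * hdot v v" for v
 proof -
  have e1: "hdot v (\<i> *s v) - hdot (\<i> *s v) v = 2 * \<i> * hdot v v" by (simp add: hdot_simps)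
  have e2: "houter v (\<i> *s v) - houter (\<i> *s v) v = mat (- 2 * \<i>) ** houter v v"
   by (simp add: houter_def mat_mult_scale vec_eq_iff)
  have e3: "hdot v (d *v (\<i> *s v)) - hdot (\<i> *s v) (d *v v) = 2 * \<i> * hdot v (d *v v)"
   by (simp add: hdot_simps mv_smult)
  have "0 = trace (bk_curv d v (\<i> *s v))" by (simp add: z trace_def)
  also have "\<dots> = 2 * \<i> * (of_nat (CARD('n)) + 2) * (hdot v (d *v v) + trace d * hdot v v)"
   unfolding bk_curv_def e1 e2 e3
   by (simp add: trace_simps mat_left_commute trace_houter matrix_houter houter_matrix matrix_mul_assoc[symmetric]
     hdot_matrix mat_vec_scale hdot_simps mat_simps(12) mv_smult algebra_simps)
  finally have "of_nat (CARD('n) + 2) * (hdot v (d *v v) + trace d * hdot v v) = 0" by (simp add: add.commute)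
  then have "hdot v (d *v v) + trace d * hdot v v = 0" unfolding mult_eq_0_iff of_nat_eq_0_iff by simp
  then show ?thesis by (simp add: eq_neg_iff_add_eq_0)
 qed
 \<comment> \<open>Summing \<open>key\<close> over the standard basis turns it into
   \<open>trace d = - n * trace d\<close>.\<close>
 have "trace d = (\<Sum>i\<in>UNIV. hdot (axis i 1) (d *v axis i 1))"
  by (simp add: trace_def hdot_def axis_def matrix_vector_mult_def if_distrib if_distribR cong: if_cong)
 also have "\<dots> = (\<Sum>i\<in>(UNIV :: 'n set). - trace d)"
  unfolding key by (intro sum.cong refl) (simp add: hdot_def axis_def if_distrib if_distribR cong: if_cong)
 finally have "(of_nat (CARD('n)) + 1) * trace d = 0" by (simp add: eq_neg_iff_add_eq_0 algebra_simps)
 then have "of_nat (CARD('n) + 1) * trace d = 0" by (simp only: of_nat_add of_nat_1)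
 then have "trace d = 0" unfolding mult_eq_0_iff of_nat_eq_0_iff by simp
 then have q: "hdot v (d *v v) = 0" for v using key by simp
 have "hdot v (d *v w) = 0" for v w
  using q[of "v + w"] q[of "v + \<i> *s w"] q[of v] q[of w]
  by (simp add: hdot_simps mat_simps mv_smult)
 then have "d *v w = 0" for w using hdot_self_eq_0[of "d *v w"] by simp
 then have "d = 0" by (intro matrix_eqI) simp
 then show ?thesis by (simp add: d_def)
qed

text \<open>The difference of the two vectors is itself inserted for \<open>w\<close>, and the
  resulting matrix is applied to it once more.\<close>

lemma torsion_vector_unique:
 assumes "\<And>w. houter t w + houter w t = houter t' w + houter w t'"
 shows "t = t'"
proof -
 have "houter (t - t') w + houter w (t - t') = 0" for w
  using assms[of w] by (simp add: houter_def vec_eq_iff algebra_simps)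
 from this[of "t - t'"] have "houter (t - t') (t - t') *v (t - t') + houter (t - t') (t - t') *v (t - t') = 0"
  by (simp add: mat_simps(7)[symmetric])
 then have "(2::real) *\<^sub>R (hdot (t - t') (t - t') *s (t - t')) = 0" by (simp only: houter_vec scaleR_2)
 then have "hdot (t - t') (t - t') *s (t - t') = 0" by (simp only: scaleR_eq_0_iff) simp
 then have "hdot (t - t') (t - t') = 0 \<or> t - t' = 0" by (simp only: vec.scale_eq_0_iff)
 then show ?thesis by (simp add: hdot_self_eq_0)
qed

text \<open>Each equation determines the next unknown: \<open>torsion\<close> the connection,
  \<open>curvature\<close> then H, the equation for dH then T, and that for dT then V. Agreement on
  an open set also equates the derivatives, and invertibility of \<open>s\<close> makes the values
  of \<omega> arbitrary.\<close>

theorem bk_local_unique: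
 fixes W :: "(complex^'n) set"
 assumes "bk_local W s \<phi> H T V" "bk_local W s \<phi>' H' T' V'" and y: "y \<in> W"
 shows "\<phi> y v = \<phi>' y v" "H y = H' y" "T y = T' y" "V y = V' y"
proof -
 interpret A: bk_local W s \<phi> H T V by fact
 interpret B: bk_local W s \<phi>' H' T' V' by fact
 have p: "\<phi> y v = \<phi>' y v" if y: "y \<in> W" for y v
 proof -
  have "\<phi> y v - \<phi>' y v = 0"
  proof (rule connection_unique[OF A.inv_s[OF y], of "%v. \<phi> y v - \<phi>' y v"])
   show "adj (\<phi> y v - \<phi>' y v) = - (\<phi> y v - \<phi>' y v)" for v
    by (simp add: adjoint_simps A.skew_\<phi>[OF y] B.skew_\<phi>[OF y])
   show "(\<phi> y v - \<phi>' y v) *v (s y *v w) = (\<phi> y w - \<phi>' y w) *v (s y *v v)" for v w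
    using A.torsion[OF y, of v w] B.torsion[OF y, of v w] by (simp add: mat_simps algebra_simps)
  qed
  then show ?thesis by simp
 qed
 show "\<phi> y v = \<phi>' y v" by (rule p[OF y])
 have dp: "dd (%y. \<phi> y w) y v = dd (%y. \<phi>' y w) y v" if "y \<in> W" for y v w
  using dd_cong[OF A.open_W that, of "%y. \<phi> y w" "%y. \<phi>' y w"] p by simp
 have h: "H y = H' y" if y: "y \<in> W" for y
 proof (rule bk_curv_inj)
  fix v w
  obtain v' where v': "s y *v v' = v" using invertible_surj[OF A.inv_s[OF y]] by blast
  obtain w' where w': "s y *v w' = w" using invertible_surj[OF A.inv_s[OF y]] by blast
  show "bk_curv (H y) v w = bk_curv (H' y) v w"
   using A.curvature[OF y, of w' v'] B.curvature[OF y, of w' v'] p[OF y] dp[OF y] by (simp add: v' w')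
 qed
 show "H y = H' y" by (rule h[OF y])
 have dh: "dd H y v = dd H' y v" if "y \<in> W" for y v
  using dd_cong[OF A.open_W that, of H H'] h by simp
 have t: "T y = T' y" if y: "y \<in> W" for y
 proof (rule torsion_vector_unique)
  fix w
  obtain w' where w': "s y *v w' = w" using invertible_surj[OF A.inv_s[OF y]] by blast
  show "houter (T y) w + houter w (T y) = houter (T' y) w + houter w (T' y)"
   using A.dH[OF y, of w'] B.dH[OF y, of w'] p[OF y] dh[OF y] h[OF y] by (simp add: w' add.assoc)
 qed
 show "T y = T' y" by (rule t[OF y])
 have dt: "dd T y v = dd T' y v" for v
  using dd_cong[OF A.open_W y, of T T'] t by simp
 fix i :: 'n
 obtain w' where w': "s y *v w' = axis i 1" using invertible_surj[OF A.inv_s[OF y]] by blast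
 have "mat (of_real (V y)) *v axis i 1 = (mat (of_real (V' y)) *v axis i 1 :: complex^'n)"
  using A.dT[OF y, of w'] B.dT[OF y, of w'] p[OF y] dt h[OF y] t[OF y] by (simp add: w' mat_simps)
 then have "of_real (V y) * (1 :: complex) = of_real (V' y) * 1"
  unfolding mat_vec_scale vec_eq_iff by (auto simp: axis_def split: if_splits)
 then show "V y = V' y" by simp
qed

subsection \<open>Change of the frame and of the coordinates\<close>

lemma unitary_cancel:
 fixes a :: "complex^'n^'n"
 assumes "adj a ** a = mat 1"
 shows "adj a ** (a ** b) = b" "adj a *v (a *v x) = x"
  "a ** (adj a ** b) = b" "a *v (adj a *v x) = x" "a ** adj a = mat 1"
proof -
 show "a ** adj a = mat 1" using assms by (simp add: matrix_left_right_inverse)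
 then show "adj a ** (a ** b) = b" "adj a *v (a *v x) = x"
  "a ** (adj a ** b) = b" "a *v (adj a *v x) = x"
  using assms by (simp_all add: matrix_mul_assoc matrix_vector_mul_assoc matrix_mul_lid)
qed

lemma mat_power_conj:
 fixes a :: "complex^'n^'n"
 assumes u: "adj a ** a = mat 1"
 shows "mat_power (a ** h ** adj a) k = a ** mat_power h k ** adj a"
 by (induction k) (simp_all add: matrix_mul_assoc[symmetric] unitary_cancel[OF u] matrix_mul_rid matrix_mul_lid)

lemma trace_conj:
 fixes a :: "complex^'n^'n"
 assumes u: "adj a ** a = mat 1"
 shows "trace (a ** h ** adj a) = trace h"
 by (subst trace_mul_sym) (simp add: unitary_cancel[OF u])

lemma hdot_unitary:
 fixes a :: "complex^'n^'n"
 assumes u: "adj a ** a = mat 1"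
 shows "hdot (a *v v) (a *v w) = hdot v w"
 by (simp add: hdot_matrix unitary_cancel[OF u])

lemma houter_unitary:
 fixes a :: "complex^'n^'n"
 shows "houter (a *v v) (a *v w) = a ** houter v w ** adj a"
 by (simp add: matrix_houter houter_matrix)

lemma bk_curv_conj:
 fixes a :: "complex^'n^'n"
 assumes u: "adj a ** a = mat 1"
 shows "bk_curv (a ** h ** adj a) (a *v v) (a *v w) = a ** bk_curv h v w ** adj a"
proof -
 define c where "c m = a ** m ** adj a" for m
 have c_lin: "c (m + k) = c m + c k" "c (m - k) = c m - c k" for m k by (simp_all add: c_def mat_simps)
 have c_mult: "c (m ** k) = c m ** c k" for m k
  by (simp add: c_def matrix_mul_assoc[symmetric] unitary_cancel[OF u])
 have c_mat: "c (mat x) = mat x" for x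
  by (simp only: c_def mat_commute[of x a, symmetric] matrix_mul_assoc[symmetric] unitary_cancel(5)[OF u] matrix_mul_rid)
 have c_vec: "c m *v (a *v x) = a *v (m *v x)" for m x
  by (simp add: c_def matrix_vector_mul_assoc[symmetric] unitary_cancel[OF u])
 have c_trace: "trace (c h) = trace h" by (simp add: c_def trace_conj[OF u])
 have c_houter: "houter (a *v x) (a *v y) = c (houter x y)" for x y by (simp add: c_def houter_unitary)
 have "bk_curv (c h) (a *v v) (a *v w) = c (bk_curv h v w)"
  by (simp only: bk_curv_def c_lin c_mult c_mat c_vec c_trace c_houter hdot_unitary[OF u])
 then show ?thesis by (simp only: c_def)
qed

text \<open>For a constant unitary matrix the connection is merely conjugated, with no derivative of
  \<open>a\<close>. Together with uniqueness this yields the U(n)-equivariance of H, T and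
  V.\<close>

theorem bk_local_gauge:
 fixes W :: "(complex^'n) set"
 assumes "bk_local W s \<phi> H T V" and u: "adj a ** a = mat 1"
 shows "bk_local W (%y. a ** s y) (%y v. a ** \<phi> y v ** adj a) (%y. a ** H y ** adj a) (%y. a *v T y) V"
proof -
 interpret bk_local W s \<phi> H T V by fact
 have l2: "linear (%m. a ** m ** adj a)"
  by (rule linearI) (simp_all add: mat_simps bilinear_lmul[OF bilinear_mm] bilinear_rmul[OF bilinear_mm])
 have D1: "dd (%y. h (f y)) y v = h (dd f y v)" if "linear h" "smooth_on W f" "y \<in> W"
  for h :: "'b::euclidean_space => 'c::euclidean_space" and f :: "complex^'n => 'b" and y v
  using dd_eqI[OF hd_linear[OF that(1) smooth_dd[OF that(2,3)]]] by simp
 note uc = unitary_cancel[OF u]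
 show ?thesis
 proof (rule bk_local.intro)
  show "smooth_on W (%y. a ** s y)" by (rule smooth_on_linear_comp[OF open_W linear_mm(1) smooth_s])
  show "smooth_on W (%y. a ** \<phi> y v ** adj a)" for v by (rule smooth_on_linear_comp[OF open_W l2 smooth_\<phi>])
  show "smooth_on W (%y. a ** H y ** adj a)" by (rule smooth_on_linear_comp[OF open_W l2 smooth_H])
  show "smooth_on W (%y. a *v T y)" by (rule smooth_on_linear_comp[OF open_W linear_mv(1) smooth_T])
  fix y assume y: "y \<in> W"
  show "invertible (a ** s y)"
  proof (rule invertible_mult[OF _ inv_s[OF y]])
   show "invertible a" unfolding invertible_def using u uc(5) by blast
  qed
  show "linear (%v. a ** \<phi> y v ** adj a)" using linear_compose[OF linear_\<phi>[OF y] l2] by (simp add: o_def)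
  show "adj (a ** H y ** adj a) = a ** H y ** adj a"
   by (simp add: adjoint_matrix_mult herm_H[OF y] matrix_mul_assoc)
  fix v
  show "adj (a ** \<phi> y v ** adj a) = - (a ** \<phi> y v ** adj a)"
   by (simp add: adjoint_matrix_mult skew_\<phi>[OF y] matrix_mul_assoc mat_simps)
  show "dd (%y. a ** H y ** adj a) y v = - ((a ** \<phi> y v ** adj a) ** (a ** H y ** adj a)) +
    (a ** H y ** adj a) ** (a ** \<phi> y v ** adj a) + houter (a *v T y) ((a ** s y) *v v) + houter ((a ** s y) *v v) (a *v T y)"
   unfolding D1[OF l2 smooth_H y] dH[OF y]
   by (simp add: mat_simps matrix_mul_assoc[symmetric] uc matrix_vector_mul_assoc[symmetric] houter_unitary)
  show "dd (%y. a *v T y) y v = - ((a ** \<phi> y v ** adj a) *v (a *v T y)) +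
    (mat_power (a ** H y ** adj a) 2 + mat (trace (a ** H y ** adj a)) ** (a ** H y ** adj a) +
    mat (of_real (V y))) *v ((a ** s y) *v v)"
   unfolding D1[OF linear_mv(1) smooth_T y] dT[OF y] mat_power_conj[OF u] trace_conj[OF u]
   by (simp add: mat_simps matrix_mul_assoc[symmetric] uc matrix_vector_mul_assoc[symmetric] mat_vec_scale mv_smult)
  show "of_real (dd V y v) = trace (a ** H y ** adj a) * (hdot (a *v T y) ((a ** s y) *v v) + hdot ((a ** s y) *v v) (a *v T y)) +
   (hdot (a *v T y) ((a ** H y ** adj a) *v ((a ** s y) *v v)) + hdot ((a ** s y) *v v) ((a ** H y ** adj a) *v (a *v T y)))"
   unfolding dV[OF y] trace_conj[OF u]
   by (simp add: matrix_vector_mul_assoc[symmetric] uc hdot_unitary[OF u])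
  fix w
  show "dd (%y. a ** s y) y v *v w - dd (%y. a ** s y) y w *v v =
    - ((a ** \<phi> y v ** adj a) *v ((a ** s y) *v w) - (a ** \<phi> y w ** adj a) *v ((a ** s y) *v v))"
   unfolding D1[OF linear_mm(1) smooth_s y] using arg_cong[OF torsion[OF y, of v w], of "(*v) a"]
   by (simp add: mat_simps matrix_vector_mul_assoc[symmetric] uc)
  show "dd (%y. a ** \<phi> y w ** adj a) y v - dd (%y. a ** \<phi> y v ** adj a) y w =
    - ((a ** \<phi> y v ** adj a) ** (a ** \<phi> y w ** adj a) - (a ** \<phi> y w ** adj a) ** (a ** \<phi> y v ** adj a)) +
    bk_curv (a ** H y ** adj a) ((a ** s y) *v v) ((a ** s y) *v w)"
   unfolding D1[OF l2 smooth_\<phi> y] matrix_vector_mul_assoc[symmetric] bk_curv_conj[OF u]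
   using arg_cong[OF curvature[OF y, of w v], of "%m. a ** m ** adj a"]
   by (simp add: mat_simps matrix_mul_assoc[symmetric] uc)
 qed (use open_W smooth_V in auto)
qed

lemma matrix_works_holo:
 assumes "\<And>a v. f (a *s v) = a *s f v" "linear f"
 shows "matrix f *v x = (f x :: complex^'n)"
proof (rule matrix_works)
 show "Vector_Spaces.linear (*s) (*s) f"
  by unfold_locales (use assms linear_add[OF assms(2)] in \<open>auto simp: algebra_simps vec.scale_right_distrib vec.scale_left_distrib\<close>)
qed

lemma smooth_on_matrix_derivative:
 assumes "open W" "smooth_on W psi"
 shows "smooth_on W (%y. matrix (dd psi y) :: complex^'n^'m)"
proof (rule smooth_on_vec[OF assms(1)], rule smooth_on_vec[OF assms(1)])
 fix i j
 have "smooth_on W (%y. dd psi y (axis j 1) $ i)" by (rule smooth_on_nth[OF assms(1) smooth_on_dd[OF assms(2)]])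
 then show "smooth_on W (%y. (matrix (dd psi y) :: complex^'n^'m) $ i $ j)"
  by (simp add: matrix_def)
qed

text \<open>Second derivatives of \<open>psi\<close> enter the exterior derivatives symmetrically
  and cancel. Complex linearity of \<open>dd psi y\<close> lets the pulled-back coframe be written
  as a complex matrix again.\<close>

theorem bk_local_pullback:
 fixes W :: "(complex^'n) set"
 assumes "bk_local W s \<phi> H T V" and W': "open W'" and psi: "holo_on W' psi" "psi ` W' \<subseteq> W"
  and inj: "\<And>y. y \<in> W' ==> inj (dd psi y)"
 shows "bk_local W' (%y. s (psi y) ** matrix (dd psi y)) (%y v. \<phi> (psi y) (dd psi y v))
  (%y. H (psi y)) (%y. T (psi y)) (%y. V (psi y))"
proof -
 interpret bk_local W s \<phi> H T V by fact
 have sm: "smooth_on W' psi" by (rule holo_on_smooth_on[OF psi(1) W'])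
 note smc = smooth_on_compose[OF W' open_W _ sm psi(2)]
 have inW: "psi y \<in> W" if "y \<in> W'" for y using that psi(2) by blast
 have lin: "linear (dd psi y)" if "y \<in> W'" for y
  by (rule linear_dd[OF sm that])
 have mw: "matrix (dd psi y) *v v = dd psi y v" if "y \<in> W'" for y v
  by (rule matrix_works_holo[OF holo_onE(2)[OF psi(1) that] lin[OF that]])
 have sw: "(s (psi y) ** matrix (dd psi y)) *v v = s (psi y) *v dd psi y v" if "y \<in> W'" for y v
  by (simp add: mw[OF that] matrix_vector_mul_assoc[symmetric])
 have dc: "dd (%y. f (psi y)) y v = dd f (psi y) (dd psi y v)" if "smooth_on W f" "y \<in> W'" for f :: "complex^'n => 'b::euclidean_space" and y v
  using dd_eqI[OF has_derivative_compose[OF smooth_dd[OF sm that(2)] smooth_dd[OF that(1) inW[OF that(2)]]]]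
  by simp
 have ss: "smooth_on W' (%y. s (psi y) ** matrix (dd psi y))"
  by (rule smooth_on_bilinear[OF W' bilinear_mm smc[OF smooth_s] smooth_on_matrix_derivative[OF W' sm]])
 have \<phi>exp: "\<phi> (psi y) (v y) = (\<Sum>b\<in>Basis. (v y \<bullet> b) *\<^sub>R \<phi> (psi y) b)" if "y \<in> W'" for y and v :: "complex^'n => complex^'n"
  by (rule linear_expand_Basis[OF linear_\<phi>[OF inW[OF that]]])
 \<comment> \<open>The product rule for a one-form along \<open>psi\<close>, applied to a moving
   vector; its second term is the one that will cancel by symmetry.\<close>
 have d\<phi>: "((%y. \<phi> (psi y) (u y)) has_derivative (%v. dd (%z. \<phi> z (u y)) (psi y) (dd psi y v) + \<phi> (psi y) (dd u y v))) (at y)"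
  if u: "smooth_on W' u" and y: "y \<in> W'" for u :: "complex^'n => complex^'n" and y
 proof -
  have c: "((%y. \<phi> (psi y) b) has_derivative (%v. dd (%z. \<phi> z b) (psi y) (dd psi y v))) (at y)" for b
   by (rule has_derivative_compose[OF smooth_dd[OF sm y] smooth_dd[OF smooth_\<phi> inW[OF y]]])
  have "((%y. \<Sum>b\<in>Basis. (u y \<bullet> b) *\<^sub>R \<phi> (psi y) b) has_derivative
    (%v. \<Sum>b\<in>Basis. (u y \<bullet> b) *\<^sub>R dd (%z. \<phi> z b) (psi y) (dd psi y v) + (dd u y v \<bullet> b) *\<^sub>R \<phi> (psi y) b)) (at y)"
   by (intro has_derivative_sum has_derivative_scaleR has_derivative_inner_left c smooth_dd[OF u y])
  then have 1: "((%y. \<phi> (psi y) (u y)) has_derivative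
    (%v. \<Sum>b\<in>Basis. (u y \<bullet> b) *\<^sub>R dd (%z. \<phi> z b) (psi y) (dd psi y v) + (dd u y v \<bullet> b) *\<^sub>R \<phi> (psi y) b)) (at y)"
   by (rule has_derivative_transform_within_open[OF _ W' y]) (rule \<phi>exp[symmetric])
  have "((%z. \<Sum>b\<in>Basis. (u y \<bullet> b) *\<^sub>R \<phi> z b) has_derivative (%v. \<Sum>b\<in>Basis. (u y \<bullet> b) *\<^sub>R dd (%z. \<phi> z b) (psi y) v)) (at (psi y))"
   by (intro has_derivative_sum has_derivative_scaleR_right smooth_dd[OF smooth_\<phi> inW[OF y]])
  then have "((%z. \<phi> z (u y)) has_derivative (%v. \<Sum>b\<in>Basis. (u y \<bullet> b) *\<^sub>R dd (%z. \<phi> z b) (psi y) v)) (at (psi y))"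
   by (rule has_derivative_transform_within_open[OF _ open_W inW[OF y]]) (rule linear_expand_Basis[OF linear_\<phi>, symmetric])
  from dd_eqI[OF this]
  have 2: "dd (%z. \<phi> z (u y)) (psi y) v = (\<Sum>b\<in>Basis. (u y \<bullet> b) *\<^sub>R dd (%z. \<phi> z b) (psi y) v)" for v by simp
  show ?thesis
   using 1 unfolding 2 \<phi>exp[OF y, of "%_. dd u y _"] by (simp add: sum.distrib)
 qed
 have dv: "smooth_on W' (%y. dd psi y v)" for v by (rule smooth_on_dd[OF sm])
 show ?thesis
 proof (rule bk_local.intro)
  show "smooth_on W' (%y. \<phi> (psi y) (dd psi y v))" for v
  proof -
   have "smooth_on W' (%y. \<Sum>b\<in>Basis. (dd psi y v \<bullet> b) *\<^sub>R \<phi> (psi y) b)"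
    by (intro smooth_on_sum[OF W'] smooth_on_bilinear[OF W' bilinear_scaleR] smc[OF smooth_\<phi>]
      smooth_on_linear_comp[OF W' _ dv] linearI) (simp_all add: inner_add_left)
   then show ?thesis by (rule smooth_on_cong[OF W', rotated]) (rule \<phi>exp[symmetric])
  qed
  fix y assume y: "y \<in> W'"
  note yW = inW[OF y]
  show "invertible (s (psi y) ** matrix (dd psi y))"
  proof (rule invertible_mult[OF inv_s[OF yW]])
   have "inj ((*v) (matrix (dd psi y)))" using inj[OF y] by (simp add: inj_def mw[OF y])
   then show "invertible (matrix (dd psi y))"
    using matrix_left_invertible_injective invertible_left_inverse by blast
  qed
  show "linear (%v. \<phi> (psi y) (dd psi y v))" using linear_compose[OF lin[OF y] linear_\<phi>[OF yW]] by (simp add: o_def)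
  fix v w
  have ds: "dd (%y. s (psi y) ** matrix (dd psi y)) y v *v w =
    dd s (psi y) (dd psi y v) *v dd psi y w + s (psi y) *v dd (%y. dd psi y w) y v" for v w
  proof -
   have "((%y. (s (psi y) ** matrix (dd psi y)) *v w) has_derivative
     (%v. dd (%y. s (psi y) ** matrix (dd psi y)) y v *v w)) (at y)"
    by (rule hd_linear[OF linear_mv(2) smooth_dd[OF ss y]])
   moreover have "((%y. s (psi y) *v dd psi y w) has_derivative
     (%v. s (psi y) *v dd (%y. dd psi y w) y v + dd s (psi y) (dd psi y v) *v dd psi y w)) (at y)"
    by (rule hd_bilinear[OF bilinear_mv has_derivative_compose[OF smooth_dd[OF sm y]
        smooth_dd[OF smooth_s yW]] smooth_dd[OF dv y]])
   then have "((%y. (s (psi y) ** matrix (dd psi y)) *v w) has_derivative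
     (%v. s (psi y) *v dd (%y. dd psi y w) y v + dd s (psi y) (dd psi y v) *v dd psi y w)) (at y)"
    by (rule has_derivative_transform_within_open[OF _ W' y]) (rule sw[symmetric])
   ultimately have "(%v. dd (%y. s (psi y) ** matrix (dd psi y)) y v *v w) =
     (%v. s (psi y) *v dd (%y. dd psi y w) y v + dd s (psi y) (dd psi y v) *v dd psi y w)"
    by (rule has_derivative_unique)
   from fun_cong[OF this, of v] show ?thesis by (simp only: add.commute)
  qed
  have sym: "dd (%y. dd psi y w) y v = dd (%y. dd psi y v) y w"
   by (rule dd_symmetric[OF W' sm y])
  show "dd (%y. s (psi y) ** matrix (dd psi y)) y v *v w - dd (%y. s (psi y) ** matrix (dd psi y)) y w *v v =
    - (\<phi> (psi y) (dd psi y v) *v ((s (psi y) ** matrix (dd psi y)) *v w) -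
     \<phi> (psi y) (dd psi y w) *v ((s (psi y) ** matrix (dd psi y)) *v v))"
   unfolding ds sw[OF y] sym torsion[OF yW, symmetric] by simp
  show "dd (%y. \<phi> (psi y) (dd psi y w)) y v - dd (%y. \<phi> (psi y) (dd psi y v)) y w =
    - (\<phi> (psi y) (dd psi y v) ** \<phi> (psi y) (dd psi y w) - \<phi> (psi y) (dd psi y w) ** \<phi> (psi y) (dd psi y v)) +
    bk_curv (H (psi y)) ((s (psi y) ** matrix (dd psi y)) *v v) ((s (psi y) ** matrix (dd psi y)) *v w)"
   unfolding dd_eqI[OF d\<phi>[OF dv y]] sw[OF y] sym curvature[OF yW, symmetric] by simp
 qed (simp_all add: dc smooth_H smooth_T smooth_V sw inW skew_\<phi> herm_H dH dT dV smc ss W')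
qed

section \<open>The fields \<open>Z\<^sub>k\<close> and the moduli map in a local frame\<close>

lemma mat_power_add: "mat_power a (i + j) = mat_power a i ** mat_power (a :: complex^'n^'n) j"
 by (induction i) (simp_all add: matrix_mul_lid matrix_mul_assoc)

lemma trace_commute_middle:
 fixes a :: "complex^'n^'n"
 assumes "h ** a = a ** h"
 shows "trace (a ** (p ** h)) = trace (a ** (h ** p))"
 by (metis assms matrix_mul_assoc trace_mul_sym)

lemma has_derivative_mat_power:
 fixes H :: "'a::real_normed_vector => complex^'n^'n"
 assumes H: "(H has_derivative D) (at y)"
 shows "((%y. mat_power (H y) m) has_derivative
  (%v. \<Sum>i<m. mat_power (H y) i ** D v ** mat_power (H y) (m - 1 - i))) (at y)"
proof (induction m)
 case 0
 then show ?case by simp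
next
 case (Suc m)
 have "((%y. H y ** mat_power (H y) m) has_derivative
   (%v. H y ** (\<Sum>i<m. mat_power (H y) i ** D v ** mat_power (H y) (m - 1 - i)) + D v ** mat_power (H y) m)) (at y)"
  using bounded_bilinear.FDERIV[OF iffD1[OF bilinear_conv_bounded_bilinear bilinear_mm] H Suc.IH] .
 moreover have "H y ** (\<Sum>i<m. mat_power (H y) i ** D v ** mat_power (H y) (m - 1 - i)) + D v ** mat_power (H y) m
   = (\<Sum>i<Suc m. mat_power (H y) i ** D v ** mat_power (H y) (Suc m - 1 - i))" for v
  by (simp only: sum.lessThan_Suc_shift linear_sum[OF linear_mm(1)])
   (simp add: matrix_mul_lid matrix_mul_assoc add.commute cong: sum.cong)
 ultimately show ?case by simp
qed

lemma has_derivative_trace_power: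
 fixes H :: "'a::real_normed_vector => complex^'n^'n"
 assumes H: "(H has_derivative D) (at y)"
 shows "((%y. trace (mat_power (H y) m)) has_derivative (%v. of_nat m * trace (mat_power (H y) (m - 1) ** D v))) (at y)"
proof -
 have "((%y. trace (mat_power (H y) m)) has_derivative
  (%v. trace (\<Sum>i<m. mat_power (H y) i ** D v ** mat_power (H y) (m - 1 - i)))) (at y)"
  by (rule bounded_linear.has_derivative[OF iffD1[OF linear_conv_bounded_linear linear_trace] has_derivative_mat_power[OF H]])
 moreover have "trace (\<Sum>i<m. mat_power (H y) i ** D v ** mat_power (H y) (m - 1 - i)) = of_nat m * trace (mat_power (H y) (m - 1) ** D v)" for v
 proof -
  have "trace (mat_power (H y) i ** D v ** mat_power (H y) (m - 1 - i)) = trace (mat_power (H y) (m - 1) ** D v)" if "i < m" for i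
  proof -
   have "trace (mat_power (H y) i ** D v ** mat_power (H y) (m - 1 - i)) = trace (mat_power (H y) (m - 1 - i) ** (mat_power (H y) i ** D v))"
    by (rule trace_mul_sym)
   moreover have "m - 1 - i + i = m - 1" using that by simp
   ultimately show ?thesis using mat_power_add[of "H y" "m - 1 - i" i] by (simp add: matrix_mul_assoc)
  qed
  then show ?thesis by (simp add: linear_sum[OF linear_trace])
 qed
 ultimately show ?thesis by simp
qed

lemma Newton_sum:
 fixes a :: "complex^'n^'n"
 assumes "1 \<le> k" "k \<le> CARD('n)"
 shows "of_nat k * Ecoef a k = - (\<Sum>j<k. Ecoef a j * trace (mat_power a (k - j)))"
proof -
 have "trace (a ** Smat a (k - 1)) = (\<Sum>j\<le>k - 1. trace (a ** (mat (Ecoef a j) ** mat_power a (k - 1 - j))))"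
  by (simp add: Smat_sum linear_sum[OF linear_mm(1)] linear_sum[OF linear_trace])
 also have "\<dots> = (\<Sum>j<k. Ecoef a j * trace (mat_power a (k - j)))"
 proof (rule sum.cong)
  show "{..k - 1} = {..<k}" using assms by auto
  fix j assume "j \<in> {..<k}"
  then have s: "k - j = Suc (k - 1 - j)" by auto
  have "a ** (mat (Ecoef a j) ** mat_power a (k - 1 - j)) = mat (Ecoef a j) ** mat_power a (k - j)"
   by (simp add: s mat_left_commute)
  then show "trace (a ** (mat (Ecoef a j) ** mat_power a (k - 1 - j))) = Ecoef a j * trace (mat_power a (k - j))"
   by (simp add: trace_simps)
 qed
 finally show ?thesis using Newton_identity[OF assms] by simp
qed

text \<open>Eigenvalues need not be differentiable functions, so Newton's identities are
  differentiated instead. Substituting the induction hypothesis and regrouping the double sum brings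
  Newton's identities in once more.\<close>

lemma has_derivative_Ecoef:
 fixes H :: "'a::real_normed_vector => complex^'n^'n"
 assumes H: "(H has_derivative D) (at y)"
 shows "k \<le> CARD('n) ==> ((%y. Ecoef (H y) k) has_derivative (%v. if k = 0 then 0 else - trace (Smat (H y) (k - 1) ** D v))) (at y)"
proof (induction k rule: less_induct)
 case (less k)
 show ?case
 proof (cases "k = 0")
  case True
  then show ?thesis by (simp add: Ecoef_0)
 next
  case False
  let ?E = "%j. Ecoef (H y) j" and ?P = "%j. mat_power (H y) j"
  let ?p = "%j. trace (mat_power (H y) j)"
  let ?dE = "%j v. if j = 0 then 0 else - trace (Smat (H y) (j - 1) ** D v)"
  have eq: "Ecoef h k = (\<Sum>j<k. Ecoef h j * trace (mat_power h (k - j))) * (- 1 / of_nat k)" for h :: "complex^'n^'n"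
   using Newton_sum[of k h] False less.prems by (simp add: field_simps)
  have "((%y. (\<Sum>j<k. Ecoef (H y) j * trace (mat_power (H y) (k - j))) * (- 1 / of_nat k)) has_derivative
   (%v. (\<Sum>j<k. ?E j * (of_nat (k - j) * trace (?P (k - j - 1) ** D v)) + ?dE j v * ?p (k - j)) * (- 1 / of_nat k))) (at y)"
   by (intro has_derivative_mult_left has_derivative_sum has_derivative_mult has_derivative_trace_power[OF H] less.IH)
    (use less.prems in auto)
  then have 1: "((%y. Ecoef (H y) k) has_derivative
   (%v. (\<Sum>j<k. ?E j * (of_nat (k - j) * trace (?P (k - j - 1) ** D v)) + ?dE j v * ?p (k - j)) * (- 1 / of_nat k))) (at y)"
   unfolding eq .
  have "(\<Sum>j<k. ?E j * (of_nat (k - j) * trace (?P (k - j - 1) ** D v)) + ?dE j v * ?p (k - j)) = of_nat k * trace (Smat (H y) (k - 1) ** D v)" for v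
  proof -
   let ?t = "%j. trace (?P j ** D v)"
   have tS: "trace (Smat (H y) m ** D v) = (\<Sum>i<Suc m. ?E i * ?t (m - i))" for m
   proof -
    have l: "linear (%a. trace (a ** D v))"
     using linear_compose[OF _ linear_trace, of "%a. a ** D v"] bilinear_mm unfolding bilinear_def o_def by blast
    show ?thesis
     by (simp only: Smat_sum linear_sum[OF l] lessThan_Suc_atMost matrix_mul_assoc[symmetric] trace_simps)
   qed
   have "(\<Sum>j<k. ?dE j v * ?p (k - j)) = (\<Sum>j\<in>{1..<k}. - (\<Sum>i<j. ?E i * ?t (j - 1 - i)) * ?p (k - j))"
   proof -
    have "(\<Sum>j<k. ?dE j v * ?p (k - j)) = (\<Sum>j\<in>{1..<k}. ?dE j v * ?p (k - j))"
     by (rule sum.mono_neutral_right) auto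
    also have "\<dots> = (\<Sum>j\<in>{1..<k}. - (\<Sum>i<j. ?E i * ?t (j - 1 - i)) * ?p (k - j))"
     by (intro sum.cong refl) (auto simp: tS)
    finally show ?thesis .
   qed
   also have "\<dots> = - (\<Sum>j\<in>{1..<k}. \<Sum>i<j. ?E i * ?t (j - 1 - i) * ?p (k - j))"
    by (simp add: sum_negf sum_distrib_right)
   also have "(\<Sum>j\<in>{1..<k}. \<Sum>i<j. ?E i * ?t (j - 1 - i) * ?p (k - j)) = (\<Sum>j\<in>{1..<k}. \<Sum>i<j. ?E i * ?t (k - 1 - j) * ?p (j - i))"
   proof -
    \<comment> \<open>For fixed i the involution \<open>j \<mapsto> i + k - j\<close> exchanges the
      gaps \<open>j - i\<close> and \<open>k - j\<close>. Afterwards the inner sum over i is that of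
      Newton's identity for index j.\<close>
    have "(\<Sum>(j, i)\<in>Sigma {1..<k} (%j. {..<j}). ?E i * ?t (j - 1 - i) * ?p (k - j)) =
     (\<Sum>(j, i)\<in>Sigma {1..<k} (%j. {..<j}). ?E i * ?t (k - 1 - j) * ?p (j - i))"
     by (rule sum.reindex_bij_witness[where i = "%(j, i). (i + k - j, i)" and j = "%(j, i). (i + k - j, i)"])
      (auto simp: algebra_simps)
    then show ?thesis by (simp add: sum.Sigma)
   qed
   also have "\<dots> = (\<Sum>j\<in>{1..<k}. - (of_nat j * ?E j) * ?t (k - 1 - j))"
    using less.prems by (intro sum.cong refl) (simp add: Newton_sum sum_distrib_right sum_distrib_left mult_ac)
   also have "\<dots> = (\<Sum>j<k. - (of_nat j * ?E j) * ?t (k - 1 - j))"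
    by (rule sum.mono_neutral_left) auto
   finally have "(\<Sum>j<k. ?dE j v * ?p (k - j)) = (\<Sum>j<k. of_nat j * ?E j * ?t (k - 1 - j))"
    by (simp add: sum_negf)
   then have "(\<Sum>j<k. ?E j * (of_nat (k - j) * ?t (k - j - 1)) + ?dE j v * ?p (k - j)) =
    (\<Sum>j<k. ?E j * (of_nat (k - j) * ?t (k - j - 1)) + of_nat j * ?E j * ?t (k - 1 - j))"
    by (simp add: sum.distrib)
   also have "\<dots> = (\<Sum>j<k. of_nat k * (?E j * ?t (k - 1 - j)))"
    by (intro sum.cong refl) (auto simp: of_nat_diff algebra_simps)
   also have "\<dots> = of_nat k * trace (Smat (H y) (k - 1) ** D v)"
    using False by (simp add: tS sum_distrib_left)
   finally show ?thesis .
  qed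
  then have "(%v. (\<Sum>j<k. ?E j * (of_nat (k - j) * trace (?P (k - j - 1) ** D v)) + ?dE j v * ?p (k - j)) * (- 1 / of_nat k))
    = (%v. if k = 0 then 0 else - trace (Smat (H y) (k - 1) ** D v))"
   using False by (simp add: fun_eq_iff)
  with 1 show ?thesis by simp
 qed
qed

definition Qmat0 :: "complex^'n^'n => complex => complex^'n^'n" where
 "Qmat0 h x = mat_power h 2 + mat (trace h) ** h + mat x"

text \<open>The coefficient of \<omega> in the covariant derivative of \<open>Smat h k *v t\<close>,
  with \<open>x\<close> in the place of V. The step differentiates
  \<open>h *v (Smat h k *v t)\<close> plus a coefficient times \<open>t\<close>; one of the terms
  from the derivative of \<open>h\<close> cancels against one from the derivative of the
  coefficient, leaving the non-Hermitian \<open>houter t (Smat h k *v t)\<close>.\<close>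

primrec Qmat :: "complex^'n^'n => complex^'n => complex => nat => complex^'n^'n" where
 "Qmat h t x 0 = Qmat0 h x"
| "Qmat h t x (Suc k) = mat (hdot t (Smat h k *v t)) - houter t (Smat h k *v t) + h ** Qmat h t x k + mat (Ecoef h (Suc k)) ** Qmat0 h x"

text \<open>The commutator identity is what makes the recursion for the \<open>Qmat\<close> preserve Hermitian matrices.\<close>
lemma Qmat_hermitian:
 fixes h :: "complex^'n^'n"
 assumes h: "adj h = h" and x: "cnj x = x"
 shows "k \<le> CARD('n) ==> adj (Qmat h t x k) = Qmat h t x k \<and>
  h ** Qmat h t x k - Qmat h t x k ** h = houter t (Smat h k *v t) - houter (Smat h k *v t) t"
proof (induction k)
 case 0
 have tr: "cnj (trace h) = trace h" using trace_adjoint[of h] h by simp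
 have p2: "mat_power h 2 = h ** h" by (simp add: numeral_2_eq_2 matrix_mul_rid)
 have "h ** Qmat h t x 0 = Qmat h t x 0 ** h"
  by (simp add: Qmat0_def p2 mat_simps matrix_mul_assoc[symmetric] mat_left_commute mat_commute)
 moreover have "adj (Qmat h t x 0) = Qmat h t x 0"
  by (simp add: Qmat0_def p2 adjoint_simps adjoint_matrix_mult adjoint_matrix_mat h tr x mat_commute)
 ultimately show ?case by (simp add: matrix_vector_mul_lid)
next
 case (Suc k)
 let ?Q = "Qmat h t x k" and ?R = "Qmat0 h x" and ?y = "Smat h k *v t"
 have IH: "adj ?Q = ?Q" "h ** ?Q - ?Q ** h = houter t ?y - houter ?y t" using Suc by auto
 have tr: "cnj (trace h) = trace h" using trace_adjoint[of h] h by simp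
 have p2: "mat_power h 2 = h ** h" by (simp add: numeral_2_eq_2 matrix_mul_rid)
 have c0: "h ** ?R = ?R ** h"
  by (simp add: Qmat0_def p2 mat_simps matrix_mul_assoc[symmetric] mat_left_commute mat_commute)
 have a0: "adj ?R = ?R"
  by (simp add: Qmat0_def p2 adjoint_simps adjoint_matrix_mult adjoint_matrix_mat h tr x mat_commute)
 have b: "cnj (hdot t ?y) = hdot t ?y" using hdot_matrix[of "Smat h k" t t] Smat_adjoint[OF h, of k] Suc.prems by (simp add: hdot_cnj)
 have e: "cnj (Ecoef h (Suc k)) = Ecoef h (Suc k)" by (rule Ecoef_real[OF h Suc.prems])
 have Qs: "Qmat h t x (Suc k) = mat (hdot t ?y) - houter t ?y + h ** ?Q + mat (Ecoef h (Suc k)) ** ?R" by simp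
 have Sy: "Smat h (Suc k) *v t = h *v ?y + Ecoef h (Suc k) *s t"
  by (simp add: mat_simps matrix_vector_mul_assoc[symmetric] mat_vec_scale)
 have "adj (Qmat h t x (Suc k)) = mat (hdot t ?y) - houter ?y t + ?Q ** h + ?R ** mat (Ecoef h (Suc k))"
  unfolding Qs adjoint_simps adjoint_matrix_mult adjoint_matrix_mat adjoint_houter b e a0 IH(1) h by simp
 also have "\<dots> = Qmat h t x (Suc k)"
  unfolding Qs using IH(2) by (simp add: mat_commute[of "Ecoef h (Suc k)" ?R] algebra_simps)
 finally have 1: "adj (Qmat h t x (Suc k)) = Qmat h t x (Suc k)" .
 have "h ** Qmat h t x (Suc k) - Qmat h t x (Suc k) ** h =
   - houter (h *v t) ?y + houter t (h *v ?y) + h ** (h ** ?Q - ?Q ** h)"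
  unfolding Qs mat_simps mat_left_commute matrix_mul_assoc[symmetric] c0 mat_commute[of _ h] matrix_houter houter_matrix h
  by simp
 also have "\<dots> = houter t (h *v ?y) - houter (h *v ?y) t"
  unfolding IH(2) by (simp add: mat_simps matrix_houter)
 also have "\<dots> = houter t (Smat h (Suc k) *v t) - houter (Smat h (Suc k) *v t) t"
  unfolding Sy by (simp add: houter_def vec_eq_iff e algebra_simps)
 finally show ?case using 1 by blast
qed

text \<open>Vanishing at \<open>y\<close> of the Lie derivative of the form \<open>h\<close> along
  \<open>Z\<close>, in coordinates.\<close>

definition lie_zero :: "(complex^'n => complex^'n => complex^'n => complex) => (complex^'n => complex^'n) => complex^'n => bool" where
 "lie_zero h Z y \<longleftrightarrow> (\<forall>v w. dd (%y. h y v w) y (Z y) + h y (dd Z y v) w + h y v (dd Z y w) = 0)"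

section \<open>The fields in a frame and the Lie derivative of the metric\<close>

context bk_local
begin

lemma dH_has: "y \<in> W ==> (H has_derivative dd H y) (at y)"
 and dT_has: "y \<in> W ==> (T has_derivative dd T y) (at y)"
 and ds_has: "y \<in> W ==> (s has_derivative dd s y) (at y)"
 by (simp_all add: smooth_dd[OF smooth_H] smooth_dd[OF smooth_T] smooth_dd[OF smooth_s])

lemma smooth_mat_power: "smooth_on W (%y. mat_power (H y) m)"
proof (induction m)
 case (Suc m)
 show ?case using smooth_on_bilinear[OF open_W bilinear_mm smooth_H Suc] by simp
qed (simp add: smooth_on_const)

lemma smooth_trace_power: "smooth_on W (%y. trace (mat_power (H y) m))"
 by (rule smooth_on_linear_comp[OF open_W linear_trace smooth_mat_power])

lemma smooth_Ecoef: "k \<le> CARD('n) ==> smooth_on W (%y. Ecoef (H y) k)"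
proof (induction k rule: less_induct)
 case (less k)
 show ?case
 proof (cases "k = 0")
  case True
  then show ?thesis by (simp add: Ecoef_0 smooth_on_const)
 next
  case False
  have eq: "Ecoef h k = (\<Sum>j<k. Ecoef h j * trace (mat_power h (k - j))) * (- 1 / of_nat k)" for h :: "complex^'n^'n"
   using Newton_sum[of k h] False less.prems by (simp add: field_simps)
  show ?thesis unfolding eq
   by (intro smooth_on_bilinear[OF open_W bilinear_mult_complex] smooth_on_sum[OF open_W] smooth_on_const
     smooth_trace_power less.IH) (use less.prems in auto)
 qed
qed

lemma smooth_Smat: "k \<le> CARD('n) ==> smooth_on W (%y. Smat (H y) k)"
proof (induction k)
 case (Suc k)
 show ?case unfolding Smat.simps
  by (intro smooth_on_add[OF open_W] smooth_on_bilinear[OF open_W bilinear_mm] smooth_H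
    smooth_on_linear_comp[OF open_W linear_mat] smooth_Ecoef Suc.IH) (use Suc.prems in auto)
qed (simp add: smooth_on_const)

lemma smooth_ST: "k \<le> CARD('n) ==> smooth_on W (%y. Smat (H y) k *v T y)"
 by (rule smooth_on_bilinear[OF open_W bilinear_mv smooth_Smat smooth_T])

text \<open>Since \<open>Smat\<close> commutes with H, the commutator of H with \<phi> has zero
  trace against it, so no connection term appears in the derivative of the next coefficient; the
  remaining connection terms combine to a single one.\<close>

lemma derivative_ST:
 assumes y: "y \<in> W"
 shows "k \<le> CARD('n) ==> dd (%y. Smat (H y) k *v T y) y v =
  - (\<phi> y v *v (Smat (H y) k *v T y)) + Qmat (H y) (T y) (of_real (V y)) k *v (s y *v v)"
proof (induction k arbitrary: v)
 case 0
 then show ?case using dT[OF y, of v] by (simp add: matrix_vector_mul_lid Qmat0_def)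
next
 case (Suc k)
 let ?Y = "%y. Smat (H y) k *v T y" and ?h = "H y" and ?t = "T y" and ?p = "\<phi> y v" and ?o = "s y *v v"
 let ?S = "Smat (H y) k" and ?e = "Ecoef (H y) (Suc k)" and ?Q = "Qmat (H y) (T y) (of_real (V y)) k" and ?R = "Qmat0 (H y) (of_real (V y))"
 have kn: "k \<le> CARD('n)" using Suc.prems by simp
 have eq: "Smat (H y) (Suc k) *v T y = H y *v (Smat (H y) k *v T y) + Ecoef (H y) (Suc k) *s T y" for y
  by (simp add: mat_simps matrix_vector_mul_assoc[symmetric] mat_vec_scale)
 have dE: "((%y. Ecoef (H y) (Suc k)) has_derivative (%v. - trace (?S ** dd H y v))) (at y)"
  using has_derivative_Ecoef[OF dH_has[OF y] Suc.prems] by simp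
 have dY: "(?Y has_derivative dd ?Y y) (at y)" by (rule smooth_dd[OF smooth_ST[OF kn] y])
 have "((%y. H y *v ?Y y + Ecoef (H y) (Suc k) *s T y) has_derivative
   (%v. (H y *v dd ?Y y v + dd H y v *v ?Y y) + (?e *s dd T y v + (- trace (?S ** dd H y v)) *s T y))) (at y)"
  by (intro has_derivative_add hd_bilinear[OF bilinear_mv]
    hd_bilinear[OF bilinear_vector_smult] dY dH_has[OF y] dT_has[OF y] dE)
 from fun_cong[OF dd_eqI[OF this], of v]
 have 1: "dd (%y. Smat (H y) (Suc k) *v T y) y v =
   (?h *v dd ?Y y v + dd H y v *v ?Y y) + (?e *s dd T y v + (- trace (?S ** dd H y v)) *s ?t)"
  by (simp only: eq)
 have Sa: "adj ?S = ?S" by (rule Smat_adjoint[OF herm_H[OF y] kn])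
 note tr0 = trace_commute_middle[OF Smat_commute[of ?h k], of ?p]
 have tr: "trace (?S ** dd H y v) = hdot ?o (?S *v ?t) + hdot (?S *v ?t) ?o"
  unfolding dH[OF y]
  by (simp add: mat_simps trace_simps tr0 matrix_houter trace_houter)
   (simp add: hdot_matrix Sa)
 have ex: "dd H y v *v ?Y y = - (?p *v (?h *v ?Y y)) + ?h *v (?p *v ?Y y) + hdot ?o (?Y y) *s ?t + hdot ?t (?Y y) *s ?o"
  unfolding dH[OF y] by (simp add: mat_simps matrix_vector_mul_assoc[symmetric] houter_vec)
 have et: "dd T y v = - (?p *v ?t) + ?R *v ?o" using dT[OF y, of v] by (simp add: Qmat0_def)
 show ?case
  unfolding 1 unfolding tr ex et Suc.IH[OF kn] eq
  by (simp add: mat_simps matrix_vector_mul_assoc[symmetric] mat_vec_scale houter_vec mv_smult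
    vec.scale_right_distrib vec.scale_right_diff_distrib vec.scale_left_distrib del: Qmat.simps(1))
qed

definition zc :: "nat => complex^'n => complex^'n" where
 "zc k y = (2 * \<i> * (-1) ^ k) *s (Smat (H y) k *v T y)"

lemma smooth_zc: "k \<le> CARD('n) ==> smooth_on W (zc k)"
 unfolding zc_def by (intro smooth_on_bilinear[OF open_W bilinear_vector_smult] smooth_on_const smooth_ST)

text \<open>The factor \<open>2 * \<i>\<close> turns the Hermitian matrix \<open>Qmat\<close> into a
  skew-Hermitian one.\<close>

lemma derivative_zc:
 assumes y: "y \<in> W" and k: "k \<le> CARD('n)"
 shows "\<exists>a. adj a = - a \<and> (\<forall>v. dd (zc k) y v = - (\<phi> y v *v zc k y) + a *v (s y *v v))"
proof (intro exI conjI allI)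
 let ?c = "2 * \<i> * (-1) ^ k :: complex" and ?Q = "Qmat (H y) (T y) (of_real (V y)) k"
 have Q: "adj ?Q = ?Q" using Qmat_hermitian[OF herm_H[OF y] _ k] by simp
 have "cnj ?c = - ?c" by (cases "even k") auto
 then show "adj (mat ?c ** ?Q) = - (mat ?c ** ?Q)"
  by (simp only: adjoint_matrix_mult adjoint_matrix_mat Q) (simp add: mat_mult_scale vec_eq_iff)
 fix v
 have "dd (zc k) y v = ?c *s dd (%y. Smat (H y) k *v T y) y v"
  unfolding zc_def
  using dd_eqI[OF hd_linear[OF linear_vector_smult(1) smooth_dd[OF smooth_ST[OF k] y]]] by simp
 then show "dd (zc k) y v = - (\<phi> y v *v zc k y) + (mat ?c ** ?Q) *v (s y *v v)"
  unfolding derivative_ST[OF y k]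
  by (simp add: zc_def matrix_vector_mul_assoc[symmetric] mat_vec_scale mv_smult vec.scale_right_distrib)
qed

text \<open>Combining \<open>torsion\<close> with the derivative of \<open>zc k\<close> shows that
  the Lie derivative of the coframe \<open>s\<close> along the field is the coframe multiplied from
  the left by \<open>a - \<phi> y Z\<close>. This matrix is skew-Hermitian, so the metric defined by
  \<open>s\<close> is preserved.\<close>

lemma zc_lie_zero:
 assumes y: "y \<in> W" and k: "k \<le> CARD('n)"
 shows "lie_zero (%y v w. hdot (s y *v v) (s y *v w)) (%y. matrix_inv (s y) *v zc k y) y"
proof -
 let ?Z = "%y. matrix_inv (s y) *v zc k y"
 obtain a where a: "adj a = - a" "\<And>v. dd (zc k) y v = - (\<phi> y v *v zc k y) + a *v (s y *v v)"
  using derivative_zc[OF y k] by blast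
 have sZ: "s y *v ?Z y = zc k y" if "y \<in> W" for y
  using matrix_inv_right[OF inv_s[OF that]] by (simp add: matrix_vector_mul_assoc)
 have smZ: "smooth_on W ?Z"
  by (intro smooth_on_bilinear[OF open_W bilinear_mv] smooth_on_matrix_inv open_W smooth_s inv_s smooth_zc k)
 note dZ = smooth_dd[OF smZ y]
 have eq: "E + A = D - F" if "A + B = - C + D" "E - B = - (F - C)" for A B C D E F :: "complex^'n"
 proof -
  have "E + A = (E - B) + (A + B)" by simp
  then show ?thesis unfolding that by simp
 qed
 have key: "dd s y (?Z y) *v v + s y *v dd ?Z y v = (a - \<phi> y (?Z y)) *v (s y *v v)" for v
 proof -
  have "((%y. s y *v ?Z y) has_derivative (%v. s y *v dd ?Z y v + dd s y v *v ?Z y)) (at y)"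
   by (rule hd_bilinear[OF bilinear_mv ds_has[OF y] dZ])
  then have "(zc k has_derivative (%v. s y *v dd ?Z y v + dd s y v *v ?Z y)) (at y)"
   by (rule has_derivative_transform_within_open[OF _ open_W y]) (rule sZ)
  from fun_cong[OF dd_eqI[OF this], of v]
  have "s y *v dd ?Z y v + dd s y v *v ?Z y = - (\<phi> y v *v zc k y) + a *v (s y *v v)" by (simp add: a(2))
  moreover have "dd s y (?Z y) *v v - dd s y v *v ?Z y = - (\<phi> y (?Z y) *v (s y *v v) - \<phi> y v *v zc k y)"
   using torsion[OF y, of "?Z y" v] unfolding sZ[OF y] .
  ultimately show ?thesis unfolding mat_simps(9) by (rule eq)
 qed
 show ?thesis
  unfolding lie_zero_def
 proof (intro allI)
  fix v w
  have sv: "((%y. s y *v v) has_derivative (%u. dd s y u *v v)) (at y)" for v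
  proof -
   have "linear (%m :: complex^'n^'n. m *v v)" by (rule linear_mv)
   from hd_linear[OF this ds_has[OF y]] show ?thesis .
  qed
  have d: "dd (%y. hdot (s y *v v) (s y *v w)) y u = hdot (s y *v v) (dd s y u *v w) + hdot (dd s y u *v v) (s y *v w)" for u
   using dd_eqI[OF hd_bilinear[OF bilinear_hdot sv sv]] by simp
  let ?b = "a - \<phi> y (?Z y)"
  have b: "adj ?b = - ?b" by (simp add: adjoint_simps a(1) skew_\<phi>[OF y])
  have "hdot (?b *v (s y *v v)) (s y *v w) = - hdot (s y *v v) (?b *v (s y *v w))"
   unfolding hdot_matrix[of ?b] b mat_simps(11) hdot_simps ..
  then have "hdot (?b *v (s y *v v)) (s y *v w) + hdot (s y *v v) (?b *v (s y *v w)) = 0" by simp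
  then show "dd (%y. hdot (s y *v v) (s y *v w)) y (?Z y) + hdot (s y *v dd ?Z y v) (s y *v w) + hdot (s y *v v) (s y *v dd ?Z y w) = 0"
   unfolding d key[symmetric] hdot_simps by (simp add: add_ac)
 qed
qed

section \<open>The differentials of the moduli functions\<close>

definition xc :: "nat => complex^'n => complex^'n" where
 "xc j y = mat_power (H y) j *v T y"

lemma derivative_A:
 assumes y: "y \<in> W"
 shows "((%y. Re (trace (mat_power (H y) (Suc m)))) has_derivative (%v. 2 * real (Suc m) * Re (hdot (xc m y) (s y *v v)))) (at y)"
proof -
 let ?P = "mat_power (H y) m"
 have P: "adj ?P = ?P" by (simp add: adjoint_mat_power herm_H[OF y])
 have "((%y. Re (trace (mat_power (H y) (Suc m)))) has_derivative (%v. Re (of_nat (Suc m) * trace (?P ** dd H y v)))) (at y)"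
  using hd_linear[OF linear_Re has_derivative_trace_power[OF dH_has[OF y], of "Suc m"]] by simp
 moreover have "Re (of_nat (Suc m) * trace (?P ** dd H y v)) = 2 * real (Suc m) * Re (hdot (xc m y) (s y *v v))" for v
 proof -
  let ?p = "\<phi> y v" and ?h = "H y"
  note tr0 = trace_commute_middle[OF mat_power_commute[of ?h m], of ?p]
  have "trace (?P ** dd H y v) = hdot (s y *v v) (xc m y) + hdot (xc m y) (s y *v v)"
   unfolding dH[OF y] xc_def
   by (simp add: mat_simps trace_simps tr0 matrix_houter trace_houter) (simp add: hdot_matrix P)
  moreover have "Re (hdot (s y *v v) (xc m y)) = Re (hdot (xc m y) (s y *v v))" by (simp add: Re_hdot inner_commute)
  ultimately show ?thesis by (simp add: algebra_simps flip: of_nat_Suc)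
 qed
 ultimately show ?thesis by simp
qed

lemma trace_H_real: "y \<in> W ==> trace (H y) = of_real (Re (trace (H y)))"
 using trace_adjoint[of "H y"] herm_H[of y] by (simp add: complex_eq_iff)

lemma derivative_V: "y \<in> W ==> dd V y v = 2 * Re (trace (H y)) * Re (hdot (xc 0 y) (s y *v v)) + 2 * Re (hdot (xc 1 y) (s y *v v))"
proof -
 assume y: "y \<in> W"
 have "dd V y v = Re (trace (H y) * (hdot (T y) (s y *v v) + hdot (s y *v v) (T y)) + (hdot (T y) (H y *v (s y *v v)) + hdot (s y *v v) (H y *v T y)))"
  using arg_cong[OF dV[OF y, of v], of Re] by simp
 also have "\<dots> = Re (trace (H y)) * Re (hdot (T y) (s y *v v) + hdot (s y *v v) (T y)) + Re (hdot (T y) (H y *v (s y *v v)) + hdot (s y *v v) (H y *v T y))"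
  by (subst trace_H_real[OF y]) simp
 also have "hdot (T y) (H y *v (s y *v v)) = hdot (H y *v T y) (s y *v v)" by (simp only: hdot_matrix herm_H[OF y])
 finally show ?thesis
  by (simp add: xc_def matrix_vector_mul_lid matrix_mul_rid) (simp add: Re_hdot inner_commute algebra_simps)
qed

lemma smooth_xc: "smooth_on W (xc j)"
 unfolding xc_def by (rule smooth_on_bilinear[OF open_W bilinear_mv smooth_mat_power smooth_T])

lemma xc_Suc: "xc (Suc j) y = H y *v xc j y"
 by (simp add: xc_def matrix_vector_mul_assoc)

lemma xc_hdot: "y \<in> W ==> hdot (xc i y) (xc j y) = hdot (T y) (xc (i + j) y)"
 by (simp add: xc_def hdot_matrix adjoint_mat_power herm_H mat_power_add matrix_vector_mul_assoc)

lemma hdot_T_xc_real: "y \<in> W ==> Im (hdot (T y) (xc j y)) = 0"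
 using arg_cong[OF hdot_cnj[of "T y" "xc j y"], of Im]
 by (simp add: xc_def hdot_matrix adjoint_mat_power herm_H)

text \<open>Passing from \<open>xc j\<close> to \<open>xc (Suc j)\<close> moves one factor H to the
  other side of the product, hence the induction for all \<open>i\<close> at once. The new terms
  from dH are products of a number \<open>hdot (T y) (xc i y)\<close>, which is real, and a number
  whose real part is zero by \<open>N\<close>.\<close>

lemma derivative_xc:
 assumes y: "y \<in> W" and N: "\<And>j. Re (hdot (xc j y) (s y *v v)) = 0"
 shows "Re (hdot (xc i y) (dd (xc j) y v + \<phi> y v *v xc j y)) = 0"
proof (induction j arbitrary: i)
 case 0
 have x0: "xc 0 = T" by (simp add: xc_def fun_eq_iff matrix_vector_mul_lid)
 let ?o = "s y *v v"
 have "dd (xc 0) y v + \<phi> y v *v xc 0 y = H y *v (H y *v ?o) + trace (H y) *s (H y *v ?o) + of_real (V y) *s ?o"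
  unfolding x0 dT[OF y]
  by (simp add: numeral_2_eq_2 matrix_mul_rid mat_simps matrix_vector_mul_assoc[symmetric] mat_vec_scale)
 then have "hdot (xc i y) (dd (xc 0) y v + \<phi> y v *v xc 0 y) =
   hdot (xc (Suc (Suc i)) y) ?o + trace (H y) * hdot (xc (Suc i) y) ?o + of_real (V y) * hdot (xc i y) ?o"
  by (simp only: hdot_simps xc_Suc hdot_matrix herm_H[OF y])
 also have "Re \<dots> = 0"
  by (subst trace_H_real[OF y]) (simp add: N)
 finally show ?case .
next
 case (Suc j)
 let ?o = "s y *v v" and ?p = "\<phi> y v"
 have "((%y. H y *v xc j y) has_derivative (%v. H y *v dd (xc j) y v + dd H y v *v xc j y)) (at y)"
  by (rule hd_bilinear[OF bilinear_mv dH_has[OF y] smooth_dd[OF smooth_xc y]])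
 from fun_cong[OF dd_eqI[OF this], of v]
 have "dd (xc (Suc j)) y v = H y *v dd (xc j) y v + dd H y v *v xc j y"
  by (simp add: xc_Suc[abs_def])
 then have "dd (xc (Suc j)) y v + ?p *v xc (Suc j) y = H y *v (dd (xc j) y v + ?p *v xc j y) + hdot ?o (xc j y) *s T y + hdot (T y) (xc j y) *s ?o"
  unfolding dH[OF y] by (simp add: xc_Suc mat_simps matrix_vector_mul_assoc[symmetric] houter_vec)
 then have "hdot (xc i y) (dd (xc (Suc j)) y v + ?p *v xc (Suc j) y) =
   hdot (xc (Suc i) y) (dd (xc j) y v + ?p *v xc j y) + hdot ?o (xc j y) * hdot (xc i y) (T y) + hdot (T y) (xc j y) * hdot (xc i y) ?o"
  by (simp add: hdot_simps xc_Suc hdot_matrix[of "H y"] herm_H[OF y] mat_simps(8))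
 moreover have "Re (hdot ?o (xc j y)) = 0" using N[of j] by (simp add: Re_hdot inner_commute)
 moreover have "Im (hdot (xc i y) (T y)) = 0"
  using hdot_T_xc_real[OF y, of i] arg_cong[OF hdot_cnj[of "T y" "xc i y"], of Im] by simp
 ultimately show ?case using Suc[of "Suc i"] hdot_T_xc_real[OF y, of j] N[of i] by simp
qed

text \<open>The connection terms cancel by skewness, so both factors may be differentiated
  covariantly and \<open>derivative_xc\<close> applies to each.\<close>

lemma derivative_B:
 assumes y: "y \<in> W" and N: "\<And>j. Re (hdot (xc j y) (s y *v v)) = 0"
 shows "dd (%y. Re (hdot (T y) (xc j y))) y v = 0"
proof -
 let ?p = "\<phi> y v"
 have x0: "xc 0 = T" by (simp add: xc_def fun_eq_iff matrix_vector_mul_lid)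
 have "((%y. Re (hdot (T y) (xc j y))) has_derivative (%v. Re (hdot (T y) (dd (xc j) y v) + hdot (dd T y v) (xc j y)))) (at y)"
  by (rule hd_linear[OF linear_Re hd_bilinear[OF bilinear_hdot dT_has[OF y] smooth_dd[OF smooth_xc y]]])
 from fun_cong[OF dd_eqI[OF this], of v]
 have "dd (%y. Re (hdot (T y) (xc j y))) y v = Re (hdot (T y) (dd (xc j) y v) + hdot (dd T y v) (xc j y))" .
 also have "hdot (T y) (dd (xc j) y v) + hdot (dd T y v) (xc j y) =
  hdot (T y) (dd (xc j) y v + ?p *v xc j y) + hdot (dd T y v + ?p *v T y) (xc j y)"
  by (simp add: hdot_simps hdot_matrix[of ?p] skew_\<phi>[OF y] mat_simps)
 also have "Re \<dots> = Re (hdot (xc 0 y) (dd (xc j) y v + ?p *v xc j y)) + Re (hdot (xc j y) (dd (xc 0) y v + ?p *v xc 0 y))"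
  by (simp add: x0 Re_hdot inner_commute)
 finally show ?thesis by (simp add: derivative_xc[OF y N])
qed

lemma Ecoef_Re: "y \<in> W ==> k \<le> CARD('n) ==> Ecoef (H y) k = of_real (Re (Ecoef (H y) k))"
 using Ecoef_real[OF herm_H, of y k] by (simp add: complex_eq_iff)

lemma ST_xc: "Smat (H y) k *v T y = (\<Sum>j\<le>k. Ecoef (H y) j *s xc (k - j) y)"
proof -
 show ?thesis by (simp add: Smat_sum linear_sum[OF linear_mv(2)] xc_def matrix_vector_mul_assoc[symmetric] mat_vec_scale)
qed

lemma hdot_ST:
 assumes y: "y \<in> W" and k: "k \<le> CARD('n)"
 shows "Re (hdot (Smat (H y) k *v T y) w) = (\<Sum>j\<le>k. Re (Ecoef (H y) j) * Re (hdot (xc (k - j) y) w))"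
proof -
 have "hdot (\<Sum>j\<le>k. Ecoef (H y) j *s xc (k - j) y) w = (\<Sum>j\<le>k. hdot (Ecoef (H y) j *s xc (k - j) y) w)"
 proof -
  have "linear (%v. hdot v w)" by (rule linear_hdot)
  from linear_sum[OF this] show ?thesis .
 qed
 moreover have "Re (hdot (Ecoef (H y) j *s xc (k - j) y) w) = Re (Ecoef (H y) j) * Re (hdot (xc (k - j) y) w)" if "j \<le> k" for j
  by (subst Ecoef_Re[OF y]) (use that k in \<open>auto simp: hdot_simps\<close>)
 ultimately show ?thesis unfolding ST_xc by (simp add: Re_sum)
qed

text \<open>Cayley-Hamilton, multiplied by a power of H, expresses \<open>xc j\<close> for
  \<open>j \<ge> n\<close> by the n preceding ones with real coefficients.\<close>

lemma xc_all:
 assumes y: "y \<in> W" and N: "\<And>j. j < CARD('n) ==> Re (hdot (xc j y) w) = 0"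
 shows "Re (hdot (xc j y) w) = 0"
proof (induction j rule: less_induct)
 case (less j)
 show ?case
 proof (cases "j < CARD('n)")
  case False
  define m where "m = j - CARD('n)"
  have j: "j = m + CARD('n)" using False by (simp add: m_def)
  have "Smat (H y) (CARD('n)) *v T y = 0" by (simp add: Cayley_Hamilton_Smat)
  then have "mat_power (H y) m *v (\<Sum>i\<le>CARD('n). Ecoef (H y) i *s xc (CARD('n) - i) y) = 0"
   unfolding ST_xc[symmetric] by simp
  moreover have "mat_power (H y) m *v (\<Sum>i\<le>CARD('n). Ecoef (H y) i *s xc (CARD('n) - i) y) = (\<Sum>i\<le>CARD('n). Ecoef (H y) i *s xc (j - i) y)"
  proof -
   have "mat_power (H y) m *v (Ecoef (H y) i *s xc (CARD('n) - i) y) = Ecoef (H y) i *s xc (j - i) y" if "i \<le> CARD('n)" for i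
    using that by (simp add: mv_smult xc_def matrix_vector_mul_assoc j mat_power_add[symmetric])
   then show ?thesis by (simp add: linear_sum[OF linear_mv(1)])
  qed
  ultimately have z: "(\<Sum>i\<le>CARD('n). Ecoef (H y) i *s xc (j - i) y) = 0" by simp
  have "0 = (\<Sum>i\<le>CARD('n). Re (hdot (Ecoef (H y) i *s xc (j - i) y) w))"
   using arg_cong[OF z, of "%v. Re (hdot v w)"] by (simp add: linear_sum[OF linear_hdot(2)] hdot_simps Re_sum)
  also have "\<dots> = (\<Sum>i\<le>CARD('n). Re (Ecoef (H y) i) * Re (hdot (xc (j - i) y) w))"
  proof (rule sum.cong[OF refl])
   fix i assume "i \<in> {..CARD('n)}"
   then show "Re (hdot (Ecoef (H y) i *s xc (j - i) y) w) = Re (Ecoef (H y) i) * Re (hdot (xc (j - i) y) w)"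
    by (subst Ecoef_Re[OF y]) (auto simp: hdot_simps)
  qed
  also have "\<dots> = (\<Sum>i\<le>CARD('n). if i = 0 then Re (hdot (xc j y) w) else 0)"
  proof (rule sum.cong[OF refl])
   fix i assume i: "i \<in> {..CARD('n)}"
   have "Re (hdot (xc (j - i) y) w) = 0" if "i \<noteq> 0" using less[of "j - i"] that False zero_less_card_finite[where 'a='n] by simp
   then show "Re (Ecoef (H y) i) * Re (hdot (xc (j - i) y) w) = (if i = 0 then Re (hdot (xc j y) w) else 0)"
    by (auto simp: Ecoef_0)
  qed
  finally show ?thesis by simp
 qed (use N in simp)
qed

text \<open>The vectors \<open>Smat (H y) k *v T y\<close> and \<open>xc j y\<close> are related by
  a triangular matrix with real entries and ones on the diagonal. The factor \<open>2 * \<i>\<close>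
  exchanges real and imaginary parts.\<close>

lemma zc_kernel:
 assumes y: "y \<in> W"
 shows "(\<forall>k<CARD('n). Im (hdot (zc k y) w) = 0) \<longleftrightarrow> (\<forall>j<CARD('n). Re (hdot (xc j y) w) = 0)"
proof -
 have zr: "Im (hdot (zc k y) w) = - 2 * (-1) ^ k * Re (hdot (Smat (H y) k *v T y) w)" for k
  by (cases "even k") (simp_all add: zc_def hdot_simps)
 have "Im (hdot (zc k y) w) = 0 \<longleftrightarrow> Re (hdot (Smat (H y) k *v T y) w) = 0" for k by (simp add: zr)
 moreover have "(\<forall>k<CARD('n). Re (hdot (Smat (H y) k *v T y) w) = 0) \<longleftrightarrow> (\<forall>j<CARD('n). Re (hdot (xc j y) w) = 0)"
 proof
  assume N: "\<forall>j<CARD('n). Re (hdot (xc j y) w) = 0"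
  then show "\<forall>k<CARD('n). Re (hdot (Smat (H y) k *v T y) w) = 0"
   by (auto simp: hdot_ST[OF y])
 next
  assume N: "\<forall>k<CARD('n). Re (hdot (Smat (H y) k *v T y) w) = 0"
  have "Re (hdot (xc j y) w) = 0" if "j < CARD('n)" for j
   using that
  proof (induction j rule: less_induct)
   case (less j)
   have "0 = (\<Sum>i\<le>j. Re (Ecoef (H y) i) * Re (hdot (xc (j - i) y) w))"
    using N less.prems hdot_ST[OF y, of j w] by simp
   also have "\<dots> = (\<Sum>i\<le>j. if i = 0 then Re (hdot (xc j y) w) else 0)"
   proof (rule sum.cong[OF refl])
    fix i assume i: "i \<in> {..j}"
    have "Re (hdot (xc (j - i) y) w) = 0" if "i \<noteq> 0" using less.IH[of "j - i"] that i less.prems by simp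
    then show "Re (Ecoef (H y) i) * Re (hdot (xc (j - i) y) w) = (if i = 0 then Re (hdot (xc j y) w) else 0)"
     by (auto simp: Ecoef_0)
   qed
   finally show ?case by simp
  qed
  then show "\<forall>j<CARD('n). Re (hdot (xc j y) w) = 0" by blast
 qed
 ultimately show ?thesis by simp
qed

end

section \<open>Maps into a manifold\<close>

abbreviation tr :: "('x, 'e::euclidean_space) chart => ('x, 'f::euclidean_space) chart => 'x => 'e => 'f" where
 "tr c d x \<equiv> dd (snd d \<circ> chart_inv c) (snd c x)"

text \<open>The point set carries no topology here, only charts with open images. This covers the
  coframe bundle, whose topology is defined by its charts.\<close>

locale smooth_atlas =
 fixes A :: "('x, 'e::euclidean_space) chart set"
 assumes inj_chart: "c \<in> A ==> inj_on (snd c) (fst c)"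
  and open_overlap: "c \<in> A ==> d \<in> A ==> open (snd c ` (fst c \<inter> fst d))"
  and smooth_transition: "c \<in> A ==> d \<in> A ==> smooth_on (snd c ` (fst c \<inter> fst d)) (snd d \<circ> chart_inv c)"

text \<open>A smooth map from an open set of a Euclidean space, tested in every chart. Sections of
  the bundle, inverses of charts and flows are all treated as plots.\<close>

definition plot :: "('x, 'e::euclidean_space) chart set => 'w::euclidean_space set => ('w => 'x) => bool" where
 "plot A W sig \<longleftrightarrow> open W \<and> sig ` W \<subseteq> carrier A \<and>
   (\<forall>c\<in>A. open {y\<in>W. sig y \<in> fst c} \<and> smooth_on {y\<in>W. sig y \<in> fst c} (snd c \<circ> sig))"

text \<open>The derivative is taken in the chart attached to the image point, matching the storage
  of tangent vectors; that chart may jump with the point, so only \<open>push_eq\<close> makes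
  smoothness statements possible.\<close>

definition push :: "('x, 'e::euclidean_space) chart set => ('w::euclidean_space => 'x) => 'w => 'w => 'e" where
 "push A sig y = dd (snd (chart_at A (sig y)) \<circ> sig) y"

lemma chart_at_in:
 assumes "x \<in> carrier A"
 shows "chart_at A x \<in> A" "x \<in> fst (chart_at A x)"
proof -
 have "chart_at A x \<in> A \<and> x \<in> fst (chart_at A x)"
  unfolding chart_at_def by (rule someI_ex) (use assms in \<open>auto simp: carrier_def\<close>)
 then show "chart_at A x \<in> A" "x \<in> fst (chart_at A x)" by auto
qed

lemma plotD:
 assumes "plot A W sig"
 shows "open W" "y \<in> W ==> sig y \<in> carrier A" "c \<in> A ==> open {y\<in>W. sig y \<in> fst c}"
  "c \<in> A ==> smooth_on {y\<in>W. sig y \<in> fst c} (snd c \<circ> sig)"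
 using assms by (auto simp: plot_def)

lemma plot_has_derivative:
 assumes "plot A W sig" "y \<in> W" "c \<in> A" "sig y \<in> fst c"
 shows "(snd c \<circ> sig has_derivative dd (snd c \<circ> sig) y) (at y)"
 by (rule smooth_dd[OF plotD(4)[OF assms(1,3)]]) (use assms in auto)

context smooth_atlas
begin

lemma chart_inv_chart: "c \<in> A ==> x \<in> fst c ==> chart_inv c (snd c x) = x"
 by (simp add: inj_chart)

lemma overlap_eq: "c \<in> A ==> {y\<in>chart_image c. chart_inv c y \<in> fst d} = snd c ` (fst c \<inter> fst d)"
 by (auto simp: chart_inv_chart)

lemma open_chart_image: "c \<in> A ==> open (chart_image c)"
 using open_overlap[of c c] by simp

lemma plot_chart_inv: "c \<in> A ==> plot A (chart_image c) (chart_inv c)"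
 unfolding plot_def using open_overlap[of c c]
 by (auto simp: overlap_eq open_overlap smooth_transition carrier_def chart_inv_chart)

lemma plot_transition:
 assumes p: "plot A W sig" and y: "y \<in> W" and c: "c \<in> A" "sig y \<in> fst c" and d: "d \<in> A" "sig y \<in> fst d"
 shows "dd (snd d \<circ> sig) y v = tr c d (sig y) (dd (snd c \<circ> sig) y v)"
proof -
 have t: "(snd d \<circ> chart_inv c has_derivative tr c d (sig y)) (at ((snd c \<circ> sig) y))"
  unfolding o_apply
  by (rule smooth_dd[OF smooth_transition[OF c(1) d(1), unfolded comp_def]]) (use c d in auto)
 have "((snd d \<circ> chart_inv c) \<circ> (snd c \<circ> sig) has_derivative tr c d (sig y) \<circ> dd (snd c \<circ> sig) y) (at y)"
  by (rule diff_chain_at[OF plot_has_derivative[OF p y c] t])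
 then have "(snd d \<circ> sig has_derivative tr c d (sig y) \<circ> dd (snd c \<circ> sig) y) (at y)"
  by (rule has_derivative_transform_within_open[OF _ plotD(3)[OF p c(1)]]) (use y c in \<open>auto simp: chart_inv_chart\<close>)
 then show ?thesis by (simp add: dd_eqI)
qed

lemma tr_comp:
 assumes "c \<in> A" "x \<in> fst c" "d \<in> A" "x \<in> fst d" "e \<in> A" "x \<in> fst e"
 shows "tr d e x (tr c d x v) = tr c e x v"
 using plot_transition[OF plot_chart_inv[OF assms(1)], of "snd c x" d e v] assms by (simp add: chart_inv_chart)

lemma tr_self:
 assumes "c \<in> A" "x \<in> fst c"
 shows "tr c c x v = v"
proof -
 have "(snd c \<circ> chart_inv c has_derivative (%v. v)) (at (snd c x))"
  by (rule has_derivative_transform_within_open[OF has_derivative_ident open_chart_image[OF assms(1)]])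
   (use assms in \<open>auto simp: chart_inv_chart\<close>)
 then show ?thesis by (simp add: dd_eqI)
qed

lemma linear_tr: "c \<in> A ==> x \<in> fst c ==> d \<in> A ==> x \<in> fst d ==> linear (tr c d x)"
 by (rule linear_dd[OF smooth_transition]) auto

lemma to_chart_tr: "to_chart A c x = tr (chart_at A x) c x"
 and from_chart_tr: "c \<in> A ==> x \<in> fst c ==> from_chart A c x = tr c (chart_at A x) x"
 by (simp_all add: to_chart_def from_chart_def)

lemma
 assumes "c \<in> A" "x \<in> fst c"
 shows to_from_chart: "to_chart A c x (from_chart A c x v) = v" and from_to_chart: "from_chart A c x (to_chart A c x v) = v"
  and linear_from_chart: "linear (from_chart A c x)" and linear_to_chart: "linear (to_chart A c x)"
proof -
 have x: "x \<in> carrier A" using assms by (auto simp: carrier_def)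
 note [simp] = to_chart_tr from_chart_tr[OF assms] tr_comp tr_self linear_tr assms chart_at_in[OF x]
 show "to_chart A c x (from_chart A c x v) = v" "from_chart A c x (to_chart A c x v) = v" "linear (from_chart A c x)" "linear (to_chart A c x)"
  by simp_all
qed

lemma push_eq: "plot A W sig ==> y \<in> W ==> c \<in> A ==> sig y \<in> fst c ==> push A sig y v = from_chart A c (sig y) (dd (snd c \<circ> sig) y v)"
 unfolding push_def
 using plot_transition[of W sig y c "chart_at A (sig y)" v] chart_at_in[of "sig y" A] plotD(2)[of A W sig y]
 by (simp add: from_chart_tr)

lemma smooth_fun_plot:
 assumes f: "smooth_fun A f" and p: "plot A W sig"
 shows "smooth_on W (f \<circ> sig)"
proof (rule smooth_on_local)
 fix y assume y: "y \<in> W"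
 let ?c = "chart_at A (sig y)" let ?W = "{y\<in>W. sig y \<in> fst ?c}"
 note c = chart_at_in[OF plotD(2)[OF p y]]
 have "smooth_on ?W (%y. (f \<circ> chart_inv ?c) ((snd ?c \<circ> sig) y))"
  by (rule smooth_on_compose[OF plotD(3)[OF p c(1)] open_chart_image[OF c(1)] _ plotD(4)[OF p c(1)]])
   (use f c in \<open>auto simp: smooth_fun_def comp_def\<close>)
 then have "smooth_on ?W (f \<circ> sig)"
  by (rule smooth_on_cong[OF plotD(3)[OF p c(1)], rotated]) (auto simp: chart_inv_chart c)
 then show "\<exists>U. open U \<and> y \<in> U \<and> smooth_on U (f \<circ> sig)" using plotD(3)[OF p c(1)] y c by blast
qed

lemma function_plot_derivative:
 assumes p: "plot A W sig" and y: "y \<in> W" and c: "c \<in> A" "sig y \<in> fst c"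
  and f: "(f \<circ> chart_inv c) differentiable (at (snd c (sig y)))"
 shows "dd (f \<circ> sig) y v = dd (f \<circ> chart_inv c) (snd c (sig y)) (dd (snd c \<circ> sig) y v)"
proof -
 have t: "(f \<circ> chart_inv c has_derivative dd (f \<circ> chart_inv c) (snd c (sig y))) (at ((snd c \<circ> sig) y))"
  using f by (simp add: frechet_derivative_works)
 have "((f \<circ> chart_inv c) \<circ> (snd c \<circ> sig) has_derivative dd (f \<circ> chart_inv c) (snd c (sig y)) \<circ> dd (snd c \<circ> sig) y) (at y)"
  by (rule diff_chain_at[OF plot_has_derivative[OF p y c] t])
 then have "(f \<circ> sig has_derivative dd (f \<circ> chart_inv c) (snd c (sig y)) \<circ> dd (snd c \<circ> sig) y) (at y)"
  by (rule has_derivative_transform_within_open[OF _ plotD(3)[OF p c(1)]]) (use y c in \<open>auto simp: chart_inv_chart\<close>)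
 then show ?thesis by (simp add: dd_eqI)
qed

lemma smooth_fun_derivative:
 assumes f: "smooth_fun A f" and p: "plot A W sig" and y: "y \<in> W"
 shows "dd (f \<circ> sig) y v = differential A f (sig y) (push A sig y v)"
proof -
 note c = chart_at_in[OF plotD(2)[OF p y]]
 show ?thesis unfolding differential_def push_def
  by (rule function_plot_derivative[OF p y c])
   (use f c smooth_dd[of "chart_image (chart_at A (sig y))"] in \<open>force simp: smooth_fun_def differentiable_def\<close>)
qed

lemma form_plot: "plot A W sig ==> y \<in> W ==> c \<in> A ==> sig y \<in> fst c ==>
  al (sig y) (push A sig y v) = one_form_in_chart A c al (snd c (sig y)) (dd (snd c \<circ> sig) y v)"
 by (simp add: push_eq[of W sig y c] one_form_in_chart_def chart_inv_chart)

lemma linear_one_form_in_chart: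
 assumes "smooth_one_form A al" "c \<in> A" "z \<in> chart_image c"
 shows "linear (one_form_in_chart A c al z)"
proof -
 obtain x where x: "x \<in> fst c" "z = snd c x" using assms by blast
 have "linear (al x)" using assms x by (auto simp: smooth_one_form_def carrier_def)
 from linear_compose[OF linear_from_chart[OF assms(2) x(1)] this]
 show ?thesis unfolding one_form_in_chart_def[abs_def] x(2) chart_inv_chart[OF assms(2) x(1)] o_def .
qed

lemma linear_form_plot:
 assumes "smooth_one_form A al" "plot A W sig" "y \<in> W"
 shows "linear (%v. al (sig y) (push A sig y v))"
proof -
 have 1: "linear (al (sig y))" using assms plotD(2)[OF assms(2,3)] by (simp add: smooth_one_form_def)
 have 2: "linear (push A sig y)" unfolding push_def
  by (rule linear_dd[OF plotD(4)[OF assms(2)]]) (use assms chart_at_in[OF plotD(2)[OF assms(2,3)]] in auto)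
 from linear_compose[OF 2 1] show ?thesis by (simp add: o_def)
qed

lemma one_form_expand:
 assumes al: "smooth_one_form A al" and c: "c \<in> A" and z: "z \<in> chart_image c"
 shows "one_form_in_chart A c al z u = (\<Sum>b\<in>Basis. (u \<bullet> b) *\<^sub>R one_form_in_chart A c al z b)"
 by (rule linear_expand_Basis[OF linear_one_form_in_chart[OF assms]])

lemma smooth_form_plot:
 assumes al: "smooth_one_form A al" and p: "plot A W sig"
 shows "smooth_on W (%y. al (sig y) (push A sig y v))"
proof (rule smooth_on_local)
 fix y assume y: "y \<in> W"
 let ?c = "chart_at A (sig y)" let ?W = "{y\<in>W. sig y \<in> fst ?c}" let ?tau = "snd ?c \<circ> sig"
 note c = chart_at_in[OF plotD(2)[OF p y]] note oW = plotD(3)[OF p c(1)]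
 have "smooth_on ?W (%y. \<Sum>b\<in>Basis. (dd ?tau y v \<bullet> b) *\<^sub>R one_form_in_chart A ?c al (?tau y) b)"
 proof (rule smooth_on_sum[OF oW], rule smooth_on_bilinear[OF oW bilinear_scaleR])
  fix b :: 'e
  have "linear (%z. z \<bullet> b)" by (rule bounded_linear.linear[OF bounded_linear_inner_left])
  from smooth_on_linear_comp[OF oW this smooth_on_dd[OF plotD(4)[OF p c(1)]]]
  show "smooth_on ?W (%y. dd ?tau y v \<bullet> b)" .
  show "smooth_on ?W (%y. one_form_in_chart A ?c al (?tau y) b)"
   by (rule smooth_on_compose[OF oW open_chart_image[OF c(1)] _ plotD(4)[OF p c(1)]])
    (use al c in \<open>auto simp: smooth_one_form_def\<close>)
 qed
 then have "smooth_on ?W (%y. al (sig y) (push A sig y v))"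
  by (rule smooth_on_cong[OF oW, rotated]) (simp add: form_plot[OF p _ c(1)] one_form_expand[OF al c(1), symmetric])
 then show "\<exists>U. open U \<and> y \<in> U \<and> smooth_on U (%y. al (sig y) (push A sig y v))" using oW y c by blast
qed

text \<open>Naturality of the exterior derivative. The derivative of \<open>dd ?tau y w\<close>
  along \<open>v\<close> is symmetric in the two vectors and drops out of the difference.\<close>

lemma d_form_plot:
 assumes al: "smooth_one_form A al" and p: "plot A W sig" and y: "y \<in> W"
 shows "dd (%y. al (sig y) (push A sig y w)) y v - dd (%y. al (sig y) (push A sig y v)) y w
  = d_one_form A al (sig y) (push A sig y v) (push A sig y w)"
proof -
 let ?c = "chart_at A (sig y)" let ?W = "{y\<in>W. sig y \<in> fst ?c}" let ?tau = "snd ?c \<circ> sig"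
 let ?F = "%b z. one_form_in_chart A ?c al z b"
 note c = chart_at_in[OF plotD(2)[OF p y]] note oW = plotD(3)[OF p c(1)]
 have smF: "smooth_on (chart_image ?c) (?F b)" for b using al c by (simp add: smooth_one_form_def)
 have yW: "y \<in> ?W" and zy: "?tau y \<in> chart_image ?c" using y c by auto
 have lF: "linear (one_form_in_chart A ?c al (?tau y))" by (rule linear_one_form_in_chart[OF al c(1) zy])
 have dF: "(?F b has_derivative dd (?F b) (?tau y)) (at (?tau y))" for b by (rule smooth_dd[OF smF zy])
 have exp: "dd (?F u) (?tau y) x = (\<Sum>b\<in>Basis. (u \<bullet> b) *\<^sub>R dd (?F b) (?tau y) x)" for u x
 proof -
  have "((%z. \<Sum>b\<in>Basis. (u \<bullet> b) *\<^sub>R ?F b z) has_derivative (%x. \<Sum>b\<in>Basis. (u \<bullet> b) *\<^sub>R dd (?F b) (?tau y) x)) (at (?tau y))"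
   by (intro has_derivative_sum has_derivative_scaleR_right dF)
  then have "(?F u has_derivative (%x. \<Sum>b\<in>Basis. (u \<bullet> b) *\<^sub>R dd (?F b) (?tau y) x)) (at (?tau y))"
   by (rule has_derivative_transform_within_open[OF _ open_chart_image[OF c(1)] zy])
    (simp add: one_form_expand[OF al c(1), symmetric])
  then show ?thesis by (simp add: dd_eqI)
 qed
 have d: "dd (%y. al (sig y) (push A sig y w)) y v = dd (?F (dd ?tau y w)) (?tau y) (dd ?tau y v) + ?F (dd (%y. dd ?tau y w) y v) (?tau y)" for v w
 proof -
  have dt: "((%y. dd ?tau y w) has_derivative dd (%y. dd ?tau y w) y) (at y)"
   by (rule smooth_dd[OF smooth_on_dd[OF plotD(4)[OF p c(1)]] yW])
  have 1: "((%y. ?F b (?tau y)) has_derivative (%v. dd (?F b) (?tau y) (dd ?tau y v))) (at y)" for b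
   by (rule has_derivative_compose[OF plot_has_derivative[OF p y c] dF])
  have "((%y. \<Sum>b\<in>Basis. (dd ?tau y w \<bullet> b) *\<^sub>R ?F b (?tau y)) has_derivative
   (%v. \<Sum>b\<in>Basis. (dd ?tau y w \<bullet> b) *\<^sub>R dd (?F b) (?tau y) (dd ?tau y v) + (dd (%y. dd ?tau y w) y v \<bullet> b) *\<^sub>R ?F b (?tau y))) (at y)"
   by (intro has_derivative_sum has_derivative_scaleR has_derivative_inner_left dt 1)
  then have "((%y. al (sig y) (push A sig y w)) has_derivative
   (%v. \<Sum>b\<in>Basis. (dd ?tau y w \<bullet> b) *\<^sub>R dd (?F b) (?tau y) (dd ?tau y v) + (dd (%y. dd ?tau y w) y v \<bullet> b) *\<^sub>R ?F b (?tau y))) (at y)"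
   by (rule has_derivative_transform_within_open[OF _ oW yW])
    (simp add: form_plot[OF p _ c(1)] one_form_expand[OF al c(1), symmetric])
  from fun_cong[OF dd_eqI[OF this], of v]
  show ?thesis by (simp only: sum.distrib exp[symmetric] linear_expand_Basis[OF lF, symmetric])
 qed
 have "dd (%y. dd ?tau y w) y v = dd (%y. dd ?tau y v) y w"
  by (rule dd_symmetric[OF oW plotD(4)[OF p c(1)] yW])
 then show ?thesis unfolding d by (simp add: d_one_form_def Let_def push_def)
qed

end

subsection \<open>Embedded submanifolds\<close>

text \<open>The coordinates of \<open>sig\<close> in a chart of \<open>P\<close> are continuous, and they are recovered from smooth functions by a local inverse.\<close>
lemma plot_submanifold:
 fixes A :: "('x, 'e::euclidean_space) chart set" and sig :: "'w::euclidean_space => 'x"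
 assumes A: "smooth_atlas A" and W: "open W" "sig ` W \<subseteq> P" and d: "d \<in> A" "sig ` W \<subseteq> fst d" and sm: "smooth_on W (snd d \<circ> sig)"
  and th: "th \<in> (submanifold_atlas A P :: ('x, 'd::euclidean_space) chart set)"
 shows "open {y\<in>W. sig y \<in> fst th}" "smooth_on {y\<in>W. sig y \<in> fst th} (snd th \<circ> sig)"
proof -
 interpret smooth_atlas A by fact
 let ?d = "snd d \<circ> sig" let ?th = "snd th \<circ> sig" let ?W = "{y\<in>W. sig y \<in> fst th}"
 have injth: "inj_on (snd th) (fst th)" using th by (simp add: submanifold_atlas_def)
 have ci: "chart_inv th (snd th p) = p" if "p \<in> fst th" for p using inv_into_f_f[OF injth that] .
 have pre: "open (?W \<inter> ?th -` U)" if "open U" for U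
 proof -
  have "\<forall>U. open U \<longrightarrow> (\<exists>N. atlas_open A N \<and> fst th \<inter> snd th -` U = P \<inter> N)"
   using th unfolding submanifold_atlas_def mem_Collect_eq by (elim conjE)
  then obtain N where N: "atlas_open A N" "fst th \<inter> snd th -` U = P \<inter> N"
   using \<open>open U\<close> by meson
  have "?W \<inter> ?th -` U = W \<inter> ?d -` (snd d ` (fst d \<inter> N))"
  proof (intro set_eqI iffI)
   fix y assume y: "y \<in> ?W \<inter> ?th -` U"
   then have "sig y \<in> N" using N(2) by auto
   then show "y \<in> W \<inter> ?d -` (snd d ` (fst d \<inter> N))" using y d by auto
  next
   fix y assume y: "y \<in> W \<inter> ?d -` (snd d ` (fst d \<inter> N))"
   then obtain p where p: "p \<in> fst d" "p \<in> N" "snd d (sig y) = snd d p" by auto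
   have "sig y = p" using inj_onD[OF inj_chart[OF d(1)] p(3)] p d y by auto
   then have "sig y \<in> P \<inter> N" using p y W by auto
   then show "y \<in> ?W \<inter> ?th -` U" using y unfolding N(2)[symmetric] by auto
  qed
  moreover have "open (snd d ` (fst d \<inter> N))" using N(1) d(1) by (simp add: atlas_open_def)
  ultimately show ?thesis using continuous_open_preimage[OF smooth_on_continuous[OF sm] W(1)] by (simp add: Int_commute)
 qed
 show oW: "open ?W" using pre[of UNIV] by simp
 have cont: "continuous_on ?W ?th" unfolding continuous_on_open_vimage[OF oW] using pre by (simp add: Int_commute)
 let ?T = "snd th ` (fst th \<inter> fst d)" let ?g = "snd d \<circ> chart_inv th"
 have oT: "open ?T" and smg: "smooth_on ?T ?g" and injg: "\<And>p. p \<in> fst th ==> p \<in> fst d ==> inj (dd ?g (snd th p))"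
  using th d(1) by (auto simp: submanifold_atlas_def smooth_map_def o_def)
 show "smooth_on ?W ?th"
 proof (rule smooth_on_local)
  fix y0 assume y0: "y0 \<in> ?W"
  have z0: "?th y0 \<in> ?T" using y0 d by auto
  have lg: "linear (dd ?g z)" if "z \<in> ?T" for z by (rule linear_dd[OF smg that])
  \<comment> \<open>A left inverse of the derivative of the inclusion. Then \<open>L\<close> after
    the inclusion is a local diffeomorphism of the model space, and its inverse recovers the
    submanifold coordinates from the ambient ones.\<close>
  obtain L where L: "linear L" "L \<circ> dd ?g (?th y0) = id"
   using linear_injective_left_inverse[OF lg[OF z0]] injg[of "sig y0"] y0 d by auto
  have D: "dd (%z. L (?g z)) (?th y0) = (%v. L (dd ?g (?th y0) v))"
   by (rule dd_eqI[OF hd_linear[OF L(1) smooth_dd[OF smg z0]]])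
  have inj: "inj (dd (%z. L (?g z)) (?th y0))"
   unfolding D using fun_cong[OF L(2)] by (intro injI) (metis comp_apply id_apply)
  obtain U V h where U: "open U" "?th y0 \<in> U" "open V" "homeomorphism U V (%z. L (?g z)) h" "smooth_on V h"
   by (rule smooth_local_inverse[OF oT smooth_on_linear_comp[OF oT L(1) smg] z0 inj])
  let ?V = "?W \<inter> ?th -` U"
  have h: "L (?d y) \<in> V" "?th y = h (L (?d y))" if "y \<in> ?V" for y
  proof -
   have "L (?g (?th y)) \<in> V \<and> h (L (?g (?th y))) = ?th y" using that U(4) unfolding homeomorphism_def by blast
   moreover have "?g (?th y) = ?d y" using that by (simp add: ci)
   ultimately show "L (?d y) \<in> V" "?th y = h (L (?d y))" by simp_all
  qed
  have "smooth_on ?V (%y. h (L (?d y)))"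
   by (rule smooth_on_compose[OF pre[OF U(1)] U(3,5) smooth_on_linear_comp[OF pre[OF U(1)] L(1) smooth_on_subset[OF sm]]])
    (use h(1) in auto)
  then have "smooth_on ?V ?th"
   by (rule smooth_on_cong[OF pre[OF U(1)], rotated]) (simp only: h(2))
  then show "\<exists>U. open U \<and> y0 \<in> U \<and> smooth_on U ?th" using pre[OF U(1)] U(2) y0 by blast
 qed
qed

text \<open>The inverse of a submanifold chart is a smooth map into the ambient manifold with values
  in \<open>P\<close>; over each ambient chart \<open>plot_submanifold\<close> makes any other
  submanifold chart smooth along it.\<close>

lemma smooth_atlas_submanifold:
 fixes A :: "('x, 'e::euclidean_space) chart set"
 assumes A: "smooth_atlas A"
 shows "smooth_atlas (submanifold_atlas A P :: ('x, 'd::euclidean_space) chart set)"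
proof -
 interpret smooth_atlas A by fact
 have *: "open (snd c ` (fst c \<inter> fst e)) \<and> smooth_on (snd c ` (fst c \<inter> fst e)) (snd e \<circ> chart_inv c)"
  if ce: "c \<in> submanifold_atlas A P" "e \<in> submanifold_atlas A P" for c e :: "('x, 'd) chart"
 proof -
  have inj: "inj_on (snd c) (fst c)" using ce by (simp add: submanifold_atlas_def)
  have ci: "chart_inv c (snd c p) = p" if "p \<in> fst c" for p using inv_into_f_f[OF inj that] .
  let ?S = "snd c ` (fst c \<inter> fst e)"
  let ?U = "%d. {y \<in> snd c ` (fst c \<inter> fst d). chart_inv c y \<in> fst e}"
  have U: "open (?U d)" "smooth_on (?U d) (snd e \<circ> chart_inv c)" if d: "d \<in> A" for d
  proof -
   have 1: "open (snd c ` (fst c \<inter> fst d))" "smooth_on (snd c ` (fst c \<inter> fst d)) (snd d \<circ> chart_inv c)"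
    using ce(1) d by (auto simp: submanifold_atlas_def smooth_map_def o_def)
   have 2: "chart_inv c ` (snd c ` (fst c \<inter> fst d)) \<subseteq> P" "chart_inv c ` (snd c ` (fst c \<inter> fst d)) \<subseteq> fst d"
    using ce(1) by (auto simp: ci submanifold_atlas_def)
   show "open (?U d)" "smooth_on (?U d) (snd e \<circ> chart_inv c)"
    by (rule plot_submanifold[OF A 1(1) 2(1) d 2(2) 1(2) ce(2)])+
  qed
  have cov: "\<exists>d\<in>A. y \<in> ?U d \<and> ?U d \<subseteq> ?S" if y: "y \<in> ?S" for y
  proof -
   obtain p where p: "p \<in> fst c" "p \<in> fst e" "y = snd c p" using y by auto
   have "p \<in> carrier A" using ce(1) p by (auto simp: submanifold_atlas_def smooth_map_def carrier_def)
   then obtain d where "d \<in> A" "p \<in> fst d" by (auto simp: carrier_def)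
   then show ?thesis using p by (intro bexI[of _ d]) (auto simp: ci)
  qed
  have "open ?S" unfolding open_subopen[of ?S] using cov U(1) by meson
  moreover have "smooth_on ?S (snd e \<circ> chart_inv c)"
   by (rule smooth_on_local) (use cov U in meson)
  ultimately show ?thesis by blast
 qed
 show ?thesis
  by unfold_locales (use * in \<open>auto simp: submanifold_atlas_def\<close>)
qed

section \<open>Local unitary frames\<close>

lemma adjoint_eqI: "(\<And>v w. hdot (m *v v) w = hdot v (n *v w)) ==> adj m = n"
proof (rule matrix_eqI, rule hdot_eqI)
 fix v w assume "\<And>v w. hdot (m *v v) w = hdot v (n *v w)"
 then show "hdot w (adj m *v v) = hdot w (n *v v)" by (simp add: hdot_matrix[symmetric])
qed

lemma invertible_hdot:
 fixes m :: "complex^'n^'n"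
 assumes "\<And>v. v \<noteq> 0 ==> m *v v \<noteq> 0"
 shows "invertible m"
 using assms matrix_left_invertible_ker[of m] matrix_left_right_inverse[of _ m] unfolding invertible_def by metis

lemma open_invertible: "open {m :: complex^'n^'n. invertible m}"
proof -
 have "continuous_on UNIV (det :: complex^'n^'n => complex)" unfolding det_def by (intro continuous_intros)
 from continuous_open_preimage[OF this open_UNIV, of "- {0 :: complex}"]
 show ?thesis by (simp add: invertible_det_nz vimage_def open_Compl)
qed

subsection \<open>The Cayley transform\<close>

text \<open>The prescribed model space of the bundle has the factor \<open>real^'n^'n\<close>. The
  antisymmetric part of a real matrix supplies the real part, and its symmetric part the imaginary
  part, of a skew-Hermitian matrix.\<close>

definition skew_of_real :: "real^'n^'n => complex^'n^'n" where
 "skew_of_real r = (\<chi> i j. Complex ((r $ i $ j - r $ j $ i) / 2) ((r $ i $ j + r $ j $ i) / 2))"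

definition real_of_skew :: "complex^'n^'n => real^'n^'n" where
 "real_of_skew m = (\<chi> i j. Re (m $ i $ j) + Im (m $ i $ j))"

lemma linear_skew_of_real: "linear skew_of_real"
 and linear_real_of_skew: "linear real_of_skew"
 by (auto intro!: linearI simp: skew_of_real_def real_of_skew_def vec_eq_iff complex_eq_iff field_simps)

lemma real_of_skew_of_real: "real_of_skew (skew_of_real r) = r"
 by (simp add: skew_of_real_def real_of_skew_def vec_eq_iff field_simps)

lemma skew_of_real_of_skew:
 assumes "adj m = - m"
 shows "skew_of_real (real_of_skew m) = m"
proof -
 have c: "cnj (m $ j $ i) = - m $ i $ j" for i j
  using arg_cong[OF assms, of "%m. m $ i $ j"] by (simp add: adjoint_matrix_def)
 have "skew_of_real (real_of_skew m) $ i $ j = m $ i $ j" for i j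
  using arg_cong[OF c[of j i], of Re] arg_cong[OF c[of j i], of Im]
  by (simp add: skew_of_real_def real_of_skew_def complex_eq_iff)
 then show ?thesis by (simp add: vec_eq_iff)
qed

lemma adjoint_skew_of_real: "adj (skew_of_real r) = - skew_of_real r"
 by (simp add: skew_of_real_def adjoint_matrix_def vec_eq_iff complex_eq_iff field_simps)

text \<open>The Cayley transform: an involution on matrices with \<open>mat 1 + k\<close>
  invertible, exchanging the skew-Hermitian matrices with the unitary ones without eigenvalue
  -1.\<close>

definition cay :: "complex^'n^'n => complex^'n^'n" where
 "cay k = (mat 1 - k) ** matrix_inv (mat 1 + k)"

lemma cay_apply: "invertible (mat 1 + k) ==> cay k *v ((mat 1 + k) *v w) = (mat 1 - k) *v w"
 unfolding cay_def matrix_vector_mul_assoc matrix_mul_assoc[symmetric] by (simp add: matrix_inv_left matrix_mul_rid)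

lemma matrix_eq_on_range:
 assumes "invertible m" "\<And>w. a *v (m *v w) = b *v (m *v (w :: complex^'n))"
 shows "a = (b :: complex^'n^'n)"
 using invertible_surj[OF assms(1)] assms(2) by (intro matrix_eqI) metis

lemma cay_cay:
 fixes k :: "complex^'n^'n"
 assumes k: "invertible (mat 1 + k)"
 shows "invertible (mat 1 + cay k)" "cay (cay k) = k"
proof -
 have 2: "(mat 1 + cay k) *v ((mat 1 + k) *v w) = 2 *s w" "(mat 1 - cay k) *v ((mat 1 + k) *v w) = 2 *s (k *v w)" for w
  unfolding mat_simps(7,9)[of "mat 1" "cay k"] cay_apply[OF k]
  by (simp_all add: mat_simps vec_eq_iff)
 show i: "invertible (mat 1 + cay k)"
 proof (rule invertible_hdot)
  fix v :: "complex^'n" assume v: "v \<noteq> 0"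
  obtain w where w: "(mat 1 + k) *v w = v" by (rule invertible_surj[OF k])
  then have "w \<noteq> 0" using v by auto
  then show "(mat 1 + cay k) *v v \<noteq> 0" using 2(1)[of w] by (simp add: w)
 qed
 show "cay (cay k) = k"
 proof (rule matrix_eq_on_range[OF i])
  fix w
  obtain x where x: "(mat 1 + k) *v x = w" by (rule invertible_surj[OF k])
  show "cay (cay k) *v ((mat 1 + cay k) *v w) = k *v ((mat 1 + cay k) *v w)"
   unfolding cay_apply[OF i] unfolding x[symmetric] 2 by (simp add: mv_smult)
 qed
qed

text \<open>The form \<open>hdot v (k *v v)\<close> is purely imaginary, so the real part of
  \<open>hdot v ((mat 1 + k) *v v)\<close> is the squared norm of \<open>v\<close>.\<close>

lemma skew_invertible:
 fixes k :: "complex^'n^'n"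
 assumes "adj k = - k"
 shows "invertible (mat 1 + k)"
proof (rule invertible_hdot)
 fix v :: "complex^'n" assume v: "v \<noteq> 0"
 have "Re (hdot v (k *v v)) = 0"
 proof -
  have "hdot (k *v v) v = - hdot v (k *v v)" by (simp add: hdot_matrix assms mat_simps hdot_simps)
  moreover have "Re (hdot (k *v v) v) = Re (hdot v (k *v v))" by (simp add: Re_hdot inner_commute)
  ultimately show ?thesis by simp
 qed
 then have "Re (hdot v ((mat 1 + k) *v v)) = (norm v)\<^sup>2"
  by (simp add: mat_simps hdot_simps hdot_self)
 then show "(mat 1 + k) *v v \<noteq> 0" using v by (auto simp: hdot_simps)
qed

lemma cay_unitary:
 fixes k :: "complex^'n^'n"
 assumes k: "adj k = - k"
 shows "adj (cay k) ** cay k = mat 1"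
proof -
 note i = skew_invertible[OF k]
 have "hdot (cay k *v v) (cay k *v v') = hdot v v'" for v v'
 proof -
  obtain w w' where w: "(mat 1 + k) *v w = v" "(mat 1 + k) *v w' = v'" using invertible_surj[OF i] by metis
  have "hdot (k *v x) y = - hdot x (k *v y)" for x y
   by (simp add: hdot_matrix k mat_simps hdot_simps)
  then show ?thesis unfolding w[symmetric] cay_apply[OF i]
   by (simp add: mat_simps hdot_simps)
 qed
 then show ?thesis
  by (intro matrix_eqI hdot_eqI) (simp add: hdot_matrix matrix_vector_mul_assoc[symmetric])
qed

lemma cay_skew:
 fixes a :: "complex^'n^'n"
 assumes a: "adj a ** a = mat 1" and i: "invertible (mat 1 + a)"
 shows "adj (cay a) = - cay a"
proof (rule adjoint_eqI)
 fix v v'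
 obtain w w' where w: "(mat 1 + a) *v w = v" "(mat 1 + a) *v w' = v'" using invertible_surj[OF i] by metis
 have "hdot (a *v x) (a *v y) = hdot x y" for x y
  by (simp add: hdot_matrix matrix_vector_mul_assoc a)
 then show "hdot (cay a *v v) v' = hdot v (- cay a *v v')"
  unfolding w[symmetric] mat_simps(11) cay_apply[OF i]
  by (simp add: mat_simps hdot_simps)
qed

lemma smooth_cay:
 assumes "open S" "smooth_on S f" "\<And>x. x \<in> S ==> invertible (mat 1 + f x)"
 shows "smooth_on S (%x. cay (f x))"
 unfolding cay_def
 by (intro smooth_on_bilinear[OF assms(1) bilinear_mm] smooth_on_diff smooth_on_matrix_inv smooth_on_add smooth_on_const assms)

subsection \<open>Smooth square roots of Gram matrices\<close>

text \<open>Conjugating \<open>G\<close> by the inverse of \<open>u\<close> normalises it to the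
  identity at \<open>y0\<close>, where the smooth square root is available; multiplying the root by
  \<open>u\<close> undoes the normalisation.\<close>

lemma local_section:
 fixes G :: "'a::euclidean_space => complex^'n^'n" and u :: "complex^'n^'n"
 assumes W: "open W" "y0 \<in> W" and G: "smooth_on W G" "\<And>y. y \<in> W ==> adj (G y) = G y"
  and u: "invertible u" "adj u ** u = G y0"
 obtains W' s where "open W'" "y0 \<in> W'" "W' \<subseteq> W" "smooth_on W' s" "s y0 = u" "\<And>y. y \<in> W' ==> adj (s y) ** s y = G y"
proof -
 obtain N and R :: "complex^'n^'n => complex^'n^'n" where R: "open N" "mat 1 \<in> N" "smooth_on N R"
  "\<And>K. K \<in> N ==> R K ** R K = K" "\<And>K. K \<in> N ==> adj K = K ==> adj (R K) = R K"
  using smooth_matrix_sqrt by blast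
 let ?i = "matrix_inv u"
 let ?K = "%y. adj ?i ** G y ** ?i"
 have ui: "u ** ?i = mat 1" "?i ** u = mat 1" using matrix_inv_right[OF u(1)] matrix_inv_left[OF u(1)] .
 have aui: "adj ?i ** adj u = mat 1" "adj u ** adj ?i = mat 1"
  by (simp_all add: adjoint_matrix_mult[symmetric] ui adjoint_matrix_mat)
 have K0: "?K y0 = mat 1"
  by (simp add: u(2)[symmetric] matrix_mul_assoc[symmetric] ui matrix_mul_rid aui)
 have smK: "smooth_on W ?K"
  by (intro smooth_on_bilinear[OF W(1) bilinear_mm] smooth_on_const G(1))
 let ?W = "W \<inter> ?K -` N"
 have oW: "open ?W" by (rule continuous_open_preimage[OF smooth_on_continuous[OF smK] W(1) R(1)])
 have R1: "R (mat 1) ** R (mat 1) = mat 1" "adj (R (mat 1)) = R (mat 1)"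
  using R(4,5)[OF R(2)] by (auto simp: adjoint_matrix_mat)
 show ?thesis
 \<comment> \<open>\<open>R (mat 1)\<close> is known to be a Hermitian involution only; the constant
   factor in front corrects the value at \<open>y0\<close> to \<open>u\<close> and leaves the Gram
   matrix unchanged.\<close>
 proof (rule that[of ?W "%y. R (mat 1) ** (R (?K y) ** u)"])
  have "smooth_on ?W (%y. R (?K y))"
   by (rule smooth_on_compose[OF oW R(1,3) smooth_on_subset[OF smK]]) auto
  then show "smooth_on ?W (%y. R (mat 1) ** (R (?K y) ** u))"
   by (intro smooth_on_bilinear[OF oW bilinear_mm] smooth_on_const)
  show "y0 \<in> ?W" using K0 R(2) W by simp
  show "R (mat 1) ** (R (?K y0) ** u) = u"
   unfolding K0 by (simp add: matrix_mul_assoc R1)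
  fix y assume y: "y \<in> ?W"
  have aR: "adj (R (?K y)) = R (?K y)"
   by (rule R(5)) (use y in \<open>auto simp: adjoint_matrix_mult G(2) matrix_mul_assoc\<close>)
  have "adj (R (mat 1) ** (R (?K y) ** u)) ** (R (mat 1) ** (R (?K y) ** u))
    = adj u ** (R (?K y) ** ((R (mat 1) ** R (mat 1)) ** (R (?K y) ** u)))"
   by (simp only: adjoint_matrix_mult aR R1(2) matrix_mul_assoc)
  also have "\<dots> = adj u ** ((R (?K y) ** R (?K y)) ** u)" by (simp only: R1 matrix_mul_lid matrix_mul_assoc)
  also have "R (?K y) ** R (?K y) = ?K y" by (rule R(4)) (use y in auto)
  also have "adj u ** (?K y ** u) = (adj u ** adj ?i) ** G y ** (?i ** u)"
   by (simp only: matrix_mul_assoc)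
  finally show "adj (R (mat 1) ** (R (?K y) ** u)) ** (R (mat 1) ** (R (?K y) ** u)) = G y"
   by (simp add: ui aui)
 qed (use oW in auto)
qed

lemma norm_matrix_trace: "(norm (u :: complex^'n^'n))\<^sup>2 = Re (trace (adj u ** u))"
proof -
 have "(norm u)\<^sup>2 = (\<Sum>i\<in>UNIV. \<Sum>j\<in>UNIV. u $ i $ j \<bullet> u $ i $ j)"
  by (simp add: power2_norm_eq_inner inner_vec_def)
 also have "\<dots> = (\<Sum>j\<in>UNIV. \<Sum>i\<in>UNIV. u $ i $ j \<bullet> u $ i $ j)" by (rule sum.swap)
 finally show ?thesis
  by (simp add: trace_def matrix_matrix_mult_def adjoint_matrix_def inner_complex_def Re_sum)
qed

lemma gram_invertible:
 fixes u :: "complex^'n^'n"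
 assumes "adj u ** u = G" "\<And>v. v \<noteq> 0 ==> 0 < Re (hdot v (G *v v))"
 shows "invertible u"
proof (rule invertible_hdot)
 fix v :: "complex^'n" assume "v \<noteq> 0"
 from assms(2)[OF this] show "u *v v \<noteq> 0"
  unfolding assms(1)[symmetric] matrix_vector_mul_assoc[symmetric] by (auto simp: hdot_simps)
qed

text \<open>On the segment from the identity to \<open>G\<close>, the matrices of the form \<open>u\<^sup>* u\<close> form an open and closed set.\<close>
lemma gram_factor:
 fixes G :: "complex^'n^'n"
 assumes G: "adj G = G" "\<And>v. v \<noteq> 0 ==> 0 < Re (hdot v (G *v v))"
 obtains u :: "complex^'n^'n" where "adj u ** u = G"
proof -
 define f where "f t = mat (of_real (1 - t)) + mat (of_real t) ** G" for t :: real
 have fa: "adj (f t) = f t" for t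
  by (simp add: f_def adjoint_simps adjoint_matrix_mult adjoint_matrix_mat G mat_commute)
 have fp: "0 < Re (hdot v (f t *v v))" if "v \<noteq> 0" "t \<in> {0..1}" for v t
 proof -
  have "Re (hdot v (f t *v v)) = (1 - t) * (norm v)\<^sup>2 + t * Re (hdot v (G *v v))"
   by (simp add: f_def mat_simps matrix_vector_mul_assoc[symmetric] mat_vec_scale hdot_simps hdot_self algebra_simps)
  moreover have "0 \<le> (1 - t) * (norm v)\<^sup>2" "0 < (norm v)\<^sup>2" "0 \<le> t * Re (hdot v (G *v v))" using that G(2)[of v] by auto
  moreover have "0 < t * Re (hdot v (G *v v))" if "t \<noteq> 0" using that \<open>t \<in> {0..1}\<close> G(2)[OF \<open>v \<noteq> 0\<close>] by simp
  ultimately show ?thesis by (cases "t = 0") auto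
 qed
 have fs: "smooth_on UNIV f" unfolding f_def
  by (intro smooth_on_add smooth_on_bilinear[OF open_UNIV bilinear_mm] smooth_on_linear_comp[OF open_UNIV linear_mat]
    smooth_on_linear_comp[OF open_UNIV linear_of_real] smooth_on_diff smooth_on_const smooth_on_id open_UNIV)
 define S where "S = {t\<in>{0..1}. \<exists>u :: complex^'n^'n. adj u ** u = f t}"
 have "openin (top_of_set {0..1}) S"
  unfolding openin_contains_ball
 proof (intro conjI ballI)
  fix t assume t: "t \<in> S"
  then obtain u :: "complex^'n^'n" where u: "adj u ** u = f t" by (auto simp: S_def)
  obtain W' and s :: "real => complex^'n^'n" where "open W'" "t \<in> W'" "\<And>y. y \<in> W' ==> adj (s y) ** s y = f y"
   by (rule local_section[OF open_UNIV UNIV_I fs fa gram_invertible[OF u fp] u]) (use t S_def in auto)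
  then show "\<exists>e>0. ball t e \<inter> {0..1} \<subseteq> S" unfolding S_def open_contains_ball by blast
 qed (auto simp: S_def)
 moreover have "closedin (top_of_set {0..1}) S"
 proof -
  let ?C = "{(t, u :: complex^'n^'n). t \<in> {0..1} \<and> adj u ** u = f t}"
  have "compact ?C"
  proof (rule compact_eq_bounded_closed[THEN iffD2], intro conjI)
   have "continuous_on UNIV (%p :: real \<times> (complex^'n^'n). adj (snd p) ** snd p - f (fst p))"
   proof (intro continuous_on_diff bounded_bilinear.continuous_on[OF iffD1[OF bilinear_conv_bounded_bilinear bilinear_mm]])
    show "continuous_on UNIV (%p :: real \<times> (complex^'n^'n). adj (snd p))"
     by (rule bounded_linear.continuous_on[OF iffD1[OF linear_conv_bounded_linear linear_adjoint_matrix] continuous_on_snd[OF continuous_on_id]])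
    show "continuous_on UNIV (%p :: real \<times> (complex^'n^'n). f (fst p))"
     by (rule continuous_on_compose2[OF smooth_on_continuous[OF fs] continuous_on_fst[OF continuous_on_id]]) auto
   qed (intro continuous_intros)
   from continuous_closed_preimage[OF this closed_UNIV, of "{0}"]
   have "closed (({0..1} \<times> UNIV) \<inter> ((%p :: real \<times> (complex^'n^'n). adj (snd p) ** snd p - f (fst p)) -` {0}))"
    by (intro closed_Int closed_Times) auto
   moreover have "({0..1} \<times> UNIV) \<inter> ((%p :: real \<times> (complex^'n^'n). adj (snd p) ** snd p - f (fst p)) -` {0}) = ?C" by auto
   ultimately show "closed ?C" by simp
   obtain b where b: "\<And>t. t \<in> {0..1} ==> norm (Re (trace (f t))) \<le> b"
   proof -
    have "continuous_on {0..1} (%t. Re (trace (f t)))"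
     by (rule smooth_on_continuous[OF smooth_on_subset[OF smooth_on_linear_comp[OF open_UNIV linear_Re smooth_on_linear_comp[OF open_UNIV linear_trace fs]]]]) auto
    then have "bounded ((%t. Re (trace (f t))) ` {0..1})" by (intro compact_imp_bounded compact_continuous_image) auto
    then show ?thesis using that unfolding bounded_iff by blast
   qed
   \<comment> \<open>The squared norm of a factor \<open>u\<close> is the trace of
     \<open>adj u ** u\<close>, hence bounded along the segment. So the pairs form a compact set,
     and the set of admissible times is closed as its projection.\<close>
   have "?C \<subseteq> {0..1} \<times> cball 0 (sqrt b)"
   proof
    fix p assume "p \<in> ?C"
    then obtain t u where p: "p = (t, u)" "t \<in> {0..1}" "adj u ** u = f t" by auto
    have "(norm u)\<^sup>2 \<le> b" using norm_matrix_trace[of u] b[OF p(2)] p(3) by simp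
    then show "p \<in> {0..1} \<times> cball 0 (sqrt b)" using p real_le_rsqrt by auto
   qed
   then show "bounded ?C" by (rule bounded_subset[rotated]) (intro bounded_Times, auto)
  qed
  then have "compact (fst ` ?C)" by (rule compact_continuous_image[rotated]) (intro continuous_intros)
  moreover have "fst ` ?C = S" by (force simp: S_def image_iff)
  ultimately show ?thesis by (intro closed_subset) (auto simp: S_def compact_imp_closed)
 qed
 moreover have "0 \<in> S"
  unfolding S_def by (auto intro!: exI[of _ "mat 1"] simp: f_def adjoint_matrix_mat)
 ultimately have "S = {0..1}" using connected_clopen[of "{0..1 :: real}"] by auto
 then have "1 \<in> S" by simp
 then show ?thesis using that by (auto simp: S_def f_def)
qed

subsection \<open>A criterion for charts of a submanifold\<close>

text \<open>\<open>Q\<close> reads the new coordinates off the ambient ones and \<open>Phi\<close>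
  parametrises the submanifold. Since \<open>Q\<close> is defined on an open ambient set, it yields
  relative openness of the domains, and as a smooth left inverse it makes the parametrisation an
  immersion.\<close>

lemma submanifold_chart:
 fixes B :: "('x, 'e::euclidean_space) chart set" and Q :: "'e => 'd::euclidean_space"
 assumes B: "smooth_atlas B" and d: "d \<in> B" and P: "P \<subseteq> carrier B"
  and Z: "open Z" "smooth_on Z Q" and T: "open T" "smooth_on T Phi"
  and TZ: "\<And>z. z \<in> T ==> Phi z \<in> Z" "\<And>z. z \<in> T ==> Q (Phi z) = z" "\<And>z. z \<in> T ==> Phi z \<in> chart_image d \<and> chart_inv d (Phi z) \<in> P"
  and PT: "\<And>p. p \<in> P ==> p \<in> fst d ==> snd d p \<in> Z ==> Q (snd d p) \<in> T \<and> Phi (Q (snd d p)) = snd d p"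
 shows "({p\<in>P. p \<in> fst d \<and> snd d p \<in> Z}, Q \<circ> snd d) \<in> submanifold_atlas B P"
proof -
 interpret smooth_atlas B by fact
 let ?D = "{p\<in>P. p \<in> fst d \<and> snd d p \<in> Z}" let ?th = "(?D, Q \<circ> snd d)"
 have inj: "inj_on (Q \<circ> snd d) ?D"
 proof (rule inj_onI)
  fix p q assume pq: "p \<in> ?D" "q \<in> ?D" "(Q \<circ> snd d) p = (Q \<circ> snd d) q"
  have "snd d p = Phi (Q (snd d p))" "snd d q = Phi (Q (snd d q))" using PT[of p] PT[of q] pq(1,2) by auto
  then have "snd d p = snd d q" using pq(3) by simp
  then show "p = q" using inj_onD[OF inj_chart[OF d]] pq by auto
 qed
 have mem: "chart_inv d (Phi z) \<in> ?D \<and> snd d (chart_inv d (Phi z)) = Phi z" if z: "z \<in> T" for z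
 proof -
  obtain q where q: "q \<in> fst d" "Phi z = snd d q" using TZ(3)[OF z] by auto
  then show ?thesis using TZ(1,3)[OF z] by (simp add: chart_inv_chart[OF d])
 qed
 have ci: "inv_into ?D (Q \<circ> snd d) z = chart_inv d (Phi z)" if z: "z \<in> T" for z
  by (rule inv_into_f_eq[OF inj]) (use mem[OF z] TZ(2)[OF z] in auto)
 have img: "(Q \<circ> snd d) ` ?D = T"
 proof (intro equalityI subsetI)
  fix z assume "z \<in> T"
  then show "z \<in> (Q \<circ> snd d) ` ?D" using mem[of z] TZ(2)[of z] by (intro image_eqI[of _ _ "chart_inv d (Phi z)"]) auto
 qed (use PT in auto)
 have oTe: "open (T \<inter> Phi -` (snd d ` (fst d \<inter> fst e)))" if "e \<in> B" for e
  by (rule continuous_open_preimage[OF smooth_on_continuous[OF T(2)] T(1) open_overlap[OF d that]])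
 have img2: "(Q \<circ> snd d) ` (?D \<inter> fst e) = T \<inter> Phi -` (snd d ` (fst d \<inter> fst e))" if e: "e \<in> B" for e
 proof (intro equalityI subsetI)
  fix z assume "z \<in> (Q \<circ> snd d) ` (?D \<inter> fst e)"
  then show "z \<in> T \<inter> Phi -` (snd d ` (fst d \<inter> fst e))" using PT by auto
 next
  fix z assume z: "z \<in> T \<inter> Phi -` (snd d ` (fst d \<inter> fst e))"
  then obtain q where q: "q \<in> fst d" "q \<in> fst e" "Phi z = snd d q" by auto
  then have "chart_inv d (Phi z) = q" by (simp add: chart_inv_chart[OF d])
  then show "z \<in> (Q \<circ> snd d) ` (?D \<inter> fst e)" using mem[of z] z q TZ(2)[of z] by (intro image_eqI[of _ _ q]) auto
 qed
 have sme: "smooth_on (T \<inter> Phi -` (snd d ` (fst d \<inter> fst e))) (%z. (snd e \<circ> chart_inv d) (Phi z))" if e: "e \<in> B" for e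
  by (rule smooth_on_compose[OF oTe[OF e] open_overlap[OF d e] smooth_transition[OF d e] smooth_on_subset[OF T(2)]]) auto
 have smt: "smooth_on (T \<inter> Phi -` (snd d ` (fst d \<inter> fst e))) (snd e \<circ> inv_into ?D (Q \<circ> snd d))" if e: "e \<in> B" for e
  by (rule smooth_on_cong[OF oTe[OF e] _ sme[OF e]]) (simp add: ci)
 show ?thesis
  unfolding submanifold_atlas_def mem_Collect_eq fst_conv snd_conv
 proof (intro conjI)
  show "?D \<subseteq> P" by blast
  show "inj_on (Q \<circ> snd d) ?D" by (rule inj)
  show "open ((Q \<circ> snd d) ` ?D)" unfolding img by (rule T)
  show "\<forall>U. open U \<longrightarrow> (\<exists>N. atlas_open B N \<and> ?D \<inter> (Q \<circ> snd d) -` U = P \<inter> N)"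
  proof (intro allI impI)
   fix U :: "'d set" assume U: "open U"
   let ?O = "Z \<inter> Q -` U" let ?N = "{p\<in>fst d. snd d p \<in> ?O}"
   have oO: "open ?O" by (rule continuous_open_preimage[OF smooth_on_continuous[OF Z(2)] Z(1) U])
   have "open (snd e ` (fst e \<inter> ?N))" if e: "e \<in> B" for e
   proof -
    have "snd e ` (fst e \<inter> ?N) = snd e ` (fst e \<inter> fst d) \<inter> (snd d \<circ> chart_inv e) -` ?O"
     by (force simp: chart_inv_chart[OF e])
    then show ?thesis
     using continuous_open_preimage[OF smooth_on_continuous[OF smooth_transition[OF e d]] open_overlap[OF e d] oO] by simp
   qed
   then have "atlas_open B ?N" using d by (auto simp: atlas_open_def carrier_def)
   moreover have "?D \<inter> (Q \<circ> snd d) -` U = P \<inter> ?N" by auto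
   ultimately show "\<exists>N. atlas_open B N \<and> ?D \<inter> (Q \<circ> snd d) -` U = P \<inter> N" by blast
  qed
  show "smooth_map {?th} B (%p. p)"
   unfolding smooth_map_def
  proof (intro conjI ballI)
   show "(%p. p) ` carrier {?th} \<subseteq> carrier B" using d by (auto simp: carrier_def)
   fix c e assume c: "c \<in> {?th}" and e: "e \<in> B"
   have *: "fst c \<inter> (%p. p) -` fst e = ?D \<inter> fst e" using c by auto
   show "open (snd c ` (fst c \<inter> (%p. p) -` fst e))"
    unfolding * using c img2[OF e] oTe[OF e] by simp
   show "smooth_on (snd c ` (fst c \<inter> (%p. p) -` fst e)) (snd e \<circ> (%p. p) \<circ> chart_inv c)"
    unfolding * using c img2[OF e] smt[OF e] by (simp add: comp_def)
  qed
  show "\<forall>e\<in>B. \<forall>p\<in>?D \<inter> fst e. inj (dd (snd e \<circ> inv_into ?D (Q \<circ> snd d)) ((Q \<circ> snd d) p))"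
  proof (intro ballI)
   fix e p assume e: "e \<in> B" and p: "p \<in> ?D \<inter> fst e"
   let ?z = "Q (snd d p)"
   have z: "?z \<in> T" "Phi ?z = snd d p" using PT[of p] p by auto
   have zS: "?z \<in> T \<inter> Phi -` (snd d ` (fst d \<inter> fst e))" using z p by auto
   have DT: "(Phi has_derivative dd Phi ?z) (at ?z)" by (rule smooth_dd[OF T(2) z(1)])
   have "((%z. Q (Phi z)) has_derivative (%v. dd Q (snd d p) (dd Phi ?z v))) (at ?z)"
    by (rule has_derivative_compose[OF DT]) (use smooth_dd[OF Z(2), of "snd d p"] p z in simp)
   then have "((%z. z) has_derivative (%v. dd Q (snd d p) (dd Phi ?z v))) (at ?z)"
    by (rule has_derivative_transform_within_open[OF _ T(1) z(1) TZ(2)])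
   from fun_cong[OF has_derivative_unique[OF has_derivative_ident this]]
   have QT: "dd Q (snd d p) (dd Phi ?z v) = v" for v by simp
   have "((%z. (snd e \<circ> chart_inv d) (Phi z)) has_derivative (%v. tr d e p (dd Phi ?z v))) (at ?z)"
    by (rule has_derivative_compose[OF DT]) (use smooth_dd[OF smooth_transition[OF d e], of "snd d p"] p z in \<open>simp add: comp_def\<close>)
   then have "(snd e \<circ> inv_into ?D (Q \<circ> snd d) has_derivative (%v. tr d e p (dd Phi ?z v))) (at ?z)"
    by (rule has_derivative_transform_within_open[OF _ T(1) z(1)]) (simp add: ci)
   then have 1: "dd (snd e \<circ> inv_into ?D (Q \<circ> snd d)) ((Q \<circ> snd d) p) = (%v. tr d e p (dd Phi ?z v))"
    by (simp add: dd_eqI)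
   show "inj (dd (snd e \<circ> inv_into ?D (Q \<circ> snd d)) ((Q \<circ> snd d) p))"
    unfolding 1
   proof (rule injI)
    fix v v' assume "tr d e p (dd Phi ?z v) = tr d e p (dd Phi ?z v')"
    then have "tr e d p (tr d e p (dd Phi ?z v)) = tr e d p (tr d e p (dd Phi ?z v'))" by simp
    then have "dd Phi ?z v = dd Phi ?z v'" using p d e by (simp add: tr_comp tr_self)
    from arg_cong[OF this, of "dd Q (snd d p)"] show "v = v'" unfolding QT .
   qed
  qed
 qed
qed

section \<open>The unitary coframe bundle\<close>

locale kaehler_manifold =
 fixes A :: "('m::{t2_space,second_countable_topology}, complex^'n) chart set" and g \<Omega>
 assumes kaehler: "kaehler A g \<Omega>"
begin

lemma carrier_UNIV: "carrier A = UNIV"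
 and open_dom: "c \<in> A ==> open (fst c)"
 and chart_homeo: "c \<in> A ==> homeomorphism (fst c) (chart_image c) (snd c) (chart_inv c)"
 and holo_transition: "c \<in> A ==> d \<in> A ==> holo_on (snd c ` (fst c \<inter> fst d)) (snd d \<circ> chart_inv c)"
 using kaehler by (auto simp: kaehler_def complex_manifold_def holo_on_def)

lemma \<Omega>_def: "\<Omega> x v w = g x (\<i> *s v) w"
 and g_sym: "g x v w = g x w v"
 and g_pos: "v \<noteq> 0 ==> g x v v > 0"
 and g_i: "g x (\<i> *s v) (\<i> *s w) = g x v w"
 and g_bilinear: "bilinear (g x)"
 using kaehler by (auto simp: kaehler_def)

lemma open_image: "c \<in> A ==> open U ==> open (snd c ` (fst c \<inter> U))"
proof -
 assume c: "c \<in> A" and U: "open U"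
 have im: "open (chart_image c)" using kaehler c by (simp add: kaehler_def complex_manifold_def)
 note h = homeomorphism_of_subsets[OF chart_homeo[OF c]]
 have "openin (top_of_set (chart_image c)) (snd c ` (fst c \<inter> U))"
  using homeomorphism_imp_open_map[OF chart_homeo[OF c], of "fst c \<inter> U"] U by (auto simp: openin_open)
 then show ?thesis using im by (simp add: openin_open_eq)
qed

sublocale smooth_atlas A
proof
 fix c d assume c: "c \<in> A" and d: "d \<in> A"
 show "inj_on (snd c) (fst c)" using homeomorphism_apply1[OF chart_homeo[OF c]] by (metis inj_onI)
 show *: "open (snd c ` (fst c \<inter> fst d))" by (rule open_image[OF c open_dom[OF d]])
 show "smooth_on (snd c ` (fst c \<inter> fst d)) (snd d \<circ> chart_inv c)" by (rule holo_on_smooth_on[OF holo_transition[OF c d] *])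
qed

lemma chart_at: "chart_at A x \<in> A" "x \<in> fst (chart_at A x)"
 using chart_at_in[of x A] by (auto simp: carrier_UNIV)

lemma tr_smult: "c \<in> A ==> x \<in> fst c ==> d \<in> A ==> x \<in> fst d ==> tr c d x (a *s v) = a *s tr c d x v"
 by (rule holo_onE(2)[OF holo_transition]) auto

lemma from_chart_smult: "c \<in> A ==> x \<in> fst c ==> from_chart A c x (a *s v) = a *s from_chart A c x v"
 and to_chart_smult: "c \<in> A ==> x \<in> fst c ==> to_chart A c x (a *s v) = a *s to_chart A c x v"
 by (simp_all add: from_chart_tr to_chart_tr tr_smult chart_at)

lemma matrix_from_chart: "c \<in> A ==> x \<in> fst c ==> matrix (from_chart A c x) *v v = from_chart A c x v"
 by (rule matrix_works_holo) (simp_all add: from_chart_smult linear_from_chart)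

lemma matrix_to_chart: "c \<in> A ==> x \<in> fst c ==> matrix (to_chart A c x) *v v = to_chart A c x v"
 by (rule matrix_works_holo) (simp_all add: to_chart_smult linear_to_chart)

lemma matrix_to_from: "c \<in> A ==> x \<in> fst c ==> matrix (to_chart A c x) ** matrix (from_chart A c x) = mat 1"
 and matrix_from_to: "c \<in> A ==> x \<in> fst c ==> matrix (from_chart A c x) ** matrix (to_chart A c x) = mat 1"
 by (rule matrix_eqI, simp add: matrix_vector_mul_assoc[symmetric] matrix_from_chart matrix_to_chart to_from_chart from_to_chart)+

text \<open>The Hermitian form with real part \<open>g\<close> and imaginary part
  \<open>\<Omega>\<close>, conjugate-linear in the first argument like \<open>hdot\<close>.\<close>

definition herm :: "'m => complex^'n => complex^'n => complex" where
 "herm x v w = Complex (g x v w) (g x (\<i> *s v) w)"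

lemma g_i_left: "g x (\<i> *s v) w = - g x v (\<i> *s w)"
proof -
 have "\<i> *s (\<i> *s w) = - w" by (simp add: vec_eq_iff)
 then show ?thesis using g_i[of x v "\<i> *s w"] g_i[of x "\<i> *s v" w] bilinear_rneg[OF g_bilinear, of x "\<i> *s v" w] by simp
qed

lemma herm_cnj: "herm x w v = cnj (herm x v w)"
 using g_i_left[of x w v] by (simp add: herm_def complex_eq_iff g_sym[of x w v] g_sym[of x w "\<i> *s v"])

lemma linear_herm: "linear (herm x v)"
 by (rule linearI) (simp_all add: herm_def complex_eq_iff bilinear_radd[OF g_bilinear] bilinear_rmul[OF g_bilinear])

lemma herm_smult: "herm x v (a *s w) = a * herm x v w"
proof -
 have "a *s w = Re a *\<^sub>R w + Im a *\<^sub>R (\<i> *s w)" by (simp add: vec_eq_iff complex_eq_iff)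
 then show ?thesis
  using g_i_left[of x v w] g_i[of x v w]
  by (simp add: herm_def complex_eq_iff bilinear_radd[OF g_bilinear] bilinear_rmul[OF g_bilinear])
qed

lemma coframe_iff: "(x, u) \<in> coframes g \<longleftrightarrow> (\<forall>v w. hdot (u *v v) (u *v w) = herm x v w)"
proof
 assume u: "(x, u) \<in> coframes g"
 show "\<forall>v w. hdot (u *v v) (u *v w) = herm x v w"
  using u by (auto simp: coframes_def herm_def complex_eq_iff Re_hdot Im_hdot mv_smult[symmetric])
next
 assume u: "\<forall>v w. hdot (u *v v) (u *v w) = herm x v w"
 have "(u *v v) \<bullet> (u *v w) = g x v w" for v w
  using arg_cong[OF u[rule_format, of v w], of Re] by (simp add: Re_hdot herm_def)
 then show "(x, u) \<in> coframes g" by (simp add: coframes_def)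
qed

text \<open>The matrix of the Hermitian metric in the coordinates of the chart \<open>c\<close>.
  Unitary coframes over the chart are exactly the factorisations
  \<open>adj m ** m = gram c y\<close>.\<close>

definition gram :: "('m, complex^'n) chart => complex^'n => complex^'n^'n" where
 "gram c y = (\<chi> i j. herm (chart_inv c y) (from_chart A c (chart_inv c y) (axis i 1)) (from_chart A c (chart_inv c y) (axis j 1)))"

lemma hdot_gram:
 assumes c: "c \<in> A" and x: "x \<in> fst c"
 shows "hdot v (gram c (snd c x) *v w) = herm x (from_chart A c x v) (from_chart A c x w)"
proof -
 define B where "B v w = herm x (from_chart A c x v) (from_chart A c x w)" for v w
 have lB: "linear (B v)" for v
  using linear_compose[OF linear_from_chart[OF c x] linear_herm] by (simp add: B_def[abs_def] o_def)
 have exp: "B v w = (\<Sum>j\<in>UNIV. w $ j * B v (axis j 1))" for v w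
 proof -
  have "B v w = B v (\<Sum>j\<in>UNIV. w $ j *s axis j 1)" by (simp add: basis_expansion)
  also have "\<dots> = (\<Sum>j\<in>UNIV. B v (w $ j *s axis j 1))" by (rule linear_sum[OF lB])
  finally show ?thesis by (simp add: B_def from_chart_smult[OF c x] herm_smult)
 qed
 have cn: "B w v = cnj (B v w)" for v w unfolding B_def by (rule herm_cnj)
 have "B v (axis j 1) = (\<Sum>i\<in>UNIV. cnj (v $ i) * B (axis i 1) (axis j 1))" for j
  using arg_cong[OF exp[of "axis j 1" v], of cnj] by (simp add: cn[symmetric])
 then have "B v w = (\<Sum>j\<in>UNIV. \<Sum>i\<in>UNIV. w $ j * (cnj (v $ i) * B (axis i 1) (axis j 1)))"
  using exp[of v w] by (simp add: sum_distrib_left)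
 also have "\<dots> = (\<Sum>i\<in>UNIV. \<Sum>j\<in>UNIV. w $ j * (cnj (v $ i) * B (axis i 1) (axis j 1)))" by (rule sum.swap)
 also have "\<dots> = hdot v (gram c (snd c x) *v w)"
  by (simp add: hdot_def matrix_vector_mult_def gram_def chart_inv_chart[OF c x] B_def sum_distrib_left mult_ac)
 finally show ?thesis by (simp add: B_def)
qed

lemma gram_adjoint:
 assumes "c \<in> A" "y \<in> chart_image c"
 shows "adj (gram c y) = gram c y"
proof (rule adjoint_eqI)
 fix v w
 obtain x where x: "x \<in> fst c" "y = snd c x" using assms(2) by blast
 show "hdot (gram c y *v v) w = hdot v (gram c y *v w)"
  using hdot_cnj[of w "gram c y *v v"] unfolding x(2) hdot_gram[OF assms(1) x(1)] herm_cnj[of x "from_chart A c x v" "from_chart A c x w"]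
  by simp
qed

lemma gram_pos:
 assumes "c \<in> A" "y \<in> chart_image c" "v \<noteq> 0"
 shows "0 < Re (hdot v (gram c y *v v))"
proof -
 obtain x where x: "x \<in> fst c" "y = snd c x" using assms(2) by blast
 have "from_chart A c x v \<noteq> 0"
  using to_from_chart[OF assms(1) x(1), of v] linear_0[OF linear_to_chart[OF assms(1) x(1)]] assms(3) by auto
 then show ?thesis unfolding x(2) hdot_gram[OF assms(1) x(1)] by (simp add: herm_def g_pos)
qed

lemma smooth_gram:
 assumes c: "c \<in> A"
 shows "smooth_on (chart_image c) (gram c)"
proof (intro smooth_on_vec[OF open_chart_image[OF c]])
 fix i j
 note o = open_chart_image[OF c]
 have sm: "smooth_on (chart_image c) (%y. two_tensor_in_chart A c g y v w)" for v w
  using kaehler c by (intro real_analytic_on_imp_smooth_on) (simp add: kaehler_def)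
 have "smooth_on (chart_image c) (%y. of_real (two_tensor_in_chart A c g y (axis i 1) (axis j 1))
   + \<i> * of_real (two_tensor_in_chart A c g y (\<i> *s axis i 1) (axis j 1)))"
  by (intro smooth_on_add[OF o] smooth_on_bilinear[OF o bilinear_mult_complex] smooth_on_const smooth_on_linear_comp[OF o linear_of_real] sm)
 then show "smooth_on (chart_image c) (%y. gram c y $ i $ j)"
  by (rule smooth_on_cong[OF o, rotated])
   (auto simp: gram_def herm_def two_tensor_in_chart_def complex_eq_iff chart_inv_chart[OF c] from_chart_smult[OF c])
qed

lemma coframe_gram:
 assumes c: "c \<in> A" and x: "x \<in> fst c"
 shows "(x, u) \<in> coframes g \<longleftrightarrow> adj (u ** matrix (from_chart A c x)) ** (u ** matrix (from_chart A c x)) = gram c (snd c x)"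
proof -
 let ?m = "u ** matrix (from_chart A c x)"
 have m: "hdot (?m *v v) (?m *v w) = hdot v ((adj ?m ** ?m) *v w)" for v w
  by (simp only: hdot_matrix matrix_vector_mul_assoc)
 have fm: "?m *v v = u *v from_chart A c x v" for v
  by (simp add: matrix_vector_mul_assoc[symmetric] matrix_from_chart[OF c x])
 show ?thesis
 proof
  assume u: "(x, u) \<in> coframes g"
  show "adj ?m ** ?m = gram c (snd c x)"
  proof (rule matrix_eqI, rule hdot_eqI)
   fix v w show "hdot w ((adj ?m ** ?m) *v v) = hdot w (gram c (snd c x) *v v)"
    unfolding m[symmetric] fm hdot_gram[OF c x] using u coframe_iff by blast
  qed
 next
  assume u: "adj ?m ** ?m = gram c (snd c x)"
  show "(x, u) \<in> coframes g" unfolding coframe_iff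
  proof (intro allI)
   fix v w show "hdot (u *v v) (u *v w) = herm x v w"
    using m[of "to_chart A c x v" "to_chart A c x w"] unfolding u fm hdot_gram[OF c x] from_to_chart[OF c x] .
  qed
 qed
qed

lemma gram_factor_invertible:
 assumes "c \<in> A" "y \<in> chart_image c" "adj u ** u = gram c y"
 shows "invertible (u :: complex^'n^'n)"
 by (rule gram_invertible[OF assms(3) gram_pos[OF assms(1,2)]])

lemma coframe_invertible:
 assumes "(x, u) \<in> coframes g"
 shows "invertible u"
proof (rule invertible_hdot)
 fix v :: "complex^'n" assume "v \<noteq> 0"
 then have "0 < Re (herm x v v)" by (simp add: herm_def g_pos)
 moreover have "hdot (u *v v) (u *v v) = herm x v v" using assms coframe_iff by blast
 ultimately show "u *v v \<noteq> 0" by (auto simp: hdot_simps)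
qed

text \<open>A local section of the coframe bundle over a patch of the chart, written as matrices in
  the coordinates of \<open>c\<close>, where smoothness can be stated.\<close>

definition frame_on :: "('m, complex^'n) chart => (complex^'n) set => (complex^'n => complex^'n^'n) => bool" where
 "frame_on c W s \<longleftrightarrow> open W \<and> W \<subseteq> chart_image c \<and> smooth_on W s \<and> (\<forall>y\<in>W. adj (s y) ** s y = gram c y)"

lemma frame_invertible: "c \<in> A ==> frame_on c W s ==> y \<in> W ==> invertible (s y)"
 using gram_factor_invertible[of c y "s y"] by (auto simp: frame_on_def)

lemma frame_through:
 fixes u :: "complex^'n^'n"
 assumes c: "c \<in> A" and y: "y \<in> chart_image c" and u: "adj u ** u = gram c y"
 obtains W s where "frame_on c W s" "y \<in> W" "s y = u"
proof -
 obtain W and s :: "complex^'n => complex^'n^'n" where W: "open W" "y \<in> W" "W \<subseteq> chart_image c" "smooth_on W s" "s y = u"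
  "\<And>y. y \<in> W ==> adj (s y) ** s y = gram c y"
  by (rule local_section[OF open_chart_image[OF c] y smooth_gram[OF c] gram_adjoint[OF c] gram_factor_invertible[OF c y u] u], assumption) (rule that)
 show ?thesis by (rule that[of W s]) (use W in \<open>auto simp: frame_on_def\<close>)
qed

lemma frame_exists:
 assumes c: "c \<in> A" and y: "y \<in> chart_image c"
 obtains W s where "frame_on c W s" "y \<in> W"
proof -
 obtain u :: "complex^'n^'n" where "adj u ** u = gram c y"
  by (rule gram_factor[OF gram_adjoint[OF c y] gram_pos[OF c y]])
 from frame_through[OF c y this] that show ?thesis by blast
qed

section \<open>Charts of the bundles of linear and of unitary coframes\<close>

definition hchart :: "('m, complex^'n) chart => ('m \<times> (complex^'n^'n), (complex^'n) \<times> (complex^'n^'n)) chart" where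
 "hchart c = (fst c \<times> UNIV, %(x, u). (snd c x, u ** matrix (from_chart A c x)))"

lemma hom_atlas_hchart: "hom_atlas A = hchart ` A"
 by (simp add: hom_atlas_def hchart_def)

lemma inj_hchart: "c \<in> A ==> inj_on (snd (hchart c)) (fst (hchart c))"
proof (rule inj_onI)
 fix p q assume c: "c \<in> A" and p: "p \<in> fst (hchart c)" "q \<in> fst (hchart c)" "snd (hchart c) p = snd (hchart c) q"
 obtain x u x' u' where pq: "p = (x, u)" "q = (x', u')" by (metis surj_pair)
 have x: "x \<in> fst c" "x = x'" using p inj_onD[OF inj_chart[OF c], of x x'] by (auto simp: pq hchart_def)
 then have "u ** matrix (from_chart A c x) = u' ** matrix (from_chart A c x)" using p by (simp add: pq hchart_def)
 from arg_cong[OF this, of "%m. m ** matrix (to_chart A c x)"] have "u = u'"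
  by (simp add: matrix_mul_assoc[symmetric] matrix_from_to[OF c x(1)] matrix_mul_rid)
 then show "p = q" using pq x by simp
qed

lemma hchart_apply: "snd (hchart c) (x, u) = (snd c x, u ** matrix (from_chart A c x))"
 and hchart_dom: "fst (hchart c) = fst c \<times> UNIV"
 by (simp_all add: hchart_def)

lemma hchart_inv:
 assumes c: "c \<in> A" and y: "y \<in> chart_image c"
 shows "chart_inv (hchart c) (y, m) = (chart_inv c y, m ** matrix (to_chart A c (chart_inv c y)))"
proof -
 obtain x where x: "x \<in> fst c" "y = snd c x" using y by blast
 show ?thesis
  by (rule inv_into_f_eq[OF inj_hchart[OF c]])
   (simp_all add: hchart_apply hchart_dom x chart_inv_chart[OF c x(1)] matrix_mul_assoc[symmetric] matrix_to_from[OF c x(1)] matrix_mul_rid)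
qed

lemma hchart_image:
 assumes c: "c \<in> A"
 shows "snd (hchart c) ` (D \<times> UNIV \<inter> fst (hchart c)) = snd c ` (fst c \<inter> D) \<times> UNIV"
proof (intro equalityI subsetI)
 fix q assume "q \<in> snd c ` (fst c \<inter> D) \<times> (UNIV :: (complex^'n^'n) set)"
 then obtain x m where q: "q = (snd c x, m)" "x \<in> fst c" "x \<in> D" by auto
 then show "q \<in> snd (hchart c) ` (D \<times> UNIV \<inter> fst (hchart c))"
  by (intro image_eqI[of _ _ "(x, m ** matrix (to_chart A c x))"])
   (simp_all add: hchart_apply hchart_dom matrix_mul_assoc[symmetric] matrix_to_from[OF c] matrix_mul_rid)
qed (auto simp: hchart_apply hchart_dom)

lemma hom_smooth_atlas: "smooth_atlas (hom_atlas A)"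
proof
 fix c' d' assume "c' \<in> hom_atlas A" "d' \<in> hom_atlas A"
 then obtain c d where c: "c \<in> A" "c' = hchart c" and d: "d \<in> A" "d' = hchart d" by (auto simp: hom_atlas_hchart)
 show "inj_on (snd c') (fst c')" unfolding c(2) by (rule inj_hchart[OF c(1)])
 let ?S = "snd c ` (fst c \<inter> fst d)" let ?S' = "snd d ` (fst d \<inter> fst c)"
 have im: "snd c' ` (fst c' \<inter> fst d') = ?S \<times> UNIV"
  unfolding c(2) d(2) hchart_dom[of d] by (subst Int_commute) (rule hchart_image[OF c(1)])
 have oS: "open ?S" "open ?S'" using open_overlap c d by auto
 then have o: "open (?S \<times> (UNIV :: (complex^'n^'n) set))" by (intro open_Times open_UNIV)
 then show "open (snd c' ` (fst c' \<inter> fst d'))" unfolding im .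
 let ?t = "snd d \<circ> chart_inv c" and ?t' = "snd c \<circ> chart_inv d"
 have smt: "smooth_on ?S ?t" "smooth_on ?S' ?t'" using smooth_transition c d by auto
 have tS: "?t ` ?S \<subseteq> ?S'" by (auto simp: chart_inv_chart[OF c(1)])
 have sm1: "smooth_on ?S (%y. matrix (dd ?t' (?t y)) :: complex^'n^'n)"
  by (rule smooth_on_compose[OF oS smooth_on_matrix_derivative[OF oS(2) smt(2)] smt(1) tS])
 have f: "smooth_on (?S \<times> UNIV) (%q :: _ \<times> (complex^'n^'n). h (fst q))" if "smooth_on ?S h" for h :: "_ => 'z::euclidean_space"
  by (rule smooth_on_compose[OF o oS(1) that smooth_on_linear[OF o linear_fst]]) auto
 have "smooth_on (?S \<times> UNIV) (%q :: _ \<times> (complex^'n^'n). (?t (fst q), snd q ** matrix (dd ?t' (?t (fst q)))))"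
  by (rule smooth_on_Pair[OF o f[OF smt(1)] smooth_on_bilinear[OF o bilinear_mm smooth_on_linear[OF o linear_snd] f[OF sm1]]])
 then have "smooth_on (?S \<times> UNIV) (snd d' \<circ> chart_inv c')"
 proof (rule smooth_on_cong[OF o, rotated])
  fix q :: "(complex^'n) \<times> (complex^'n^'n)" assume "q \<in> ?S \<times> UNIV"
  then obtain x m where q: "q = (snd c x, m)" and x: "x \<in> fst c" "x \<in> fst d" by auto
  have "matrix (to_chart A c x) ** matrix (from_chart A d x) = matrix (tr d c x)"
  proof (rule matrix_eqI)
   fix v
   have "matrix (tr d c x) *v v = tr d c x v"
    by (rule matrix_works_holo) (use tr_smult linear_tr c d x in auto)
   moreover have "to_chart A c x (from_chart A d x v) = tr d c x v"
    using tr_comp[OF d(1) x(2) chart_at c(1) x(1)] by (simp add: to_chart_tr from_chart_tr[OF d(1) x(2)])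
   ultimately show "(matrix (to_chart A c x) ** matrix (from_chart A d x)) *v v = matrix (tr d c x) *v v"
    by (simp add: matrix_vector_mul_assoc[symmetric] matrix_from_chart[OF d(1) x(2)] matrix_to_chart[OF c(1) x(1)])
  qed
  then show "(?t (fst q), snd q ** matrix (dd ?t' (?t (fst q)))) = (snd d' \<circ> chart_inv c') q"
   unfolding q c(2) d(2) using x
   by (simp add: hchart_inv[OF c(1)] hchart_apply chart_inv_chart[OF c(1)] matrix_mul_assoc[symmetric])
 qed
 then show "smooth_on (snd c' ` (fst c' \<inter> fst d')) (snd d' \<circ> chart_inv c')" unfolding im .
qed

abbreviation "PA \<equiv> coframe_atlas A g"

sublocale hom: smooth_atlas "hom_atlas A" by (rule hom_smooth_atlas)

sublocale P: smooth_atlas "coframe_atlas A g"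
 unfolding coframe_atlas_def by (rule smooth_atlas_submanifold[OF hom_smooth_atlas])

text \<open>Near a given coframe, the coframes are parametrised by Cayley transforms of skew-Hermitian matrices times a frame.\<close>
lemma coframe_chart_exists:
 assumes p: "(x, u) \<in> coframes g"
 shows "\<exists>th\<in>coframe_atlas A g. (x, u) \<in> fst th"
proof -
 let ?c = "chart_at A x"
 note c = chart_at[of x]
 let ?u = "u ** matrix (from_chart A ?c x)"
 have u: "adj ?u ** ?u = gram ?c (snd ?c x)" using coframe_gram[OF c] p by blast
 have yi: "snd ?c x \<in> chart_image ?c" using c(2) by (rule imageI)
 obtain W s where s: "frame_on ?c W s" and yW: "snd ?c x \<in> W" and su: "s (snd ?c x) = ?u"
  by (rule frame_through[OF c(1) yi u])
 have W: "open W" "W \<subseteq> chart_image ?c" "smooth_on W s" and ss: "\<And>y. y \<in> W ==> adj (s y) ** s y = gram ?c y"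
  using s by (auto simp: frame_on_def)
 note si = matrix_inv_right[OF frame_invertible[OF c(1) s]] matrix_inv_left[OF frame_invertible[OF c(1) s]]
 let ?a = "%q. snd q ** matrix_inv (s (fst q))"
 let ?X = "W \<times> (UNIV :: (complex^'n^'n) set)"
 have oX: "open ?X" using W(1) by (intro open_Times open_UNIV)
 have f: "smooth_on (W \<times> UNIV) (%q :: _ \<times> 'y::euclidean_space. h (fst q))" if "smooth_on W h" for h :: "_ => 'z::euclidean_space"
  by (rule smooth_on_compose[OF open_Times[OF W(1) open_UNIV] W(1) that
   smooth_on_linear[OF open_Times[OF W(1) open_UNIV] linear_fst]]) auto
 have sma: "smooth_on ?X ?a"
  by (intro smooth_on_bilinear[OF oX bilinear_mm] smooth_on_linear[OF oX linear_snd]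
    f[OF smooth_on_matrix_inv[OF W(1,3) frame_invertible[OF c(1) s]]])
 \<comment> \<open>The matrix \<open>?a q\<close> compares the given coframe with the frame
   \<open>s\<close>. Its Cayley transform is defined where the matrix plus the identity is
   invertible, an open condition.\<close>
 let ?Z = "?X \<inter> (%q. mat 1 + ?a q) -` {m. invertible m}"
 have oZ: "open ?Z"
  by (rule continuous_open_preimage[OF _ oX open_invertible]) (rule smooth_on_continuous[OF smooth_on_add[OF oX smooth_on_const sma]])
 let ?Q = "%q. (fst q, real_of_skew (cay (?a q)))"
 have smQ: "smooth_on ?Z ?Q"
  by (intro smooth_on_Pair[OF oZ] smooth_on_linear[OF oZ linear_fst] smooth_on_linear_comp[OF oZ linear_real_of_skew]
    smooth_cay[OF oZ] smooth_on_subset[OF sma]) auto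
 let ?T = "W \<times> (UNIV :: (real^'n^'n) set)"
 have oT: "open ?T" using W(1) by (intro open_Times open_UNIV)
 let ?k = "%r. cay (skew_of_real r)"
 let ?F = "%q. (fst q, ?k (snd q) ** s (fst q))"
 have smF: "smooth_on ?T ?F"
  by (intro smooth_on_Pair[OF oT] smooth_on_linear[OF oT linear_fst]
    smooth_on_bilinear[OF oT bilinear_mm] smooth_cay[OF oT] f[OF W(3)] smooth_on_linear_comp[OF oT linear_skew_of_real]
    smooth_on_linear[OF oT linear_snd] skew_invertible adjoint_skew_of_real)
 note ki = skew_invertible[OF adjoint_skew_of_real]
 have aF: "?a (?F q) = ?k (snd q)" if "q \<in> ?T" for q
  using that by (auto simp: matrix_mul_assoc[symmetric] si matrix_mul_rid)
 have "({p\<in>coframes g. p \<in> fst (hchart ?c) \<and> snd (hchart ?c) p \<in> ?Z}, ?Q \<circ> snd (hchart ?c)) \<in> submanifold_atlas (hom_atlas A) (coframes g)"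
 proof (rule submanifold_chart[OF hom_smooth_atlas _ _ oZ smQ oT smF])
  show "hchart ?c \<in> hom_atlas A" using c by (auto simp: hom_atlas_hchart)
  show "coframes g \<subseteq> carrier (hom_atlas A)" using chart_at by (auto simp: hom_atlas_hchart carrier_def hchart_dom)
  fix q assume q: "q \<in> ?T"
  show "?F q \<in> ?Z" using q aF[OF q] cay_cay(1)[OF ki] by auto
  show "?Q (?F q) = q" unfolding aF[OF q] by (simp add: cay_cay(2)[OF ki] real_of_skew_of_real)
  let ?y = "fst q" let ?x = "chart_inv ?c ?y" let ?m = "?k (snd q) ** s ?y"
  have y: "?y \<in> W" "?y \<in> chart_image ?c" using q W by auto
  have x: "?x \<in> fst ?c" "snd ?c ?x = ?y" using y(2) by (auto simp: inv_into_into f_inv_into_f)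
  have "?F q \<in> chart_image (hchart ?c)" using hchart_image[OF c(1), of UNIV] y by simp
  moreover have "chart_inv (hchart ?c) (?F q) \<in> coframes g"
   unfolding hchart_inv[OF c(1) y(2)] coframe_gram[OF c(1) x(1)] x(2) matrix_mul_assoc[symmetric] matrix_to_from[OF c(1) x(1)] matrix_mul_rid
    adjoint_matrix_mult unitary_cancel(1)[OF cay_unitary[OF adjoint_skew_of_real]]
   by (rule ss[OF y(1)])
  ultimately show "?F q \<in> chart_image (hchart ?c) \<and> chart_inv (hchart ?c) (?F q) \<in> coframes g" by blast
 next
  fix p assume p: "p \<in> coframes g" "p \<in> fst (hchart ?c)" "snd (hchart ?c) p \<in> ?Z"
  obtain x' u' where p': "p = (x', u')" by (metis surj_pair)
  let ?m = "u' ** matrix (from_chart A ?c x')"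
  let ?y = "snd ?c x'" let ?b = "?m ** matrix_inv (s ?y)"
  have x': "x' \<in> fst ?c" using p by (simp add: p' hchart_dom)
  have y: "?y \<in> W" and bi: "invertible (mat 1 + ?b)" using p by (simp_all add: p' hchart_apply)
  have mm: "adj ?m ** ?m = adj (s ?y) ** s ?y"
   using coframe_gram[OF c(1) x'] p(1) ss[OF y] by (simp add: p')
  have "adj ?b ** ?b = adj (matrix_inv (s ?y)) ** (adj ?m ** ?m) ** matrix_inv (s ?y)"
   by (simp only: adjoint_matrix_mult matrix_mul_assoc)
  also have "\<dots> = adj (s ?y ** matrix_inv (s ?y)) ** (s ?y ** matrix_inv (s ?y))"
   unfolding mm by (simp only: adjoint_matrix_mult matrix_mul_assoc)
  also have "\<dots> = mat 1" by (simp add: si[OF y] adjoint_matrix_mat)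
  finally have bu: "adj ?b ** ?b = mat 1" .
  have "skew_of_real (real_of_skew (cay ?b)) = cay ?b" by (rule skew_of_real_of_skew[OF cay_skew[OF bu bi]])
  then have "?F (?Q (?y, ?m)) = (?y, ?b ** s ?y)" by (simp add: cay_cay(2)[OF bi])
  then show "?Q (snd (hchart ?c) p) \<in> ?T \<and> ?F (?Q (snd (hchart ?c) p)) = snd (hchart ?c) p"
   using y by (simp add: p' hchart_apply matrix_mul_assoc[symmetric] si[OF y] matrix_mul_rid)
 qed
 moreover have "snd (hchart ?c) (x, u) \<in> ?Z"
 proof -
  \<comment> \<open>The frame was chosen to pass through \<open>u\<close>, so the comparison matrix
    is the identity at the given coframe.\<close>
  have "mat 1 + mat 1 = (mat 2 :: complex^'n^'n)" by (simp add: mat_def vec_eq_iff)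
  moreover have "invertible (mat 2 :: complex^'n^'n)" by (rule invertible_hdot) (simp add: mat_vec_scale)
  ultimately show ?thesis using yW by (simp add: hchart_apply su[symmetric] si)
 qed
 ultimately show ?thesis unfolding coframe_atlas_def using p c
  by (intro bexI) (auto simp: hchart_dom)
qed

lemma carrier_PA: "carrier PA = coframes g"
proof
 show "carrier PA \<subseteq> coframes g" by (auto simp: carrier_def coframe_atlas_def submanifold_atlas_def)
 show "coframes g \<subseteq> carrier PA" using coframe_chart_exists by (force simp: carrier_def)
qed

end

section \<open>The structure equations in a local frame\<close>

text \<open>A smooth map into the submanifold is smooth into the ambient manifold; needed to project
  sections and inverse bundle charts to the base.\<close>

lemma plot_submanifold_into:
 fixes B :: "('x, 'e::euclidean_space) chart set" and sig :: "'w::euclidean_space => 'x"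
 assumes B: "smooth_atlas B" and p: "plot (submanifold_atlas B P :: ('x, 'd::euclidean_space) chart set) W sig"
 shows "plot B W sig"
proof -
 let ?S = "submanifold_atlas B P :: ('x, 'd) chart set"
 interpret smooth_atlas B by fact
 interpret S: smooth_atlas ?S by (rule smooth_atlas_submanifold[OF B])
 have sub: "fst th \<subseteq> carrier B" if "th \<in> ?S" for th
  using that by (auto simp: submanifold_atlas_def smooth_map_def carrier_def)
 have loc: "\<exists>U. open U \<and> y \<in> U \<and> U \<subseteq> {y\<in>W. sig y \<in> fst d} \<and> smooth_on U (snd d \<circ> sig)"
  if y: "y \<in> W" and d: "d \<in> B" "sig y \<in> fst d" for y d
 proof -
  let ?t = "chart_at ?S (sig y)" let ?O = "snd ?t ` (fst ?t \<inter> fst d)"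
  note t = chart_at_in[OF plotD(2)[OF p y]]
  have o: "open ?O" and sm: "smooth_on ?O (snd d \<circ> chart_inv ?t)"
   using t(1) d(1) by (auto simp: submanifold_atlas_def smooth_map_def o_def)
  let ?W = "{y\<in>W. sig y \<in> fst ?t}" let ?U = "?W \<inter> (snd ?t \<circ> sig) -` ?O"
  have oU: "open ?U" by (rule continuous_open_preimage[OF smooth_on_continuous[OF plotD(4)[OF p t(1)]] plotD(3)[OF p t(1)] o])
  have dom: "sig z \<in> fst d" if z: "z \<in> ?U" for z
  proof -
   obtain q where q: "q \<in> fst ?t" "q \<in> fst d" "snd ?t (sig z) = snd ?t q" using z by auto
   have "sig z = q" using inj_onD[OF S.inj_chart[OF t(1)] q(3)] q z by auto
   then show ?thesis using q by simp
  qed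
  have "smooth_on ?U (%z. (snd d \<circ> chart_inv ?t) ((snd ?t \<circ> sig) z))"
   by (rule smooth_on_compose[OF oU o sm smooth_on_subset[OF plotD(4)[OF p t(1)]]]) auto
  then have "smooth_on ?U (snd d \<circ> sig)"
   by (rule smooth_on_cong[OF oU, rotated]) (simp add: S.chart_inv_chart[OF t(1)])
  moreover have "y \<in> ?U" using y t d by auto
  ultimately show ?thesis using oU dom by blast
 qed
 show ?thesis
  unfolding plot_def
 proof (intro conjI ballI)
  show "open W" by (rule plotD(1)[OF p])
  show "sig ` W \<subseteq> carrier B"
  proof
   fix x assume "x \<in> sig ` W"
   then obtain y where y: "y \<in> W" "x = sig y" by blast
   from sub chart_at_in[OF plotD(2)[OF p y(1)]] show "x \<in> carrier B" unfolding y(2) by blast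
  qed
  fix d assume d: "d \<in> B"
  show "open {y\<in>W. sig y \<in> fst d}"
   by (subst open_subopen) (use loc[OF _ d] in blast)
  show "smooth_on {y\<in>W. sig y \<in> fst d} (snd d \<circ> sig)"
   by (rule smooth_on_local) (use loc[OF _ d] in blast)
 qed
qed

context kaehler_manifold
begin

lemma plot_hom: "plot PA W sig ==> plot (hom_atlas A) W sig"
 unfolding coframe_atlas_def by (rule plot_submanifold_into[OF hom_smooth_atlas])

lemma plot_fst:
 assumes p: "plot (hom_atlas A) W sig"
 shows "plot A W (fst \<circ> sig)"
 unfolding plot_def
proof (intro conjI ballI)
 show "open W" by (rule plotD(1)[OF p])
 show "(fst \<circ> sig) ` W \<subseteq> carrier A" by (simp add: carrier_UNIV)
 fix c assume c: "c \<in> A"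
 then have hc: "hchart c \<in> hom_atlas A" by (simp add: hom_atlas_hchart)
 have eq: "{y\<in>W. (fst \<circ> sig) y \<in> fst c} = {y\<in>W. sig y \<in> fst (hchart c)}" by (auto simp: hchart_dom mem_Times_iff)
 show o: "open {y\<in>W. (fst \<circ> sig) y \<in> fst c}" unfolding eq by (rule plotD(3)[OF p hc])
 have "smooth_on {y\<in>W. (fst \<circ> sig) y \<in> fst c} (%y. fst ((snd (hchart c) \<circ> sig) y))"
  by (rule smooth_on_linear_comp[OF o linear_fst]) (unfold eq, rule plotD(4)[OF p hc])
 then show "smooth_on {y\<in>W. (fst \<circ> sig) y \<in> fst c} (snd c \<circ> (fst \<circ> sig))"
  by (rule smooth_on_cong[OF o, rotated]) (simp add: hchart_def split: prod.split)
qed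

text \<open>The chain rule for the bundle projection: along a plot, \<omega> sees only the
  derivative of the projected map.\<close>

lemma taut_plot:
 assumes p: "plot PA W sig" and y: "y \<in> W"
 shows "tautological_form A g (sig y) (push PA sig y v) = snd (sig y) *v push A (fst \<circ> sig) y v"
proof -
 let ?t = "chart_at PA (sig y)" let ?c = "chart_at A (fst (sig y))"
 note t = chart_at_in[OF plotD(2)[OF p y]] note c = chart_at[of "fst (sig y)"]
 let ?f = "%q. snd ?c (fst q)"
 have ci: "chart_inv ?t (snd ?t (sig y)) = sig y" by (rule P.chart_inv_chart[OF t])
 have "plot A (chart_image ?t) (fst \<circ> chart_inv ?t)"
  by (rule plot_fst[OF plot_hom[OF P.plot_chart_inv[OF t(1)]]])
 from plot_has_derivative[OF this imageI[OF t(2)] c(1)] c(2)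
 have "(?f \<circ> chart_inv ?t) differentiable (at (snd ?t (sig y)))"
  by (auto simp: ci differentiable_def comp_def)
 from P.function_plot_derivative[OF p y t this, of v]
 show ?thesis by (simp add: tautological_form_def tangent_map_def push_def comp_def)
qed

lemma smooth_taut:
 assumes p: "plot PA W sig"
 shows "smooth_on W (%y. snd (sig y) *v push A (fst \<circ> sig) y v)"
proof (rule smooth_on_local)
 fix y assume y: "y \<in> W"
 let ?c = "chart_at A (fst (sig y))" let ?W = "{y\<in>W. sig y \<in> fst (hchart ?c)}"
 note c = chart_at[of "fst (sig y)"]
 have hc: "hchart ?c \<in> hom_atlas A" using c by (simp add: hom_atlas_hchart)
 have eq: "?W = {y\<in>W. (fst \<circ> sig) y \<in> fst ?c}" by (auto simp: hchart_dom mem_Times_iff)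
 note ph = plot_hom[OF p] note o = plotD(3)[OF ph hc]
 have "smooth_on ?W (%y. snd ((snd (hchart ?c) \<circ> sig) y) *v dd (snd ?c \<circ> (fst \<circ> sig)) y v)"
  by (intro smooth_on_bilinear[OF o bilinear_mv] smooth_on_linear_comp[OF o linear_snd]
   plotD(4)[OF ph hc] smooth_on_dd) (unfold eq, rule plotD(4)[OF plot_fst[OF ph] c(1)])
 then have "smooth_on ?W (%y. snd (sig y) *v push A (fst \<circ> sig) y v)"
 proof (rule smooth_on_cong[OF o, rotated])
  fix z assume z: "z \<in> ?W"
  then have x: "fst (sig z) \<in> fst ?c" and zW: "z \<in> W" by (auto simp: hchart_dom mem_Times_iff)
  have "push A (fst \<circ> sig) z v = from_chart A ?c (fst (sig z)) (dd (snd ?c \<circ> (fst \<circ> sig)) z v)"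
   using push_eq[OF plot_fst[OF ph] zW c(1)] x by simp
  then show "snd ((snd (hchart ?c) \<circ> sig) z) *v dd (snd ?c \<circ> (fst \<circ> sig)) z v = snd (sig z) *v push A (fst \<circ> sig) z v"
   by (simp add: hchart_def case_prod_beta matrix_vector_mul_assoc[symmetric] matrix_from_chart[OF c(1) x])
 qed
 moreover have "y \<in> ?W" using y c by (simp add: hchart_dom mem_Times_iff)
 ultimately show "\<exists>U. open U \<and> y \<in> U \<and> smooth_on U (%y. snd (sig y) *v push A (fst \<circ> sig) y v)" using o by blast
qed

text \<open>Makes \<open>d_form_plot\<close> applicable to \<omega>, so the equation for d\<omega>
  on the bundle can be restricted to sections.\<close>

lemma smooth_tautological_form: "smooth_one_form PA (tautological_form A g)"
 unfolding smooth_one_form_def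
proof (intro conjI ballI allI)
 fix p assume p: "p \<in> carrier PA"
 let ?t = "chart_at PA p"
 note t = chart_at_in[OF p]
 have ci: "chart_inv ?t (snd ?t p) = p" by (rule P.chart_inv_chart[OF t])
 have pl: "plot A (chart_image ?t) (fst \<circ> chart_inv ?t)"
  by (rule plot_fst[OF plot_hom[OF P.plot_chart_inv[OF t(1)]]])
 have "linear (push A (fst \<circ> chart_inv ?t) (snd ?t p))" unfolding push_def
  by (rule linear_dd[OF plotD(4)[OF pl]]) (use chart_at t in \<open>auto simp: ci\<close>)
 moreover have "push A (fst \<circ> chart_inv ?t) (snd ?t p) = tangent_map PA A fst p"
  by (simp add: push_def tangent_map_def ci comp_def)
 ultimately have "linear (%v. snd p *v tangent_map PA A fst p v)"
  using linear_compose[of "tangent_map PA A fst p" "(*v) (snd p)"] bilinear_mv unfolding bilinear_def o_def by auto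
 then show "linear (tautological_form A g p)" by (simp add: tautological_form_def[abs_def])
next
 fix t v assume t: "t \<in> PA"
 note pl = P.plot_chart_inv[OF t]
 show "smooth_on (chart_image t) (%y. one_form_in_chart PA t (tautological_form A g) y v)"
 proof (rule smooth_on_cong[OF P.open_chart_image[OF t] _ smooth_taut[OF pl, of v]])
  fix z assume z: "z \<in> chart_image t"
  then obtain q where q: "q \<in> fst t" "z = snd t q" by blast
  show "snd (chart_inv t z) *v push A (fst \<circ> chart_inv t) z v = one_form_in_chart PA t (tautological_form A g) z v"
   unfolding taut_plot[OF pl z, symmetric]
   using P.form_plot[OF pl z t, of "tautological_form A g" v] q P.tr_self[OF t q(1), of v]
   by (simp add: P.chart_inv_chart[OF t])
 qed
qed

text \<open>Coframes are stored with respect to the chart attached to the point, whereas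
  \<open>s\<close> refers to the chart \<open>c\<close>; the factor \<open>to_chart\<close> converts
  between them.\<close>

definition lift :: "('m, complex^'n) chart => (complex^'n => complex^'n^'n) => complex^'n => 'm \<times> (complex^'n^'n)" where
 "lift c s y = (chart_inv c y, s y ** matrix (to_chart A c (chart_inv c y)))"

lemma chart_inv_in: "y \<in> chart_image c ==> chart_inv c y \<in> fst c" "y \<in> chart_image c ==> snd c (chart_inv c y) = y"
 by (auto simp: inv_into_into f_inv_into_f)

lemma lift_coframe:
 assumes c: "c \<in> A" and s: "frame_on c W s" and y: "y \<in> W"
 shows "lift c s y \<in> coframes g"
proof -
 have yi: "y \<in> chart_image c" using s y by (auto simp: frame_on_def)
 show ?thesis
  unfolding lift_def coframe_gram[OF c chart_inv_in(1)[OF yi]] chart_inv_in(2)[OF yi] matrix_mul_assoc[symmetric]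
   matrix_to_from[OF c chart_inv_in(1)[OF yi]] matrix_mul_rid
  using s y by (simp add: frame_on_def)
qed

lemma plot_lift:
 assumes c: "c \<in> A" and s: "frame_on c W s"
 shows "plot PA W (lift c s)"
proof -
 have W: "open W" "W \<subseteq> chart_image c" "smooth_on W s" using s by (auto simp: frame_on_def)
 have hc: "hchart c \<in> hom_atlas A" using c by (simp add: hom_atlas_hchart)
 have eq: "snd (hchart c) (lift c s y) = (y, s y)" if "y \<in> W" for y
  using that W(2) chart_inv_in[of y c]
  by (auto simp: lift_def hchart_apply matrix_mul_assoc[symmetric] matrix_to_from[OF c] matrix_mul_rid)
 have sm: "smooth_on W (snd (hchart c) \<circ> lift c s)"
  by (rule smooth_on_cong[OF W(1) _ smooth_on_Pair[OF W(1) smooth_on_id[OF W(1)] W(3)]]) (simp add: eq)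
 have im: "lift c s ` W \<subseteq> coframes g" "lift c s ` W \<subseteq> fst (hchart c)"
  using lift_coframe[OF c s] chart_inv_in(1)[OF subsetD[OF W(2)]] by (auto simp: hchart_dom lift_def)
 show ?thesis
  unfolding plot_def carrier_PA using W(1) im(1) plot_submanifold[OF hom_smooth_atlas W(1) im(1) hc im(2) sm]
  unfolding coframe_atlas_def by blast
qed

lemma taut_lift:
 assumes c: "c \<in> A" and s: "frame_on c W s" and y: "y \<in> W"
 shows "tautological_form A g (lift c s y) (push PA (lift c s) y v) = s y *v v"
proof -
 have W: "open W" "W \<subseteq> chart_image c" using s by (auto simp: frame_on_def)
 have yi: "y \<in> chart_image c" using W y by blast
 note x = chart_inv_in[OF yi]
 note pl = plot_lift[OF c s]
 have "push A (fst \<circ> lift c s) y v = from_chart A c (chart_inv c y) (dd (snd c \<circ> (fst \<circ> lift c s)) y v)"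
  using push_eq[OF plot_fst[OF plot_hom[OF pl]] y c, of v] x by (simp add: lift_def)
 also have "dd (snd c \<circ> (fst \<circ> lift c s)) y v = v"
 proof -
  have "(snd c \<circ> (fst \<circ> lift c s) has_derivative (%v. v)) (at y)"
   by (rule has_derivative_transform_within_open[OF has_derivative_ident W(1) y])
    (simp add: lift_def chart_inv_in(2)[OF subsetD[OF W(2)]])
  then show ?thesis by (simp add: dd_eqI)
 qed
 finally have e: "push A (fst \<circ> lift c s) y v = from_chart A c (chart_inv c y) v" .
 show ?thesis
  unfolding taut_plot[OF pl y] e
  by (simp add: lift_def matrix_vector_mul_assoc[symmetric] matrix_to_chart[OF c x(1)] to_from_chart[OF c x(1)])
qed

end

locale bochner = kaehler_manifold A g \<Omega>
 for A :: "('m::{t2_space,second_countable_topology}, complex^'n) chart set" and g \<Omega> +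
 fixes \<phi> H T V
 assumes bk: "bochner_kaehler A g \<Omega> \<phi> H T V"
begin

definition conn :: "('m, complex^'n) chart => (complex^'n => complex^'n^'n) => complex^'n => complex^'n => complex^'n^'n" where
 "conn c s y v = \<phi> (lift c s y) (push PA (lift c s) y v)"

text \<open>Exterior derivatives and differentials commute with restriction to the section, and
  \<open>taut_lift\<close> identifies \<omega> there with \<open>s y *v v\<close>; every equation of
  \<open>bochner_kaehler\<close> thus becomes one of \<open>bk_local\<close>.\<close>

theorem frame_bk_local:
 assumes c: "c \<in> A" and s: "frame_on c W s"
 shows "bk_local W s (conn c s) (H \<circ> lift c s) (T \<circ> lift c s) (V \<circ> lift c s)"
proof -
 let ?w = "tautological_form A g" let ?l = "lift c s" let ?p = "push PA ?l"
 note B = bk[unfolded bochner_kaehler_def connection_form_def Let_def]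
 have W: "open W" "smooth_on W s" using s by (auto simp: frame_on_def)
 note pl = plot_lift[OF c s] note tl = taut_lift[OF c s] note lc = lift_coframe[OF c s]
 have \<phi>: "smooth_one_form PA \<phi>" and H: "smooth_fun PA H" and T: "smooth_fun PA T" and V: "smooth_fun PA V" using B by blast+
 have sv: "dd (%y. s y *v w) y v = dd s y v *v w" if "y \<in> W" for y v w
 proof -
  have "linear (%m :: complex^'n^'n. m *v w)" by (rule linear_mv)
  from dd_eqI[OF hd_linear[OF this smooth_dd[OF W(2) that]]] show ?thesis by simp
 qed
 show ?thesis
 proof (rule bk_local.intro)
  show "smooth_on W (%y. conn c s y v)" for v unfolding conn_def by (rule P.smooth_form_plot[OF \<phi> pl])
  show "smooth_on W (H \<circ> ?l)" "smooth_on W (T \<circ> ?l)" "smooth_on W (V \<circ> ?l)"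
   using P.smooth_fun_plot[OF H pl] P.smooth_fun_plot[OF T pl] P.smooth_fun_plot[OF V pl] .
  fix y assume y: "y \<in> W"
  show "invertible (s y)" by (rule frame_invertible[OF c s y])
  show "linear (conn c s y)" using P.linear_form_plot[OF \<phi> pl y] by (simp add: conn_def[abs_def])
  fix v w
  show "adj (conn c s y v) = - conn c s y v" unfolding conn_def using B lc[OF y] by blast
  have "dd (%y. ?w (?l y) (?p y w)) y v - dd (%y. ?w (?l y) (?p y v)) y w = - wedge (*v) (\<phi> (?l y)) (?w (?l y)) (?p y v) (?p y w)"
   unfolding P.d_form_plot[OF smooth_tautological_form pl y] using B lc[OF y] by blast
  moreover have "dd (%y. ?w (?l y) (?p y u)) y x = dd s y x *v u" for u x
   using dd_cong[OF W(1) y, of "%y. ?w (?l y) (?p y u)" "%y. s y *v u"] tl sv[OF y] by simp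
  ultimately show "dd s y v *v w - dd s y w *v v = - (conn c s y v *v (s y *v w) - conn c s y w *v (s y *v v))"
   by (simp add: wedge_def conn_def tl[OF y])
  show "dd (%y. conn c s y w) y v - dd (%y. conn c s y v) y w =
    - (conn c s y v ** conn c s y w - conn c s y w ** conn c s y v) + bk_curv ((H \<circ> ?l) y) (s y *v v) (s y *v w)"
  proof -
   have "d_one_form PA \<phi> (?l y) (?p y v) (?p y w) =
      - wedge (**) (\<phi> (?l y)) (\<phi> (?l y)) (?p y v) (?p y w)
      + mat (wedge hdot (?w (?l y)) (?w (?l y)) (?p y v) (?p y w)) ** H (?l y)
      - H (?l y) ** wedge houter (?w (?l y)) (?w (?l y)) (?p y v) (?p y w)
      - wedge houter (?w (?l y)) (?w (?l y)) (?p y v) (?p y w) ** H (?l y)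
      + mat (wedge hdot (?w (?l y)) (%a. H (?l y) *v ?w (?l y) a) (?p y v) (?p y w))
      + mat (trace (H (?l y))) **
        (mat (wedge hdot (?w (?l y)) (?w (?l y)) (?p y v) (?p y w)) - wedge houter (?w (?l y)) (?w (?l y)) (?p y v) (?p y w))"
    using B lc[OF y] by blast
   then show ?thesis
    unfolding conn_def P.d_form_plot[OF \<phi> pl y] by (simp add: wedge_def tl[OF y] bk_curv_def algebra_simps)
  qed
  show "adj ((H \<circ> ?l) y) = (H \<circ> ?l) y" using B lc[OF y] by simp
  have "differential PA H (?l y) (?p y v) =
      - (\<phi> (?l y) (?p y v) ** H (?l y)) + H (?l y) ** \<phi> (?l y) (?p y v) + houter (T (?l y)) (?w (?l y) (?p y v)) + houter (?w (?l y) (?p y v)) (T (?l y))"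
   using B lc[OF y] by blast
  then show "dd (H \<circ> ?l) y v = - (conn c s y v ** (H \<circ> ?l) y) + (H \<circ> ?l) y ** conn c s y v
    + houter ((T \<circ> ?l) y) (s y *v v) + houter (s y *v v) ((T \<circ> ?l) y)"
   unfolding P.smooth_fun_derivative[OF H pl y] by (simp add: conn_def tl[OF y])
  have "differential PA T (?l y) (?p y v) = - (\<phi> (?l y) (?p y v) *v T (?l y))
    + (mat_power (H (?l y)) 2 + mat (trace (H (?l y))) ** H (?l y) + mat (complex_of_real (V (?l y)))) *v ?w (?l y) (?p y v)"
   using B lc[OF y] by blast
  then show "dd (T \<circ> ?l) y v = - (conn c s y v *v (T \<circ> ?l) y) +
    (mat_power ((H \<circ> ?l) y) 2 + mat (trace ((H \<circ> ?l) y)) ** (H \<circ> ?l) y + mat (complex_of_real ((V \<circ> ?l) y))) *v (s y *v v)"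
   unfolding P.smooth_fun_derivative[OF T pl y] by (simp add: conn_def tl[OF y])
  have "complex_of_real (differential PA V (?l y) (?p y v)) =
      trace (H (?l y)) * (hdot (T (?l y)) (?w (?l y) (?p y v)) + hdot (?w (?l y) (?p y v)) (T (?l y)))
      + (hdot (T (?l y)) (H (?l y) *v ?w (?l y) (?p y v)) + hdot (?w (?l y) (?p y v)) (H (?l y) *v T (?l y)))"
   using B lc[OF y] by blast
  then show "complex_of_real (dd (V \<circ> ?l) y v) = trace ((H \<circ> ?l) y) * (hdot ((T \<circ> ?l) y) (s y *v v) + hdot (s y *v v) ((T \<circ> ?l) y))
    + (hdot ((T \<circ> ?l) y) ((H \<circ> ?l) y *v (s y *v v)) + hdot (s y *v v) ((H \<circ> ?l) y *v (T \<circ> ?l) y))"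
   unfolding P.smooth_fun_derivative[OF V pl y] by (simp add: tl[OF y])
 qed (use W in auto)
qed

end

section \<open>The fields \<open>Z\<^sub>k\<close> and the moduli map on the manifold\<close>

text \<open>The components of \<open>moduli_map\<close> as functions of the values of H, T and V.
  Index \<open>j < n\<close> is the component A with subscript j + 1, index n is V, and
  \<open>j > n\<close> is the component B with subscript j - n + 2, hence with exponent j - n -
  1.\<close>

definition mod_comp :: "complex^'n^'n => complex^'n => real => nat => real" where
 "mod_comp h t v j = (if j < CARD('n) then Re (trace (mat_power h (Suc j))) else if j = CARD('n) then v
   else Re (hdot t (mat_power h (j - CARD('n) - 1) *v t)))"

definition (in kaehler_manifold) herm_chart :: "('m, complex^'n) chart => complex^'n => complex^'n => complex^'n => complex" where
 "herm_chart c y v w = hdot v (gram c y *v w)"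

context bochner
begin

section \<open>Equivariance and the global fields\<close>

lemma lift_through:
 assumes c: "c \<in> A" and x: "x \<in> fst c" and u: "(x, u) \<in> coframes g"
 obtains W s where "frame_on c W s" "snd c x \<in> W" "lift c s (snd c x) = (x, u)"
proof -
 let ?u = "u ** matrix (from_chart A c x)"
 have 1: "adj ?u ** ?u = gram c (snd c x)" using coframe_gram[OF c x] u by blast
 obtain W s where s: "frame_on c W s" "snd c x \<in> W" "s (snd c x) = ?u"
  by (rule frame_through[OF c imageI[OF x] 1])
 have "lift c s (snd c x) = (x, u)"
  by (simp add: lift_def s(3) chart_inv_chart[OF c x] matrix_mul_assoc[symmetric] matrix_from_to[OF c x] matrix_mul_rid)
 with s that show ?thesis by blast
qed

lemma coframe_exists: obtains u where "(x, u) \<in> coframes g"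
proof -
 note c = chart_at[of x]
 obtain W s where s: "frame_on (chart_at A x) W s" "snd (chart_at A x) x \<in> W"
  by (rule frame_exists[OF c(1) imageI[OF c(2)]])
 show ?thesis using lift_coframe[OF c(1) s] that by (simp add: lift_def chart_inv_chart[OF c])
qed

lemma coframes_unitary:
 assumes "(x, u) \<in> coframes g" "(x, u') \<in> coframes g"
 obtains a where "adj a ** a = mat 1" "u' = a ** u"
proof -
 let ?a = "u' ** matrix_inv u"
 note i = coframe_invertible[OF assms(1)]
 have 1: "?a ** u = u'" by (simp add: matrix_mul_assoc[symmetric] matrix_inv_left[OF i] matrix_mul_rid)
 have "adj ?a ** ?a = mat 1"
 proof (rule matrix_eqI, rule hdot_eqI)
  fix v w
  obtain v' w' where v: "u *v v' = v" and w: "u *v w' = w" using invertible_surj[OF i] by metis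
  have "hdot (u' *v w') (u' *v v') = hdot (u *v w') (u *v v')" using assms coframe_iff by metis
  moreover have "u' *v (matrix_inv u *v (u *v z)) = u' *v z" for z
   by (simp only: matrix_vector_mul_assoc matrix_mul_assoc[symmetric] matrix_inv_left[OF i] matrix_mul_rid)
  ultimately show "hdot w ((adj ?a ** ?a) *v v) = hdot w (mat 1 *v v)"
   unfolding v[symmetric] w[symmetric] matrix_vector_mul_assoc[symmetric] adjoint_matrix_mult hdot_matrix[symmetric]
   by (simp add: hdot_matrix[symmetric])
 qed
 with 1 that show ?thesis by metis
qed

text \<open>If \<open>s\<close> is a frame through the given coframe, \<open>a ** s\<close> is one
  through the rotated coframe. Its structure functions are also described by
  \<open>bk_local_gauge\<close>, and uniqueness equates the two descriptions.\<close>

lemma equivariance: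
 assumes u: "(x, u) \<in> coframes g" and a: "adj a ** a = mat 1"
 shows "H (x, a ** u) = a ** H (x, u) ** adj a" "T (x, a ** u) = a *v T (x, u)" "V (x, a ** u) = V (x, u)"
proof -
 let ?c = "chart_at A x"
 note c = chart_at[of x]
 obtain W s where s: "frame_on ?c W s" "snd ?c x \<in> W" "lift ?c s (snd ?c x) = (x, u)"
  by (rule lift_through[OF c u])
 let ?s = "%y. a ** s y"
 have W: "open W" using s by (simp add: frame_on_def)
 have "adj (?s y) ** ?s y = adj (s y) ** s y" for y
  by (simp only: adjoint_matrix_mult matrix_mul_assoc[symmetric] unitary_cancel[OF a])
 moreover have "smooth_on W ?s"
  using s by (intro smooth_on_bilinear[OF W bilinear_mm] smooth_on_const) (simp add: frame_on_def)
 ultimately have s': "frame_on ?c W ?s" using s by (simp add: frame_on_def)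
 have "s (snd ?c x) ** matrix (to_chart A ?c x) = u" using s(3) by (simp add: lift_def chart_inv_chart[OF c])
 then have l: "lift ?c ?s (snd ?c x) = (x, a ** u)" by (simp add: lift_def matrix_mul_assoc[symmetric] chart_inv_chart[OF c])
 note e = bk_local_unique[OF frame_bk_local[OF c(1) s'] bk_local_gauge[OF frame_bk_local[OF c(1) s(1)] a] s(2), unfolded o_apply l s(3)]
 show "H (x, a ** u) = a ** H (x, u) ** adj a" "T (x, a ** u) = a *v T (x, u)" "V (x, a ** u) = V (x, u)"
  using e by blast+
qed

lemma Smat_conj:
 fixes a :: "complex^'n^'n"
 assumes a: "adj a ** a = mat 1" and k: "k \<le> CARD('n)"
 shows "Smat (a ** h ** adj a) k = a ** Smat h k ** adj a"
proof -
 have E: "Ecoef (a ** h ** adj a) j = Ecoef h j" if "j \<le> CARD('n)" for j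
  by (rule Ecoef_determined[OF _ that]) (simp add: mat_power_conj[OF a] trace_conj[OF a])
 have l: "linear (%m. a ** m ** adj a)"
  using linear_compose[of "(**) a" "%m. m ** adj a"] bilinear_mm unfolding bilinear_def o_def by blast
 show ?thesis
  unfolding Smat_sum linear_sum[OF l]
  by (rule sum.cong[OF refl]) (use k in \<open>simp add: E mat_power_conj[OF a]\<close>, simp add: matrix_mul_assoc[symmetric] mat_left_commute)
qed

text \<open>\<open>Zf k\<close> is the field with subscript k + 2. An arbitrary coframe is used at
  each point; equivariance makes the result independent of it.\<close>

definition Zf :: "nat => 'm => complex^'n" where
 "Zf k x = (let u = (SOME u. (x, u) \<in> coframes g) in matrix_inv u *v z_fun H T k (x, u))"

lemma Zf_coframe:
 assumes u: "(x, u) \<in> coframes g" and k: "k \<le> CARD('n)"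
 shows "u *v Zf k x = z_fun H T k (x, u)"
proof -
 define u0 where "u0 = (SOME u. (x, u) \<in> coframes g)"
 have u0: "(x, u0) \<in> coframes g" unfolding u0_def by (rule someI[where P = "%u. (x, u) \<in> coframes g", OF u])
 obtain a where a: "adj a ** a = mat 1" "u = a ** u0" by (rule coframes_unitary[OF u0 u])
 have "u0 *v Zf k x = z_fun H T k (x, u0)"
  unfolding Zf_def u0_def[symmetric] Let_def matrix_vector_mul_assoc matrix_inv_right[OF coframe_invertible[OF u0]] by simp
 then have "u *v Zf k x = a *v z_fun H T k (x, u0)" by (simp add: a(2) matrix_vector_mul_assoc[symmetric])
 also have "\<dots> = z_fun H T k (x, u)"
  unfolding a(2) z_fun_Smat equivariance[OF u0 a(1)] Smat_conj[OF a(1) k] matrix_vector_mul_assoc[symmetric] unitary_cancel[OF a(1)] mv_smult ..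
 finally show ?thesis .
qed

lemma represents_Zf: "k \<le> CARD('n) ==> represents g (Zf k) (z_fun H T k)"
 unfolding represents_def using Zf_coframe by (auto simp: split_beta)

lemma mod_comp_coframe:
 assumes u: "(x, u) \<in> coframes g"
 shows "moduli_map g H T V x $ i = mod_comp (H (x, u)) (T (x, u)) (V (x, u)) (nat (Rep_bit1 i))"
proof -
 define p where "p = (SOME p. p \<in> coframes g \<and> fst p = x)"
 have p: "p \<in> coframes g \<and> fst p = x" unfolding p_def by (rule someI[of _ "(x, u)"]) (use u in simp)
 then obtain u0 where u0: "p = (x, u0)" "(x, u0) \<in> coframes g" by (metis prod.collapse)
 obtain a where a: "adj a ** a = mat 1" "u = a ** u0" by (rule coframes_unitary[OF u0(2) u])
 have "mod_comp (H (x, u)) (T (x, u)) (V (x, u)) j = mod_comp (H p) (T p) (V p) j" for j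
  unfolding mod_comp_def a(2) equivariance[OF u0(2) a(1)] u0(1) mat_power_conj[OF a(1)] trace_conj[OF a(1)]
  by (simp add: matrix_vector_mul_assoc[symmetric] unitary_cancel[OF a(1)] hdot_unitary[OF a(1)])
 moreover have "moduli_map g H T V x $ i = mod_comp (H p) (T p) (V p) (nat (Rep_bit1 i))"
  unfolding moduli_map_def p_def[symmetric] by (auto simp: Let_def mod_comp_def A_inv_def B_inv_def numeral_3_eq_3)
 ultimately show ?thesis by simp
qed

lemma Zf_lift:
 assumes c: "c \<in> A" and s: "frame_on c W s" and y: "y \<in> W" and k: "k \<le> CARD('n)"
 shows "field_in_chart A c (Zf k) y = matrix_inv (s y) *v bk_local.zc (H \<circ> lift c s) (T \<circ> lift c s) k y"
  "s y *v field_in_chart A c (Zf k) y = z_fun H T k (lift c s y)"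
proof -
 interpret L: bk_local W s "conn c s" "H \<circ> lift c s" "T \<circ> lift c s" "V \<circ> lift c s" by (rule frame_bk_local[OF c s])
 have yi: "y \<in> chart_image c" using s y by (auto simp: frame_on_def)
 have "(s y ** matrix (to_chart A c (chart_inv c y))) *v Zf k (chart_inv c y) = z_fun H T k (lift c s y)"
  using Zf_coframe[OF _ k] lift_coframe[OF c s y] by (simp add: lift_def)
 then show 1: "s y *v field_in_chart A c (Zf k) y = z_fun H T k (lift c s y)"
  by (simp add: field_in_chart_def matrix_vector_mul_assoc[symmetric] matrix_to_chart[OF c chart_inv_in(1)[OF yi]])
 have "z_fun H T k (lift c s y) = L.zc k y" by (simp add: L.zc_def z_fun_Smat)
 then show "field_in_chart A c (Zf k) y = matrix_inv (s y) *v L.zc k y"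
  using arg_cong[OF 1, of "(*v) (matrix_inv (s y))"] by (simp add: matrix_vector_mul_assoc matrix_inv_left[OF L.inv_s[OF y]])
qed

lemma smooth_Zf:
 assumes k: "k \<le> CARD('n)"
 shows "smooth_field A (Zf k)"
 unfolding smooth_field_def
proof (intro ballI smooth_on_local)
 fix c y assume c: "c \<in> A" and y: "y \<in> chart_image c"
 obtain W s where s: "frame_on c W s" "y \<in> W" by (rule frame_exists[OF c y])
 interpret L: bk_local W s "conn c s" "H \<circ> lift c s" "T \<circ> lift c s" "V \<circ> lift c s" by (rule frame_bk_local[OF c s(1)])
 have "smooth_on W (%y. matrix_inv (s y) *v L.zc k y)"
  by (intro smooth_on_bilinear[OF L.open_W bilinear_mv] smooth_on_matrix_inv L.open_W L.smooth_s L.inv_s L.smooth_zc k)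
 then have "smooth_on W (field_in_chart A c (Zf k))"
  by (rule smooth_on_cong[OF L.open_W, rotated]) (rule Zf_lift(1)[OF c s(1) _ k, symmetric])
 then show "\<exists>U. open U \<and> y \<in> U \<and> smooth_on U (field_in_chart A c (Zf k))" using L.open_W s by blast
qed

lemma lie_zero_cong:
 assumes "open W" "y \<in> W" "\<And>z v w. z \<in> W ==> h z v w = h' z v w" "\<And>z. z \<in> W ==> X z = X' z"
 shows "lie_zero h X y \<longleftrightarrow> lie_zero h' X' y"
proof -
 have "dd X y = dd X' y" "dd (%z. h z v w) y = dd (%z. h' z v w) y" for v w
  by (rule dd_cong[OF assms(1,2)], simp add: assms)+
 then show ?thesis by (simp add: lie_zero_def assms(3,4)[OF assms(2)])
qed

lemma lie_zero_Zf:
 assumes k: "k \<le> CARD('n)" and c: "c \<in> A" and y: "y \<in> chart_image c"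
 shows "lie_zero (herm_chart c) (field_in_chart A c (Zf k)) y"
proof -
 obtain W s where s: "frame_on c W s" "y \<in> W" by (rule frame_exists[OF c y])
 interpret L: bk_local W s "conn c s" "H \<circ> lift c s" "T \<circ> lift c s" "V \<circ> lift c s" by (rule frame_bk_local[OF c s(1)])
 have he: "hdot (s z *v v) (s z *v w) = herm_chart c z v w" if "z \<in> W" for z v w
  using s(1) that by (simp add: herm_chart_def frame_on_def hdot_matrix matrix_vector_mul_assoc)
 have "lie_zero (%y v w. hdot (s y *v v) (s y *v w)) (%y. matrix_inv (s y) *v L.zc k y) y
  \<longleftrightarrow> lie_zero (herm_chart c) (field_in_chart A c (Zf k)) y"
  by (rule lie_zero_cong[OF L.open_W s(2)]) (simp_all add: he Zf_lift(1)[OF c s(1) _ k])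
 then show ?thesis using L.zc_lie_zero[OF s(2) k] by blast
qed

text \<open>In a frame the fields are, up to the common factor \<open>2 * \<i>\<close> and signs,
  real combinations of the vectors H^j T, whose mutual products are real because H is
  Hermitian.\<close>

lemma Zf_isotropic:
 assumes j: "j \<le> CARD('n)" and k: "k \<le> CARD('n)"
 shows "Im (herm x (Zf j x) (Zf k x)) = 0"
proof -
 obtain u where u: "(x, u) \<in> coframes g" by (rule coframe_exists)
 note c = chart_at[of x]
 obtain W s where s: "frame_on (chart_at A x) W s" "snd (chart_at A x) x \<in> W" "lift (chart_at A x) s (snd (chart_at A x) x) = (x, u)"
  by (rule lift_through[OF c u])
 interpret L: bk_local W s "conn (chart_at A x) s" "H \<circ> lift (chart_at A x) s" "T \<circ> lift (chart_at A x) s" "V \<circ> lift (chart_at A x) s"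
  by (rule frame_bk_local[OF c(1) s(1)])
 let ?y = "snd (chart_at A x) x" let ?S = "%j. Smat (H (x, u)) j *v T (x, u)"
 have "Im (hdot (L.xc i ?y) (?S k)) = 0" for i
 proof -
  have "Im (Ecoef (H (x, u)) m * hdot (L.xc i ?y) (L.xc (k - m) ?y)) = 0" if "m \<le> k" for m
   unfolding L.xc_hdot[OF s(2)] using L.Ecoef_Re[OF s(2), of m] L.hdot_T_xc_real[OF s(2), of "i + (k - m)"] that k s(3)
   by (simp add: complex_eq_iff)
  then show ?thesis
   using L.ST_xc[of ?y k] s(3) by (simp add: linear_sum[OF linear_hdot(1)] Im_sum hdot_simps)
 qed
 then have r: "Im (hdot (?S k) (L.xc i ?y)) = 0" for i
  using arg_cong[OF hdot_cnj[of "L.xc i ?y" "?S k"], of Im] by simp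
 have "Im (hdot (?S k) (?S j)) = 0"
 proof -
  have "Im (Ecoef (H (x, u)) m * hdot (?S k) (L.xc (j - m) ?y)) = 0" if "m \<le> j" for m
   using L.Ecoef_Re[OF s(2), of m] r[of "j - m"] that j s(3) by (simp add: complex_eq_iff)
  moreover have "?S j = (\<Sum>m\<le>j. Ecoef (H (x, u)) m *s L.xc (j - m) ?y)" using L.ST_xc[of ?y j] s(3) by simp
  ultimately show ?thesis by (simp add: linear_sum[OF linear_hdot(1)] Im_sum hdot_simps del: Smat.simps)
 qed
 then have "Im (hdot (?S j) (?S k)) = 0" using arg_cong[OF hdot_cnj[of "?S k" "?S j"], of Im] by simp
 moreover have "herm x (Zf j x) (Zf k x) = hdot (z_fun H T j (x, u)) (z_fun H T k (x, u))"
  using u coframe_iff Zf_coframe[OF u j] Zf_coframe[OF u k] by metis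
 \<comment> \<open>Conjugation of the first prefactor makes the product of both real.\<close>
 moreover have "Im (hdot ((2 * \<i> * (-1) ^ j) *s v) ((2 * \<i> * (-1) ^ k) *s w)) = 4 * (-1) ^ j * (-1) ^ k * Im (hdot v w)" for v w :: "complex^'n"
  by (cases "even j"; cases "even k") (simp_all add: hdot_simps)
 ultimately show ?thesis by (simp add: z_fun_Smat)
qed

text \<open>Uniqueness of the structure functions makes everything natural under local holomorphic isometries.\<close>
lemma local_isometry:
 assumes c: "c \<in> A" and d: "d \<in> A" and W: "open W" "W \<subseteq> chart_image c" and psi: "holo_on W psi" "psi ` W \<subseteq> chart_image d"
  and iso: "\<And>y v w. y \<in> W ==> herm_chart d (psi y) (dd psi y v) (dd psi y w) = herm_chart c y v w" and y: "y \<in> W"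
 shows "k \<le> CARD('n) ==> field_in_chart A d (Zf k) (psi y) = dd psi y (field_in_chart A c (Zf k) y)"
  "moduli_map g H T V (chart_inv d (psi y)) = moduli_map g H T V (chart_inv c y)"
proof -
 have psiy: "psi y \<in> chart_image d" using psi(2) y by blast
 obtain U s where s: "frame_on d U s" "psi y \<in> U" by (rule frame_exists[OF d psiy])
 have U: "open U" "U \<subseteq> chart_image d" "smooth_on U s" "\<And>z. z \<in> U ==> adj (s z) ** s z = gram d z"
  using s(1) by (auto simp: frame_on_def)
 let ?W = "W \<inter> psi -` U"
 have oW: "open ?W" by (rule continuous_open_preimage[OF holo_on_continuous[OF psi(1)] W(1) U(1)])
 have yW: "y \<in> ?W" using y s by simp
 have h: "holo_on ?W psi" by (rule holo_on_subset[OF psi(1)]) auto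
 note sm = holo_on_smooth_on[OF h oW]
 \<comment> \<open>The pulled-back frame is unitary for the chart \<open>c\<close> because
   \<open>psi\<close> is an isometry. Its structure functions are therefore those of a frame over
   \<open>c\<close> and, by \<open>bk_local_pullback\<close>, also those of \<open>s\<close>
   composed with \<open>psi\<close>.\<close>
 let ?s = "%y. s (psi y) ** matrix (dd psi y)"
 have mat: "matrix (dd psi z) *v v = dd psi z v" if "z \<in> ?W" for z v
  by (rule matrix_works_holo[OF holo_onE(2)[OF h that] linear_dd[OF sm that]])
 have ss: "adj (?s z) ** ?s z = gram c z" if z: "z \<in> ?W" for z
 proof (rule matrix_eqI, rule hdot_eqI)
  fix v w
  have "hdot w ((adj (?s z) ** ?s z) *v v) = hdot (dd psi z w) ((adj (s (psi z)) ** s (psi z)) *v dd psi z v)"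
   unfolding matrix_vector_mul_assoc[symmetric] hdot_matrix[symmetric] mat[OF z] ..
  then show "hdot w ((adj (?s z) ** ?s z) *v v) = hdot w (gram c z *v v)"
   using iso[of z w v] z U(4)[of "psi z"] by (simp add: herm_chart_def)
 qed
 have inj: "inj (dd psi z)" if z: "z \<in> ?W" for z
 proof -
  note l = linear_dd[OF sm z]
  have "v = 0" if "dd psi z v = 0" for v
  proof (rule ccontr)
   assume "v \<noteq> 0"
   then have "0 < Re (herm_chart c z v v)" using gram_pos[OF c, of z v] z W(2) by (auto simp: herm_chart_def)
   then show False using iso[of z v v] z that by (simp add: herm_chart_def hdot_simps)
  qed
  then show ?thesis using linear_injective_0[OF l] by blast
 qed
 have s': "frame_on c ?W ?s"
  unfolding frame_on_def using oW W(2) ss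
  by (auto intro!: smooth_on_bilinear[OF oW bilinear_mm] smooth_on_compose[OF oW U(1,3) sm] smooth_on_matrix_derivative[OF oW sm])
 have im: "psi ` ?W \<subseteq> U" by auto
 note e = bk_local_unique[OF frame_bk_local[OF c s'] bk_local_pullback[OF frame_bk_local[OF d s(1)] oW h im inj] yW]
 have H: "H (lift c ?s y) = H (lift d s (psi y))" and T: "T (lift c ?s y) = T (lift d s (psi y))" and V: "V (lift c ?s y) = V (lift d s (psi y))"
  using e by auto
 show "field_in_chart A d (Zf k) (psi y) = dd psi y (field_in_chart A c (Zf k) y)" if k: "k \<le> CARD('n)"
 proof (rule invertible_cancel[OF frame_invertible[OF d s]])
  have "?s y *v field_in_chart A c (Zf k) y = s (psi y) *v field_in_chart A d (Zf k) (psi y)"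
   unfolding Zf_lift(2)[OF c s' yW k] Zf_lift(2)[OF d s k] z_fun_Smat H T ..
  then show "s (psi y) *v field_in_chart A d (Zf k) (psi y) = s (psi y) *v dd psi y (field_in_chart A c (Zf k) y)"
   by (simp add: matrix_vector_mul_assoc[symmetric] mat[OF yW])
 qed
 have "moduli_map g H T V (chart_inv d (psi y)) $ i = moduli_map g H T V (chart_inv c y) $ i" for i
  using mod_comp_coframe[of "chart_inv d (psi y)" "snd (lift d s (psi y))" i] mod_comp_coframe[of "chart_inv c y" "snd (lift c ?s y)" i]
   lift_coframe[OF c s' yW] lift_coframe[OF d s] H T V by (simp add: lift_def)
 then show "moduli_map g H T V (chart_inv d (psi y)) = moduli_map g H T V (chart_inv c y)" by (simp add: vec_eq_iff)
qed

section \<open>The differential of the moduli map and the span of the fields at a point\<close>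

lemma moduli_lift:
 assumes c: "c \<in> A" and s: "frame_on c W s" and y: "y \<in> W"
 shows "(moduli_map g H T V \<circ> chart_inv c) y $ i = mod_comp (H (lift c s y)) (T (lift c s y)) (V (lift c s y)) (nat (Rep_bit1 i))"
 using mod_comp_coframe[of "chart_inv c y" "snd (lift c s y)" i] lift_coframe[OF c s y] by (simp add: lift_def)

lemma moduli_kernel:
 assumes c: "c \<in> A" and s: "frame_on c W s" and y: "y \<in> W"
 shows "((moduli_map g H T V \<circ> chart_inv c) has_derivative dd (moduli_map g H T V \<circ> chart_inv c) y) (at y)"
  "dd (moduli_map g H T V \<circ> chart_inv c) y v = 0 \<longleftrightarrow> (\<forall>k<CARD('n). Im (hdot (z_fun H T k (lift c s y)) (s y *v v)) = 0)"
proof -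
 interpret L: bk_local W s "conn c s" "H \<circ> lift c s" "T \<circ> lift c s" "V \<circ> lift c s" by (rule frame_bk_local[OF c s])
 let ?f = "moduli_map g H T V \<circ> chart_inv c"
 let ?m = "%j y. mod_comp (H (lift c s y)) (T (lift c s y)) (V (lift c s y)) j"
 have x0: "L.xc 0 = T \<circ> lift c s" by (simp add: L.xc_def fun_eq_iff matrix_vector_mul_lid)
 have mj: "?m j = (if j < CARD('n) then (%y. Re (trace (mat_power ((H \<circ> lift c s) y) (Suc j)))) else if j = CARD('n) then V \<circ> lift c s
   else (%y. Re (hdot ((T \<circ> lift c s) y) (L.xc (j - CARD('n) - 1) y))))" for j
  by (auto simp: fun_eq_iff mod_comp_def L.xc_def)
 have dif: "(?m j has_derivative dd (?m j) y) (at y)" for j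
 proof (rule smooth_dd[OF _ y])
  show "smooth_on W (?m j)" unfolding mj
   using smooth_on_linear_comp[OF L.open_W linear_Re L.smooth_trace_power, of "Suc j"] L.smooth_V
    smooth_on_linear_comp[OF L.open_W linear_Re smooth_on_bilinear[OF L.open_W bilinear_hdot L.smooth_T L.smooth_xc], of "j - CARD('n) - 1"]
   by simp
 qed
 let ?D = "%v. \<chi> i. dd (?m (nat (Rep_bit1 i))) y v"
 have D: "(?f has_derivative ?D) (at y)"
 proof (rule has_derivative_vec)
  fix i
  show "((%y. ?f y $ i) has_derivative (%v. ?D v $ i)) (at y)"
   by (rule has_derivative_transform_within_open[OF _ L.open_W y])
    (use dif[of "nat (Rep_bit1 i)"] moduli_lift[OF c s] in simp_all)
 qed
 then show "(?f has_derivative dd ?f y) (at y)" by (simp add: dd_eqI)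
 have "dd ?f y v = 0 \<longleftrightarrow> (\<forall>j<CARD('n). Re (hdot (L.xc j y) (s y *v v)) = 0)"
 proof
  assume 0: "dd ?f y v = 0"
  show "\<forall>j<CARD('n). Re (hdot (L.xc j y) (s y *v v)) = 0"
  proof (intro allI impI)
   fix j assume j: "j < CARD('n)"
   have "Rep_bit1 (Abs_bit1 (int j) :: 'n bit1) = int j" using j by (intro Abs_bit1_inverse) auto
   then have "dd (?m j) y v = 0"
    using arg_cong[OF 0, of "%w. w $ Abs_bit1 (int j)"] dd_eqI[OF D] by simp
   moreover have "dd (?m j) y v = 2 * real (Suc j) * Re (hdot (L.xc j y) (s y *v v))"
    using dd_eqI[OF L.derivative_A[OF y, of j]] j by (simp add: mj)
   ultimately show "Re (hdot (L.xc j y) (s y *v v)) = 0" by simp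
  qed
 next
  assume N0: "\<forall>j<CARD('n). Re (hdot (L.xc j y) (s y *v v)) = 0"
  have N: "Re (hdot (L.xc j y) (s y *v v)) = 0" for j by (rule L.xc_all[OF y N0[rule_format]])
  have 1: "dd (%y. Re (trace (mat_power ((H \<circ> lift c s) y) (Suc j)))) y v = 0" for j
   unfolding dd_eqI[OF L.derivative_A[OF y]] N by simp
  have 2: "dd (V \<circ> lift c s) y v = 0" unfolding L.derivative_V[OF y] N by simp
  have "dd (?m j) y v = 0" for j
  proof -
   consider "?m j = (%y. Re (trace (mat_power ((H \<circ> lift c s) y) (Suc j))))" | "?m j = V \<circ> lift c s"
    | "?m j = (%y. Re (hdot ((T \<circ> lift c s) y) (L.xc (j - CARD('n) - 1) y)))"
    unfolding mj by presburger
   then show ?thesis using 1[of j] 2 L.derivative_B[OF y N, of "j - CARD('n) - 1"] by cases (simp_all only:)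
  qed
  then show "dd ?f y v = 0" unfolding dd_eqI[OF D] by (simp add: vec_eq_iff)
 qed
 moreover have "L.zc k y = z_fun H T k (lift c s y)" for k by (simp add: L.zc_def z_fun_Smat)
 ultimately show "dd ?f y v = 0 \<longleftrightarrow> (\<forall>k<CARD('n). Im (hdot (z_fun H T k (lift c s y)) (s y *v v)) = 0)"
  using L.zc_kernel[OF y, of "s y *v v"] by simp
qed

lemma Im_herm: "Im (herm x v w) = \<Omega> x v w"
 by (simp add: herm_def \<Omega>_def)

lemma differential_moduli_kernel:
 "differential A (moduli_map g H T V) x v = 0 \<longleftrightarrow> (\<forall>k<CARD('n). \<Omega> x (Zf k x) v = 0)"
proof -
 let ?c = "chart_at A x"
 note c = chart_at[of x]
 obtain u where u: "(x, u) \<in> coframes g" by (rule coframe_exists)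
 obtain W s where s: "frame_on ?c W s" "snd ?c x \<in> W" "lift ?c s (snd ?c x) = (x, u)" by (rule lift_through[OF c u])
 have "matrix (to_chart A ?c x) = mat 1"
  by (rule matrix_eqI) (unfold matrix_to_chart[OF c], simp add: to_chart_tr tr_self[OF c])
 then have "s (snd ?c x) = u" using s(3) by (simp add: lift_def chart_inv_chart[OF c] matrix_mul_rid)
 then have "differential A (moduli_map g H T V) x v = 0 \<longleftrightarrow> (\<forall>k<CARD('n). Im (hdot (z_fun H T k (x, u)) (u *v v)) = 0)"
  using moduli_kernel(2)[OF c(1) s(1,2), of v] s(3) by (simp add: differential_def)
 moreover have "Im (hdot (z_fun H T k (x, u)) (u *v v)) = \<Omega> x (Zf k x) v" if "k < CARD('n)" for k
 proof -
  have "hdot (u *v Zf k x) (u *v v) = herm x (Zf k x) v" using u coframe_iff by blast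
  then show ?thesis using Zf_coframe[OF u, of k] that by (simp add: Im_herm[symmetric])
 qed
 ultimately show ?thesis by simp
qed

text \<open>Through a coframe, \<open>\<Omega> x v w\<close> becomes the real inner product of
  \<open>J v\<close> and \<open>u *v w\<close>. The kernel of the differential corresponds to the
  orthogonal complement of the \<open>J\<close>-image of the span, and taking the complement twice
  returns that image.\<close>

theorem span_Zf:
 "span ((%k. Zf k x) ` {..<CARD('n)}) = omega_complement \<Omega> x {v. differential A (moduli_map g H T V) x v = 0}"
proof -
 obtain u where u: "(x, u) \<in> coframes g" by (rule coframe_exists)
 note i = coframe_invertible[OF u]
 define J where "J v = \<i> *s (u *v v)" for v
 have lJ: "linear J"
  using linear_compose[of "(*v) u" "(*s) \<i>"] bilinear_mv bilinear_vector_smult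
  unfolding bilinear_def o_def J_def[abs_def, symmetric] by blast
 have \<Omega>: "\<Omega> x v w = J v \<bullet> (u *v w)" for v w
  using u coframe_iff[of x u] Im_hdot[of "u *v v" "u *v w"] by (simp add: Im_herm[symmetric] J_def)
 have injJ: "J v = J w \<longleftrightarrow> v = w" for v w using invertible_cancel[OF i, of v w] by (auto simp: J_def)
 let ?Z = "(%k. Zf k x) ` {..<CARD('n)}"
 have K: "{v. differential A (moduli_map g H T V) x v = 0} = {v. u *v v \<in> orthogonal_comp (span (J ` ?Z))}"
 proof -
  have "(\<forall>k<CARD('n). \<Omega> x (Zf k x) v = 0) \<longleftrightarrow> (\<forall>z\<in>span (J ` ?Z). orthogonal (u *v v) z)" for v
  proof
   assume "\<forall>k<CARD('n). \<Omega> x (Zf k x) v = 0"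
   then have "z \<in> span (J ` ?Z) ==> orthogonal (u *v v) z" for z
    by (rule_tac orthogonal_to_span[of z "J ` ?Z"]) (auto simp: \<Omega> orthogonal_def inner_commute)
   then show "\<forall>z\<in>span (J ` ?Z). orthogonal (u *v v) z" by blast
  next
   assume "\<forall>z\<in>span (J ` ?Z). orthogonal (u *v v) z"
   then have "orthogonal (u *v v) (J (Zf k x))" if "k < CARD('n)" for k using that span_base[of "J (Zf k x)" "J ` ?Z"] by blast
   then show "\<forall>k<CARD('n). \<Omega> x (Zf k x) v = 0" by (simp add: \<Omega> orthogonal_def inner_commute)
  qed
  then show ?thesis unfolding differential_moduli_kernel orthogonal_comp_def by (auto simp: orthogonal_commute)
 qed
 have "v \<in> omega_complement \<Omega> x {v. differential A (moduli_map g H T V) x v = 0} \<longleftrightarrow> v \<in> span ?Z" for v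
 proof -
  have "v \<in> omega_complement \<Omega> x {v. differential A (moduli_map g H T V) x v = 0} \<longleftrightarrow>
    (\<forall>w. u *v w \<in> orthogonal_comp (span (J ` ?Z)) \<longrightarrow> J v \<bullet> (u *v w) = 0)"
   unfolding K omega_complement_def by (simp add: \<Omega>)
  also have "\<dots> \<longleftrightarrow> (\<forall>z\<in>orthogonal_comp (span (J ` ?Z)). J v \<bullet> z = 0)" using invertible_surj[OF i] by metis
  also have "\<dots> \<longleftrightarrow> J v \<in> orthogonal_comp (orthogonal_comp (span (J ` ?Z)))"
   by (auto simp: orthogonal_comp_def orthogonal_def inner_commute)
  also have "orthogonal_comp (orthogonal_comp (span (J ` ?Z))) = span (J ` ?Z)" by (rule orthogonal_comp_self[OF subspace_span])
  also have "J v \<in> span (J ` ?Z) \<longleftrightarrow> v \<in> span ?Z"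
   using injJ by (auto simp: linear_span_image[OF lJ])
  finally show ?thesis .
 qed
 then show ?thesis by blast
qed

end

section \<open>Flows of Kaehler fields\<close>

lemma partial_derivatives:
 fixes f :: "real \<times> 'a::real_normed_vector => 'b::real_normed_vector"
 assumes "(f has_derivative D) (at (t, y))"
 shows "((%s. f (s, y)) has_vector_derivative D (1, 0)) (at t)" "((%z. f (t, z)) has_derivative (%v. D (0, v))) (at y)"
proof -
 interpret D: bounded_linear D by (rule has_derivative_bounded_linear[OF assms])
 have "((%s. f (s, y)) has_derivative (%h. D (h, 0))) (at t)"
  by (rule has_derivative_compose[OF has_derivative_Pair[OF has_derivative_ident has_derivative_const] assms])
 moreover have e: "(%h. D (h, 0)) = (%h. h *\<^sub>R D (1, 0))"
 proof
  fix h show "D (h, 0) = h *\<^sub>R D (1, 0)"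
   using D.scaleR[of h "(1, 0)"] unfolding scaleR_Pair real_scaleR_def mult_1_right scaleR_zero_right .
 qed
 ultimately show "((%s. f (s, y)) has_vector_derivative D (1, 0)) (at t)" unfolding has_vector_derivative_def e by blast
 show "((%z. f (t, z)) has_derivative (%v. D (0, v))) (at y)"
  by (rule has_derivative_compose[OF has_derivative_Pair[OF has_derivative_const has_derivative_ident] assms])
qed

lemma locally_constant_interval:
 fixes f :: "real => 'a::real_normed_vector"
 assumes "\<And>t. t \<in> {-eps<..<eps} ==> (f has_vector_derivative 0) (at t)" "s \<in> {-eps<..<eps}" "t \<in> {-eps<..<eps}"
 shows "f s = f t"
proof (rule has_derivative_zero_unique[of "{-eps<..<eps}" f s t])
 fix x assume "x \<in> {-eps<..<eps}"
 from has_derivative_at_withinI[OF assms(1)[OF this, unfolded has_vector_derivative_def]]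
 show "(f has_derivative (%h. 0)) (at x within {-eps<..<eps})" by simp
qed (use assms in auto)

context kaehler_manifold
begin

lemma herm_push:
 assumes p: "plot A B F" and q: "q \<in> B" and d: "d \<in> A" "F q \<in> fst d"
 shows "herm (F q) (push A F q v) (push A F q w) = herm_chart d (snd d (F q)) (dd (snd d \<circ> F) q v) (dd (snd d \<circ> F) q w)"
 by (simp only: herm_chart_def hdot_gram[OF d] push_eq[OF p q d])

text \<open>The time derivative of the transported metric is its Lie derivative at the moving point.
  Transported vectors obey the linearised equation because the mixed second derivatives of the flow
  commute.\<close>

lemma herm_push_constant:
 assumes p: "plot A B F" and X: "smooth_field A X"
  and lie: "\<And>c y. c \<in> A ==> y \<in> chart_image c ==> lie_zero (herm_chart c) (field_in_chart A c X) y"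
  and flow: "\<And>q. q \<in> B ==> push A F q (1, 0) = X (F q)" and q: "(t, y) \<in> B"
 shows "((%t. herm (F (t, y)) (push A F (t, y) (0, v)) (push A F (t, y) (0, w))) has_vector_derivative 0) (at t)"
proof -
 let ?d = "chart_at A (F (t, y))" let ?f = "snd ?d \<circ> F" let ?X = "field_in_chart A ?d X"
 let ?B = "{q\<in>B. F q \<in> fst ?d}"
 note d = chart_at[of "F (t, y)"]
 note oB = plotD(3)[OF p d(1)] note sf = plotD(4)[OF p d(1)]
 have qB: "(t, y) \<in> ?B" using q d by simp
 have sX: "smooth_on (chart_image ?d) ?X" using X d by (simp add: smooth_field_def)
 have f1: "dd ?f q (1, 0) = ?X (?f q)" if "q \<in> ?B" for q
  using push_eq[OF p _ d(1), of q "(1, 0)"] flow[of q] that to_from_chart[OF d(1), of "F q" "dd ?f q (1, 0)"]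
  by (simp add: field_in_chart_def chart_inv_chart[OF d(1)])
 have fi: "?f q \<in> chart_image ?d" if "q \<in> ?B" for q using that by simp
 have curve: "((%s. ?f (s, y)) has_vector_derivative ?X (?f (t, y))) (at t)"
  using partial_derivatives(1)[OF smooth_dd[OF sf qB]] f1[OF qB] by simp
 have eta: "((%s. dd ?f (s, y) (0, v)) has_vector_derivative dd ?X (?f (t, y)) (dd ?f (t, y) (0, v))) (at t)" for v
 proof -
  have "dd (%q. dd ?f q (0, v)) (t, y) (1, 0) = dd (%q. dd ?f q (1, 0)) (t, y) (0, v)"
   by (rule dd_symmetric[OF oB sf qB])
  also have "dd (%q. dd ?f q (1, 0)) (t, y) = dd (%q. ?X (?f q)) (t, y)"
   by (rule dd_cong[OF oB qB f1])
  also have "dd (%q. ?X (?f q)) (t, y) = (%v. dd ?X (?f (t, y)) (dd ?f (t, y) v))"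
   by (rule dd_eqI[OF has_derivative_compose[OF smooth_dd[OF sf qB] smooth_dd[OF sX fi[OF qB]]]])
  finally have e: "dd (%q. dd ?f q (0, v)) (t, y) (1, 0) = dd ?X (?f (t, y)) (dd ?f (t, y) (0, v))" .
  show ?thesis
   using partial_derivatives(1)[OF smooth_dd[OF smooth_on_dd[OF sf] qB, of "(0, v)"]] unfolding e .
 qed
 let ?G = "%s. gram ?d (?f (s, y))" let ?eta = "%v s. dd ?f (s, y) (0, v)"
 have dG: "(gram ?d has_derivative dd (gram ?d) (?f (t, y))) (at (?f (t, y)))"
  by (rule smooth_dd[OF smooth_gram[OF d(1)] fi[OF qB]])
 have G: "(?G has_derivative (%h. dd (gram ?d) (?f (t, y)) (h *\<^sub>R ?X (?f (t, y))))) (at t)"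
  by (rule has_derivative_compose[OF curve[unfolded has_vector_derivative_def] dG])
 have Gl: "dd (gram ?d) (?f (t, y)) (h *\<^sub>R x) = h *\<^sub>R dd (gram ?d) (?f (t, y)) x" for h x
  by (rule linear_scale[OF has_derivative_linear[OF dG]])
 have "((%s. hdot (?eta v s) (?G s *v ?eta w s)) has_derivative
  (%h. hdot (?eta v t) (?G t *v (h *\<^sub>R dd ?X (?f (t, y)) (?eta w t)) + dd (gram ?d) (?f (t, y)) (h *\<^sub>R ?X (?f (t, y))) *v ?eta w t)
    + hdot (h *\<^sub>R dd ?X (?f (t, y)) (?eta v t)) (?G t *v ?eta w t))) (at t)"
  by (intro hd_bilinear[OF bilinear_hdot] hd_bilinear[OF bilinear_mv] G
   eta[unfolded has_vector_derivative_def])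
 moreover have "hdot (?eta v t) (?G t *v (h *\<^sub>R dd ?X (?f (t, y)) (?eta w t)) + dd (gram ?d) (?f (t, y)) (h *\<^sub>R ?X (?f (t, y))) *v ?eta w t)
    + hdot (h *\<^sub>R dd ?X (?f (t, y)) (?eta v t)) (?G t *v ?eta w t) = 0" for h
 proof -
  have hd: "dd (%z. herm_chart ?d z (?eta v t) (?eta w t)) (?f (t, y)) x = hdot (?eta v t) (dd (gram ?d) (?f (t, y)) x *v ?eta w t)" for x
  proof -
   have l: "linear (%m :: complex^'n^'n. hdot (?eta v t) (m *v ?eta w t))"
    using linear_compose[of "%m. m *v ?eta w t" "hdot (?eta v t)"] bilinear_mv bilinear_hdot unfolding bilinear_def o_def by blast
   from dd_eqI[OF hd_linear[OF l dG]] show ?thesis by (simp add: herm_chart_def)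
  qed
  from lie[OF d(1) fi[OF qB], unfolded lie_zero_def, rule_format, of "?eta v t" "?eta w t"]
  have "hdot (?eta v t) (dd (gram ?d) (?f (t, y)) (?X (?f (t, y))) *v ?eta w t) + hdot (dd ?X (?f (t, y)) (?eta v t)) (?G t *v ?eta w t)
   + hdot (?eta v t) (?G t *v dd ?X (?f (t, y)) (?eta w t)) = 0"
   unfolding hd unfolding herm_chart_def .
  then have "h *\<^sub>R (hdot (?eta v t) (dd (gram ?d) (?f (t, y)) (?X (?f (t, y))) *v ?eta w t) + hdot (dd ?X (?f (t, y)) (?eta v t)) (?G t *v ?eta w t)
   + hdot (?eta v t) (?G t *v dd ?X (?f (t, y)) (?eta w t))) = 0" by simp
  then show ?thesis
   unfolding Gl
   by (simp add: bilinear_radd[OF bilinear_hdot] bilinear_rmul[OF bilinear_hdot] bilinear_lmul[OF bilinear_hdot]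
    bilinear_lmul[OF bilinear_mv] bilinear_rmul[OF bilinear_mv] scaleR_add_right add_ac)
 qed
 ultimately have "((%s. hdot (?eta v s) (?G s *v ?eta w s)) has_vector_derivative 0) (at t)" by (simp add: has_vector_derivative_def)
 moreover have "open ((%s. (s, y)) -` ?B)" by (rule open_vimage[OF oB]) (intro continuous_intros)
 moreover have "t \<in> (%s. (s, y)) -` ?B" using qB by simp
 ultimately show ?thesis
  by (rule has_vector_derivative_transform_within_open) (use herm_push[OF p _ d(1)] in \<open>simp add: herm_chart_def\<close>)
qed

lemma flow_plot:
 assumes fl: "local_flow A X eps W Phi" and a: "a \<in> A"
 shows "plot A ({-eps<..<eps} \<times> snd a ` (fst a \<inter> W)) (%(t, z). Phi t (chart_inv a z))"
  "\<And>q. q \<in> {-eps<..<eps} \<times> snd a ` (fst a \<inter> W) ==>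
   push A (%(t, z). Phi t (chart_inv a z)) q (1, 0) = X ((%(t, z). Phi t (chart_inv a z)) q)"
proof -
 let ?F = "%(t, z). Phi t (chart_inv a z)" let ?B = "{-eps<..<eps} \<times> snd a ` (fst a \<inter> W)"
 let ?b = "({-eps<..<eps} \<times> (fst a \<inter> W), %(t, x). (t, snd a x))"
 have b: "?b \<in> flow_box_atlas A eps W" using a by (auto simp: flow_box_atlas_def)
 have inj: "inj_on (snd ?b) (fst ?b)" by (auto simp: inj_on_def dest: inj_onD[OF inj_chart[OF a]])
 have bi: "chart_inv ?b (t, z) = (t, chart_inv a z)" if "(t, z) \<in> ?B" for t z
  by (rule inv_into_f_eq[OF inj]) (use that in \<open>auto simp: chart_inv_chart[OF a]\<close>)
 have sm: "smooth_map (flow_box_atlas A eps W) A (%(t, x). Phi t x)" and oW: "atlas_open A W" using fl by (auto simp: local_flow_def)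
 have oB: "open ?B" using oW a by (auto simp: atlas_open_def intro!: open_Times)
 show pl: "plot A ?B ?F"
  unfolding plot_def
 proof (intro conjI ballI)
  show "open ?B" by (rule oB)
  show "?F ` ?B \<subseteq> carrier A" by (simp add: carrier_UNIV)
  fix d assume d: "d \<in> A"
  have eq: "snd ?b ` (fst ?b \<inter> (%(t, x). Phi t x) -` fst d) = {q\<in>?B. ?F q \<in> fst d}"
   by (force simp: chart_inv_chart[OF a])
  note s = sm[unfolded smooth_map_def, THEN conjunct2, rule_format, OF b d, unfolded eq]
  show o: "open {q\<in>?B. ?F q \<in> fst d}" using s by blast
  show "smooth_on {q\<in>?B. ?F q \<in> fst d} (snd d \<circ> ?F)"
   by (rule smooth_on_cong[OF o _ s[THEN conjunct2]]) (use bi in auto)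
 qed
 fix q assume q: "q \<in> ?B"
 then obtain t x where tx: "q = (t, snd a x)" "t \<in> {-eps<..<eps}" "x \<in> fst a" "x \<in> W" by auto
 let ?e = "chart_at A (Phi t x)"
 have "((%s. snd ?e (Phi s x)) has_vector_derivative X (Phi t x)) (at t)" using fl tx by (simp add: local_flow_def)
 moreover have "((%s. (snd ?e \<circ> ?F) (s, snd a x)) has_vector_derivative dd (snd ?e \<circ> ?F) (t, snd a x) (1, 0)) (at t)"
  by (rule partial_derivatives(1)[OF plot_has_derivative[OF pl _ chart_at(1)]])
   (use q tx chart_at(2)[of "Phi t x"] in \<open>auto simp: chart_inv_chart[OF a]\<close>)
 ultimately show "push A ?F q (1, 0) = X (?F q)"
  using vector_derivative_unique_at by (force simp: push_def tx chart_inv_chart[OF a])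
qed

text \<open>Along any local flow the transported Hermitian form is constant in time and equals the
  original one at time 0. Its imaginary part is the condition on \<Omega>.\<close>

theorem lie_zero_kaehler_field:
 assumes X: "smooth_field A X"
  and lie: "\<And>c y. c \<in> A ==> y \<in> chart_image c ==> lie_zero (herm_chart c) (field_in_chart A c X) y"
 shows "X \<in> kaehler_fields A \<Omega>"
 unfolding kaehler_fields_def
proof (safe intro!: X)
 fix eps W Phi t x
 assume fl: "local_flow A X eps W Phi" and t: "t \<in> {-eps<..<eps}" and x: "x \<in> W"
 let ?a = "chart_at A x" let ?y = "snd ?a x"
 note a = chart_at[of x]
 let ?F = "%(t, z). Phi t (chart_inv ?a z)" let ?B = "{-eps<..<eps} \<times> snd ?a ` (fst ?a \<inter> W)"
 note pl = flow_plot[OF fl a(1)]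
 have yB: "(s, ?y) \<in> ?B" if "s \<in> {-eps<..<eps}" for s using that x a by auto
 let ?T = "%s v. push A ?F (s, ?y) (0, v)"
 have T: "tangent_map A A (Phi s) x v = ?T s v" if s: "s \<in> {-eps<..<eps}" for s v
 proof -
  let ?e = "chart_at A (Phi s x)"
  have "((%z. (snd ?e \<circ> ?F) (s, z)) has_derivative (%v. dd (snd ?e \<circ> ?F) (s, ?y) (0, v))) (at ?y)"
   by (rule partial_derivatives(2)[OF plot_has_derivative[OF pl(1) yB[OF s] chart_at(1)]])
    (use chart_at(2)[of "Phi s x"] in \<open>simp add: chart_inv_chart[OF a]\<close>)
  from dd_eqI[OF this] show ?thesis
   by (simp add: tangent_map_def push_def chart_inv_chart[OF a] comp_def)
 qed
 have eps: "0 \<in> {-eps<..<eps}" and Phi0: "\<And>x. x \<in> W ==> Phi 0 x = x" and oW: "atlas_open A W" using fl by (auto simp: local_flow_def)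
 have T0: "?T 0 v = v" for v
 proof -
  have "open (snd ?a ` (fst ?a \<inter> W))" using oW a by (simp add: atlas_open_def)
  then have "(snd ?a \<circ> Phi 0 \<circ> chart_inv ?a has_derivative (%v. v)) (at ?y)"
   by (rule has_derivative_transform_within_open[OF has_derivative_ident]) (use a x in \<open>auto simp: chart_inv_chart Phi0\<close>)
  then show ?thesis unfolding T[OF eps, symmetric] by (simp add: tangent_map_def Phi0[OF x] dd_eqI)
 qed
 have h: "herm (Phi t x) (?T t v) (?T t w) = herm x v w" for v w
 proof -
  let ?h = "%s. herm (?F (s, ?y)) (?T s v) (?T s w)"
  have "?h t = ?h 0"
   by (rule locally_constant_interval[OF herm_push_constant[OF pl(1) X lie pl(2) yB] t eps])
  then show ?thesis by (simp add: T0 chart_inv_chart[OF a] Phi0[OF x])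
 qed
 show "\<Omega> (Phi t x) (tangent_map A A (Phi t) x v) (tangent_map A A (Phi t) x w) = \<Omega> x v w" for v w
  using arg_cong[OF h[of v w], of Im] by (simp add: T[OF t] herm_def \<Omega>_def)
 have lT: "linear (?T t)"
  unfolding push_def
  by (rule linear_Pair_partial[OF linear_dd[OF plotD(4)[OF pl(1) chart_at(1)]]])
   (use yB[OF t] chart_at(2) in auto)
 have hz: "v = 0" if "herm z v v = 0" for z v using g_pos[of v z] that by (auto simp: herm_def complex_eq_iff)
 have "inj (?T t)"
  unfolding linear_injective_0[OF lT]
 proof (intro allI impI)
  fix v assume "?T t v = 0"
  then have "herm x v v = 0" using h[of v v] linear_0[OF linear_herm] by simp
  then show "v = 0" by (rule hz)
 qed
 then have sT: "surj (?T t)" by (rule linear_inj_imp_surj[OF lT])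
 show "tangent_map A A (Phi t) x (\<i> *s v) = \<i> *s tangent_map A A (Phi t) x v" for v
 proof -
  have cl: "herm z (\<i> *s v) w = - \<i> * herm z v w" for z v w
   using herm_smult[of z w \<i> v] by (simp add: herm_cnj[of z w "\<i> *s v"] herm_cnj[of z w v] complex_eq_iff)
  \<comment> \<open>This defect is orthogonal to the image of \<open>?T t\<close>, which is the
    whole tangent space; preservation of the Hermitian form thus forces complex linearity.\<close>
  let ?d = "?T t (\<i> *s v) - \<i> *s ?T t v"
  have sub: "herm z w (p - q) = herm z w p - herm z w q" for z w p q by (rule linear_diff[OF linear_herm])
  have "herm (Phi t x) (?T t w) ?d = 0" for w
   unfolding sub h herm_smult by simp
  then have "herm (Phi t x) ?d ?d = 0" using surjD[OF sT, of ?d] by metis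
  from hz[OF this] show ?thesis by (simp add: T[OF t])
 qed
qed

end

text \<open>At time 0 the spatial derivative of the flow is the identity, and by symmetry of second
  derivatives its velocity is the derivative of the vector field.\<close>

lemma flow_linearisation:
 fixes Psi :: "real \<times> 'a::euclidean_space => 'a"
 assumes eps: "eps > 0" and W: "open W" "y \<in> W" and sm: "smooth_on ({-eps<..<eps} \<times> W) Psi" and X: "smooth_on U X" "W \<subseteq> U"
  and 0: "\<And>z. z \<in> W ==> Psi (0, z) = z" and inU: "\<And>z t. z \<in> W ==> t \<in> {-eps<..<eps} ==> Psi (t, z) \<in> U"
  and flow: "\<And>z t. z \<in> W ==> t \<in> {-eps<..<eps} ==> ((%s. Psi (s, z)) has_vector_derivative X (Psi (t, z))) (at t)"
 shows "((%t. dd Psi (t, y) (0, v)) has_vector_derivative dd X y v) (at 0)"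
proof -
 let ?B = "{-eps<..<eps} \<times> W"
 have oB: "open ?B" using W by (intro open_Times) auto
 have q: "(0, y) \<in> ?B" using eps W by simp
 have f1: "dd Psi p (1, 0) = X (Psi p)" if p: "p \<in> ?B" for p
 proof -
  obtain t z where tz: "p = (t, z)" "t \<in> {-eps<..<eps}" "z \<in> W" using p by auto
  show ?thesis
   using vector_derivative_unique_at[OF partial_derivatives(1)[OF smooth_dd[OF sm p, unfolded tz(1)]] flow[OF tz(3,2)]] tz by simp
 qed
 have "(%v. dd Psi (0, y) (0, v)) = (%v. v)"
 proof (rule has_derivative_unique)
  show "((%z. Psi (0, z)) has_derivative (%v. dd Psi (0, y) (0, v))) (at y)"
   by (rule partial_derivatives(2)[OF smooth_dd[OF sm q]])
  show "((%z. Psi (0, z)) has_derivative (%v. v)) (at y)"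
   by (rule has_derivative_transform_within_open[OF has_derivative_ident W]) (simp add: 0)
 qed
 from fun_cong[OF this] have id: "dd Psi (0, y) (0, v) = v" .
 have dX: "(X has_derivative dd X y) (at (Psi (0, y)))" unfolding 0[OF W(2)] by (rule smooth_dd[OF X(1)]) (use W X in auto)
 have "dd (%q. dd Psi q (0, v)) (0, y) (1, 0) = dd (%q. dd Psi q (1, 0)) (0, y) (0, v)"
  by (rule dd_symmetric[OF oB sm q])
 also have "dd (%q. dd Psi q (1, 0)) (0, y) = dd (%q. X (Psi q)) (0, y)" by (rule dd_cong[OF oB q f1])
 also have "dd (%q. X (Psi q)) (0, y) = (%w. dd X y (dd Psi (0, y) w))"
  by (rule dd_eqI[OF has_derivative_compose[OF smooth_dd[OF sm q] dX]])
 finally have "dd (%q. dd Psi q (0, v)) (0, y) (1, 0) = dd X y v" by (simp add: id)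
 then show ?thesis using partial_derivatives(1)[OF smooth_dd[OF smooth_on_dd[OF sm] q, of "(0, v)"]] by simp
qed

lemma smult_real_complex: "c *s v = Re c *\<^sub>R v + Im c *\<^sub>R (\<i> *s (v :: complex^'n))"
 by (simp add: vec_eq_iff complex_eq_iff)

context kaehler_manifold
begin

lemma local_flow_in_chart:
 assumes a: "a \<in> A" and X: "smooth_field A X" and eps: "eps > 0" and W: "open W" "W \<subseteq> chart_image a"
  and sm: "smooth_on ({-eps<..<eps} \<times> W) Psi" and 0: "\<And>z. z \<in> W ==> Psi (0, z) = z"
  and inU: "\<And>z t. z \<in> W ==> t \<in> {-eps<..<eps} ==> Psi (t, z) \<in> chart_image a"
  and flow: "\<And>z t. z \<in> W ==> t \<in> {-eps<..<eps} ==> ((%s. Psi (s, z)) has_vector_derivative field_in_chart A a X (Psi (t, z))) (at t)"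
 shows "local_flow A X eps {x\<in>fst a. snd a x \<in> W} (%t x. chart_inv a (Psi (t, snd a x)))"
 unfolding local_flow_def
proof (intro conjI ballI)
 let ?W = "{x\<in>fst a. snd a x \<in> W}" and ?Phi = "%t x. chart_inv a (Psi (t, snd a x))"
 have oW: "open (snd c ` (fst c \<inter> ?W))" if c: "c \<in> A" for c
 proof -
  have "snd c ` (fst c \<inter> ?W) = snd c ` (fst c \<inter> fst a) \<inter> (snd a \<circ> chart_inv c) -` W"
   by (force simp: chart_inv_chart[OF c])
  then show ?thesis
   using continuous_open_preimage[OF smooth_on_continuous[OF smooth_transition[OF c a]] open_overlap[OF c a] W(1)] by simp
 qed
 then show "atlas_open A ?W" by (simp add: atlas_open_def carrier_UNIV)
 show "eps > 0" by (rule eps)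
 show "?Phi 0 x = x" if "x \<in> ?W" for x using that by (simp add: 0 chart_inv_chart[OF a])
 have mem: "chart_inv a q \<in> fst d \<longleftrightarrow> q \<in> snd a ` (fst a \<inter> fst d)" if "q \<in> chart_image a" for q d
  using overlap_eq[OF a, of d] that by blast
 show "smooth_map (flow_box_atlas A eps ?W) A (%(t, x). ?Phi t x)"
  unfolding smooth_map_def
 proof (intro conjI ballI)
  show "(%(t, x). ?Phi t x) ` carrier (flow_box_atlas A eps ?W) \<subseteq> carrier A" by (simp add: carrier_UNIV)
  fix b d assume b: "b \<in> flow_box_atlas A eps ?W" and d: "d \<in> A"
  obtain c where c: "c \<in> A" "b = ({-eps<..<eps} \<times> (fst c \<inter> ?W), %(t, x). (t, snd c x))"
   using b by (auto simp: flow_box_atlas_def)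
  let ?S = "snd c ` (fst c \<inter> ?W)" let ?B = "{-eps<..<eps} \<times> ?S" let ?t = "snd a \<circ> chart_inv c"
  let ?g = "%q. Psi (fst q, ?t (snd q))" let ?O = "snd a ` (fst a \<inter> fst d)"
  have oB: "open ?B" using oW[OF c(1)] by (intro open_Times) auto
  have tW: "?t z \<in> W" if "z \<in> ?S" for z using that by (auto simp: chart_inv_chart[OF c(1)])
  have inj: "inj_on (snd b) (fst b)" unfolding c(2) by (auto simp: inj_on_def dest: inj_onD[OF inj_chart[OF c(1)]])
  have bi: "chart_inv b q = (fst q, chart_inv c (snd q))" if "q \<in> ?B" for q
   by (rule inv_into_f_eq[OF inj]) (use that in \<open>auto simp: c(2) chart_inv_chart[OF c(1)]\<close>)
  have smt: "smooth_on ?S ?t" by (rule smooth_on_subset[OF smooth_transition[OF c(1) a]]) auto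
  have smg: "smooth_on ?B ?g"
  proof (rule smooth_on_compose[OF oB _ sm])
   show "open ({-eps<..<eps} \<times> W)" using W by (intro open_Times) auto
   show "smooth_on ?B (%q. (fst q, ?t (snd q)))"
    by (intro smooth_on_Pair[OF oB] smooth_on_linear[OF oB linear_fst]
     smooth_on_compose[OF oB oW[OF c(1)] smt smooth_on_linear[OF oB linear_snd]]) auto
   show "(%q. (fst q, ?t (snd q))) ` ?B \<subseteq> {-eps<..<eps} \<times> W" using tW by auto
  qed
  have gU: "?g q \<in> chart_image a" if "q \<in> ?B" for q using that inU[OF tW[of "snd q"], of "fst q"] by auto
  have eq: "snd b ` (fst b \<inter> (%(t, x). ?Phi t x) -` fst d) = ?B \<inter> ?g -` ?O"
  proof -
   have "snd b ` (fst b \<inter> (%(t, x). ?Phi t x) -` fst d) = {q\<in>?B. chart_inv a (?g q) \<in> fst d}"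
    unfolding c(2) by (force simp: chart_inv_chart[OF c(1)])
   also have "\<dots> = ?B \<inter> ?g -` ?O" using mem[OF gU] by blast
   finally show ?thesis .
  qed
  have o: "open (?B \<inter> ?g -` ?O)"
   by (rule continuous_open_preimage[OF smooth_on_continuous[OF smg] oB open_overlap[OF a d]])
  then show "open (snd b ` (fst b \<inter> (%(t, x). ?Phi t x) -` fst d))" unfolding eq .
  have "smooth_on (?B \<inter> ?g -` ?O) (%q. (snd d \<circ> chart_inv a) (?g q))"
   by (rule smooth_on_compose[OF o open_overlap[OF a d] smooth_transition[OF a d] smooth_on_subset[OF smg]]) auto
  then show "smooth_on (snd b ` (fst b \<inter> (%(t, x). ?Phi t x) -` fst d)) (snd d \<circ> (%(t, x). ?Phi t x) \<circ> chart_inv b)"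
   unfolding eq by (rule smooth_on_cong[OF o, rotated]) (simp add: bi)
 qed
 fix x t assume x: "x \<in> ?W" and t: "t \<in> {-eps<..<eps}"
 let ?y = "snd a x" let ?p = "?Phi t x" let ?e = "chart_at A ?p"
 have y: "?y \<in> W" using x by simp
 note pin = chart_inv_in[OF inU[OF y t]]
 have "((%s. (snd ?e \<circ> chart_inv a) (Psi (s, ?y))) has_derivative (%h. tr a ?e ?p (h *\<^sub>R field_in_chart A a X (Psi (t, ?y))))) (at t)"
 proof (rule has_derivative_compose[OF flow[OF y t, unfolded has_vector_derivative_def]])
  have "Psi (t, ?y) \<in> snd a ` (fst a \<inter> fst ?e)" using pin chart_at(2)[of ?p] by (metis IntI imageI)
  from smooth_dd[OF smooth_transition[OF a chart_at(1)] this]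
  show "(snd ?e \<circ> chart_inv a has_derivative tr a ?e ?p) (at (Psi (t, ?y)))" by (simp add: pin)
 qed
 moreover have "tr a ?e ?p (h *\<^sub>R field_in_chart A a X (Psi (t, ?y))) = h *\<^sub>R X ?p" for h
  unfolding linear_scale[OF linear_tr[OF a pin(1) chart_at]]
  using from_to_chart[OF a pin(1)] by (simp add: field_in_chart_def from_chart_tr[OF a pin(1)])
 ultimately show "((%s. snd ?e (?Phi s x)) has_vector_derivative X ?p) (at t)"
  by (simp add: has_vector_derivative_def)
qed

text \<open>The Euclidean flow in a chart is recognised as a \<open>local_flow\<close> on the
  manifold, so the conditions in \<open>kaehler_fields\<close> apply to it; read in the chart, they
  say that it consists of holomorphic isometries.\<close>

theorem kaehler_field_flow:
 assumes X: "X \<in> kaehler_fields A \<Omega>" and a: "a \<in> A" and y0: "y0 \<in> chart_image a"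
 obtains eps W Psi where "eps > 0" "open W" "y0 \<in> W" "W \<subseteq> chart_image a" "smooth_on ({-eps<..<eps} \<times> W) Psi"
  "\<And>z. z \<in> W ==> Psi (0, z) = z" "\<And>z t. z \<in> W ==> t \<in> {-eps<..<eps} ==> Psi (t, z) \<in> chart_image a"
  "\<And>z t. z \<in> W ==> t \<in> {-eps<..<eps} ==> ((%s. Psi (s, z)) has_vector_derivative field_in_chart A a X (Psi (t, z))) (at t)"
  "\<And>t. t \<in> {-eps<..<eps} ==> holo_on W (%z. Psi (t, z))"
  "\<And>z t v w. z \<in> W ==> t \<in> {-eps<..<eps} ==>
   herm_chart a (Psi (t, z)) (dd (%z. Psi (t, z)) z v) (dd (%z. Psi (t, z)) z w) = herm_chart a z v w"
proof -
 have sX: "smooth_field A X" using X by (simp add: kaehler_fields_def)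
 have sXa: "smooth_on (chart_image a) (field_in_chart A a X)" using sX a by (simp add: smooth_field_def)
 obtain eps W Psi where W: "eps > 0" "open W" "y0 \<in> W" "W \<subseteq> chart_image a" "smooth_on ({-eps<..<eps} \<times> W) Psi"
  "\<And>z. z \<in> W ==> Psi (0, z) = z" "\<And>z t. z \<in> W ==> t \<in> {-eps<..<eps} ==> Psi (t, z) \<in> chart_image a"
  "\<And>z t. z \<in> W ==> t \<in> {-eps<..<eps} ==> ((%s. Psi (s, z)) has_vector_derivative field_in_chart A a X (Psi (t, z))) (at t)"
  by (rule smooth_local_flow[OF open_chart_image[OF a] sXa y0]) (rule that)
 let ?W = "{x\<in>fst a. snd a x \<in> W}" and ?Phi = "%t x. chart_inv a (Psi (t, snd a x))"
 have fl: "local_flow A X eps ?W ?Phi" by (rule local_flow_in_chart[OF a sX W(1,2,4-8)])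
 have dz: "((%z. Psi (t, z)) has_derivative (%v. dd Psi (t, z) (0, v))) (at z)" if "z \<in> W" "t \<in> {-eps<..<eps}" for z t
  by (rule partial_derivatives(2)[OF smooth_dd[OF W(5)]]) (use that in simp)
 have key: "(\<forall>v. dd (%z. Psi (t, z)) z (\<i> *s v) = \<i> *s dd (%z. Psi (t, z)) z v) \<and>
   (\<forall>v w. herm_chart a (Psi (t, z)) (dd (%z. Psi (t, z)) z v) (dd (%z. Psi (t, z)) z w) = herm_chart a z v w)"
  if z: "z \<in> W" and t: "t \<in> {-eps<..<eps}" for z t
 proof -
  have zi: "z \<in> chart_image a" using z W(4) by blast
  let ?x = "chart_inv a z" let ?b = "chart_at A ?x" let ?p = "?Phi t ?x" let ?e = "chart_at A ?p"
  let ?D = "dd (%z. Psi (t, z)) z" let ?T = "tangent_map A A (?Phi t) ?x"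
  note x = chart_inv_in[OF zi] note pin = chart_inv_in[OF W(7)[OF z t]]
  have xW: "?x \<in> ?W" using x z by simp
  have T: "?T v = from_chart A a ?p (?D (to_chart A a ?x v))" for v
  proof -
   have 1: "(snd a \<circ> chart_inv ?b has_derivative tr ?b a ?x) (at (snd ?b ?x))"
    by (rule smooth_dd[OF smooth_transition[OF chart_at(1) a]]) (use x chart_at(2)[of ?x] in blast)
   have ci: "(snd a \<circ> chart_inv ?b) (snd ?b ?x) = z" by (simp add: chart_inv_chart[OF chart_at] x)
   have 2: "((%z. Psi (t, z)) has_derivative ?D) (at ((snd a \<circ> chart_inv ?b) (snd ?b ?x)))"
    unfolding ci dd_eqI[OF dz[OF z t]] by (rule dz[OF z t])
   have "Psi (t, z) \<in> snd a ` (fst a \<inter> fst ?e)" using pin chart_at(2)[of ?p] x by (metis IntI imageI)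
   from smooth_dd[OF smooth_transition[OF a chart_at(1)] this]
   have 3: "(snd ?e \<circ> chart_inv a has_derivative tr a ?e ?p) (at (Psi (t, (snd a \<circ> chart_inv ?b) (snd ?b ?x))))"
    unfolding ci using pin x by simp
   have "((%q. (snd ?e \<circ> chart_inv a) (Psi (t, (snd a \<circ> chart_inv ?b) q))) has_derivative (%v. tr a ?e ?p (?D (tr ?b a ?x v)))) (at (snd ?b ?x))"
    by (rule has_derivative_compose[OF has_derivative_compose[OF 1 2] 3])
   from dd_eqI[OF this] show ?thesis
    using from_chart_tr[OF a, of ?p] pin x by (simp add: tangent_map_def to_chart_tr comp_def)
  qed
  have pin': "?p \<in> fst a" "snd a ?p = Psi (t, z)" using pin x by simp_all
  have D: "?D v = to_chart A a ?p (?T (from_chart A a ?x v))" for v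
   by (simp only: T to_from_chart[OF a x(1)] to_from_chart[OF a pin'(1)])
  have Ti: "?T (\<i> *s v) = \<i> *s ?T v" and T\<Omega>: "\<Omega> ?p (?T v) (?T w) = \<Omega> ?x v w" for v w
   using X[unfolded kaehler_fields_def mem_Collect_eq, THEN conjunct2, rule_format, OF fl t xW] by auto
  have hT: "herm ?p (?T v) (?T w) = herm ?x v w" for v w
  proof -
   \<comment> \<open>The metric is recovered from \<Omega> and the complex structure, so preserving
     these two preserves the whole Hermitian form.\<close>
   have "g q u w = - \<Omega> q (\<i> *s u) w" for q u w
    by (simp add: \<Omega>_def bilinear_lneg[OF g_bilinear])
   then have "g ?p (?T v) (?T w) = g ?x v w" using T\<Omega>[of "\<i> *s v" w] by (simp add: Ti)
   then show ?thesis using T\<Omega>[of v w] by (simp add: herm_def \<Omega>_def)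
  qed
  have "?D (\<i> *s v) = \<i> *s ?D v" for v
   by (simp only: D Ti from_chart_smult[OF a x(1)] to_chart_smult[OF a pin'(1)])
  moreover have "herm_chart a (Psi (t, z)) (?D v) (?D w) = herm_chart a z v w" for v w
   using hdot_gram[OF a pin'(1), of "?D v" "?D w"] hdot_gram[OF a x(1), of v w] hT[of "from_chart A a ?x v" "from_chart A a ?x w"]
   by (simp only: herm_chart_def x(2) pin(2) D from_to_chart[OF a pin(1)])
  ultimately show ?thesis by blast
 qed
 show ?thesis
 proof (rule that[OF W])
  fix t assume t: "t \<in> {-eps<..<eps}"
  show "holo_on W (%z. Psi (t, z))"
   unfolding holo_on_def
  proof (intro ballI exI conjI allI)
   fix z c v assume z: "z \<in> W"
   let ?D = "dd (%z. Psi (t, z)) z"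
   show d: "((%z. Psi (t, z)) has_derivative ?D) (at z)" using dz[OF z t] by (simp add: dd_eqI)
   note l = has_derivative_linear[OF d]
   show "?D (c *s v) = c *s ?D v"
    unfolding smult_real_complex[of c v] smult_real_complex[of c "?D v"] using key[OF z t] by (simp add: linear_add[OF l] linear_scale[OF l])
  qed
  show "herm_chart a (Psi (t, z)) (dd (%z. Psi (t, z)) z v) (dd (%z. Psi (t, z)) z w) = herm_chart a z v w" if "z \<in> W" for z v w
   using key[OF that t] by blast
 qed
qed

end

context bochner
begin

text \<open>All three facts arise by differentiating at time 0 what holds for the flow: its
  derivatives are complex-linear, and by \<open>local_isometry\<close> it carries
  \<open>Zf k\<close> to itself and preserves the moduli. The second is the vanishing of the
  bracket, the third tangency to the fibres of the moduli map.\<close>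

theorem kaehler_field_properties:
 assumes X: "X \<in> kaehler_fields A \<Omega>" and a: "a \<in> A" and y: "y \<in> chart_image a"
 shows "dd (field_in_chart A a X) y (c *s v) = c *s dd (field_in_chart A a X) y v"
  "k \<le> CARD('n) ==> dd (field_in_chart A a (Zf k)) y (field_in_chart A a X y) = dd (field_in_chart A a X) y (field_in_chart A a (Zf k) y)"
  "dd (moduli_map g H T V \<circ> chart_inv a) y (field_in_chart A a X y) = 0"
proof -
 let ?X = "field_in_chart A a X" and ?Z = "field_in_chart A a (Zf k)" and ?f = "moduli_map g H T V \<circ> chart_inv a"
 have sX: "smooth_on (chart_image a) ?X" using X a by (simp add: kaehler_fields_def smooth_field_def)
 obtain eps W Psi where W: "eps > 0" "open W" "y \<in> W" "W \<subseteq> chart_image a" "smooth_on ({-eps<..<eps} \<times> W) Psi"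
  "\<And>z. z \<in> W ==> Psi (0, z) = z" "\<And>z t. z \<in> W ==> t \<in> {-eps<..<eps} ==> Psi (t, z) \<in> chart_image a"
  "\<And>z t. z \<in> W ==> t \<in> {-eps<..<eps} ==> ((%s. Psi (s, z)) has_vector_derivative ?X (Psi (t, z))) (at t)"
  and h: "\<And>t. t \<in> {-eps<..<eps} ==> holo_on W (%z. Psi (t, z))"
  and iso: "\<And>z t v w. z \<in> W ==> t \<in> {-eps<..<eps} ==>
   herm_chart a (Psi (t, z)) (dd (%z. Psi (t, z)) z v) (dd (%z. Psi (t, z)) z w) = herm_chart a z v w"
  by (rule kaehler_field_flow[OF X a y]) (rule that)
 have eps0: "0 \<in> {-eps<..<eps}" "open {-eps<..<eps}" using W(1) by auto
 let ?u = "%v t. dd Psi (t, y) (0, v)"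
 have u': "(?u v has_vector_derivative dd ?X y v) (at 0)" for v
  by (rule flow_linearisation[OF W(1-3,5) sX W(4,6-8)])
 have u: "dd (%z. Psi (t, z)) y = (%v. ?u v t)" if "t \<in> {-eps<..<eps}" for t
  by (rule dd_eqI[OF partial_derivatives(2)[OF smooth_dd[OF W(5)]]]) (use that W in simp)
 have curve: "((%t. Psi (t, y)) has_vector_derivative ?X y) (at 0)" using W(8)[OF W(3) eps0(1)] W(6)[OF W(3)] by simp
 have im: "(%z. Psi (t, z)) ` W \<subseteq> chart_image a" if "t \<in> {-eps<..<eps}" for t using W(7) that by blast
 note li = local_isometry[OF a a W(2,4) h im iso W(3)]
 have comp: "((%t. F (Psi (t, y))) has_vector_derivative dd F y (?X y)) (at 0)" if F: "(F has_derivative dd F y) (at y)" for F :: "complex^'n => 'z::real_normed_vector"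
 proof -
  have F': "(F has_derivative dd F y) (at (Psi (0, y)))" using F W(6)[OF W(3)] by simp
  have "((%t. F (Psi (t, y))) has_derivative (%h. dd F y (h *\<^sub>R ?X y))) (at 0)"
   by (rule has_derivative_compose[OF curve[unfolded has_vector_derivative_def] F'])
  then show ?thesis by (simp add: has_vector_derivative_def linear_scale[OF has_derivative_linear[OF F]])
 qed
 show "dd ?X y (c *s v) = c *s dd ?X y v"
 proof -
  have "(?u (c *s v) has_vector_derivative c *s dd ?X y v) (at 0)"
  proof (rule has_vector_derivative_transform_within_open[OF _ eps0(2,1)])
   have "bounded_linear ((*s) c :: complex^'n => complex^'n)"
    using bilinear_vector_smult unfolding bilinear_def linear_conv_bounded_linear by blast
   from bounded_linear.has_vector_derivative[OF this u'[of v]]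
   show "((%t. c *s ?u v t) has_vector_derivative c *s dd ?X y v) (at 0)" .
   show "c *s ?u v t = ?u (c *s v) t" if "t \<in> {-eps<..<eps}" for t
    using holo_onE(2)[OF h[OF that] W(3), of c v] by (simp add: u[OF that])
  qed
  then show ?thesis by (rule vector_derivative_unique_at[OF u'])
 qed
 show "dd ?Z y (?X y) = dd ?X y (?Z y)" if k: "k \<le> CARD('n)"
 proof -
  have sZ: "smooth_on (chart_image a) ?Z" using smooth_Zf[OF k] a by (simp add: smooth_field_def)
  have "(?u (?Z y) has_vector_derivative dd ?Z y (?X y)) (at 0)"
  proof (rule has_vector_derivative_transform_within_open[OF comp[OF smooth_dd[OF sZ y]] eps0(2,1)])
   show "?Z (Psi (t, y)) = ?u (?Z y) t" if t: "t \<in> {-eps<..<eps}" for t using li(1)[OF t t _ t k] by (simp add: u[OF t])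
  qed
  then show ?thesis using vector_derivative_unique_at[OF u'] by simp
 qed
 obtain U s where s: "frame_on a U s" "y \<in> U" by (rule frame_exists[OF a y])
 have "((%t. ?f y) has_vector_derivative dd ?f y (?X y)) (at 0)"
 proof (rule has_vector_derivative_transform_within_open[OF comp[OF moduli_kernel(1)[OF a s]] eps0(2,1)])
  show "?f (Psi (t, y)) = ?f y" if t: "t \<in> {-eps<..<eps}" for t using li(2)[OF t t _ t] by simp
 qed
 then show "dd ?f y (?X y) = 0" using vector_derivative_unique_at[OF has_vector_derivative_const] by metis
qed

end

section \<open>Holomorphic fields with real coefficients\<close>

lemma matrix_columns_mult: "(\<chi> i p. m p $ i) *v (c :: complex^'n) = (\<Sum>p\<in>UNIV. c $ p *s (m p :: complex^'n))"
 by (simp add: vec_eq_iff matrix_vector_mult_def mult.commute)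

text \<open>Solving for the coefficients gives a map with complex-linear derivative and real values.
  Its derivative is real on \<open>v\<close> and on \<open>\<i> *s v\<close>, hence zero, and the
  coefficients are constant on a ball.\<close>

lemma real_holomorphic_coefficients:
 fixes m :: "'n::finite => complex^'n => complex^'n"
 assumes U: "open U" "y1 \<in> U" and m: "\<And>p. holo_on U (m p)" and N: "holo_on U N" and inv: "invertible (\<chi> i p. m p y1 $ i)"
  and real: "\<And>y c p. y \<in> U ==> invertible (\<chi> i p. m p y $ i) ==> N y = (\<Sum>p\<in>UNIV. c $ p *s m p y) ==> Im (c $ p) = 0"
 obtains W c where "open W" "y1 \<in> W" "W \<subseteq> U" "\<And>p. Im (c $ p) = 0" "\<And>y. y \<in> W ==> N y = (\<Sum>p\<in>UNIV. c $ p *s m p y)"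
proof -
 define M where "M y = (\<chi> i p. m p y $ i)" for y
 have smm: "smooth_on U (m p)" for p by (rule holo_on_smooth_on[OF m U(1)])
 have smM: "smooth_on U M"
  unfolding M_def by (intro smooth_on_vec[OF U(1)]) (simp add: smooth_on_nth[OF U(1) smm])
 let ?V = "U \<inter> M -` {a. invertible a}"
 have oV: "open ?V" by (rule continuous_open_preimage[OF smooth_on_continuous[OF smM] U(1) open_invertible])
 have y1: "y1 \<in> ?V" using U inv by (simp add: M_def)
 define F where "F y = matrix_inv (M y) *v N y" for y
 have smF: "smooth_on ?V F" unfolding F_def
  by (intro smooth_on_bilinear[OF oV bilinear_mv] smooth_on_matrix_inv[OF oV] smooth_on_subset[OF smM]
   smooth_on_subset[OF holo_on_smooth_on[OF N U(1)]]) auto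
 have MF: "M y *v F y = N y" if "y \<in> ?V" for y
  using that by (simp add: F_def matrix_vector_mul_assoc matrix_inv_right)
 have ImF: "Im (F y $ p) = 0" if "y \<in> ?V" for y p
  by (rule real) (use that MF[OF that] in \<open>auto simp: M_def matrix_columns_mult\<close>)
 have dF0: "dd F y v = 0" if y: "y \<in> ?V" for y v
 proof -
  note dF = smooth_dd[OF smF y]
  let ?D = "%v. \<chi> i p. dd (m p) y v $ i"
  have dm: "(m p has_derivative dd (m p) y) (at y)" for p by (rule smooth_dd[OF smm]) (use y in simp)
  have dM: "(M has_derivative ?D) (at y)"
  proof (rule has_derivative_vec, rule has_derivative_vec)
   fix i p
   show "((%y. M y $ i $ p) has_derivative (%v. ?D v $ i $ p)) (at y)"
    unfolding M_def using bounded_linear.has_derivative[OF bounded_linear_vec_nth dm[of p], of i] by simp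
  qed
  have "((%y. M y *v F y) has_derivative (%v. M y *v dd F y v + ?D v *v F y)) (at y)"
   by (rule hd_bilinear[OF bilinear_mv dM dF])
  then have "(N has_derivative (%v. M y *v dd F y v + ?D v *v F y)) (at y)"
   by (rule has_derivative_transform_within_open[OF _ oV y]) (rule MF)
  from dd_eqI[OF this]
  have dN: "dd N y v = M y *v dd F y v + ?D v *v F y" for v by simp
  have yU: "y \<in> U" using y by simp
  have "?D (\<i> *s v) *v F y = \<i> *s (?D v *v F y)" for v
   by (simp add: vec_eq_iff matrix_vector_mult_def holo_onE(2)[OF m yU] sum_distrib_left mult_ac)
  then have "M y *v dd F y (\<i> *s v) = M y *v (\<i> *s dd F y v)" for v
   using holo_onE(2)[OF N yU, of \<i> v] unfolding dN by (simp add: vec.scale_right_distrib mv_smult)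
  then have i: "dd F y (\<i> *s v) = \<i> *s dd F y v" for v
   using invertible_cancel[of "M y"] y by blast
  have Im: "Im (dd F y v $ p) = 0" for v p
  proof -
   have "linear (%w :: complex^'n. Im (w $ p))" by (rule linearI) simp_all
   from hd_linear[OF this dF] have "((%y. Im (F y $ p)) has_derivative (%v. Im (dd F y v $ p))) (at y)" .
   then have "((%y. 0) has_derivative (%v. Im (dd F y v $ p))) (at y)"
    by (rule has_derivative_transform_within_open[OF _ oV y]) (rule ImF)
   from fun_cong[OF has_derivative_unique[OF this has_derivative_const]] show ?thesis .
  qed
  have "Re (dd F y v $ p) = 0" for p using Im[of "\<i> *s v" p] by (simp add: i)
  with Im show ?thesis by (simp add: vec_eq_iff complex_eq_iff)
 qed
 obtain r where r: "r > 0" "ball y1 r \<subseteq> ?V" using oV y1 open_contains_ball by blast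
 have "\<exists>c. \<forall>y\<in>ball y1 r. F y = c"
 proof (rule has_derivative_zero_constant[OF convex_ball])
  fix y assume "y \<in> ball y1 r"
  then have y: "y \<in> ?V" using r by blast
  have "dd F y = (%v. 0)" using dF0[OF y] by (rule ext)
  with has_derivative_at_withinI[OF smooth_dd[OF smF y]]
  show "(F has_derivative (%v. 0)) (at y within ball y1 r)" by simp
 qed
 then obtain c where c: "\<And>y. y \<in> ball y1 r ==> F y = c" by blast
 show ?thesis
 proof (rule that[of "ball y1 r" c])
  show "Im (c $ p) = 0" for p using ImF[OF y1] c[of y1] r(1) by simp
  show "N y = (\<Sum>p\<in>UNIV. c $ p *s m p y)" if "y \<in> ball y1 r" for y
   using MF[OF subsetD[OF r(2) that]] c[OF that] by (simp add: M_def matrix_columns_mult)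
 qed (use r in auto)
qed

text \<open>The map is restricted to the complex line through \<open>z\<close> and \<open>w\<close>;
  the preimage of the ball is convex, so the identity theorem in one variable carries the zero from
  near \<open>z\<close> to \<open>w\<close>.\<close>

lemma holo_on_ball_zero:
 fixes f :: "complex^'n => complex^'m"
 assumes f: "holo_on (ball y r) f" and z: "z \<in> ball y r" and U: "open U" "z \<in> U" "\<And>w. w \<in> U ==> f w = 0" and w: "w \<in> ball y r"
 shows "f w = 0"
proof -
 let ?l = "%zeta :: complex. z + zeta *s (w - z)"
 have cl: "continuous_on UNIV ?l"
  by (intro continuous_on_add continuous_on_const bounded_bilinear.continuous_on[OF bounded_bilinear_vector_smult] continuous_on_id)
 let ?S = "?l -` ball y r"
 have oS: "open ?S" and oU: "open (?S \<inter> ?l -` U)" using cl U(1) by (auto intro!: open_Int open_vimage)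
 have "convex ?S"
 proof (rule convexI)
  fix a b :: complex and u v :: real assume *: "a \<in> ?S" "b \<in> ?S" "0 \<le> u" "0 \<le> v" "u + v = 1"
  have "?l (u *\<^sub>R a + v *\<^sub>R b) = u *\<^sub>R ?l a + v *\<^sub>R ?l b"
  proof -
   have v: "v = 1 - u" using *(5) by simp
   show ?thesis unfolding v by (simp add: vec_eq_iff scaleR_conv_of_real[where 'a = complex] algebra_simps)
  qed
  then show "u *\<^sub>R a + v *\<^sub>R b \<in> ?S" using convexD[OF convex_ball, of "?l a" y r "?l b" u v] * by simp
 qed
 have h: "(%zeta. f (?l zeta) $ i) holomorphic_on ?S" for i
  unfolding holomorphic_on_def
 proof
  fix zeta assume zeta: "zeta \<in> ?S"
  have dl: "(?l has_derivative (%h. h *s (w - z))) (at zeta)"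
  proof -
   have "bounded_linear (%h :: complex. h *s (w - z))" by (rule bounded_bilinear.bounded_linear_left[OF bounded_bilinear_vector_smult])
   from has_derivative_add[OF has_derivative_const bounded_linear_imp_has_derivative[OF this]] show ?thesis by simp
  qed
  have lz: "?l zeta \<in> ball y r" using zeta by simp
  have "((%zeta. f (?l zeta) $ i) has_derivative (%h. dd f (?l zeta) (h *s (w - z)) $ i)) (at zeta)"
   by (rule bounded_linear.has_derivative[OF bounded_linear_vec_nth has_derivative_compose[OF dl holo_onE(1)[OF f lz]]])
  then have "((%zeta. f (?l zeta) $ i) has_field_derivative dd f (?l zeta) (w - z) $ i) (at zeta)"
   unfolding has_field_derivative_def holo_onE(2)[OF f lz] by (simp add: mult_commute_abs)
  then show "(%zeta. f (?l zeta) $ i) field_differentiable at zeta within ?S"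
   using field_differentiable_at_within field_differentiable_def by blast
 qed
 have "f (?l 1) $ i = 0" for i
 proof (rule analytic_continuation_open[OF oU oS, of "%zeta. f (?l zeta) $ i" "%_. 0"])
  show "?S \<inter> ?l -` U \<noteq> {}"
  proof -
   have "?l 0 = z" by simp
   then have "0 \<in> ?S \<inter> ?l -` U" using z U(2) by (simp only: Int_iff vimage_eq)
   then show ?thesis by blast
  qed
  show "connected ?S" by (rule convex_connected[OF \<open>convex ?S\<close>])
 qed (use h w U(3) in auto)
 then show ?thesis by (simp add: vec_eq_iff)
qed

text \<open>The extended basis is indexed by the coordinate type, so that it forms the columns of an
  invertible square matrix.\<close>

lemma complex_basis_extend:
 fixes S :: "(complex^'n) set"
 assumes "vec.independent S"
 obtains b :: "'n => complex^'n" where "inj b" "S \<subseteq> range b" "invertible (\<chi> i p. b p $ i)"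
proof -
 let ?B = "vec.extend_basis S"
 have B: "vec.independent ?B" "S \<subseteq> ?B" "vec.span ?B = UNIV"
  using vec.independent_extend_basis[OF assms] vec.extend_basis_superset[OF assms] vec.span_extend_basis[OF assms] .
 have "card ?B = CARD('n)" using vec.dim_eq_card[of ?B UNIV] B by (simp add: card_cart_basis)
 moreover have fB: "finite ?B" by (rule vec.finiteI_independent[OF B(1)])
 ultimately obtain b :: "'n => complex^'n" where b: "bij_betw b UNIV ?B"
  using finite_same_card_bij[of "UNIV :: 'n set" ?B] by auto
 have ib: "inj b" and rb: "range b = ?B" using b by (auto simp: bij_betw_def)
 have "invertible (\<chi> i p. b p $ i)"
 proof (rule invertible_hdot, rule notI)
  fix c :: "complex^'n" assume c: "c \<noteq> 0" "(\<chi> i p. b p $ i) *v c = 0"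
  have "(\<Sum>v\<in>?B. c $ inv b v *s v) = (\<Sum>p\<in>UNIV. c $ p *s b p)"
   unfolding rb[symmetric] by (simp add: sum.reindex[OF ib] inv_f_f[OF ib])
  then have "(\<Sum>v\<in>?B. c $ inv b v *s v) = 0" using c(2) by (simp add: matrix_columns_mult)
  from vec.independentD[OF B(1) fB subset_refl this] have "c $ inv b (b p) = 0" for p using rb by blast
  then show False using c(1) by (simp add: inv_f_f[OF ib] vec_eq_iff)
 qed
 with that ib rb B(2) show ?thesis by blast
qed

text \<open>Independence of an indexed family rather than of its range, so that a repeated vector
  counts as a dependence.\<close>

definition real_independent :: "'i set => ('i => 'v::real_vector) => bool" where
 "real_independent J w \<longleftrightarrow> (\<forall>f. (\<Sum>p\<in>J. f p *\<^sub>R w p) = 0 \<longrightarrow> (\<forall>p\<in>J. f p = 0))"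

context kaehler_manifold
begin

text \<open>On a totally real family the Hermitian form restricts to a real inner product.\<close>
lemma isotropic_definite:
 assumes re: "\<forall>p\<in>J. \<forall>q\<in>J. Im (herm x (w p) (w q)) = 0" and ind: "real_independent J w"
  and z: "\<forall>q\<in>J. (\<Sum>p\<in>J. f p * Re (herm x (w q) (w p))) = 0"
 shows "\<forall>p\<in>J. f p = 0"
proof -
 let ?P = "\<Sum>p\<in>J. f p *\<^sub>R w p"
 have e: "herm x v ?P = (\<Sum>p\<in>J. f p *\<^sub>R herm x v (w p))" for v
  by (simp add: linear_sum[OF linear_herm] linear_scale[OF linear_herm])
 have "herm x (w q) ?P = 0" if q: "q \<in> J" for q
  unfolding e using z q re by (simp add: complex_eq_iff Re_sum Im_sum)
 then have "herm x ?P (w q) = 0" if "q \<in> J" for q using that herm_cnj[of x ?P "w q"] by simp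
 then have "herm x ?P ?P = 0" unfolding e[of ?P] by simp
 then have "g x ?P ?P = 0" by (simp add: herm_def complex_eq_iff)
 then have "?P = 0" using g_pos[of ?P x] by fastforce
 then show ?thesis using ind by (simp add: real_independent_def)
qed

lemma field_in_chart_comb:
 assumes c: "c \<in> A" and y: "y \<in> chart_image c"
 shows "field_in_chart A c (%x. X x - (\<Sum>p\<in>J. r p *\<^sub>R Z p x)) y = field_in_chart A c X y - (\<Sum>p\<in>J. r p *\<^sub>R field_in_chart A c (Z p) y)"
 using linear_to_chart[OF c chart_inv_in(1)[OF y]]
 by (simp add: field_in_chart_def linear_diff linear_sum linear_scale)

lemma field_in_chart_zero:
 assumes c: "c \<in> A" and x: "x \<in> fst c"
 shows "field_in_chart A c X (snd c x) = 0 \<longleftrightarrow> X x = 0"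
 using from_to_chart[OF c x, of "X x"] linear_0[OF linear_from_chart[OF c x]] linear_0[OF linear_to_chart[OF c x]]
 by (auto simp: field_in_chart_def chart_inv_chart[OF c x])

lemma open_chart_preimage:
 assumes c: "c \<in> A" and B: "open B"
 shows "open {x\<in>fst c. snd c x \<in> B}"
 using continuous_open_preimage[OF _ open_dom[OF c] B, of "snd c"] chart_homeo[OF c] by (simp add: homeomorphism_def vimage_def Int_def)

text \<open>The set of points near which the field vanishes is open. At a limit point, a coordinate
  ball meets it, and \<open>holo_on_ball_zero\<close> spreads the zero over the ball; so the set is
  also closed.\<close>

theorem holo_field_unique_continuation:
 assumes conn: "connected (UNIV :: 'm set)" and X: "\<And>c. c \<in> A ==> holo_on (chart_image c) (field_in_chart A c X)"
  and N: "open N" "N \<noteq> {}" "\<And>x. x \<in> N ==> X x = 0"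
 shows "X x = 0"
proof -
 let ?S = "\<Union>{N. open N \<and> (\<forall>x\<in>N. X x = 0)}"
 have "open ?S" by auto
 moreover have "closed ?S"
 proof -
  have "x \<in> ?S" if x: "x \<in> closure ?S" for x
  proof -
   let ?c = "chart_at A x"
   note c = chart_at[of x]
   obtain r where r: "r > 0" "ball (snd ?c x) r \<subseteq> chart_image ?c"
    using open_chart_image[OF c(1)] c(2) unfolding open_contains_ball by blast
   let ?O = "{z\<in>fst ?c. snd ?c z \<in> ball (snd ?c x) r}"
   have oO: "open ?O" by (rule open_chart_preimage[OF c(1) open_ball])
   have "x \<in> ?O" using c r by simp
   then have "?O \<inter> ?S \<noteq> {}" using open_Int_closure_eq_empty[OF oO, of ?S] x by blast
   then obtain z N where z: "z \<in> ?O" "z \<in> N" "open N" "\<And>x. x \<in> N ==> X x = 0" by blast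
   have zero: "field_in_chart A ?c X w = 0" if w: "w \<in> ball (snd ?c x) r" for w
   proof (rule holo_on_ball_zero[OF holo_on_subset[OF X[OF c(1)] r(2)] _ open_image[OF c(1) z(3)] _ _ w])
    show "snd ?c z \<in> ball (snd ?c x) r" "snd ?c z \<in> snd ?c ` (fst ?c \<inter> N)" using z by auto
    show "field_in_chart A ?c X u = 0" if "u \<in> snd ?c ` (fst ?c \<inter> N)" for u
     using that z(4) field_in_chart_zero[OF c(1)] by auto
   qed
   then have "X u = 0" if "u \<in> ?O" for u using that field_in_chart_zero[OF c(1), of u X] by blast
   then show ?thesis using oO \<open>x \<in> ?O\<close> by blast
  qed
  then show ?thesis unfolding closure_subset_eq[symmetric] by blast
 qed
 moreover have "?S \<noteq> {}" using N by blast
 ultimately have "?S = UNIV" using conn connected_clopen[of "UNIV :: 'm set"] by auto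
 then show ?thesis by blast
qed

end

context bochner
begin

lemma Zf_kaehler: "k \<le> CARD('n) ==> Zf k \<in> kaehler_fields A \<Omega>"
 by (rule lie_zero_kaehler_field[OF smooth_Zf lie_zero_Zf])

lemma kaehler_field_holo:
 assumes X: "X \<in> kaehler_fields A \<Omega>" and a: "a \<in> A"
 shows "holo_on (chart_image a) (field_in_chart A a X)"
 unfolding holo_on_def
proof (intro ballI exI conjI allI)
 fix y c v assume y: "y \<in> chart_image a"
 show "(field_in_chart A a X has_derivative dd (field_in_chart A a X) y) (at y)"
  by (rule smooth_dd[OF _ y]) (use X a in \<open>simp add: kaehler_fields_def smooth_field_def\<close>)
 show "dd (field_in_chart A a X) y (c *s v) = c *s dd (field_in_chart A a X) y v" by (rule kaehler_field_properties(1)[OF X a y])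
qed

text \<open>If \<open>X\<close> is near \<open>x1\<close> a real combination of a totally real family of the \<open>Z\<^sub>k\<close>, then the coefficients are constant;
 unique continuation then gives the same combination on all of \<open>M\<close>.\<close>
lemma constant_coefficients:
 fixes b :: "'n => complex^'n" and k :: "'n => nat"
 assumes conn: "connected (UNIV :: 'm set)" and X: "X \<in> kaehler_fields A \<Omega>"
  and k: "\<And>p. p \<in> J ==> k p < CARD('n) \<and> Zf (k p) x1 = b p" and b: "invertible (\<chi> i p. b p $ i)"
  and real: "\<And>x. real_independent J (%p. Zf (k p) x) ==> \<exists>f. X x = (\<Sum>p\<in>J. f p *\<^sub>R Zf (k p) x)"
 obtains r where "X = (%x. \<Sum>p\<in>J. r p *\<^sub>R Zf (k p) x)"
proof -
 let ?a = "chart_at A x1" let ?y = "snd ?a x1" let ?X = "field_in_chart A ?a X"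
 note a = chart_at[of x1]
 \<comment> \<open>The fields indexed by \<open>J\<close> are completed by constant vectors to a
   family that is a complex frame at \<open>x1\<close>.\<close>
 define m where "m p = (if p \<in> J then field_in_chart A ?a (Zf (k p)) else (%y. b p))" for p
 have yi: "?y \<in> chart_image ?a" using a by simp
 have at1: "field_in_chart A ?a Y ?y = Y x1" for Y by (simp add: field_in_chart_def chart_inv_chart[OF a] to_chart_tr tr_self[OF a])
 have m1: "m p ?y = b p" for p using k by (simp add: m_def at1)
 have hm: "holo_on (chart_image ?a) (m p)" for p
 proof (cases "p \<in> J")
  case True
  then show ?thesis using kaehler_field_holo[OF Zf_kaehler a(1), of "k p"] k[OF True] by (simp add: m_def)
 next
  case False
  then show ?thesis by (auto simp: m_def holo_on_def intro!: exI[of _ "%v. 0"])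
 qed
 have comb: "(\<Sum>p\<in>UNIV. (\<chi> p. if p \<in> J then complex_of_real (f p) else 0) $ p *s m p y) = (\<Sum>p\<in>J. f p *\<^sub>R field_in_chart A ?a (Zf (k p)) y)" for f y
 proof -
  have "(\<Sum>p\<in>UNIV. (\<chi> p. if p \<in> J then complex_of_real (f p) else 0) $ p *s m p y) = (\<Sum>p\<in>J. complex_of_real (f p) *s m p y)"
   by (rule sum.mono_neutral_cong_right) auto
  also have "\<dots> = (\<Sum>p\<in>J. f p *\<^sub>R field_in_chart A ?a (Zf (k p)) y)"
   by (rule sum.cong) (auto simp: m_def of_real_smult)
  finally show ?thesis .
 qed
 have chart: "(\<Sum>p\<in>J. f p *\<^sub>R field_in_chart A ?a (Zf (k p)) (snd ?a x)) = to_chart A ?a x (\<Sum>p\<in>J. f p *\<^sub>R Zf (k p) x)" if x: "x \<in> fst ?a" for f x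
  using linear_to_chart[OF a(1) x] by (simp add: field_in_chart_def chart_inv_chart[OF a(1) x] linear_sum linear_scale)
 \<comment> \<open>Expansion in a complex frame is unique, so the real combination guaranteed by
   \<open>real\<close> is the given one: coefficients inside \<open>J\<close> are real and those
   outside vanish.\<close>
 have coef: "\<exists>f. \<forall>p. c $ p = (if p \<in> J then complex_of_real (f p) else 0)"
  if y: "y \<in> chart_image ?a" and i: "invertible (\<chi> i p. m p y $ i)" and c: "?X y = (\<Sum>p\<in>UNIV. c $ p *s m p y)" for y c
 proof -
  obtain x where x: "x \<in> fst ?a" "y = snd ?a x" using y by blast
  have eq: "c = c'" if "(\<Sum>p\<in>UNIV. c $ p *s m p y) = (\<Sum>p\<in>UNIV. c' $ p *s m p y)" for c c'
   using invertible_cancel[OF i, of c c'] that by (simp add: matrix_columns_mult)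
  have "\<exists>f. X x = (\<Sum>p\<in>J. f p *\<^sub>R Zf (k p) x)"
  proof (rule real, unfold real_independent_def, intro allI impI ballI)
   fix f p assume 0: "(\<Sum>p\<in>J. f p *\<^sub>R Zf (k p) x) = 0" and p: "p \<in> J"
   have "(\<Sum>p\<in>UNIV. (\<chi> p. if p \<in> J then complex_of_real (f p) else 0) $ p *s m p y) = (\<Sum>p\<in>UNIV. 0 $ p *s m p y)"
    unfolding comb x(2) chart[OF x(1)] 0 by (simp add: linear_0[OF linear_to_chart[OF a(1) x(1)]])
   from arg_cong[OF eq[OF this], of "%c. c $ p"] p show "f p = 0" by simp
  qed
  then obtain f where f: "X x = (\<Sum>p\<in>J. f p *\<^sub>R Zf (k p) x)" by blast
  have X: "?X y = (\<Sum>p\<in>UNIV. (\<chi> p. if p \<in> J then complex_of_real (f p) else 0) $ p *s m p y)"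
   unfolding comb unfolding x(2) chart[OF x(1)] f[symmetric] by (simp add: field_in_chart_def chart_inv_chart[OF a(1) x(1)])
  have "c = (\<chi> p. if p \<in> J then complex_of_real (f p) else 0)" by (rule eq[OF trans[OF c[symmetric] X]])
  then show ?thesis by auto
 qed
 have i1: "invertible (\<chi> i p. m p ?y $ i)" using b by (simp add: m1)
 obtain W c where W: "open W" "?y \<in> W" "W \<subseteq> chart_image ?a" and c: "\<And>p. Im (c $ p) = 0" "\<And>y. y \<in> W ==> ?X y = (\<Sum>p\<in>UNIV. c $ p *s m p y)"
 proof (rule real_holomorphic_coefficients[OF open_chart_image[OF a(1)] yi hm kaehler_field_holo[OF X a(1)] i1])
  fix y c p assume "y \<in> chart_image ?a" "invertible (\<chi> i p. m p y $ i)" "?X y = (\<Sum>p\<in>UNIV. c $ p *s m p y)"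
  from coef[OF this] show "Im (c $ p) = 0" by auto
 qed (rule that)
 obtain r where r: "\<And>p. c $ p = (if p \<in> J then complex_of_real (r p) else 0)"
  using coef[OF yi i1 c(2)[OF W(2)]] by blast
 let ?Y = "%x. X x - (\<Sum>p\<in>J. r p *\<^sub>R Zf (k p) x)"
 have "?Y x = 0" for x
 proof (rule holo_field_unique_continuation[OF conn])
  fix d assume d: "d \<in> A"
  have hX: "holo_on (chart_image d) (field_in_chart A d X)" and hZ: "\<And>p. p \<in> J ==> holo_on (chart_image d) (field_in_chart A d (Zf (k p)))"
   using kaehler_field_holo[OF X d] kaehler_field_holo[OF Zf_kaehler d] k less_imp_le by blast+
  show "holo_on (chart_image d) (field_in_chart A d ?Y)"
   unfolding holo_on_def
  proof (intro ballI exI conjI allI)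
   fix z assume z: "z \<in> chart_image d"
   let ?D = "%v. dd (field_in_chart A d X) z v - (\<Sum>p\<in>J. r p *\<^sub>R dd (field_in_chart A d (Zf (k p))) z v)"
   have "((%z. field_in_chart A d X z - (\<Sum>p\<in>J. r p *\<^sub>R field_in_chart A d (Zf (k p)) z)) has_derivative ?D) (at z)"
    by (intro has_derivative_diff has_derivative_sum has_derivative_scaleR_right holo_onE(1)[OF hX z] holo_onE(1)[OF hZ z])
   then show "(field_in_chart A d ?Y has_derivative ?D) (at z)"
    by (rule has_derivative_transform_within_open[OF _ open_chart_image[OF d] z]) (simp add: field_in_chart_comb[OF d])
   show "?D (c *s v) = c *s ?D v" for c v
    using holo_onE(2)[OF hX z] holo_onE(2)[OF hZ z]
    by (simp add: vec.scale_right_diff_distrib vec.scale_sum_right vec_eq_iff sum_distrib_left)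
  qed
 next
  show "open {x\<in>fst ?a. snd ?a x \<in> W}" by (rule open_chart_preimage[OF a(1) W(1)])
  show "{x\<in>fst ?a. snd ?a x \<in> W} \<noteq> {}" using a W by blast
  fix x assume x: "x \<in> {x\<in>fst ?a. snd ?a x \<in> W}"
  have "c = (\<chi> p. if p \<in> J then complex_of_real (r p) else 0)" using r by (simp add: vec_eq_iff)
  then have "?X (snd ?a x) = (\<Sum>p\<in>J. r p *\<^sub>R field_in_chart A ?a (Zf (k p)) (snd ?a x))"
   using c(2)[of "snd ?a x"] x comb[of r "snd ?a x"] by simp
  then have "field_in_chart A ?a ?Y (snd ?a x) = 0" using x W(3) by (subst field_in_chart_comb[OF a(1)]) auto
  then show "?Y x = 0" using field_in_chart_zero[OF a(1), of x ?Y] x by blast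
 qed
 then have "X = (%x. \<Sum>p\<in>J. r p *\<^sub>R Zf (k p) x)" by (simp add: fun_eq_iff)
 with that show ?thesis by blast
qed

end

section \<open>The central subalgebra\<close>

context kaehler_manifold
begin

text \<open>The mutual Hermitian products of the family are real, so the real and imaginary parts of
  the coefficients of a complex relation satisfy separate real systems.\<close>

lemma isotropic_complex_independent:
 assumes re: "\<forall>p\<in>J. \<forall>q\<in>J. Im (herm x (w p) (w q)) = 0" and ind: "real_independent J w"
  and 0: "(\<Sum>p\<in>J. u p *s w p) = 0" and p: "p \<in> J"
 shows "u p = 0"
proof -
 have e: "(\<Sum>p\<in>J. u p * herm x (w q) (w p)) = 0" for q
  using arg_cong[OF 0, of "herm x (w q)"] by (simp add: linear_sum[OF linear_herm] linear_0[OF linear_herm] herm_smult)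
 have "(\<Sum>p\<in>J. Re (u p) * Re (herm x (w q) (w p))) = 0 \<and> (\<Sum>p\<in>J. Im (u p) * Re (herm x (w q) (w p))) = 0" if q: "q \<in> J" for q
 proof -
  have "(\<Sum>p\<in>J. u p * herm x (w q) (w p)) = (\<Sum>p\<in>J. u p * of_real (Re (herm x (w q) (w p))))"
   by (rule sum.cong) (use re q in \<open>auto simp: complex_eq_iff\<close>)
  then have "(\<Sum>p\<in>J. u p * of_real (Re (herm x (w q) (w p)))) = 0" using e by simp
  from arg_cong[OF this, of Re] arg_cong[OF this, of Im] show ?thesis by (simp add: Re_sum Im_sum)
 qed
 then have "\<forall>q\<in>J. (\<Sum>p\<in>J. Re (u p) * Re (herm x (w q) (w p))) = 0" "\<forall>q\<in>J. (\<Sum>p\<in>J. Im (u p) * Re (herm x (w q) (w p))) = 0"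
  by blast+
 from this[THEN isotropic_definite[OF re ind]] show ?thesis using p by (simp add: complex_eq_iff)
qed

lemma field_in_chart_at: "field_in_chart A (chart_at A x) Y (snd (chart_at A x) x) = Y x"
 by (simp add: field_in_chart_def chart_inv_chart[OF chart_at] to_chart_tr tr_self[OF chart_at])

lemma smooth_herm_chart: "c \<in> A ==> smooth_on (chart_image c) (%y. herm_chart c y v w)"
 unfolding herm_chart_def
 by (intro smooth_on_bilinear[OF open_chart_image bilinear_hdot] smooth_on_bilinear[OF open_chart_image bilinear_mv] smooth_gram smooth_on_const)

lemma bilinear_herm_chart: "bilinear (herm_chart c y)"
 unfolding bilinear_def herm_chart_def
 using bilinear_hdot bilinear_mv linear_compose[of "(*v) (gram c y)" "hdot _"] unfolding bilinear_def o_def by blast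

text \<open>The conditions in \<open>kaehler_fields\<close> concern flows and are not visibly stable
  under linear combinations. Here they are replaced by the Lie derivative condition, which is linear
  in the field and implies them; together with vanishing brackets this gives a subspace of the
  centre.\<close>

definition central_fields :: "('m => complex^'n) set" where
 "central_fields = {X. smooth_field A X \<and> (\<forall>c\<in>A. \<forall>y\<in>chart_image c. lie_zero (herm_chart c) (field_in_chart A c X) y) \<and>
   (\<forall>Y\<in>kaehler_fields A \<Omega>. \<forall>x. lie_bracket A X Y x = 0)}"

lemma central_fields_comb:
 assumes X: "X \<in> central_fields" and Y: "Y \<in> central_fields"
 shows "(%x. a *\<^sub>R X x + b *\<^sub>R Y x) \<in> central_fields"
proof -
 let ?C = "%x. a *\<^sub>R X x + b *\<^sub>R Y x"
 have f: "field_in_chart A c ?C y = a *\<^sub>R field_in_chart A c X y + b *\<^sub>R field_in_chart A c Y y" if "c \<in> A" "y \<in> chart_image c" for c y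
  using linear_to_chart[OF that(1) chart_inv_in(1)[OF that(2)]] by (simp add: field_in_chart_def linear_add linear_scale)
 have sm: "smooth_on (chart_image c) (field_in_chart A c X)" "smooth_on (chart_image c) (field_in_chart A c Y)" if "c \<in> A" for c
  using X Y that by (auto simp: central_fields_def smooth_field_def)
 have s: "smooth_on (chart_image c) (field_in_chart A c ?C)" if c: "c \<in> A" for c
 proof (rule smooth_on_cong[OF open_chart_image[OF c]])
  show "smooth_on (chart_image c) (%y. a *\<^sub>R field_in_chart A c X y + b *\<^sub>R field_in_chart A c Y y)"
   by (intro smooth_on_add[OF open_chart_image[OF c]] smooth_on_bilinear[OF open_chart_image[OF c] bilinear_scaleR] smooth_on_const sm c)
 qed (simp add: f[OF c])
 have d: "dd (field_in_chart A c ?C) y v = a *\<^sub>R dd (field_in_chart A c X) y v + b *\<^sub>R dd (field_in_chart A c Y) y v"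
  if c: "c \<in> A" "y \<in> chart_image c" for c y v
 proof -
  have "((%y. a *\<^sub>R field_in_chart A c X y + b *\<^sub>R field_in_chart A c Y y) has_derivative
   (%v. a *\<^sub>R dd (field_in_chart A c X) y v + b *\<^sub>R dd (field_in_chart A c Y) y v)) (at y)"
   by (intro has_derivative_add has_derivative_scaleR_right smooth_dd[OF sm(1)] smooth_dd[OF sm(2)] c)
  then have "(field_in_chart A c ?C has_derivative
   (%v. a *\<^sub>R dd (field_in_chart A c X) y v + b *\<^sub>R dd (field_in_chart A c Y) y v)) (at y)"
   by (rule has_derivative_transform_within_open[OF _ open_chart_image[OF c(1)] c(2)]) (simp add: f[OF c(1)])
  from fun_cong[OF dd_eqI[OF this]] show ?thesis .
 qed
 have "lie_zero (herm_chart c) (field_in_chart A c ?C) y" if c: "c \<in> A" "y \<in> chart_image c" for c y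
  unfolding lie_zero_def
 proof (intro allI)
  fix v w
  let ?e = "%Z. dd (%y. herm_chart c y v w) y (field_in_chart A c Z y) + herm_chart c y (dd (field_in_chart A c Z) y v) w + herm_chart c y v (dd (field_in_chart A c Z) y w)"
  note l = linear_dd[OF smooth_herm_chart[OF c(1)] c(2)]
  have "?e ?C = a *\<^sub>R ?e X + b *\<^sub>R ?e Y"
   unfolding f[OF c] d[OF c]
   by (simp add: linear_add[OF l] linear_scale[OF l] bilinear_ladd[OF bilinear_herm_chart] bilinear_radd[OF bilinear_herm_chart]
    bilinear_lmul[OF bilinear_herm_chart] bilinear_rmul[OF bilinear_herm_chart] scaleR_add_right)
  also have "\<dots> = 0"
  proof -
   have "lie_zero (herm_chart c) (field_in_chart A c X) y" "lie_zero (herm_chart c) (field_in_chart A c Y) y"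
    using X Y c unfolding central_fields_def by blast+
   from this[unfolded lie_zero_def, rule_format, of v w] show ?thesis by simp
  qed
  finally show "?e ?C = 0" .
 qed
 moreover have "lie_bracket A ?C Z x = 0" if Z: "Z \<in> kaehler_fields A \<Omega>" for Z x
 proof -
  let ?c = "chart_at A x" let ?y = "snd ?c x"
  have y: "?y \<in> chart_image ?c" using chart_at(2) by blast
  have "smooth_on (chart_image ?c) (field_in_chart A ?c Z)" using Z chart_at by (simp add: kaehler_fields_def smooth_field_def)
  note l = linear_dd[OF this y]
  have "lie_bracket A ?C Z x = a *\<^sub>R lie_bracket A X Z x + b *\<^sub>R lie_bracket A Y Z x"
   by (simp add: lie_bracket_def Let_def d[OF chart_at(1) y] linear_add[OF l] linear_scale[OF l] algebra_simps)
  also have "\<dots> = 0" using X Y Z by (simp add: central_fields_def)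
  finally show ?thesis .
 qed
 ultimately show ?thesis using s by (simp add: central_fields_def smooth_field_def)
qed

lemma central_fields_center: "central_fields \<subseteq> lie_center A (kaehler_fields A \<Omega>)"
 unfolding lie_center_def using lie_zero_kaehler_field by (auto simp: central_fields_def)

end

context bochner
begin

lemma Zf_central: "k \<le> CARD('n) ==> Zf k \<in> central_fields"
proof -
 assume k: "k \<le> CARD('n)"
 have "lie_bracket A (Zf k) Y x = 0" if Y: "Y \<in> kaehler_fields A \<Omega>" for Y x
 proof -
  have "snd (chart_at A x) x \<in> chart_image (chart_at A x)" using chart_at(2) by blast
  from kaehler_field_properties(2)[OF Y chart_at(1) this k] show ?thesis
   by (simp add: lie_bracket_def Let_def field_in_chart_at)
 qed
 then show ?thesis using smooth_Zf[OF k] lie_zero_Zf[OF k] by (simp add: central_fields_def)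
qed

lemma span_Zf_central: "span (Zf ` {..<CARD('n)}) \<subseteq> central_fields"
proof (rule span_minimal)
 show "Zf ` {..<CARD('n)} \<subseteq> central_fields" using Zf_central by auto
 note c = central_fields_comb
 show "subspace central_fields"
 proof (rule subspaceI)
  show "0 \<in> central_fields" using c[OF Zf_central[of 0] Zf_central[of 0], of 0 0] by (simp add: zero_fun_def)
  show "X + Y \<in> central_fields" if "X \<in> central_fields" "Y \<in> central_fields" for X Y
   using c[OF that, of 1 1] by (simp add: plus_fun_def)
  show "r *\<^sub>R X \<in> central_fields" if "X \<in> central_fields" for r X
   using c[OF that that, of r 0] by (simp add: scaleR_fun_def)
 qed
qed

section \<open>Dimensions of the span of the fields and of its values\<close>

lemma linear_eval: "linear (%X :: 'm => complex^'n. X x)"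
 by (rule linearI) (simp_all add: plus_fun_def scaleR_fun_def)

lemma dim_eval_le: "dim (span ((%k. Zf k x) ` {..<CARD('n)})) \<le> dim (span (Zf ` {..<CARD('n)}))"
proof -
 obtain B where B: "B \<subseteq> Zf ` {..<CARD('n)}" "independent B" "Zf ` {..<CARD('n)} \<subseteq> span B" "card B = dim (Zf ` {..<CARD('n)})"
  by (rule basis_exists)
 have fB: "finite B" using B(1) finite_subset by blast
 have "(%k. Zf k x) ` {..<CARD('n)} \<subseteq> (%X. X x) ` span B" using B(3) by blast
 also have "\<dots> = span ((%X. X x) ` B)" by (rule linear_span_image[OF linear_eval, symmetric])
 finally have "dim ((%k. Zf k x) ` {..<CARD('n)}) \<le> card ((%X. X x) ` B)"
  using fB by (intro dim_le_card) auto
 also have "\<dots> \<le> card B" by (rule card_image_le[OF fB])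
 finally show ?thesis using B(4) by (simp add: dim_span)
qed

lemma dim_span_Zf_le: "dim (span (Zf ` {..<CARD('n)})) \<le> CARD('n)"
proof -
 have "dim (span (Zf ` {..<CARD('n)})) \<le> card (Zf ` {..<CARD('n)})" by (rule dim_le_card) auto
 also have "\<dots> \<le> CARD('n)" using card_image_le[of "{..<CARD('n)}" Zf] by simp
 finally show ?thesis .
qed

text \<open>At a point where the pointwise dimension is maximal, a real basis is selected among the
  values of the fields. Isotropy makes it complex independent, and it is extended to a complex basis
  \<open>b\<close>; \<open>J\<close> marks the members that came from fields.\<close>

lemma generic_point:
 obtains x1 J and b :: "'n => complex^'n" and k :: "'n => nat" where
  "\<And>x. dim (span ((%k. Zf k x) ` {..<CARD('n)})) \<le> card J" "dim (span ((%k. Zf k x1) ` {..<CARD('n)})) = card J"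
  "\<And>p. p \<in> J ==> k p < CARD('n) \<and> Zf (k p) x1 = b p" "invertible (\<chi> i p. b p $ i)"
proof -
 let ?d = "%x. dim (span ((%k. Zf k x) ` {..<CARD('n)}))"
 have "?d x < Suc (CARD('n))" for x using dim_eval_le[of x] dim_span_Zf_le by linarith
 then have "\<exists>x. True \<and> (\<forall>y. True \<longrightarrow> ?d y \<le> ?d x)" by (intro ex_has_greatest_nat[of _ undefined]) auto
 then obtain x1 where x1: "\<And>x. ?d x \<le> ?d x1" by blast
 let ?S = "(%k. Zf k x1) ` {..<CARD('n)}"
 obtain B where B: "B \<subseteq> ?S" "independent B" "?S \<subseteq> span B" "card B = dim ?S" by (rule basis_exists)
 have fB: "finite B" using B(1) finite_subset by blast
 have "\<forall>v\<in>B. \<exists>k. k < CARD('n) \<and> Zf k x1 = v" using B(1) by blast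
 then obtain kap where kap: "\<And>v. v \<in> B ==> kap v < CARD('n) \<and> Zf (kap v) x1 = v" by metis
 have re: "\<forall>v\<in>B. \<forall>w\<in>B. Im (herm x1 v w) = 0"
 proof (intro ballI)
  fix v w assume v: "v \<in> B" and w: "w \<in> B"
  show "Im (herm x1 v w) = 0" using Zf_isotropic[of "kap v" "kap w" x1] kap[OF v] kap[OF w] by simp
 qed
 have ind: "real_independent B (%v. v)"
  unfolding real_independent_def
 proof (intro allI impI ballI)
  fix f v assume f: "(\<Sum>v\<in>B. f v *\<^sub>R v) = 0" and v: "v \<in> B"
  show "f v = 0" by (rule independentD[OF B(2) fB subset_refl f v])
 qed
 have "vec.independent B"
  unfolding vec.dependent_finite[OF fB]
 proof (intro notI, elim exE conjE bexE)
  fix u v assume u: "(\<Sum>v\<in>B. u v *s v) = 0" and v: "v \<in> B" "u v \<noteq> 0"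
  have "u v = 0" by (rule isotropic_complex_independent[OF re ind u v(1)])
  with v show False by simp
 qed
 then obtain b :: "'n => complex^'n" where b: "inj b" "B \<subseteq> range b" "invertible (\<chi> i p. b p $ i)"
  by (rule complex_basis_extend)
 let ?J = "{p. b p \<in> B}"
 have "b ` ?J = B" using b(2) by auto
 moreover have "card (b ` ?J) = card ?J" by (rule card_image[OF inj_on_subset[OF b(1)]]) simp
 ultimately have J: "card ?J = ?d x1" using B(4) by (simp add: dim_span)
 show ?thesis by (rule that[of ?J x1 "kap \<circ> b" b]) (use x1 J kap b(3) in auto)
qed

lemma sum_Zf_span:
 assumes "X = (%x. \<Sum>p\<in>J. r p *\<^sub>R Zf (k p) x)"
 shows "X \<in> span ((%p. Zf (k p)) ` J)"
proof -
 have "X = (\<Sum>p\<in>J. r p *\<^sub>R Zf (k p))"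
 proof
  fix x show "X x = (\<Sum>p\<in>J. r p *\<^sub>R Zf (k p)) x"
   unfolding assms linear_sum[OF linear_eval[of x]] by (simp add: scaleR_fun_def)
 qed
 moreover have "(\<Sum>p\<in>J. r p *\<^sub>R Zf (k p)) \<in> span ((%p. Zf (k p)) ` J)"
  by (intro span_sum span_scale span_base imageI)
 ultimately show ?thesis by simp
qed

text \<open>Wherever the fields selected by \<open>J\<close> are independent, maximality makes them
  a basis of the span of all the fields at that point, so every other field is a real combination
  there. \<open>constant_coefficients\<close> makes the combination global, so the whole span has
  dimension at most the size of \<open>J\<close>.\<close>

theorem dim_Zf_attained:
 assumes conn: "connected (UNIV :: 'm set)"
 shows "\<exists>x. dim (span ((%k. Zf k x) ` {..<CARD('n)})) = dim (span (Zf ` {..<CARD('n)}))"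
proof -
 obtain x1 J and b :: "'n => complex^'n" and k :: "'n => nat" where
  J: "\<And>x. dim (span ((%k. Zf k x) ` {..<CARD('n)})) \<le> card J" "dim (span ((%k. Zf k x1) ` {..<CARD('n)})) = card J"
  and k: "\<And>p. p \<in> J ==> k p < CARD('n) \<and> Zf (k p) x1 = b p" and b: "invertible (\<chi> i p. b p $ i)"
  by (rule generic_point) (rule that)
 have "Zf j \<in> span ((%p. Zf (k p)) ` J)" if j: "j < CARD('n)" for j
 proof -
  obtain r where "Zf j = (%x. \<Sum>p\<in>J. r p *\<^sub>R Zf (k p) x)"
  proof (rule constant_coefficients[OF conn Zf_kaehler k b])
   fix x assume ind: "real_independent J (%p. Zf (k p) x)"
   let ?w = "%p. Zf (k p) x"
   have inj: "inj_on ?w J"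
   proof (rule inj_onI, rule ccontr)
    fix p q assume pq: "p \<in> J" "q \<in> J" "?w p = ?w q" "p \<noteq> q"
    have "(\<Sum>i\<in>J. ((if i = p then 1 else 0) - (if i = q then 1 else 0)) *\<^sub>R ?w i) = ?w p - ?w q"
     using pq by (simp add: scaleR_diff_left sum_subtractf if_distrib[of "%a. a *\<^sub>R _"] cong: if_cong)
    then have "(\<Sum>i\<in>J. ((if i = p then 1 else 0) - (if i = q then 1 else 0)) *\<^sub>R ?w i) = 0" using pq(3) by simp
    from ind[unfolded real_independent_def, rule_format, of "%i. (if i = p then 1 else 0) - (if i = q then 1 else 0)", OF this pq(1)]
    show False using pq(4) by simp
   qed
   have ti: "independent (?w ` J)"
    unfolding dependent_finite[OF finite_imageI[OF finite[of J]]]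
   proof (intro notI, elim exE conjE bexE)
    fix u v assume u: "(\<Sum>v\<in>?w ` J. u v *\<^sub>R v) = 0" and v: "v \<in> ?w ` J" "u v \<noteq> 0"
    have "(\<Sum>p\<in>J. u (?w p) *\<^sub>R ?w p) = 0" using u by (simp add: sum.reindex[OF inj])
    from ind[unfolded real_independent_def, rule_format, of "%p. u (?w p)", OF this] show False using v by blast
   qed
   have ts: "?w ` J \<subseteq> span ((%k. Zf k x) ` {..<CARD('n)})" using k by (auto intro!: span_base)
   have "span ((%k. Zf k x) ` {..<CARD('n)}) \<subseteq> span (?w ` J)"
    by (rule card_ge_dim_independent[OF ts ti]) (use J(1)[of x] in \<open>simp add: card_image[OF inj]\<close>)
   moreover have "Zf j x \<in> span ((%k. Zf k x) ` {..<CARD('n)})" using j by (auto intro!: span_base)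
   ultimately have "Zf j x \<in> span (?w ` J)" by blast
   then obtain u where "Zf j x = (\<Sum>v\<in>?w ` J. u v *\<^sub>R v)" unfolding span_finite[OF finite_imageI[OF finite[of J]]] by blast
   then show "\<exists>f. Zf j x = (\<Sum>p\<in>J. f p *\<^sub>R Zf (k p) x)"
    by (intro exI[of _ "%p. u (?w p)"]) (simp add: sum.reindex[OF inj])
  qed (use j that in auto)
  then show ?thesis by (rule sum_Zf_span)
 qed
 then have "Zf ` {..<CARD('n)} \<subseteq> span ((%p. Zf (k p)) ` J)" by blast
 then have "dim (Zf ` {..<CARD('n)}) \<le> card ((%p. Zf (k p)) ` J)" by (rule dim_le_card) simp
 also have "\<dots> \<le> card J" by (rule card_image_le) simp
 finally have "dim (span (Zf ` {..<CARD('n)})) \<le> card J" by (simp add: dim_span)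
 then show ?thesis using dim_eval_le[of x1] J(2) by (intro exI[of _ x1]) linarith
qed

text \<open>In the maximal case the selected fields form a complex frame wherever they are
  independent, so any Kaehler field has complex coefficients in it. Tangency to the fibres of the
  moduli map forces these to be real, and \<open>constant_coefficients\<close> applies.\<close>

theorem kaehler_fields_span:
 assumes conn: "connected (UNIV :: 'm set)" and n: "dim (span (Zf ` {..<CARD('n)})) = CARD('n)"
 shows "kaehler_fields A \<Omega> = span (Zf ` {..<CARD('n)})"
proof
 show "span (Zf ` {..<CARD('n)}) \<subseteq> kaehler_fields A \<Omega>"
  using span_Zf_central central_fields_center unfolding lie_center_def by blast
 obtain x1 J and b :: "'n => complex^'n" and k :: "'n => nat" where
  J: "\<And>x. dim (span ((%k. Zf k x) ` {..<CARD('n)})) \<le> card J" "dim (span ((%k. Zf k x1) ` {..<CARD('n)})) = card J"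
  and k: "\<And>p. p \<in> J ==> k p < CARD('n) \<and> Zf (k p) x1 = b p" and b: "invertible (\<chi> i p. b p $ i)"
  by (rule generic_point) (rule that)
 obtain x where "dim (span ((%k. Zf k x) ` {..<CARD('n)})) = CARD('n)" using dim_Zf_attained[OF conn] n by auto
 then have "CARD('n) \<le> card J" using J(1)[of x] by simp
 then have JU: "J = UNIV" by (rule card_seteq[OF finite subset_UNIV])
 show "kaehler_fields A \<Omega> \<subseteq> span (Zf ` {..<CARD('n)})"
 proof
  fix X assume X: "X \<in> kaehler_fields A \<Omega>"
  obtain r where "X = (%x. \<Sum>p\<in>J. r p *\<^sub>R Zf (k p) x)"
  proof (rule constant_coefficients[OF conn X k b])
   fix x assume ind: "real_independent J (%p. Zf (k p) x)"
   let ?w = "%p. Zf (k p) x" let ?a = "chart_at A x"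
   have re: "\<forall>p\<in>J. \<forall>q\<in>J. Im (herm x (?w p) (?w q)) = 0"
    using Zf_isotropic[of "k _" "k _" x] k by (meson less_imp_le)
   have "invertible (\<chi> i p. ?w p $ i)"
   proof (rule invertible_hdot, rule notI)
    fix c :: "complex^'n" assume c: "c \<noteq> 0" "(\<chi> i p. ?w p $ i) *v c = 0"
    then have "(\<Sum>p\<in>J. c $ p *s ?w p) = 0" by (simp add: matrix_columns_mult JU)
    from isotropic_complex_independent[OF re ind this] have "c $ p = 0" for p using JU by blast
    then show False using c(1) by (simp add: vec_eq_iff)
   qed
   then obtain c where "(\<chi> i p. ?w p $ i) *v c = X x" by (rule invertible_surj)
   then have c: "X x = (\<Sum>p\<in>J. c $ p *s ?w p)" by (simp add: matrix_columns_mult JU)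
   \<comment> \<open>\<Omega> vanishes between each field and \<open>X x\<close>, while the products
     among the fields are real. The imaginary parts of the coefficients therefore solve the
     homogeneous real system of \<open>isotropic_definite\<close>.\<close>
   have Im: "\<forall>p\<in>J. Im (c $ p) = 0"
   proof (rule isotropic_definite[OF re ind], rule ballI)
    fix q assume q: "q \<in> J"
    have yi: "snd ?a x \<in> chart_image ?a" using chart_at(2) by blast
    have "differential A (moduli_map g H T V) x (X x) = 0"
     using kaehler_field_properties(3)[OF X chart_at(1) yi] by (simp add: differential_def field_in_chart_at)
    then have "Im (herm x (?w q) (X x)) = 0" using k[OF q] by (simp add: differential_moduli_kernel Im_herm)
    moreover have "herm x (?w q) (X x) = (\<Sum>p\<in>J. c $ p * herm x (?w q) (?w p))"
     by (simp add: c linear_sum[OF linear_herm] herm_smult)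
    ultimately show "(\<Sum>p\<in>J. Im (c $ p) * Re (herm x (?w q) (?w p))) = 0" using re q by (simp add: Im_sum)
   qed
   have "X x = (\<Sum>p\<in>J. Re (c $ p) *\<^sub>R ?w p)"
    unfolding c by (intro sum.cong refl) (simp add: smult_real_complex[of "c $ _"] Im)
   then show "\<exists>f. X x = (\<Sum>p\<in>J. f p *\<^sub>R Zf (k p) x)" by (rule exI[of _ "%p. Re (c $ p)"])
  qed (assumption, rule that)
  then have "X \<in> span ((%p. Zf (k p)) ` J)" by (rule sum_Zf_span)
  moreover have "(%p. Zf (k p)) ` J \<subseteq> Zf ` {..<CARD('n)}" using k by auto
  ultimately show "X \<in> span (Zf ` {..<CARD('n)})" using span_mono by blast
 qed
qed

end

theorem theorem4:
  fixes A :: "('m::{t2_space,second_countable_topology}, complex^'n) chart set"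
    and g \<Omega> :: "'m \<Rightarrow> complex^'n \<Rightarrow> complex^'n \<Rightarrow> real"
    and \<phi> :: "'m \<times> (complex^'n^'n) \<Rightarrow> (complex^'n) \<times> (real^'n^'n) \<Rightarrow> complex^'n^'n"
    and H :: "'m \<times> (complex^'n^'n) \<Rightarrow> complex^'n^'n"
    and T :: "'m \<times> (complex^'n^'n) \<Rightarrow> complex^'n"
    and V :: "'m \<times> (complex^'n^'n) \<Rightarrow> real"
  assumes "bochner_kaehler A g \<Omega> \<phi> H T V"
  shows "\<exists>Z :: nat \<Rightarrow> 'm \<Rightarrow> complex^'n.
    (\<forall>k\<in>{0..CARD('n) - 1}.
       Z (k + 2) \<in> kaehler_fields A \<Omega> \<and> represents g (Z (k + 2)) (z_fun H T k)) \<and>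
    span (Z ` {2..CARD('n) + 1}) \<subseteq> lie_center A (kaehler_fields A \<Omega>) \<and>
    (\<forall>x. span ((\<lambda>k. Z k x) ` {2..CARD('n) + 1})
           = omega_complement \<Omega> x {v. differential A (moduli_map g H T V) x v = 0}) \<and>
    (connected (UNIV :: 'm set) \<longrightarrow>
       dim (span (Z ` {2..CARD('n) + 1})) \<le> CARD('n) \<and>
       (\<exists>x. dim (span ((\<lambda>k. Z k x) ` {2..CARD('n) + 1})) = dim (span (Z ` {2..CARD('n) + 1}))) \<and>
       (\<forall>x. dim (span ((\<lambda>k. Z k x) ` {2..CARD('n) + 1})) \<le> dim (span (Z ` {2..CARD('n) + 1}))) \<and>
       (dim (span (Z ` {2..CARD('n) + 1})) = CARD('n) \<longrightarrow>
          kaehler_fields A \<Omega> = span (Z ` {2..CARD('n) + 1})))"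
proof -
 have "kaehler A g \<Omega>" using assms by (simp add: bochner_kaehler_def Let_def)
 then interpret bochner A g \<Omega> \<phi> H T V
  using assms by (intro bochner.intro kaehler_manifold.intro bochner_axioms.intro)
 \<comment> \<open>The witness is \<open>Zf (k - 2)\<close>: the fields of the theorem carry
   subscripts from 2 to n + 1, those of the proof from 0 to n - 1.\<close>
 have shift: "(%k. F (k - 2)) ` {2..CARD('n) + 1} = F ` {..<CARD('n)}" for F :: "nat => 'z"
  by (force simp: image_iff intro: bexI[of _ "_ + 2"])
 show ?thesis
 proof (rule exI[of _ "%k. Zf (k - 2)"], unfold shift, intro conjI ballI allI impI)
  fix k assume "k \<in> {0..CARD('n) - 1}"
  then have k: "k \<le> CARD('n)" by simp
  show "Zf (k + 2 - 2) \<in> kaehler_fields A \<Omega>" using Zf_kaehler[OF k] by simp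
  show "represents g (Zf (k + 2 - 2)) (z_fun H T k)" using represents_Zf[OF k] by simp
 next
  show "span (Zf ` {..<CARD('n)}) \<subseteq> lie_center A (kaehler_fields A \<Omega>)"
   using span_Zf_central central_fields_center by blast
 next
  show "span ((%k. Zf (k - 2) x) ` {2..CARD('n) + 1}) = omega_complement \<Omega> x {v. differential A (moduli_map g H T V) x v = 0}" for x
   unfolding shift[of "%k. Zf k x"] by (rule span_Zf)
 next
  assume conn: "connected (UNIV :: 'm set)"
  show "dim (span (Zf ` {..<CARD('n)})) \<le> CARD('n)" by (rule dim_span_Zf_le)
  show "\<exists>x. dim (span ((%k. Zf (k - 2) x) ` {2..CARD('n) + 1})) = dim (span (Zf ` {..<CARD('n)}))"
   unfolding shift[of "%k. Zf k x" for x] by (rule dim_Zf_attained[OF conn])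
  show "dim (span ((%k. Zf (k - 2) x) ` {2..CARD('n) + 1})) \<le> dim (span (Zf ` {..<CARD('n)}))" for x
   unfolding shift[of "%k. Zf k x"] by (rule dim_eval_le)
  assume "dim (span (Zf ` {..<CARD('n)})) = CARD('n)"
  then show "kaehler_fields A \<Omega> = span (Zf ` {..<CARD('n)})" by (rule kaehler_fields_span[OF conn])
 qed
qed

end
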